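(* Let $\gamma\in\mathbb{R}\setminus\{0\}$, $r,\tau\in(1,\infty)$, $q\in(0,\infty)$, and put $m:=\min\{r,\tau\}$. Assume one of: (a) $m\in(n,\infty)$; (b) $m\in(1,n]$, $\gamma\in(0,\infty)$, and $n(\frac1m-\frac1q)<1$; (c) $m\in(1,n]$, $\gamma\in(-\infty,0)$, and $q\in(0,m)$. Then for every $f\in\dot W^{1,L^{r,\tau}}(\mathbb{R}^n)$, $$\sup_{\lambda>0}\lambda\left\|\left[\int_{\mathbb{R}^n}\mathbf{1}_{E_{\lambda,\gamma/q}[f]}(\cdot,y)|\cdot-y|^{\gamma-n}dy\right]^{1/q}\right\|_{L^{r,\tau}(\mathbb{R}^n)}\sim\|\,|\nabla f|\,\|_{L^{r,\tau}(\mathbb{R}^n)},$$ with positive equivalence constants independent of $f$. Moreover, for every $f\in\dot W^{1,L^{r,\tau}}(\mathbb{R}^n)$: (i) if $\gamma\in(0,\infty)$, then $\lim_{\lambda\to\infty}\lambda\left\|\left[\int_{\mathbb{R}^n}\mathbf{1}_{E_{\lambda,\gamma/q}[f]}(\cdot,y)|\cdot-y|^{\gamma-n}dy\right]^{1/q}\right\|_{L^{r,\tau}(\mathbb{R}^n)}=\left[\frac{\kappa(q,n)}{\gamma}\right]^{1/q}\|\,|\nabla f|\,\|_{L^{r,\tau}(\mathbb{R}^n)}$; (ii) if $\gamma\in(-\infty,0)$ and in addition either $n\ge2$ and $q\in(0,\frac{n-\gamma}{n}m)$, or $n=1$, $\gamma\in(-\infty,-1)$ and $q\in(0,-\gamma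 m)$, then $\lim_{\lambda\to0^+}\lambda\left\|\left[\int_{\mathbb{R}^n}\mathbf{1}_{E_{\lambda,\gamma/q}[f]}(\cdot,y)|\cdot-y|^{\gamma-n}dy\right]^{1/q}\right\|_{L^{r,\tau}(\mathbb{R}^n)}=\left[-\frac{\kappa(q,n)}{\gamma}\right]^{1/q}\|\,|\nabla f|\,\|_{L^{r,\tau}(\mathbb{R}^n)}$.
   Context: For $r,\tau\in(0,\infty)$, the Lorentz space $L^{r,\tau}(\mathbb{R}^n)$ is the set of measurable $f$ with $\|f\|_{L^{r,\tau}}:=\{\int_0^\infty[t^{1/r}f^*(t)]^\tau\frac{dt}{t}\}^{1/\tau}<\infty$, where $f^*(t):=\inf\{s>0:|\{x:|f(x)|>s\}|\le t\}$ is the decreasing rearrangement. $\dot W^{1,L^{r,\tau}}(\mathbb{R}^n)$: distributions $f$ with $|\nabla f|\in L^{r,\tau}(\mathbb{R}^n)$. $E_{\lambda,\beta}[f]:=\{(x,y):x\ne y,\ |f(x)-f(y)|/|x-y|^{1+\beta}>\lambda\}$. $\kappa(q,n):=\int_{\mathbb{S}^{n-1}}|e\cdot\omega|^q\,d\omega$, $e$ a unit vector. *)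

theory Defs
  imports "HOL-Analysis.Analysis"
begin

definition enn_powr :: "ennreal \<Rightarrow> real \<Rightarrow> ennreal" where
  "enn_powr x p = (if x = \<infinity> then \<infinity> else ennreal (enn2real x powr p))"

text \<open>f^*(t) = inf{s>0 : |{x : |f x| > s}| <= t}; Inf of the empty set is \<infinity>.\<close>
definition rearr :: "('a::euclidean_space \<Rightarrow> ennreal) \<Rightarrow> real \<Rightarrow> ennreal" where
  "rearr g t = Inf (ennreal ` {s::real. 0 < s \<and> emeasure lebesgue {x. g x > ennreal s} \<le> ennreal t})"

definition lorentz_norm :: "real \<Rightarrow> real \<Rightarrow> ('a::euclidean_space \<Rightarrow> ennreal) \<Rightarrow> ennreal" where
  "lorentz_norm r \<tau> g =
     enn_powr (\<integral>\<^sup>+ t\<in>{0<..}. enn_powr (ennreal (t powr (1/r)) * rearr g t) \<tau> * ennreal (1 / t) \<partial>lborel)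
              (1 / \<tau>)"

definition pdiff :: "'a::euclidean_space \<Rightarrow> ('a \<Rightarrow> real) \<Rightarrow> 'a \<Rightarrow> real" where
  "pdiff v \<phi> x = frechet_derivative \<phi> (at x) v"

fun iter_pdiff :: "'a::euclidean_space list \<Rightarrow> ('a \<Rightarrow> real) \<Rightarrow> 'a \<Rightarrow> real" where
  "iter_pdiff [] \<phi> = \<phi>"
| "iter_pdiff (v # vs) \<phi> = pdiff v (iter_pdiff vs \<phi>)"

definition smooth_fun :: "('a::euclidean_space \<Rightarrow> real) \<Rightarrow> bool" where
  "smooth_fun \<phi> \<longleftrightarrow> (\<forall>vs. set vs \<subseteq> Basis \<longrightarrow> (\<forall>x. iter_pdiff vs \<phi> differentiable (at x)))"

definition test_function :: "('a::euclidean_space \<Rightarrow> real) \<Rightarrow> bool" where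
  "test_function \<phi> \<longleftrightarrow> smooth_fun \<phi> \<and> compact (closure {x. \<phi> x \<noteq> 0})"

definition locally_integrable :: "('a::euclidean_space \<Rightarrow> 'b::{banach,second_countable_topology}) \<Rightarrow> bool" where
  "locally_integrable f \<longleftrightarrow> (\<forall>K. compact K \<longrightarrow> set_integrable lebesgue K f)"

definition weak_gradient :: "('a::euclidean_space \<Rightarrow> real) \<Rightarrow> ('a \<Rightarrow> 'a) \<Rightarrow> bool" where
  "weak_gradient f g \<longleftrightarrow> locally_integrable f \<and> locally_integrable g \<and>
     (\<forall>\<phi>. test_function \<phi> \<longrightarrow> (\<forall>i\<in>Basis.
        (\<integral>x. f x * pdiff i \<phi> x \<partial>lebesgue) = - (\<integral>x. (g x \<bullet> i) * \<phi> x \<partial>lebesgue)))"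

definition in_WL :: "real \<Rightarrow> real \<Rightarrow> ('a::euclidean_space \<Rightarrow> real) \<Rightarrow> ('a \<Rightarrow> 'a) \<Rightarrow> bool" where
  "in_WL r \<tau> f g \<longleftrightarrow> weak_gradient f g \<and> lorentz_norm r \<tau> (\<lambda>x. ennreal (norm (g x))) < \<infinity>"

definition E_set :: "real \<Rightarrow> real \<Rightarrow> ('a::euclidean_space \<Rightarrow> real) \<Rightarrow> ('a \<times> 'a) set" where
  "E_set lam \<beta> f = {(x, y). x \<noteq> y \<and> \<bar>f x - f y\<bar> / norm (x - y) powr (1 + \<beta>) > lam}"

definition G_fun :: "real \<Rightarrow> real \<Rightarrow> real \<Rightarrow> ('a::euclidean_space \<Rightarrow> real) \<Rightarrow> 'a \<Rightarrow> ennreal" where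
  "G_fun \<gamma> q lam f x = enn_powr
     (\<integral>\<^sup>+ y. indicator (E_set lam (\<gamma> / q) f) (x, y) * ennreal (norm (x - y) powr (\<gamma> - real DIM('a))) \<partial>lebesgue)
     (1 / q)"

definition Phi :: "real \<Rightarrow> real \<Rightarrow> real \<Rightarrow> real \<Rightarrow> real \<Rightarrow> ('a::euclidean_space \<Rightarrow> real) \<Rightarrow> ennreal" where
  "Phi r \<tau> \<gamma> q lam f = ennreal lam * lorentz_norm r \<tau> (G_fun \<gamma> q lam f)"

text \<open>Surface (cone) measure: sigma(A) = n * |{t w : 0 < t < 1, w in A}|.\<close>
definition sphere_measure :: "'a::euclidean_space measure" where
  "sphere_measure = scale_measure (of_nat DIM('a))
     (distr (restrict_space lborel (ball 0 1 - {0})) borel (\<lambda>x. x /\<^sub>R norm x))"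

definition kappa :: "real \<Rightarrow> 'a::euclidean_space itself \<Rightarrow> real" where
  "kappa q _ = enn2real (\<integral>\<^sup>+ \<omega>. ennreal (\<bar>(SOME e::'a. e \<in> Basis) \<bullet> \<omega>\<bar> powr q) \<partial>sphere_measure)"

end

theory Submission
  imports Defs
begin

text \<open>
  Blowing up at a point \<open>x\<close> with radius \<open>R = lam powr (- q / \<gamma>)\<close> turns \<open>(lam * G_fun \<gamma> q lam f x) powr q\<close>
  into the \<open>norm k powr (\<gamma> - n)\<close>-measure of the set where the difference quotient
  \<open>\<bar>f (x + R k) - f x\<bar> / R\<close> exceeds \<open>norm k powr (1 + \<gamma> / q)\<close>, and \<open>R\<close> tends to \<open>0\<close> in both
  limits (i) and (ii). A subcritical Sobolev-Poincare inequality bounds the \<open>L\<^sup>p\<close> averages of these quotients,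
  for some \<open>p > q\<close>, by the maximal function \<open>M(|g|\<^sup>s)\<close> to the power \<open>1/s\<close> with \<open>s < min r \<tau>\<close>; summing over
  dyadic rings gives the same pointwise bound for \<open>lam * G_fun \<gamma> q lam f\<close>, hence the upper estimate and a
  dominating function in the Lorentz space. The same inequality for \<open>f - g x \<bullet> k\<close> at the Lebesgue points
  of \<open>g\<close> shows that the quotients converge to \<open>\<bar>g x \<bullet> k\<bar>\<close>, so \<open>lam * G_fun \<gamma> q lam f\<close> converges almost everywhere to
  \<open>(kappa / \<bar>\<gamma>\<bar>) powr (1 / q) * norm (g x)\<close>. Dominated convergence yields both limits, and the limit
  gives the lower estimate.
\<close>

section \<open>Powers of extended nonnegative reals and Jensen's inequality\<close>

text \<open>The Lorentz functional is in general only a quasi-norm, so nothing rests on a triangle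
  inequality or on duality: monotonicity, homogeneity and a dominated convergence theorem for
  distribution functions carry the argument. The exponents are pinned down from three sides:
  \<open>s < min r \<tau>\<close> is what Hardy's inequality asks of the maximal operator,
  \<open>p > q\<close> makes the integral over the ring radius converge on both sides of its
  crossover, and \<open>n * (1 / s - 1 / p) < 1\<close> is the subcritical condition; each case of
  the hypothesis leaves room for all three. Since \<open>f\<close> is known only through its weak
  gradient, the Sobolev estimate is proved for mollifications, with constants independent of the
  scale, and passed to the limit by Fatou's lemma. Its exceptional null set depends on
  \<open>f\<close> and the mollifier only, so the vector \<open>w\<close>, the radius and the growth
  constant may be chosen after the point: \<open>w = 0\<close> gives the maximal bound,
  \<open>w = g x\<close> the convergence. The rings are indexed by a continuous radius, which turns
  the sum over rings into an integral to which dominated convergence applies.\<close>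

lemma enn_powr_ennreal: "0 \<le> a \<Longrightarrow> enn_powr (ennreal a) p = ennreal (a powr p)"
  by (simp add: enn_powr_def)

lemma enn_powr_top [simp]: "enn_powr top p = top"
  by (simp add: enn_powr_def)

lemma enn_powr_0 [simp]: "enn_powr 0 p = 0"
  by (simp add: enn_powr_def)

lemma enn_powr_one [simp]: "enn_powr x 1 = x"
  by (cases x rule: ennreal_cases) (auto simp: enn_powr_ennreal)

lemma enn_powr_mono: "0 \<le> p \<Longrightarrow> x \<le> y \<Longrightarrow> enn_powr x p \<le> enn_powr y p"
  by (cases x rule: ennreal_cases; cases y rule: ennreal_cases)
     (auto simp: enn_powr_ennreal powr_mono2 ennreal_le_iff top_unique intro!: ennreal_leI)

lemma enn_powr_eq_top_iff [simp]: "enn_powr x p = top \<longleftrightarrow> x = top"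
  by (cases x rule: ennreal_cases) (auto simp: enn_powr_ennreal)

lemma enn_powr_eq_0_iff [simp]: "enn_powr x p = 0 \<longleftrightarrow> x = 0"
  by (cases x rule: ennreal_cases) (auto simp: enn_powr_ennreal ennreal_eq_0_iff)

lemma enn_powr_mult: "enn_powr (x * y) p = enn_powr x p * enn_powr y p"
proof (cases "x = top \<or> y = top")
  case True
  then show ?thesis
    by (auto simp: ennreal_mult_top ennreal_top_mult)
next
  case False
  then obtain a b where "x = ennreal a" "y = ennreal b" "a \<ge> 0" "b \<ge> 0"
    by (metis ennreal_cases)
  then show ?thesis
    by (simp add: enn_powr_ennreal powr_mult flip: ennreal_mult)
qed

lemma enn_powr_enn_powr: "enn_powr (enn_powr x p) q = enn_powr x (p * q)"
  by (cases x rule: ennreal_cases) (auto simp: enn_powr_ennreal powr_powr)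

lemma enn_powr_less_iff:
  assumes "0 < p"
  shows "enn_powr x p < enn_powr y p \<longleftrightarrow> x < y"
proof -
  have "x < y \<Longrightarrow> enn_powr x p < enn_powr y p" for x y
    using assms
    by (cases x rule: ennreal_cases; cases y rule: ennreal_cases)
       (auto simp: enn_powr_ennreal ennreal_less_iff powr_less_mono2)
  moreover have "y \<le> x \<Longrightarrow> enn_powr y p \<le> enn_powr x p"
    using assms by (intro enn_powr_mono) auto
  ultimately show ?thesis
    by (metis leD not_le)
qed

lemma enn_powr_inverse:
  assumes "0 < p"
  shows "enn_powr (enn_powr x p) (1 / p) = x" "enn_powr (enn_powr x (1 / p)) p = x"
  using assms by (simp_all add: enn_powr_enn_powr)

lemma enn_powr_less_swap:
  assumes "0 < p"
  shows "a < enn_powr x p \<longleftrightarrow> enn_powr a (1 / p) < x" "enn_powr x p < a \<longleftrightarrow> x < enn_powr a (1 / p)"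
  using enn_powr_less_iff[OF assms] enn_powr_inverse[OF assms] by metis+

lemma enn_powr_le_swap:
  assumes "0 < p"
  shows "a \<le> enn_powr x p \<longleftrightarrow> enn_powr a (1 / p) \<le> x" "enn_powr x p \<le> a \<longleftrightarrow> x \<le> enn_powr a (1 / p)"
  using enn_powr_less_swap[OF assms, of x a] enn_powr_less_swap[OF assms, of a x]
  by (auto simp flip: not_less)

lemma tendsto_enn_powr:
  assumes "0 < p" "(f \<longlongrightarrow> l) F"
  shows "((\<lambda>x. enn_powr (f x) p) \<longlongrightarrow> enn_powr l p) F"
proof (rule order_tendstoI)
  fix a assume "a < enn_powr l p"
  then have "enn_powr a (1 / p) < l"
    using enn_powr_less_swap assms by blast
  then have "\<forall>\<^sub>F x in F. enn_powr a (1 / p) < f x"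
    using assms(2) by (simp add: order_tendsto_iff)
  then show "\<forall>\<^sub>F x in F. a < enn_powr (f x) p"
    by eventually_elim (simp add: enn_powr_less_swap[OF assms(1)])
next
  fix a assume "enn_powr l p < a"
  then have "l < enn_powr a (1 / p)"
    using enn_powr_less_swap assms by blast
  then have "\<forall>\<^sub>F x in F. f x < enn_powr a (1 / p)"
    using assms(2) by (simp add: order_tendsto_iff)
  then show "\<forall>\<^sub>F x in F. enn_powr (f x) p < a"
    by eventually_elim (simp add: enn_powr_less_swap[OF assms(1)])
qed

lemma measurable_enn_powr [measurable]:
  "f \<in> borel_measurable M \<Longrightarrow> (\<lambda>x. enn_powr (f x) p) \<in> borel_measurable M"
proof -
  assume [measurable]: "f \<in> borel_measurable M"
  have "(\<lambda>x. if f x = \<infinity> then \<infinity> else ennreal (enn2real (f x) powr p)) \<in> borel_measurable M"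
    by measurable
  then show ?thesis unfolding enn_powr_def .
qed

text \<open>Only \<open>x + y \<le> 2 * max x y\<close> is used, so the constant serves exponents
  below 1 as well as above.\<close>

lemma enn_powr_add_le:
  assumes "0 \<le> p"
  shows "enn_powr (x + y) p \<le> ennreal (2 powr p) * (enn_powr x p + enn_powr y p)"
proof -
  have "x + y \<le> 2 * max x y"
    by (metis add_mono max.cobounded1 max.cobounded2 mult_2)
  then have "enn_powr (x + y) p \<le> enn_powr (2 * max x y) p"
    using assms by (rule enn_powr_mono[rotated])
  also have "\<dots> = ennreal (2 powr p) * enn_powr (max x y) p"
    using enn_powr_ennreal[of 2 p] by (simp add: enn_powr_mult)
  also have "\<dots> \<le> ennreal (2 powr p) * (enn_powr x p + enn_powr y p)"
    by (intro mult_left_mono) (auto simp: max_def add_increasing add_increasing2)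
  finally show ?thesis .
qed

text \<open>Convexity: after rearrangement, the graph of \<open>x powr p\<close> lies above its
  tangent at \<open>c\<close>. It is Young's inequality for \<open>x powr p\<close> and
  \<open>c powr p\<close> with weights \<open>1 / p\<close> and \<open>1 - 1 / p\<close>, multiplied
  by \<open>p\<close>.\<close>

lemma power_tangent_line:
  fixes p c x :: real
  assumes "1 \<le> p" "0 < c" "0 \<le> x"
  shows "p * c powr (p - 1) * x \<le> x powr p + (p - 1) * c powr p"
proof (cases "p = 1 \<or> x = 0")
  case False
  with assms have p: "1 < p" and x: "0 < x" by auto
  have "(x powr p) powr (1/p) * (c powr p) powr (1 - 1/p) \<le> 1/p * x powr p + (1 - 1/p) * c powr p"
    using assms p x by (intro Youngs_inequality_0) auto
  also have "(x powr p) powr (1/p) * (c powr p) powr (1 - 1/p) = x * c powr (p - 1)"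
    using p x assms by (simp add: powr_powr right_diff_distrib)
  finally have "p * (x * c powr (p - 1)) \<le> p * (1/p * x powr p + (1 - 1/p) * c powr p)"
    using p by (intro mult_left_mono) auto
  then show ?thesis using p by (simp add: algebra_simps)
next
  case True
  then show ?thesis
  proof
    assume "x = 0"
    have "0 \<le> (p - 1) * c powr p" using assms by (intro mult_nonneg_nonneg) auto
    then show ?thesis using \<open>x = 0\<close> assms by (cases "p = 0") auto
  qed (use assms in auto)
qed

text \<open>Hoelder's inequality with one explicit weight; the proof integrates a tangent line of
  \<open>x \<mapsto> x powr p\<close> at the mean value.\<close>
lemma nn_integral_weighted_jensen:
  fixes F :: "'a \<Rightarrow> ennreal" and W :: "'a \<Rightarrow> real"
  assumes p: "1 \<le> p" and F [measurable]: "F \<in> borel_measurable M"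
    and W [measurable]: "W \<in> borel_measurable M" and Wpos: "\<And>x. x \<in> space M \<Longrightarrow> 0 < W x"
    and K: "(\<integral>\<^sup>+x. ennreal (W x) \<partial>M) \<le> ennreal K" "0 < K"
  shows "enn_powr (\<integral>\<^sup>+x. F x \<partial>M) p
    \<le> ennreal (K powr (p - 1)) * (\<integral>\<^sup>+x. enn_powr (F x) p * ennreal (W x powr (1 - p)) \<partial>M)"
    (is "enn_powr ?I p \<le> _ * ?J")
proof -
  \<comment> \<open>The tangent point \<open>c\<close> stays free here; it is fixed only once the
    integral is known to be finite and positive.\<close>
  have main: "ennreal (p * c powr (p - 1)) * ?I \<le> ?J + ennreal ((p - 1) * c powr p * K)" if c: "0 < c" for c
  proof -
    have "ennreal (p * c powr (p - 1)) * F x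
        \<le> enn_powr (F x) p * ennreal (W x powr (1 - p)) + ennreal ((p - 1) * c powr p) * ennreal (W x)"
      if x: "x \<in> space M" for x
    proof (cases "F x" rule: ennreal_cases)
      case (real a)
      have W: "0 < W x" using Wpos x by auto
      have "p * c powr (p - 1) * (a / W x) \<le> (a / W x) powr p + (p - 1) * c powr p"
        using p c real W by (intro power_tangent_line) auto
      then have "W x * (p * c powr (p - 1) * (a / W x)) \<le> W x * ((a / W x) powr p + (p - 1) * c powr p)"
        using W by (intro mult_left_mono) auto
      then have "p * c powr (p - 1) * a \<le> a powr p * (W x powr (1 - p)) + (p - 1) * c powr p * W x"
        using W real by (simp add: powr_divide powr_diff algebra_simps)
      then show ?thesis
        using real p W by (simp add: enn_powr_ennreal flip: ennreal_mult ennreal_plus)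
    next
      case top
      then show ?thesis using Wpos[OF x] by (simp add: ennreal_top_mult)
    qed
    then have "(\<integral>\<^sup>+x. ennreal (p * c powr (p - 1)) * F x \<partial>M)
      \<le> (\<integral>\<^sup>+x. enn_powr (F x) p * ennreal (W x powr (1 - p)) + ennreal ((p - 1) * c powr p) * ennreal (W x) \<partial>M)"
      by (rule nn_integral_mono)
    also have "\<dots> = ?J + ennreal ((p - 1) * c powr p) * (\<integral>\<^sup>+x. ennreal (W x) \<partial>M)"
      by (subst nn_integral_add) (auto simp: nn_integral_cmult)
    also have "\<dots> \<le> ?J + ennreal ((p - 1) * c powr p) * ennreal K"
      using K by (intro add_left_mono mult_left_mono) auto
    finally show ?thesis
      using p K by (simp add: nn_integral_cmult ennreal_mult)
  qed
  show ?thesis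
  proof (cases ?I rule: ennreal_cases)
    case top
    have "?J + ennreal ((p - 1) * K) = top"
      using main[of 1] p top by (simp add: ennreal_mult_top top_unique)
    then show ?thesis using K by (simp add: ennreal_mult_top)
  next
    case (real I)
    show ?thesis
    proof (cases "I = 0")
      case True then show ?thesis using real by simp
    next
      case False
      with real have I: "0 < I" by auto
      show ?thesis
      proof (cases ?J rule: ennreal_cases)
        case top then show ?thesis using K by (simp add: ennreal_mult_top)
      next
        case J: (real J)
        \<comment> \<open>If \<open>W\<close> has mass \<open>K\<close>, this is the mean of
          \<open>F / W\<close> for the density \<open>W\<close>. It gives
          \<open>c powr p * K = c powr (p - 1) * I\<close>, so that all but one of the
          \<open>p\<close> copies on the left of \<open>main\<close> cancel.\<close>
        define c where "c = I / K"
        have c: "0 < c" using I K by (simp add: c_def)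
        have cK: "c * K = I" using K by (simp add: c_def)
        have "p * c powr (p - 1) * I \<le> J + (p - 1) * c powr p * K"
          using main[OF c] J real p K I c
          by (simp add: ennreal_le_iff flip: ennreal_mult ennreal_plus)
        moreover have "c powr p * K = c powr (p - 1) * I"
          using c by (simp add: powr_diff flip: cK)
        then have "(p - 1) * c powr p * K = (p - 1) * (c powr (p - 1) * I)" by simp
        ultimately have "c powr (p - 1) * I \<le> J" by (simp add: left_diff_distrib mult.assoc)
        then have "K powr (p - 1) * (c powr (p - 1) * I) \<le> K powr (p - 1) * J"
          by (intro mult_left_mono) auto
        moreover have "K powr (p - 1) * (c powr (p - 1) * I) = I powr p"
          using K I by (simp add: c_def powr_divide powr_diff)
        ultimately show ?thesis
          using real J K by (simp add: enn_powr_ennreal ennreal_le_iff flip: ennreal_mult)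
      qed
    qed
  qed
qed

lemma nn_integral_power_le:
  fixes F :: "'a \<Rightarrow> ennreal"
  assumes p: "1 \<le> p" and F [measurable]: "F \<in> borel_measurable M" and S [measurable]: "S \<in> sets M"
    and K: "emeasure M S \<le> ennreal K" "0 < K"
  shows "enn_powr (\<integral>\<^sup>+x\<in>S. F x \<partial>M) p \<le> ennreal (K powr (p - 1)) * (\<integral>\<^sup>+x\<in>S. enn_powr (F x) p \<partial>M)"
proof -
  have "S \<inter> space M \<in> sets M" by measurable
  then have "enn_powr (\<integral>\<^sup>+x. F x \<partial>restrict_space M S) p
     \<le> ennreal (K powr (p - 1)) * (\<integral>\<^sup>+x. enn_powr (F x) p * ennreal (1 powr (1 - p)) \<partial>restrict_space M S)"
    using p K F S
    by (intro nn_integral_weighted_jensen)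
       (auto simp: emeasure_restrict_space space_restrict_space intro: measurable_restrict_space1)
  then show ?thesis
    by (simp add: nn_integral_restrict_space)
qed

section \<open>Affine substitutions and volumes of balls\<close>

lemma nn_integral_lborel_affine:
  fixes F :: "'a::euclidean_space \<Rightarrow> ennreal" and c :: real
  assumes [measurable]: "F \<in> borel_measurable borel" and c: "0 < c"
  shows "(\<integral>\<^sup>+y. F y \<partial>lborel) = ennreal (c ^ DIM('a)) * (\<integral>\<^sup>+x. F (t + c *\<^sub>R x) \<partial>lborel)"
proof -
  have "(\<integral>\<^sup>+y. F y \<partial>lborel)
      = (\<integral>\<^sup>+y. F y \<partial>density (distr lborel borel (\<lambda>x. t + c *\<^sub>R x)) (\<lambda>_. ennreal (\<bar>c\<bar> ^ DIM('a))))"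
    using lborel_affine[of c t] c by auto
  also have "\<dots> = ennreal (\<bar>c\<bar> ^ DIM('a)) * (\<integral>\<^sup>+x. F (t + c *\<^sub>R x) \<partial>lborel)"
    by (simp add: nn_integral_density nn_integral_distr nn_integral_cmult)
  finally show ?thesis using c by simp
qed

lemma nn_integral_lborel_translate:
  fixes F :: "'a::euclidean_space \<Rightarrow> ennreal"
  assumes [measurable]: "F \<in> borel_measurable borel"
  shows "(\<integral>\<^sup>+x. F (t + x) \<partial>lborel) = (\<integral>\<^sup>+y. F y \<partial>lborel)"
  using nn_integral_lborel_affine[of F 1 t] by simp

lemma nn_integral_lborel_translate':
  fixes F :: "'a::euclidean_space \<Rightarrow> ennreal"
  assumes "F \<in> borel_measurable borel"
  shows "(\<integral>\<^sup>+x. F (x + t) \<partial>lborel) = (\<integral>\<^sup>+y. F y \<partial>lborel)"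
  using nn_integral_lborel_translate[OF assms, of t] by (simp add: add.commute)

definition vol :: "'a::euclidean_space itself \<Rightarrow> real"
  where "vol _ = unit_ball_vol (real DIM('a))"

lemma vol_pos [simp]: "0 < vol TYPE('a::euclidean_space)"
  by (simp add: vol_def)

lemma vol_nonneg [simp]: "0 \<le> vol TYPE('a::euclidean_space)"
  by (simp add: less_imp_le)

lemma emeasure_lborel_ball:
  "0 \<le> r \<Longrightarrow> emeasure lborel (ball (a::'a::euclidean_space) r) = ennreal (vol TYPE('a) * r ^ DIM('a))"
  by (simp add: vol_def emeasure_ball)

section \<open>A Sobolev-Poincare inequality on the unit ball\<close>

lemma ball_sets_borel [measurable]: "ball (a::'a::euclidean_space) r \<in> sets borel"
  by simp

lemma nn_integral_lborel_swap:
  fixes f :: "'a::euclidean_space \<Rightarrow> 'b::euclidean_space \<Rightarrow> ennreal"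
  assumes "(\<lambda>(x, y). f x y) \<in> borel_measurable (borel \<Otimes>\<^sub>M borel)"
  shows "(\<integral>\<^sup>+x. \<integral>\<^sup>+y. f x y \<partial>lborel \<partial>lborel) = (\<integral>\<^sup>+y. \<integral>\<^sup>+x. f x y \<partial>lborel \<partial>lborel)"
proof -
  have "pair_sigma_finite (lborel :: 'b measure) (lborel :: 'a measure)"
    by (simp add: lborel.sigma_finite_measure_axioms pair_sigma_finite_def)
  moreover have "(\<lambda>(y, x). f x y) \<in> borel_measurable (lborel \<Otimes>\<^sub>M lborel)"
    using measurable_compose[OF measurable_pair_swap' assms]
    by (simp add: case_prod_beta' cong: measurable_cong_sets)
  ultimately show ?thesis
    by (simp add: pair_sigma_finite.Fubini')
qed

lemma enn_powr_add_exponent: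
  "enn_powr x (a + b) = enn_powr x a * enn_powr x b"
  by (cases x rule: ennreal_cases) (auto simp: enn_powr_ennreal powr_add ennreal_mult ennreal_top_mult)

lemma nn_integral_powr_0:
  fixes a c :: real
  assumes "-1 < a" "0 \<le> c"
  shows "(\<integral>\<^sup>+x\<in>{0<..<c}. ennreal (x powr a) \<partial>lborel) = ennreal (c powr (a + 1) / (a + 1))"
proof -
  have "((\<lambda>x. x powr a) has_integral (c powr (a + 1) / (a + 1))) {0<..<c}"
    using has_integral_powr_from_0[OF assms] has_integral_Icc_iff_Ioo by blast
  then have "(\<integral>\<^sup>+x. ennreal (indicator {0<..<c} x * (x powr a)) \<partial>lborel) = ennreal (c powr (a + 1) / (a + 1))"
    by (rule nn_integral_has_integral_lebesgue[rotated]) simp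
  then show ?thesis
    by (simp add: ennreal_mult'' ennreal_indicator mult.commute)
qed

lemma nn_integral_powr_top:
  fixes a c :: real
  assumes "a < -1" "0 < c"
  shows "(\<integral>\<^sup>+x\<in>{c<..}. ennreal (x powr a) \<partial>lborel) = ennreal (- (c powr (a + 1) / (a + 1)))"
proof -
  have "((\<lambda>x. x powr a) has_integral (- (c powr (a + 1) / (a + 1)))) {c..}"
    using has_integral_powr_to_inf[of a c] assms by simp
  then have "((\<lambda>x. x powr a) has_integral (- (c powr (a + 1) / (a + 1)))) {c<..}"
    by (rule has_integral_spike_set_eq[THEN iffD1, rotated 2])
       (auto intro: negligible_subset[of "{c}"])
  then have "(\<integral>\<^sup>+x. ennreal (indicator {c<..} x * (x powr a)) \<partial>lborel) = ennreal (- (c powr (a + 1) / (a + 1)))"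
    by (rule nn_integral_has_integral_lebesgue[rotated]) simp
  then show ?thesis
    by (simp add: ennreal_mult'' ennreal_indicator mult.commute)
qed

text \<open>Jensen's inequality on the ball, followed by an \<open>s\<close>-th root. The hypothesis
  is factored as \<open>N powr s * J\<close> so that \<open>N\<close> leaves the root with exponent
  1.\<close>

lemma nn_integral_ball_Lp_bound:
  fixes A :: "'a::euclidean_space \<Rightarrow> ennreal"
  assumes s: "1 \<le> s" and A [measurable]: "A \<in> borel_measurable borel" and t: "0 < t"
    and J: "(\<integral>\<^sup>+x\<in>ball a t. enn_powr (A x) s \<partial>lborel) \<le> ennreal (N powr s * J)" "0 \<le> N" "0 \<le> J"
  shows "(\<integral>\<^sup>+x\<in>ball a t. A x \<partial>lborel)
    \<le> ennreal ((vol TYPE('a) * t ^ DIM('a)) powr (1 - 1 / s) * N * J powr (1 / s))"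
proof -
  let ?K = "vol TYPE('a) * t ^ DIM('a)"
  have K: "0 < ?K" using t by simp
  have "enn_powr (\<integral>\<^sup>+x\<in>ball a t. A x \<partial>lborel) s
      \<le> ennreal (?K powr (s - 1)) * (\<integral>\<^sup>+x\<in>ball a t. enn_powr (A x) s \<partial>lborel)"
    using K t by (intro nn_integral_power_le s) (auto simp: emeasure_lborel_ball)
  also have "\<dots> \<le> ennreal (?K powr (s - 1)) * ennreal (N powr s * J)"
    using J by (intro mult_left_mono) auto
  finally have "(\<integral>\<^sup>+x\<in>ball a t. A x \<partial>lborel) \<le> enn_powr (ennreal (?K powr (s - 1) * (N powr s * J))) (1 / s)"
    using s J by (subst (asm) enn_powr_le_swap) (auto simp: ennreal_mult)
  also have "\<dots> = ennreal (?K powr ((s - 1) / s) * N * J powr (1 / s))"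
    using s J K by (simp add: enn_powr_ennreal powr_mult powr_powr mult.assoc)
  also have "(s - 1) / s = 1 - 1 / s"
    using s by (simp add: field_simps)
  finally show ?thesis .
qed

text \<open>\<open>\<alpha>\<close> is the exponent of the weight \<open>t powr - \<alpha>\<close>
  in the weighted Jensen inequality for a radial integral over the unit interval. The first bound
  makes the weight integrable at 0, the second the power of \<open>t\<close> that is left over.
  Subcriticality, in the form \<open>n * (p / s - 1) < p\<close>, leaves a gap between the two
  constraints; for \<open>p = 1\<close> also \<open>s = 1\<close>, and the weight is
  constant.\<close>

lemma powr_exponent_exists:
  fixes n s p :: real
  assumes "1 \<le> s" "s \<le> p" "n * (1 / s - 1 / p) < 1"
  obtains \<alpha> where "\<alpha> < 1" "-1 < \<alpha> * (p - 1) + n * (1 - p / s)"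
proof (cases "p = 1")
  case True
  then show ?thesis using assms by (intro that[of 0]) auto
next
  case False
  with assms have p: "1 < p" by auto
  have "p * (n * (1 / s - 1 / p)) < p * 1"
    using p assms by (intro mult_strict_left_mono) auto
  then have "n * (p / s - 1) < p"
    using p assms by (simp add: field_simps)
  then have "(n * (p / s - 1) - 1) / (p - 1) < 1"
    using p by (simp add: field_simps)
  then obtain \<alpha> where a: "(n * (p / s - 1) - 1) / (p - 1) < \<alpha>" "\<alpha> < 1"
    using dense by blast
  have "n * (p / s - 1) - 1 < \<alpha> * (p - 1)"
    using a(1) p by (simp add: pos_divide_less_eq)
  then show ?thesis using a p by (intro that[of \<alpha>]) (auto simp: algebra_simps)
qed

text \<open>Interpolating the trivial \<open>L\<^sup>s \<rightarrow> L\<^sup>\<infinity>\<close> and \<open>L\<^sup>s \<rightarrow> L\<^sup>s\<close> bounds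
  replaces Young's convolution inequality.\<close>
lemma ball_average_Lp_Ls:
  fixes A :: "'a::euclidean_space \<Rightarrow> ennreal"
  assumes s: "1 \<le> s" and sp: "s \<le> p" and A [measurable]: "A \<in> borel_measurable borel" and t: "0 < t"
    and N: "(\<integral>\<^sup>+x. enn_powr (A x) s \<partial>lborel) \<le> ennreal (N powr s)" "0 \<le> N"
  defines "K \<equiv> vol TYPE('a) * t ^ DIM('a)"
  shows "(\<integral>\<^sup>+z. enn_powr (\<integral>\<^sup>+k\<in>ball 0 t. A (z + k) \<partial>lborel) p \<partial>lborel)
    \<le> ennreal (K powr (p - p / s + 1) * N powr p)"
proof -
  have K: "0 < K" using t by (simp add: K_def)
  define a where "a z = (\<integral>\<^sup>+k\<in>ball 0 t. A (z + k) \<partial>lborel)" for z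
  have a_meas [measurable]: "a \<in> borel_measurable borel"
    unfolding a_def by measurable
  have a_le: "a z \<le> ennreal (K powr (1 - 1 / s) * N)" for z
  proof -
    have "(\<integral>\<^sup>+k\<in>ball 0 t. enn_powr (A (z + k)) s \<partial>lborel) \<le> (\<integral>\<^sup>+k. enn_powr (A (z + k)) s \<partial>lborel)"
      by (intro nn_integral_mono) (auto simp: indicator_def)
    also have "\<dots> = (\<integral>\<^sup>+k. enn_powr (A k) s \<partial>lborel)"
      by (rule nn_integral_lborel_translate) simp
    finally have "(\<integral>\<^sup>+k\<in>ball 0 t. enn_powr (A (z + k)) s \<partial>lborel) \<le> ennreal (N powr s * 1)"
      using N by simp
    from nn_integral_ball_Lp_bound[OF s _ t this] show ?thesis
      using N by (simp add: a_def K_def)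
  qed
  have "enn_powr (a z) p \<le> ennreal ((K powr (1 - 1 / s) * N) powr (p - s)) * (ennreal (K powr (s - 1))
      * (\<integral>\<^sup>+k\<in>ball 0 t. enn_powr (A (z + k)) s \<partial>lborel))" for z
  proof -
    \<comment> \<open>\<open>p - s\<close> of the powers take the uniform bound \<open>a_le\<close>;
      the remaining \<open>s\<close> go under the integral by Jensen's inequality.\<close>
    have "enn_powr (a z) p = enn_powr (a z) (p - s) * enn_powr (a z) s"
      by (simp flip: enn_powr_add_exponent)
    also have "enn_powr (a z) (p - s) \<le> enn_powr (ennreal (K powr (1 - 1 / s) * N)) (p - s)"
      using sp a_le by (intro enn_powr_mono) auto
    also have "\<dots> = ennreal ((K powr (1 - 1 / s) * N) powr (p - s))"
      using N by (intro enn_powr_ennreal) auto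
    also have "enn_powr (a z) s \<le> ennreal (K powr (s - 1)) * (\<integral>\<^sup>+k\<in>ball 0 t. enn_powr (A (z + k)) s \<partial>lborel)"
      unfolding a_def using K s t by (intro nn_integral_power_le) (auto simp: K_def emeasure_lborel_ball)
    finally show ?thesis
      by (simp add: mult_left_mono mult_right_mono)
  qed
  then have "(\<integral>\<^sup>+z. enn_powr (a z) p \<partial>lborel) \<le> (\<integral>\<^sup>+z. ennreal ((K powr (1 - 1 / s) * N) powr (p - s)) *
      (ennreal (K powr (s - 1)) * (\<integral>\<^sup>+k\<in>ball 0 t. enn_powr (A (z + k)) s \<partial>lborel)) \<partial>lborel)"
    by (rule nn_integral_mono)
  also have "\<dots> = ennreal ((K powr (1 - 1 / s) * N) powr (p - s)) *
      (ennreal (K powr (s - 1)) * (\<integral>\<^sup>+z. (\<integral>\<^sup>+k\<in>ball 0 t. enn_powr (A (z + k)) s \<partial>lborel) \<partial>lborel))"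
    by (simp add: nn_integral_cmult)
  also have "(\<integral>\<^sup>+z. (\<integral>\<^sup>+k\<in>ball 0 t. enn_powr (A (z + k)) s \<partial>lborel) \<partial>lborel)
      = (\<integral>\<^sup>+k. \<integral>\<^sup>+z. enn_powr (A (z + k)) s * indicator (ball 0 t) k \<partial>lborel \<partial>lborel)"
    by (intro nn_integral_lborel_swap) measurable
  also have "\<dots> = (\<integral>\<^sup>+k. (\<integral>\<^sup>+z. enn_powr (A z) s \<partial>lborel) * indicator (ball (0::'a) t) k \<partial>lborel)"
    using nn_integral_lborel_translate'[of "\<lambda>z. enn_powr (A z) s"]
    by (intro nn_integral_cong) (simp add: nn_integral_multc)
  also have "\<dots> = (\<integral>\<^sup>+z. enn_powr (A z) s \<partial>lborel) * ennreal K"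
    using t by (simp add: nn_integral_cmult emeasure_lborel_ball K_def)
  also have "\<dots> \<le> ennreal (N powr s) * ennreal K"
    using N by (intro mult_right_mono) auto
  also have "ennreal ((K powr (1 - 1 / s) * N) powr (p - s)) * (ennreal (K powr (s - 1)) * (ennreal (N powr s) * ennreal K))
      = ennreal ((K powr (1 - 1 / s) * N) powr (p - s) * (K powr (s - 1) * (N powr s * K)))"
    using K by (simp flip: ennreal_mult)
  also have "(K powr (1 - 1 / s) * N) powr (p - s) * (K powr (s - 1) * (N powr s * K))
      = K powr ((1 - 1 / s) * (p - s)) * K powr (s - 1) * K powr 1 * (N powr (p - s) * N powr s)"
    using K N by (simp add: powr_mult powr_powr)
  also have "\<dots> = K powr ((1 - 1 / s) * (p - s) + (s - 1) + 1) * N powr p"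
    by (simp only: powr_add[symmetric]) simp
  also have "(1 - 1 / s) * (p - s) + (s - 1) + 1 = p - p / s + 1"
    using s by (simp add: field_simps)
  finally show ?thesis
    unfolding a_def by (simp add: mult_left_mono)
qed

lemma nn_integral_ball_scale:
  fixes F :: "'a::euclidean_space \<Rightarrow> ennreal"
  assumes [measurable]: "F \<in> borel_measurable borel" and R: "0 < R"
  shows "ennreal (R ^ DIM('a)) * (\<integral>\<^sup>+k\<in>ball 0 t. F (x + R *\<^sub>R k) \<partial>lborel) = (\<integral>\<^sup>+y\<in>ball x (R * t). F y \<partial>lborel)"
proof -
  have "indicator (ball x (R * t)) (x + R *\<^sub>R k) = (indicator (ball 0 t) k :: ennreal)" for k :: 'a
    using R by (auto simp: indicator_def dist_norm)
  then show ?thesis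
    by (subst nn_integral_lborel_affine[OF _ R, of _ x]) auto
qed

lemma ennreal_scaled_le_cancel:
  assumes "ennreal c * X \<le> ennreal (c * b)" "0 < c" "0 \<le> b"
  shows "X \<le> ennreal b"
proof -
  have "ennreal (1 / c) * (ennreal c * X) \<le> ennreal (1 / c) * ennreal (c * b)"
    using assms by (intro mult_left_mono) auto
  then show ?thesis
    using assms by (simp add: mult.assoc[symmetric] flip: ennreal_mult)
qed

text \<open>The values \<open>u z\<close> and \<open>u 0\<close> are compared through the mean of
  \<open>u\<close> over the unit ball. The part at \<open>z\<close> becomes a Riesz potential of
  \<open>A\<close>, sliced by the parameter \<open>t\<close> of the segments; each slice is an
  average of \<open>A\<close> over a ball of radius \<open>2 * t\<close>, to which the
  \<open>L\<^sup>s\<close> to \<open>L\<^sup>p\<close> bound applies. The part at 0 uses the growth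
  of \<open>A\<close> around 0. No derivative of \<open>u\<close> occurs: \<open>A\<close> is any
  function that dominates increments along segments, which suits mollifications, where
  \<open>A\<close> is an average of the weak gradient. \<open>C\<close> depends on the exponents and
  the dimension only.\<close>

lemma unit_ball_sobolev_poincare:
  assumes s: "1 \<le> s" and sp: "s \<le> p" and snp: "real DIM('a::euclidean_space) * (1 / s - 1 / p) < 1"
  shows "\<exists>C\<ge>0. \<forall>(u :: 'a \<Rightarrow> real) A N. u \<in> borel_measurable borel \<longrightarrow> A \<in> borel_measurable borel \<longrightarrow> 0 \<le> N \<longrightarrow>
     (\<forall>z h. ennreal \<bar>u (z + h) - u z\<bar> \<le> ennreal (norm h) * (\<integral>\<^sup>+t\<in>{0<..<1}. A (z + t *\<^sub>R h) \<partial>lborel)) \<longrightarrow>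
     (\<forall>t. 0 < t \<and> t \<le> 1 \<longrightarrow> (\<integral>\<^sup>+x\<in>ball 0 t. enn_powr (A x) s \<partial>lborel) \<le> ennreal (N powr s * t ^ DIM('a))) \<longrightarrow>
     (\<integral>\<^sup>+h\<in>ball 0 1. ennreal (\<bar>u h - u 0\<bar> powr p) \<partial>lborel) \<le> ennreal (C * N powr p)"
proof -
  let ?n = "DIM('a)"
  obtain \<alpha> where \<alpha>: "\<alpha> < 1" "-1 < \<alpha> * (p - 1) + real ?n * (1 - p / s)"
    using powr_exponent_exists[OF s sp snp] .
  define V where "V = vol TYPE('a)"
  \<comment> \<open>\<open>K\<close> is the mass of the weight \<open>t powr - \<alpha>\<close> on
    the unit interval, and \<open>\<kappa>\<close> the power of \<open>t\<close> that remains after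
    combining Jensen's weight, the Jacobian and the averaging bound; the choice of
    \<open>\<alpha>\<close> makes both integrals finite. \<open>L\<close> comes from averages over
    radius \<open>2 * t\<close>, and \<open>c\<close> from the growth bound at the centre.\<close>
  define K where "K = 1 / (1 - \<alpha>)"
  define \<kappa> where "\<kappa> = \<alpha> * (p - 1) + real ?n * (1 - p / s)"
  define L where "L = (V * 2 ^ ?n) powr (p - p / s + 1)"
  define c where "c = V powr (1 - 1 / s)"
  define C where "C = (1 / V) powr p * (2 powr p * (2 powr p * (K powr (p - 1) * (L * (1 / (\<kappa> + 1)))) + V * c powr p))"
  have V: "0 < V" by (simp add: V_def)
  have K: "0 < K" using \<alpha> by (simp add: K_def)
  have \<kappa>: "-1 < \<kappa>" using \<alpha> by (simp add: \<kappa>_def)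
  have p: "1 \<le> p" using s sp by simp
  have "C \<ge> 0" using V K \<kappa> by (simp add: C_def L_def)
  moreover {
    fix u :: "'a \<Rightarrow> real" and A N
    assume u [measurable]: "u \<in> borel_measurable borel" and A [measurable]: "A \<in> borel_measurable borel"
      and N: "0 \<le> N"
      and FTC: "\<And>z h. ennreal \<bar>u (z + h) - u z\<bar> \<le> ennreal (norm h) * (\<integral>\<^sup>+t\<in>{0<..<1}. A (z + t *\<^sub>R h) \<partial>lborel)"
      and bd: "\<And>t. 0 < t \<Longrightarrow> t \<le> 1 \<Longrightarrow> (\<integral>\<^sup>+x\<in>ball 0 t. enn_powr (A x) s \<partial>lborel) \<le> ennreal (N powr s * t ^ ?n)"
    \<comment> \<open>The growth bound is needed at every radius \<open>t\<close>: the mass of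
      \<open>A\<close> on \<open>ball 0 t\<close> exactly compensates the Jacobian of
      \<open>h \<mapsto> t *\<^sub>R h\<close>. This is what allows the single value
      \<open>u 0\<close> in place of a mean of \<open>u\<close>.\<close>
    have center: "(\<integral>\<^sup>+h\<in>ball 0 1. ennreal \<bar>u h - u 0\<bar> \<partial>lborel) \<le> ennreal (c * N)"
    proof -
      have *: "(\<integral>\<^sup>+h\<in>ball 0 1. A (t *\<^sub>R h) \<partial>lborel) \<le> ennreal (c * N)" if t: "0 < t" "t < 1" for t
      proof -
        have "ennreal (t ^ ?n) * (\<integral>\<^sup>+h\<in>ball 0 1. A (0 + t *\<^sub>R h) \<partial>lborel) = (\<integral>\<^sup>+x\<in>ball 0 t. A x \<partial>lborel)"
          using t nn_integral_ball_scale[of A t 0 1] by simp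
        also have "\<dots> \<le> ennreal ((V * t ^ ?n) powr (1 - 1 / s) * N * (t ^ ?n) powr (1 / s))"
          using t N bd[of t] unfolding V_def by (intro nn_integral_ball_Lp_bound s) auto
        also have "(V * t ^ ?n) powr (1 - 1 / s) * N * (t ^ ?n) powr (1 / s)
            = V powr (1 - 1 / s) * N * ((t ^ ?n) powr (1 - 1 / s) * (t ^ ?n) powr (1 / s))"
          using V t by (simp add: powr_mult)
        also have "(t ^ ?n) powr (1 - 1 / s) * (t ^ ?n) powr (1 / s) = t ^ ?n"
          using t by (simp flip: powr_add)
        finally have "ennreal (t ^ ?n) * (\<integral>\<^sup>+h\<in>ball 0 1. A (0 + t *\<^sub>R h) \<partial>lborel) \<le> ennreal (t ^ ?n * (c * N))"
          by (simp add: c_def mult.commute)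
        from ennreal_scaled_le_cancel[OF this] show ?thesis
          using t N V by (simp add: c_def)
      qed
      have "(\<integral>\<^sup>+h\<in>ball 0 1. ennreal \<bar>u h - u 0\<bar> \<partial>lborel)
          \<le> (\<integral>\<^sup>+h. (\<integral>\<^sup>+t. A (t *\<^sub>R h) * indicator {0<..<1} t * indicator (ball 0 1) h \<partial>lborel) \<partial>lborel)"
      proof (intro nn_integral_mono)
        fix h :: 'a
        show "ennreal \<bar>u h - u 0\<bar> * indicator (ball 0 1) h
          \<le> (\<integral>\<^sup>+t. A (t *\<^sub>R h) * indicator {0<..<1} t * indicator (ball 0 1) h \<partial>lborel)"
        proof (cases "h \<in> ball 0 1")
          case True
          then have "ennreal (norm h) \<le> 1" by auto
          then show ?thesis
            using order_trans[OF FTC[of 0 h] mult_right_mono[of _ 1]] True by simp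
        qed simp
      qed
      also have "\<dots> = (\<integral>\<^sup>+t. (\<integral>\<^sup>+h. A (t *\<^sub>R h) * indicator {0<..<1} t * indicator (ball 0 1) h \<partial>lborel) \<partial>lborel)"
        by (intro nn_integral_lborel_swap) measurable
      also have "\<dots> = (\<integral>\<^sup>+t. (\<integral>\<^sup>+h\<in>ball 0 1. A (t *\<^sub>R h) \<partial>lborel) * indicator {0<..<1} t \<partial>lborel)"
        by (subst nn_integral_multc[symmetric]) (auto intro!: nn_integral_cong simp: mult_ac)
      also have "\<dots> \<le> (\<integral>\<^sup>+t. ennreal (c * N) * indicator {0<..<(1::real)} t \<partial>lborel)"
        using * by (intro nn_integral_mono) (auto simp: indicator_def)
      also have "\<dots> = ennreal (c * N)"
        by (simp add: nn_integral_cmult)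
      finally show ?thesis .
    qed
    \<comment> \<open>\<open>A\<close> is controlled only on the unit ball. Segments between points
      of the ball stay inside it, so the truncation loses nothing and makes the global
      \<open>L\<^sup>s\<close> bound available.\<close>
    define At where "At x = A x * indicator (ball 0 1) x" for x
    have At [measurable]: "At \<in> borel_measurable borel" unfolding At_def by measurable
    define a where "a t z = (\<integral>\<^sup>+k\<in>ball 0 (2 * t). At (z + k) \<partial>lborel)" for t z
    have a_meas: "(\<lambda>(t, z). a t z) \<in> borel_measurable (borel \<Otimes>\<^sub>M borel)"
    proof -
      have "(\<lambda>(t, z). \<integral>\<^sup>+k. At (z + k) * indicator {(t, k). norm k < 2 * t} (t, k) \<partial>lborel) \<in> borel_measurable (borel \<Otimes>\<^sub>M borel)"
        by measurable
      then show ?thesis by (simp add: a_def indicator_def mem_ball dist_norm)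
    qed
    note a_meas' [measurable] = measurable_compose[OF measurable_Pair a_meas, unfolded split_beta fst_conv snd_conv]
    have point: "ennreal V * ennreal \<bar>u z - u 0\<bar>
        \<le> 2 * (\<integral>\<^sup>+t\<in>{0<..<1}. ennreal (t powr - real ?n) * a t z \<partial>lborel) + ennreal (c * N)"
      if z: "z \<in> ball 0 1" for z
    proof -
      \<comment> \<open>Substitution \<open>y = z + (1 / t) *\<^sub>R k\<close>. As \<open>z\<close>
        and \<open>y\<close> both lie in the unit ball, \<open>k\<close> has norm below
        \<open>2 * t\<close>.\<close>
      have inner: "(\<integral>\<^sup>+y\<in>ball 0 1. A (z + t *\<^sub>R (y - z)) \<partial>lborel) \<le> ennreal (t powr - real ?n) * a t z"
        if t: "0 < t" "t < 1" for t
      proof -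
        have "(\<integral>\<^sup>+y\<in>ball 0 1. A (z + t *\<^sub>R (y - z)) \<partial>lborel)
          = ennreal ((1 / t) ^ ?n) * (\<integral>\<^sup>+k. A (z + t *\<^sub>R ((z + (1 / t) *\<^sub>R k) - z)) * indicator (ball 0 1) (z + (1 / t) *\<^sub>R k) \<partial>lborel)"
          using t by (intro nn_integral_lborel_affine) auto
        also have "\<dots> \<le> ennreal ((1 / t) ^ ?n) * a t z"
          unfolding a_def
        proof (intro mult_left_mono nn_integral_mono)
          fix k :: 'a
          show "A (z + t *\<^sub>R ((z + (1 / t) *\<^sub>R k) - z)) * indicator (ball 0 1) (z + (1 / t) *\<^sub>R k)
              \<le> At (z + k) * indicator (ball 0 (2 * t)) k"
          proof (cases "z + (1 / t) *\<^sub>R k \<in> ball 0 1")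
            case True
            have "norm ((1 / t) *\<^sub>R k) \<le> norm (z + (1 / t) *\<^sub>R k) + norm z"
              by (metis add_diff_cancel_left' norm_triangle_ineq4)
            also have "\<dots> < 2" using True z by simp
            finally have k: "norm k < 2 * t" using t by (simp add: field_simps)
            have "z + k = (1 - t) *\<^sub>R z + t *\<^sub>R (z + (1 / t) *\<^sub>R k)"
              using t by (simp add: algebra_simps)
            then have "z + k \<in> ball 0 1"
              using convexD[OF convex_ball z True, of "1 - t" t] t by auto
            then show ?thesis using k t by (simp add: At_def indicator_def)
          qed simp
        qed simp
        also have "(1 / t) ^ ?n = t powr - real ?n"
          using t by (simp add: powr_minus powr_realpow power_one_over inverse_eq_divide)
        finally show ?thesis .
      qed
      \<comment> \<open>The constant \<open>\<bar>u z - u 0\<bar>\<close> is integrated over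
        \<open>y\<close> in the unit ball, which produces the factor \<open>V\<close>, and the
        triangle inequality is applied through \<open>u y\<close>.\<close>
      have "ennreal V * ennreal \<bar>u z - u 0\<bar> = (\<integral>\<^sup>+y\<in>ball (0::'a) 1. ennreal \<bar>u z - u 0\<bar> \<partial>lborel)"
        by (subst nn_integral_cmult_indicator) (simp_all add: emeasure_lborel_ball V_def mult.commute)
      also have "\<dots> \<le> (\<integral>\<^sup>+y. ennreal \<bar>u y - u z\<bar> * indicator (ball 0 1) y + ennreal \<bar>u y - u 0\<bar> * indicator (ball 0 1) y \<partial>lborel)"
        by (intro nn_integral_mono) (auto simp: indicator_def simp flip: ennreal_plus intro!: ennreal_leI)
      also have "\<dots> = (\<integral>\<^sup>+y\<in>ball 0 1. ennreal \<bar>u y - u z\<bar> \<partial>lborel) + (\<integral>\<^sup>+y\<in>ball 0 1. ennreal \<bar>u y - u 0\<bar> \<partial>lborel)"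
        by (intro nn_integral_add) auto
      also have "(\<integral>\<^sup>+y\<in>ball 0 1. ennreal \<bar>u y - u z\<bar> \<partial>lborel)
         \<le> (\<integral>\<^sup>+y. (\<integral>\<^sup>+t. 2 * (A (z + t *\<^sub>R (y - z)) * indicator {0<..<1} t * indicator (ball 0 1) y) \<partial>lborel) \<partial>lborel)"
      proof (intro nn_integral_mono)
        fix y :: 'a
        show "ennreal \<bar>u y - u z\<bar> * indicator (ball 0 1) y
          \<le> (\<integral>\<^sup>+t. 2 * (A (z + t *\<^sub>R (y - z)) * indicator {0<..<1} t * indicator (ball 0 1) y) \<partial>lborel)"
        proof (cases "y \<in> ball 0 1")
          case True
          then have "norm (y - z) \<le> 2" using z norm_triangle_ineq4[of y z] by auto
          then have "ennreal (norm (y - z)) \<le> 2" by (metis ennreal_leI ennreal_numeral zero_le_numeral)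
          then show ?thesis
            using order_trans[OF FTC[of z "y - z"] mult_right_mono[of _ 2]] True by (simp add: nn_integral_cmult)
        qed simp
      qed
      also have "\<dots> = (\<integral>\<^sup>+t. (\<integral>\<^sup>+y. 2 * (A (z + t *\<^sub>R (y - z)) * indicator {0<..<1} t * indicator (ball 0 1) y) \<partial>lborel) \<partial>lborel)"
        by (intro nn_integral_lborel_swap) measurable
      also have "\<dots> = (\<integral>\<^sup>+t. 2 * ((\<integral>\<^sup>+y\<in>ball 0 1. A (z + t *\<^sub>R (y - z)) \<partial>lborel) * indicator {0<..<1} t) \<partial>lborel)"
        by (subst nn_integral_multc[symmetric], simp, subst nn_integral_cmult[symmetric])
           (auto intro!: nn_integral_cong simp: mult_ac)
      also have "\<dots> \<le> (\<integral>\<^sup>+t. 2 * ((ennreal (t powr - real ?n) * a t z) * indicator {0<..<1} t) \<partial>lborel)"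
        using inner by (intro nn_integral_mono mult_left_mono) (auto simp: indicator_def)
      also have "\<dots> = 2 * (\<integral>\<^sup>+t\<in>{0<..<1}. ennreal (t powr - real ?n) * a t z \<partial>lborel)"
        by (intro nn_integral_cmult) measurable
      finally show ?thesis using center by (meson add_mono order_trans order_refl)
    qed
    have Lp: "(\<integral>\<^sup>+z. enn_powr (\<integral>\<^sup>+t\<in>{0<..<1}. ennreal (t powr - real ?n) * a t z \<partial>lborel) p \<partial>lborel)
        \<le> ennreal (K powr (p - 1) * (L * (1 / (\<kappa> + 1))) * N powr p)"
    proof -
      \<comment> \<open>The factor \<open>t powr - n\<close> to the power \<open>p\<close>, times
        Jensen's weight \<open>(t powr - \<alpha>) powr (1 - p)\<close>. The slice bound later adds
        \<open>n * (p - p / s + 1)\<close> and turns \<open>e\<close> into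
        \<open>\<kappa>\<close>.\<close>
      define e where "e = \<alpha> * (p - 1) - real ?n * p"
      have step: "enn_powr (\<integral>\<^sup>+t\<in>{0<..<1}. ennreal (t powr - real ?n) * a t z \<partial>lborel) p
        \<le> ennreal (K powr (p - 1)) * (\<integral>\<^sup>+t. ennreal (t powr e) * indicator {0<..<1} t * enn_powr (a t z) p \<partial>lborel)" for z
      proof -
        let ?M = "restrict_space lborel {0<..<1::real}"
        have "enn_powr (\<integral>\<^sup>+t. ennreal (t powr - real ?n) * a t z \<partial>?M) p
           \<le> ennreal (K powr (p - 1)) * (\<integral>\<^sup>+t. enn_powr (ennreal (t powr - real ?n) * a t z) p * ennreal ((t powr - \<alpha>) powr (1 - p)) \<partial>?M)"
        proof (intro nn_integral_weighted_jensen p)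
          show "(\<integral>\<^sup>+t. ennreal (t powr - \<alpha>) \<partial>?M) \<le> ennreal K"
            using nn_integral_powr_0[of "- \<alpha>" 1] \<alpha> by (simp add: nn_integral_restrict_space K_def)
        qed (auto simp: K space_restrict_space intro!: measurable_restrict_space1)
        also have "\<dots> = ennreal (K powr (p - 1)) * (\<integral>\<^sup>+t. ennreal (t powr e) * enn_powr (a t z) p \<partial>?M)"
        proof (rule arg_cong[where f="(*) _"], rule nn_integral_cong)
          fix t assume "t \<in> space ?M"
          then have t: "0 < t" by (simp add: space_restrict_space)
          have "enn_powr (ennreal (t powr - real ?n)) p * ennreal ((t powr - \<alpha>) powr (1 - p)) = ennreal (t powr e)"
            using t by (simp add: enn_powr_ennreal powr_powr e_def algebra_simps flip: ennreal_mult powr_add)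
          then show "enn_powr (ennreal (t powr - real ?n) * a t z) p * ennreal ((t powr - \<alpha>) powr (1 - p))
              = ennreal (t powr e) * enn_powr (a t z) p"
            by (simp add: enn_powr_mult mult_ac)
        qed
        finally show ?thesis
          by (simp add: nn_integral_restrict_space mult_ac)
      qed
      have slice: "(\<integral>\<^sup>+z. enn_powr (a t z) p \<partial>lborel) \<le> ennreal (L * t powr (real ?n * (p - p / s + 1)) * N powr p)"
        if t: "0 < t" for t
      proof -
        have "(\<integral>\<^sup>+x. enn_powr (At x) s \<partial>lborel) = (\<integral>\<^sup>+x\<in>ball 0 1. enn_powr (A x) s \<partial>lborel)"
          by (intro nn_integral_cong) (auto simp: At_def indicator_def)
        also have "\<dots> \<le> ennreal (N powr s)" using bd[of 1] by simp
        finally have "(\<integral>\<^sup>+z. enn_powr (a t z) p \<partial>lborel)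
            \<le> ennreal ((V * (2 * t) ^ ?n) powr (p - p / s + 1) * N powr p)"
          unfolding a_def V_def using s sp t N by (intro ball_average_Lp_Ls) auto
        also have "(V * (2 * t) ^ ?n) powr (p - p / s + 1) = L * t powr (real ?n * (p - p / s + 1))"
          using V t by (simp add: L_def power_mult_distrib powr_mult powr_powr flip: powr_realpow)
        finally show ?thesis .
      qed
      have "(\<integral>\<^sup>+z. enn_powr (\<integral>\<^sup>+t\<in>{0<..<1}. ennreal (t powr - real ?n) * a t z \<partial>lborel) p \<partial>lborel)
        \<le> (\<integral>\<^sup>+z. ennreal (K powr (p - 1)) * (\<integral>\<^sup>+t. ennreal (t powr e) * indicator {0<..<1} t * enn_powr (a t z) p \<partial>lborel) \<partial>lborel)"
        by (intro nn_integral_mono step)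
      also have "\<dots> = ennreal (K powr (p - 1)) * (\<integral>\<^sup>+z. (\<integral>\<^sup>+t. ennreal (t powr e) * indicator {0<..<1} t * enn_powr (a t z) p \<partial>lborel) \<partial>lborel)"
        by (intro nn_integral_cmult) measurable
      also have "(\<integral>\<^sup>+z. (\<integral>\<^sup>+t. ennreal (t powr e) * indicator {0<..<1} t * enn_powr (a t z) p \<partial>lborel) \<partial>lborel)
          = (\<integral>\<^sup>+t. (\<integral>\<^sup>+z. ennreal (t powr e) * indicator {0<..<1} t * enn_powr (a t z) p \<partial>lborel) \<partial>lborel)"
        by (intro nn_integral_lborel_swap) measurable
      also have "\<dots> = (\<integral>\<^sup>+t. ennreal (t powr e) * indicator {0<..<1} t * (\<integral>\<^sup>+z. enn_powr (a t z) p \<partial>lborel) \<partial>lborel)"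
        by (intro nn_integral_cong nn_integral_cmult) measurable
      also have "\<dots> \<le> (\<integral>\<^sup>+t. ennreal (L * N powr p) * (ennreal (t powr \<kappa>) * indicator {0<..<1} t) \<partial>lborel)"
      proof (intro nn_integral_mono)
        fix t :: real
        show "ennreal (t powr e) * indicator {0<..<1} t * (\<integral>\<^sup>+z. enn_powr (a t z) p \<partial>lborel)
          \<le> ennreal (L * N powr p) * (ennreal (t powr \<kappa>) * indicator {0<..<1} t)"
        proof (cases "t \<in> {0<..<1}")
          case True
          have "ennreal (t powr e) * (\<integral>\<^sup>+z. enn_powr (a t z) p \<partial>lborel)
              \<le> ennreal (t powr e) * ennreal (L * t powr (real ?n * (p - p / s + 1)) * N powr p)"
            using slice True by (intro mult_left_mono) auto
          also have "\<dots> = ennreal (L * N powr p * (t powr e * t powr (real ?n * (p - p / s + 1))))"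
            by (simp add: L_def mult_ac flip: ennreal_mult)
          also have "t powr e * t powr (real ?n * (p - p / s + 1)) = t powr \<kappa>"
            by (simp add: e_def \<kappa>_def algebra_simps flip: powr_add)
          finally show ?thesis using True by (simp add: L_def ennreal_mult)
        qed simp
      qed
      also have "\<dots> = ennreal (L * N powr p) * (\<integral>\<^sup>+t\<in>{0<..<1}. ennreal (t powr \<kappa>) \<partial>lborel)"
        by (intro nn_integral_cmult) measurable
      also have "\<dots> = ennreal (L * N powr p * (1 / (\<kappa> + 1)))"
        using \<kappa> by (subst nn_integral_powr_0) (auto simp: L_def simp flip: ennreal_mult)
      finally show ?thesis
        using \<kappa> by (simp add: L_def mult_ac mult_left_mono mult_right_mono flip: ennreal_mult)
    qed
    have "(\<integral>\<^sup>+h\<in>ball 0 1. ennreal (\<bar>u h - u 0\<bar> powr p) \<partial>lborel)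
      \<le> (\<integral>\<^sup>+z. ennreal ((1 / V) powr p) * (ennreal (2 powr p) * (ennreal (2 powr p) *
          enn_powr (\<integral>\<^sup>+t\<in>{0<..<1}. ennreal (t powr - real ?n) * a t z \<partial>lborel) p + ennreal ((c * N) powr p) * indicator (ball 0 1) z)) \<partial>lborel)"
    proof (intro nn_integral_mono)
      fix z :: 'a
      let ?I = "\<integral>\<^sup>+t\<in>{0<..<1}. ennreal (t powr - real ?n) * a t z \<partial>lborel"
      show "ennreal (\<bar>u z - u 0\<bar> powr p) * indicator (ball 0 1) z
        \<le> ennreal ((1 / V) powr p) * (ennreal (2 powr p) * (ennreal (2 powr p) * enn_powr ?I p + ennreal ((c * N) powr p) * indicator (ball 0 1) z))"
      proof (cases "z \<in> ball 0 1")
        case True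
        have "ennreal \<bar>u z - u 0\<bar> = ennreal (1 / V) * (ennreal V * ennreal \<bar>u z - u 0\<bar>)"
          using V by (simp flip: ennreal_mult)
        also have "\<dots> \<le> ennreal (1 / V) * (2 * ?I + ennreal (c * N))"
          using point[OF True] by (intro mult_left_mono) auto
        finally have "enn_powr (ennreal \<bar>u z - u 0\<bar>) p \<le> enn_powr (ennreal (1 / V) * (2 * ?I + ennreal (c * N))) p"
          using p by (intro enn_powr_mono) auto
        also have "\<dots> = ennreal ((1 / V) powr p) * enn_powr (2 * ?I + ennreal (c * N)) p"
          using V by (simp add: enn_powr_mult enn_powr_ennreal)
        also have "\<dots> \<le> ennreal ((1 / V) powr p) * (ennreal (2 powr p) * (enn_powr (2 * ?I) p + enn_powr (ennreal (c * N)) p))"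
          using p by (intro mult_left_mono enn_powr_add_le) auto
        also have "enn_powr (2 * ?I) p = ennreal (2 powr p) * enn_powr ?I p"
          using enn_powr_ennreal[of 2 p] by (simp add: enn_powr_mult)
        also have "enn_powr (ennreal (c * N)) p = ennreal ((c * N) powr p)"
          using N by (intro enn_powr_ennreal) (simp add: c_def)
        finally show ?thesis using True by (simp add: enn_powr_ennreal)
      qed simp
    qed
    also have "\<dots> = ennreal ((1 / V) powr p) * (ennreal (2 powr p) * (ennreal (2 powr p) *
          (\<integral>\<^sup>+z. enn_powr (\<integral>\<^sup>+t\<in>{0<..<1}. ennreal (t powr - real ?n) * a t z \<partial>lborel) p \<partial>lborel) + ennreal ((c * N) powr p) * ennreal V))"
      by (simp add: nn_integral_cmult nn_integral_add emeasure_lborel_ball V_def)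
    also have "\<dots> \<le> ennreal ((1 / V) powr p) * (ennreal (2 powr p) * (ennreal (2 powr p) *
          ennreal (K powr (p - 1) * (L * (1 / (\<kappa> + 1))) * N powr p) + ennreal ((c * N) powr p) * ennreal V))"
      by (intro mult_left_mono add_right_mono Lp) auto
    also have "\<dots> = ennreal (C * N powr p)"
      using V \<kappa> N by (simp add: C_def L_def c_def powr_mult algebra_simps flip: ennreal_mult ennreal_plus)
    finally have "(\<integral>\<^sup>+h\<in>ball 0 1. ennreal (\<bar>u h - u 0\<bar> powr p) \<partial>lborel) \<le> ennreal (C * N powr p)" .
  }
  ultimately show ?thesis by blast
qed

section \<open>The maximal function and Lorentz norms\<close>

text \<open>Strict lower bounds by finite levels are the form in which rearrangements are described
  below, so equalities between them are best tested this way.\<close>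

lemma ennreal_eqI_less:
  fixes x y :: ennreal
  assumes "\<And>a. 0 \<le> a \<Longrightarrow> ennreal a < x \<longleftrightarrow> ennreal a < y"
  shows "x = y"
proof -
  have "\<not> x < y" if "\<And>a. 0 \<le> a \<Longrightarrow> ennreal a < x \<longleftrightarrow> ennreal a < y" for x y
  proof
    assume "x < y"
    then have "x \<noteq> top" by auto
    then obtain a where "0 \<le> a" "x = ennreal a" by (metis ennreal_cases)
    then show False using that[of a] \<open>x < y\<close> by simp
  qed
  then show ?thesis using assms by (meson linorder_neqE)
qed

text \<open>Centred Hardy-Littlewood maximal function, normalised by the power of the radius in
  place of the volume; factors \<open>vol\<close> therefore appear in its estimates.\<close>

definition maximal :: "('a::euclidean_space \<Rightarrow> ennreal) \<Rightarrow> 'a \<Rightarrow> ennreal"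
  where "maximal F x = (SUP r\<in>{0<..}. ennreal (1 / r ^ DIM('a)) * (\<integral>\<^sup>+y\<in>ball x r. F y \<partial>lborel))"

text \<open>If the integral over \<open>ball x r\<close> exceeds \<open>a\<close>, then, by
  continuity from below, so does the integral over a slightly smaller concentric ball, and that ball
  lies in \<open>ball y r\<close> for all \<open>y\<close> near \<open>x\<close>.\<close>

lemma nn_integral_ball_lower_semicontinuous:
  fixes F :: "'a::euclidean_space \<Rightarrow> ennreal"
  assumes [measurable]: "F \<in> borel_measurable borel"
  shows "open {x. a < (\<integral>\<^sup>+y\<in>ball x r. F y \<partial>lborel)}"
proof (subst open_dist, safe)
  fix x assume "a < (\<integral>\<^sup>+y\<in>ball x r. F y \<partial>lborel)"
  define \<mu> where "\<mu> = density lborel F"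
  have \<mu>: "emeasure \<mu> (ball x r) = (\<integral>\<^sup>+y\<in>ball x r. F y \<partial>lborel)" for x r
    unfolding \<mu>_def by (subst emeasure_density) auto
  have "(SUP k. emeasure \<mu> (ball x (r - 1 / real (Suc k)))) = emeasure \<mu> (\<Union>k. ball x (r - 1 / real (Suc k)))"
    by (intro SUP_emeasure_incseq)
       (auto simp: \<mu>_def incseq_def field_simps intro!: subset_ball divide_left_mono)
  also have "(\<Union>k. ball x (r - 1 / real (Suc k))) = ball x r"
  proof (intro equalityI subsetI)
    fix y assume "y \<in> ball x r"
    then obtain k where "1 / real (Suc k) < r - dist x y"
      using nat_approx_posE[of "r - dist x y"] by (auto simp: inverse_eq_divide)
    then show "y \<in> (\<Union>k. ball x (r - 1 / real (Suc k)))"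
      by (intro UN_I[of k]) auto
  next
    fix y assume "y \<in> (\<Union>k. ball x (r - 1 / real (Suc k)))"
    then obtain k where "dist x y < r - 1 / real (Suc k)" by auto
    moreover have "0 < 1 / real (Suc k)" by simp
    ultimately show "y \<in> ball x r" unfolding mem_ball by linarith
  qed
  finally have "a < (SUP k. emeasure \<mu> (ball x (r - 1 / real (Suc k))))"
    using \<open>a < _\<close> by (simp add: \<mu>)
  then obtain k where k: "a < emeasure \<mu> (ball x (r - 1 / real (Suc k)))"
    unfolding less_SUP_iff by blast
  show "\<exists>e>0. \<forall>y. dist y x < e \<longrightarrow> y \<in> {x. a < (\<integral>\<^sup>+y\<in>ball x r. F y \<partial>lborel)}"
  proof (intro exI[of _ "1 / real (Suc k)"] conjI allI impI)
    fix y assume y: "dist y x < 1 / real (Suc k)"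
    have "ball x (r - 1 / real (Suc k)) \<subseteq> ball y r"
    proof
      fix z assume "z \<in> ball x (r - 1 / real (Suc k))"
      then show "z \<in> ball y r" using y dist_triangle[of y z x] by auto
    qed
    then have "emeasure \<mu> (ball x (r - 1 / real (Suc k))) \<le> emeasure \<mu> (ball y r)"
      by (intro emeasure_mono) (auto simp: \<mu>_def)
    then show "y \<in> {x. a < (\<integral>\<^sup>+y\<in>ball x r. F y \<partial>lborel)}"
      using k by (simp add: \<mu>)
  qed simp
qed

lemma less_ennreal_inverse_mult_iff:
  assumes "0 < c"
  shows "a < ennreal (1 / c) * X \<longleftrightarrow> ennreal c * a < X"
proof -
  have *: "ennreal c * (ennreal (1 / c) * X) = X" "ennreal (1 / c) * (ennreal c * a) = a"
    using assms by (simp_all add: mult.assoc[symmetric] flip: ennreal_mult)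
  show ?thesis
  proof
    assume "a < ennreal (1 / c) * X"
    then have "ennreal c * a < ennreal c * (ennreal (1 / c) * X)"
      using assms by (intro ennreal_mult_strict_left_mono) auto
    then show "ennreal c * a < X" using * by simp
  next
    assume "ennreal c * a < X"
    then have "ennreal (1 / c) * (ennreal c * a) < ennreal (1 / c) * X"
      using assms by (intro ennreal_mult_strict_left_mono) auto
    then show "a < ennreal (1 / c) * X" using * by simp
  qed
qed

text \<open>A superlevel set is a union over uncountably many radii; it is measurable because each
  member is open.\<close>

lemma maximal_measurable [measurable]:
  fixes F :: "'a::euclidean_space \<Rightarrow> ennreal"
  assumes "F \<in> borel_measurable borel"
  shows "maximal F \<in> borel_measurable borel"
proof (rule borel_measurableI_greater)
  fix a
  have "{x \<in> space borel. a < maximal F x}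
      = (\<Union>r\<in>{0<..}. {x. ennreal (r ^ DIM('a)) * a < (\<integral>\<^sup>+y\<in>ball x r. F y \<partial>lborel)})"
    by (auto simp: maximal_def less_SUP_iff less_ennreal_inverse_mult_iff)
  also have "open \<dots>"
    using nn_integral_ball_lower_semicontinuous[OF assms] by auto
  finally show "{x \<in> space borel. a < maximal F x} \<in> sets borel"
    by simp
qed

lemma maximal_ge:
  fixes F :: "'a::euclidean_space \<Rightarrow> ennreal"
  assumes "0 < r"
  shows "(\<integral>\<^sup>+y\<in>ball x r. F y \<partial>lborel) \<le> ennreal (r ^ DIM('a)) * maximal F x"
proof -
  have "ennreal (1 / r ^ DIM('a)) * (\<integral>\<^sup>+y\<in>ball x r. F y \<partial>lborel) \<le> maximal F x"
    using assms unfolding maximal_def by (intro SUP_upper) auto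
  then have "ennreal (r ^ DIM('a)) * (ennreal (1 / r ^ DIM('a)) * (\<integral>\<^sup>+y\<in>ball x r. F y \<partial>lborel))
      \<le> ennreal (r ^ DIM('a)) * maximal F x"
    by (intro mult_left_mono) auto
  then show ?thesis
    using assms by (simp add: mult.assoc[symmetric] flip: ennreal_mult)
qed

text \<open>Vitali's covering argument with enlargement factor 5. It needs bounded radii, which is
  why an infinite integral is split off as trivial.\<close>

lemma maximal_weak_type:
  fixes F :: "'a::euclidean_space \<Rightarrow> ennreal"
  assumes F [measurable]: "F \<in> borel_measurable borel" and a: "0 < a"
  shows "emeasure lborel {x. ennreal a < maximal F x}
    \<le> ennreal (5 ^ DIM('a) * vol TYPE('a) / a) * (\<integral>\<^sup>+x. F x \<partial>lborel)"
proof (cases "\<integral>\<^sup>+x. F x \<partial>lborel" rule: ennreal_cases)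
  case top
  moreover have "0 < 5 ^ DIM('a) * vol TYPE('a) / a" using a by simp
  ultimately show ?thesis by (simp add: ennreal_mult_top ennreal_eq_0_iff)
next
  case (real I)
  let ?n = "DIM('a)"
  define S where "S = {x. ennreal a < maximal F x}"
  have "\<exists>r>0. ennreal (r ^ ?n * a) < (\<integral>\<^sup>+y\<in>ball x r. F y \<partial>lborel)" if "x \<in> S" for x
    using that a by (auto simp: S_def maximal_def less_SUP_iff less_ennreal_inverse_mult_iff ennreal_mult)
  then obtain r where r: "\<And>x. x \<in> S \<Longrightarrow> 0 < r x"
      "\<And>x. x \<in> S \<Longrightarrow> ennreal (r x ^ ?n * a) < (\<integral>\<^sup>+y\<in>ball x (r x). F y \<partial>lborel)"
    by metis
  \<comment> \<open>For a radius above 1 the chain \<open>r x \<le> r x ^ n < I / a\<close> gives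
    the bound.\<close>
  have rB: "r x \<le> max 1 (I / a)" if x: "x \<in> S" for x
  proof (cases "r x \<le> 1")
    case False
    have "ennreal (r x ^ ?n * a) < ennreal I"
      using r(2)[OF x] by (rule less_le_trans)
        (auto simp: indicator_def simp flip: real(2) intro!: nn_integral_mono)
    then have "r x ^ ?n * a < I"
      using r(1)[OF x] a by (subst (asm) ennreal_less_iff) auto
    moreover have "r x \<le> r x ^ ?n"
      using False by (intro self_le_power) auto
    ultimately show ?thesis
      using a by (smt (verit) max.coboundedI2 mult_right_mono pos_le_divide_eq)
  qed auto
  have cov: "S \<subseteq> (\<Union>i\<in>S. ball i (r i))" using r(1) by auto
  have rB': "\<And>i. i \<in> S \<Longrightarrow> 0 < r i \<and> r i \<le> max 1 (I / a)" using r(1) rB by auto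
  obtain C where C: "countable C" "C \<subseteq> S" "pairwise (\<lambda>i j. disjnt (ball i (r i)) (ball j (r j))) C"
      "S \<subseteq> (\<Union>i\<in>C. ball i (5 * r i))"
    by (rule Vitali_covering_lemma_balls[OF cov rB']) blast+
  define \<mu> where "\<mu> = density lborel F"
  have \<mu>: "emeasure \<mu> X = (\<integral>\<^sup>+y\<in>X. F y \<partial>lborel)" if "X \<in> sets borel" for X
    unfolding \<mu>_def using that by (subst emeasure_density) auto
  have "emeasure lborel S = (\<integral>\<^sup>+x. indicator S x \<partial>lborel)"
    unfolding S_def by simp
  also have "\<dots> \<le> (\<integral>\<^sup>+x. (\<integral>\<^sup>+i. indicator (ball i (5 * r i)) x \<partial>count_space C) \<partial>lborel)"
  proof (intro nn_integral_mono)
    fix x :: 'a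
    show "(indicator S x :: ennreal) \<le> (\<integral>\<^sup>+i. indicator (ball i (5 * r i)) x \<partial>count_space C)"
    proof (cases "x \<in> S")
      case True
      then obtain j where j: "j \<in> C" "x \<in> ball j (5 * r j)" using C(4) by auto
      have "(1::ennreal) = indicator (ball j (5 * r j)) x" using j by simp
      also have "\<dots> \<le> (\<integral>\<^sup>+i. indicator (ball i (5 * r i)) x \<partial>count_space C)"
        using j(1) by (rule nn_integral_ge_point)
      finally show ?thesis using True by simp
    qed simp
  qed
  also have "\<dots> = (\<integral>\<^sup>+i. (\<integral>\<^sup>+x. indicator (ball i (5 * r i)) x \<partial>lborel) \<partial>count_space C)"
    using C(1) by (intro nn_integral_count_space_nn_integral) auto
  also have "\<dots> \<le> (\<integral>\<^sup>+i. ennreal (5 ^ ?n * vol TYPE('a) / a) * emeasure \<mu> (ball i (r i)) \<partial>count_space C)"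
  proof (intro nn_integral_mono)
    fix i assume "i \<in> space (count_space C)"
    then have i: "i \<in> S" using C by auto
    have "(\<integral>\<^sup>+x. indicator (ball i (5 * r i)) x \<partial>lborel) = ennreal (5 ^ ?n * vol TYPE('a) / a * (r i ^ ?n * a))"
      using r(1)[OF i] a by (simp add: emeasure_lborel_ball power_mult_distrib mult_ac)
    also have "\<dots> = ennreal (5 ^ ?n * vol TYPE('a) / a) * ennreal (r i ^ ?n * a)"
      using a by (intro ennreal_mult) (auto simp: r(1)[OF i] less_imp_le vol_pos)
    also have "\<dots> \<le> ennreal (5 ^ ?n * vol TYPE('a) / a) * emeasure \<mu> (ball i (r i))"
      using r(2)[OF i] by (intro mult_left_mono) (auto simp: \<mu>)
    finally show "(\<integral>\<^sup>+x. indicator (ball i (5 * r i)) x \<partial>lborel)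
        \<le> ennreal (5 ^ ?n * vol TYPE('a) / a) * emeasure \<mu> (ball i (r i))" .
  qed
  also have "\<dots> = ennreal (5 ^ ?n * vol TYPE('a) / a) * (\<integral>\<^sup>+i. emeasure \<mu> (ball i (r i)) \<partial>count_space C)"
    by (intro nn_integral_cmult) auto
  also have "(\<integral>\<^sup>+i. emeasure \<mu> (ball i (r i)) \<partial>count_space C) = emeasure \<mu> (\<Union>i\<in>C. ball i (r i))"
    using C by (intro emeasure_UN_countable[symmetric])
      (auto simp: \<mu>_def disjoint_family_on_def pairwise_def disjnt_def)
  also have "\<dots> \<le> emeasure \<mu> UNIV"
    by (intro emeasure_mono) (auto simp: \<mu>_def)
  also have "\<dots> = (\<integral>\<^sup>+x. F x \<partial>lborel)"
    by (simp add: \<mu>)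
  finally show ?thesis
    by (simp add: S_def mult_left_mono)
qed

section \<open>Distribution function, rearrangement and Lorentz norm\<close>

definition distr_fun :: "('a::euclidean_space \<Rightarrow> ennreal) \<Rightarrow> real \<Rightarrow> ennreal"
  where "distr_fun G a = emeasure lborel {x. ennreal a < G x}"

lemma distr_fun_antimono:
  assumes [measurable]: "G \<in> borel_measurable borel" and "a \<le> b"
  shows "distr_fun G b \<le> distr_fun G a"
  unfolding distr_fun_def using assms(2) ennreal_leI[OF assms(2)]
  by (intro emeasure_mono) auto

lemma distr_fun_measurable [measurable]:
  fixes G :: "'a::euclidean_space \<Rightarrow> ennreal"
  assumes [measurable]: "G \<in> borel_measurable borel"
  shows "distr_fun G \<in> borel_measurable borel"
proof -
  have "(\<lambda>a. \<integral>\<^sup>+x. indicator {(a, x). ennreal a < G x} (a, x) \<partial>lborel) \<in> borel_measurable borel"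
    by measurable
  also have "(\<lambda>a. \<integral>\<^sup>+x. indicator {(a, x). ennreal a < G x} (a, x) \<partial>lborel) = distr_fun G"
  proof
    fix a
    have "(\<integral>\<^sup>+x. indicator {(a, x). ennreal a < G x} (a, x) \<partial>lborel) = (\<integral>\<^sup>+x. indicator {x. ennreal a < G x} x \<partial>lborel)"
      by (intro nn_integral_cong) (auto simp: indicator_def)
    then show "(\<integral>\<^sup>+x. indicator {(a, x). ennreal a < G x} (a, x) \<partial>lborel) = distr_fun G a"
      by (simp add: distr_fun_def)
  qed
  finally show ?thesis .
qed

text \<open>The rearrangement is the generalised inverse of the distribution function. The
  equivalence is exact for strict inequalities because \<open>distr_fun G\<close> is continuous from
  the right, by continuity of the measure from below. All later facts about \<open>rearr\<close> are
  read off from this one.\<close>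

lemma less_rearr_iff:
  fixes G :: "'a::euclidean_space \<Rightarrow> ennreal"
  assumes [measurable]: "G \<in> borel_measurable borel" and a: "0 \<le> a"
  shows "ennreal a < rearr G t \<longleftrightarrow> ennreal t < distr_fun G a"
proof -
  have d: "emeasure lebesgue {x. ennreal s < G x} = distr_fun G s" for s
    by (simp add: distr_fun_def)
  show ?thesis
  proof
    assume L: "ennreal a < rearr G t"
    show "ennreal t < distr_fun G a"
    proof (rule ccontr)
      assume *: "\<not> ennreal t < distr_fun G a"
      \<comment> \<open>Levels strictly above \<open>a\<close> are used: the infimum ranges over
        positive numbers, and this also covers \<open>a = 0\<close>.\<close>
      have le: "rearr G t \<le> ennreal s" if "a < s" for s
        unfolding rearr_def d using that a * distr_fun_antimono[OF assms(1), of a s]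
        by (intro INF_lower) auto
      have "rearr G t \<le> ennreal a"
      proof (rule ennreal_le_epsilon)
        fix e :: real assume "0 < e"
        then show "rearr G t \<le> ennreal a + ennreal e"
          using le[of "a + e"] a by simp
      qed
      then show False using L by simp
    qed
  next
    assume R: "ennreal t < distr_fun G a"
    have "{x. ennreal a < G x} = (\<Union>k. {x. ennreal (a + 1 / real (Suc k)) < G x})"
    proof (intro equalityI subsetI)
      fix x assume "x \<in> {x. ennreal a < G x}"
      then obtain y where y: "ennreal a < y" "y < G x" by (meson dense mem_Collect_eq)
      then obtain b where b: "y = ennreal b" "0 \<le> b" by (metis ennreal_cases not_top_less top.extremum_strict)
      then have "a < b" using y a by (simp add: ennreal_less_iff)
      then obtain k where "1 / real (Suc k) < b - a"
        using nat_approx_posE[of "b - a"] by (auto simp: inverse_eq_divide)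
      then have "ennreal (a + 1 / real (Suc k)) \<le> y" using b by (auto intro!: ennreal_leI)
      then show "x \<in> (\<Union>k. {x. ennreal (a + 1 / real (Suc k)) < G x})"
        using y by (intro UN_I[of k]) auto
    next
      fix x assume "x \<in> (\<Union>k. {x. ennreal (a + 1 / real (Suc k)) < G x})"
      then obtain k where "ennreal (a + 1 / real (Suc k)) < G x" by auto
      moreover have "ennreal a \<le> ennreal (a + 1 / real (Suc k))" by (intro ennreal_leI) simp
      ultimately show "x \<in> {x. ennreal a < G x}" by auto
    qed
    then have "distr_fun G a = emeasure lborel (\<Union>k. {x. ennreal (a + 1 / real (Suc k)) < G x})"
      by (simp add: distr_fun_def)
    also have "\<dots> = (SUP k. distr_fun G (a + 1 / real (Suc k)))"
      unfolding distr_fun_def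
    proof (intro SUP_emeasure_incseq[symmetric])
      show "incseq (\<lambda>k. {x. ennreal (a + 1 / real (Suc k)) < G x})"
      proof (rule incseq_SucI, safe)
        fix k x assume "ennreal (a + 1 / real (Suc k)) < G x"
        moreover have "ennreal (a + 1 / real (Suc (Suc k))) \<le> ennreal (a + 1 / real (Suc k))"
          by (intro ennreal_leI) (simp add: field_simps)
        ultimately show "ennreal (a + 1 / real (Suc (Suc k))) < G x" by simp
      qed
    qed auto
    finally obtain k where k: "ennreal t < distr_fun G (a + 1 / real (Suc k))"
      using R by (auto simp: less_SUP_iff)
    let ?b = "a + 1 / real (Suc k)"
    have "ennreal ?b \<le> rearr G t"
      unfolding rearr_def d
    proof (rule INF_greatest, safe)
      fix s :: real assume s: "0 < s" "distr_fun G s \<le> ennreal t"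
      then have "\<not> s \<le> ?b" using k distr_fun_antimono[OF assms(1), of s ?b] by (meson leD order_trans)
      then show "ennreal ?b \<le> ennreal s" by (intro ennreal_leI) auto
    qed
    moreover have "ennreal a < ennreal ?b" using a by (simp add: ennreal_less_iff)
    ultimately show "ennreal a < rearr G t" by simp
  qed
qed

lemma rearr_measurable [measurable]:
  fixes G :: "'a::euclidean_space \<Rightarrow> ennreal"
  assumes [measurable]: "G \<in> borel_measurable borel"
  shows "rearr G \<in> borel_measurable borel"
proof (rule borel_measurableI_greater)
  fix y
  show "{t \<in> space borel. y < rearr G t} \<in> sets borel"
  proof (cases y rule: ennreal_cases)
    case (real a)
    then show ?thesis using less_rearr_iff[OF assms] by simp
  qed simp
qed

lemma rearr_cmult:
  fixes G :: "'a::euclidean_space \<Rightarrow> ennreal"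
  assumes [measurable]: "G \<in> borel_measurable borel" and c: "0 < c"
  shows "rearr (\<lambda>x. ennreal c * G x) t = ennreal c * rearr G t"
proof (rule ennreal_eqI_less)
  fix a :: real assume a: "0 \<le> a"
  have *: "ennreal a < ennreal c * X \<longleftrightarrow> ennreal (a / c) < X" for X
    using less_ennreal_inverse_mult_iff[of "1 / c" "ennreal a" X] c a
    by (simp add: mult.commute flip: ennreal_mult)
  show "ennreal a < rearr (\<lambda>x. ennreal c * G x) t \<longleftrightarrow> ennreal a < ennreal c * rearr G t"
    using a c by (simp add: * less_rearr_iff distr_fun_def)
qed

lemma lorentz_norm_alt:
  "lorentz_norm r \<tau> G
    = enn_powr (\<integral>\<^sup>+t\<in>{0<..}. ennreal (t powr (\<tau> / r - 1)) * enn_powr (rearr G t) \<tau> \<partial>lborel) (1 / \<tau>)"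
proof -
  have "enn_powr (ennreal (t powr (1 / r)) * rearr G t) \<tau> * ennreal (1 / t)
      = ennreal (t powr (\<tau> / r - 1)) * enn_powr (rearr G t) \<tau>" if "0 < t" for t
  proof -
    have "enn_powr (ennreal (t powr (1 / r)) * rearr G t) \<tau> * ennreal (1 / t)
      = (ennreal (t powr (\<tau> / r)) * ennreal (1 / t)) * enn_powr (rearr G t) \<tau>"
      by (simp add: enn_powr_mult enn_powr_ennreal powr_powr mult_ac)
    also have "ennreal (t powr (\<tau> / r)) * ennreal (1 / t) = ennreal (t powr (\<tau> / r - 1))"
      using that by (simp add: powr_diff flip: ennreal_mult)
    finally show ?thesis .
  qed
  then have "(\<integral>\<^sup>+t\<in>{0<..}. enn_powr (ennreal (t powr (1 / r)) * rearr G t) \<tau> * ennreal (1 / t) \<partial>lborel)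
      = (\<integral>\<^sup>+t\<in>{0<..}. ennreal (t powr (\<tau> / r - 1)) * enn_powr (rearr G t) \<tau> \<partial>lborel)"
    by (intro nn_integral_cong) (auto simp: indicator_def)
  then show ?thesis
    by (simp add: lorentz_norm_def)
qed

lemma lorentz_norm_cmult:
  fixes G :: "'a::euclidean_space \<Rightarrow> ennreal"
  assumes [measurable]: "G \<in> borel_measurable borel" and c: "0 < c" and \<tau>: "0 < \<tau>"
  shows "lorentz_norm r \<tau> (\<lambda>x. ennreal c * G x) = ennreal c * lorentz_norm r \<tau> G"
proof -
  have "(\<integral>\<^sup>+t\<in>{0<..}. ennreal (t powr (\<tau> / r - 1)) * enn_powr (rearr (\<lambda>x. ennreal c * G x) t) \<tau> \<partial>lborel)
      = (\<integral>\<^sup>+t. ennreal (c powr \<tau>) * (ennreal (t powr (\<tau> / r - 1)) * enn_powr (rearr G t) \<tau> * indicator {0<..} t) \<partial>lborel)"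
    using c by (intro nn_integral_cong) (simp add: rearr_cmult enn_powr_mult enn_powr_ennreal mult_ac)
  also have "\<dots> = ennreal (c powr \<tau>) * (\<integral>\<^sup>+t\<in>{0<..}. ennreal (t powr (\<tau> / r - 1)) * enn_powr (rearr G t) \<tau> \<partial>lborel)"
    by (intro nn_integral_cmult) measurable
  finally show ?thesis
    using c \<tau> by (simp add: lorentz_norm_alt enn_powr_mult enn_powr_ennreal powr_powr)
qed

lemma rearr_mono_AE:
  fixes G H :: "'a::euclidean_space \<Rightarrow> ennreal"
  assumes [measurable]: "G \<in> borel_measurable borel" "H \<in> borel_measurable borel"
    and le: "AE x in lborel. G x \<le> H x"
  shows "rearr G t \<le> rearr H t"
proof (rule ccontr)
  assume "\<not> rearr G t \<le> rearr H t"
  then have lt: "rearr H t < rearr G t" by simp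
  then obtain a where a: "0 \<le> a" "rearr H t = ennreal a" by (metis ennreal_cases not_top_less)
  have "distr_fun G a \<le> distr_fun H a"
    unfolding distr_fun_def using le by (intro emeasure_mono_AE) auto
  then have "ennreal a < rearr H t"
    using lt a less_rearr_iff[of G a t] less_rearr_iff[of H a t] by simp
  then show False using a by simp
qed

lemma lorentz_norm_mono_AE:
  fixes G H :: "'a::euclidean_space \<Rightarrow> ennreal"
  assumes [measurable]: "G \<in> borel_measurable borel" "H \<in> borel_measurable borel"
    and le: "AE x in lborel. G x \<le> H x" and \<tau>: "0 < \<tau>"
  shows "lorentz_norm r \<tau> G \<le> lorentz_norm r \<tau> H"
  unfolding lorentz_norm_alt using \<tau>
  by (intro enn_powr_mono nn_integral_mono mult_right_mono mult_left_mono rearr_mono_AE[OF assms(1,2) le]) auto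

text \<open>The layer-cake formula for a single number, infinite values included. Inserted under an
  integral over \<open>x\<close>, it turns powers of a function into its superlevel sets.\<close>

lemma enn_powr_layer_cake:
  assumes p: "0 < p"
  shows "enn_powr X p = (\<integral>\<^sup>+a. ennreal (p * a powr (p - 1)) * (indicator {0<..} a * indicator {a. ennreal a < X} a) \<partial>lborel)"
    (is "_ = ?R X")
proof -
  have fin: "enn_powr (ennreal c) p = ?R (ennreal c)" if c: "0 \<le> c" for c
  proof -
    have "?R (ennreal c) = (\<integral>\<^sup>+a. ennreal p * (ennreal (a powr (p - 1)) * indicator {0<..<c} a) \<partial>lborel)"
      using c p by (intro nn_integral_cong) (auto simp: indicator_def ennreal_mult ennreal_less_iff)
    also have "\<dots> = ennreal p * ennreal (c powr p / p)"
      using nn_integral_powr_0[of "p - 1" c] p c by (subst nn_integral_cmult) auto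
    also have "\<dots> = ennreal (c powr p)"
      using p by (simp flip: ennreal_mult)
    finally show ?thesis using c by (simp add: enn_powr_ennreal)
  qed
  show ?thesis
  proof (cases X rule: ennreal_cases)
    case top
    define Z where "Z = ?R top"
    have Z: "ennreal (c powr p) \<le> Z" if "0 \<le> c" for c
    proof -
      have "ennreal (c powr p) = ?R (ennreal c)"
        using fin[OF that] enn_powr_ennreal[OF that] by simp
      also have "\<dots> \<le> Z"
        unfolding Z_def by (intro nn_integral_mono mult_left_mono) (auto simp: indicator_def)
      finally show ?thesis .
    qed
    have "Z = top"
    proof (cases Z rule: ennreal_cases)
      case (real b)
      \<comment> \<open>A finite value \<open>b\<close> of the integral is refuted by truncating at
        the level whose \<open>p\<close>-th power is \<open>b + 1\<close>.\<close>
      have "((b + 1) powr (1 / p)) powr p = b + 1"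
        using p real by (simp add: powr_powr)
      then have "ennreal (b + 1) \<le> ennreal b"
        using Z[of "(b + 1) powr (1 / p)"] real by simp
      then show ?thesis using real by (simp add: ennreal_le_iff del: ennreal_plus)
    qed
    then have "?R top = top" unfolding Z_def .
    then show ?thesis using top by simp
  qed (use fin in auto)
qed

text \<open>The Lorentz norm through the distribution function, which behaves better than the
  rearrangement under limits.\<close>
lemma lorentz_norm_distr_fun:
  fixes G :: "'a::euclidean_space \<Rightarrow> ennreal"
  assumes [measurable]: "G \<in> borel_measurable borel" and r: "0 < r" and \<tau>: "0 < \<tau>"
  shows "lorentz_norm r \<tau> G
    = enn_powr (ennreal r * (\<integral>\<^sup>+a\<in>{0<..}. ennreal (a powr (\<tau> - 1)) * enn_powr (distr_fun G a) (\<tau> / r) \<partial>lborel)) (1 / \<tau>)"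
proof -
  \<comment> \<open>The region below the graph of \<open>distr_fun G\<close> coincides with the one
    below the graph of \<open>rearr G\<close>. Integrating over \<open>a\<close> first gives the
    power of the rearrangement, over \<open>t\<close> first the power of the distribution function;
    both are the layer-cake formula.\<close>
  let ?i = "\<lambda>a t. indicator {(a, t). 0 < a \<and> 0 < t \<and> ennreal t < distr_fun G a} (a, t) :: ennreal"
  have "(\<integral>\<^sup>+t\<in>{0<..}. ennreal (t powr (\<tau> / r - 1)) * enn_powr (rearr G t) \<tau> \<partial>lborel)
      = (\<integral>\<^sup>+t. (\<integral>\<^sup>+a. ennreal (t powr (\<tau> / r - 1)) * ennreal (\<tau> * a powr (\<tau> - 1)) * ?i a t \<partial>lborel) \<partial>lborel)"
  proof (intro nn_integral_cong)
    fix t :: real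
    show "ennreal (t powr (\<tau> / r - 1)) * enn_powr (rearr G t) \<tau> * indicator {0<..} t
       = (\<integral>\<^sup>+a. ennreal (t powr (\<tau> / r - 1)) * ennreal (\<tau> * a powr (\<tau> - 1)) * ?i a t \<partial>lborel)"
    proof (cases "0 < t")
      case True
      have "(\<integral>\<^sup>+a. ennreal (t powr (\<tau> / r - 1)) * ennreal (\<tau> * a powr (\<tau> - 1)) * ?i a t \<partial>lborel)
        = (\<integral>\<^sup>+a. ennreal (t powr (\<tau> / r - 1)) * (ennreal (\<tau> * a powr (\<tau> - 1)) * (indicator {0<..} a * indicator {a. ennreal a < rearr G t} a)) \<partial>lborel)"
        using True by (intro nn_integral_cong) (auto simp: indicator_def less_rearr_iff)
      also have "\<dots> = ennreal (t powr (\<tau> / r - 1)) * enn_powr (rearr G t) \<tau>"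
        unfolding enn_powr_layer_cake[OF \<tau>] by (intro nn_integral_cmult) measurable
      finally show ?thesis using True by simp
    qed (simp add: indicator_def)
  qed
  also have "\<dots> = (\<integral>\<^sup>+a. (\<integral>\<^sup>+t. ennreal (t powr (\<tau> / r - 1)) * ennreal (\<tau> * a powr (\<tau> - 1)) * ?i a t \<partial>lborel) \<partial>lborel)"
    by (intro nn_integral_lborel_swap) measurable
  also have "\<dots> = (\<integral>\<^sup>+a. ennreal r * (ennreal (a powr (\<tau> - 1)) * enn_powr (distr_fun G a) (\<tau> / r) * indicator {0<..} a) \<partial>lborel)"
  proof (intro nn_integral_cong)
    fix a :: real
    show "(\<integral>\<^sup>+t. ennreal (t powr (\<tau> / r - 1)) * ennreal (\<tau> * a powr (\<tau> - 1)) * ?i a t \<partial>lborel)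
      = ennreal r * (ennreal (a powr (\<tau> - 1)) * enn_powr (distr_fun G a) (\<tau> / r) * indicator {0<..} a)"
    proof (cases "0 < a")
      case True
      have "(\<integral>\<^sup>+t. ennreal (t powr (\<tau> / r - 1)) * ennreal (\<tau> * a powr (\<tau> - 1)) * ?i a t \<partial>lborel)
        = (\<integral>\<^sup>+t. ennreal (r * a powr (\<tau> - 1)) * (ennreal (\<tau> / r * t powr (\<tau> / r - 1)) * (indicator {0<..} t * indicator {t. ennreal t < distr_fun G a} t)) \<partial>lborel)"
        using True r \<tau> by (intro nn_integral_cong) (auto simp: indicator_def mult_ac simp flip: ennreal_mult)
      also have "\<dots> = ennreal (r * a powr (\<tau> - 1)) * enn_powr (distr_fun G a) (\<tau> / r)"
        using r \<tau> by (subst enn_powr_layer_cake, simp) (intro nn_integral_cmult, measurable)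
      finally show ?thesis using True r by (simp add: ennreal_mult mult.assoc)
    qed (simp add: indicator_def)
  qed
  also have "\<dots> = ennreal r * (\<integral>\<^sup>+a\<in>{0<..}. ennreal (a powr (\<tau> - 1)) * enn_powr (distr_fun G a) (\<tau> / r) \<partial>lborel)"
    by (intro nn_integral_cmult) measurable
  finally show ?thesis by (simp add: lorentz_norm_alt)
qed

text \<open>On the levels below \<open>a\<close> the distribution function is at least its value at
  \<open>a\<close>, and the weight integrates to \<open>a powr \<tau> / \<tau>\<close>.\<close>

lemma lorentz_norm_chebyshev:
  fixes G :: "'a::euclidean_space \<Rightarrow> ennreal"
  assumes [measurable]: "G \<in> borel_measurable borel" and r: "0 < r" and \<tau>: "0 < \<tau>" and a: "0 < a"
  shows "ennreal (a powr \<tau> / \<tau>) * enn_powr (distr_fun G a) (\<tau> / r)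
    \<le> (\<integral>\<^sup>+a\<in>{0<..}. ennreal (a powr (\<tau> - 1)) * enn_powr (distr_fun G a) (\<tau> / r) \<partial>lborel)"
proof -
  have "ennreal (a powr \<tau> / \<tau>) * enn_powr (distr_fun G a) (\<tau> / r)
      = (\<integral>\<^sup>+b\<in>{0<..<a}. ennreal (b powr (\<tau> - 1)) \<partial>lborel) * enn_powr (distr_fun G a) (\<tau> / r)"
    using nn_integral_powr_0[of "\<tau> - 1" a] a \<tau> by simp
  also have "\<dots> = (\<integral>\<^sup>+b. ennreal (b powr (\<tau> - 1)) * indicator {0<..<a} b * enn_powr (distr_fun G a) (\<tau> / r) \<partial>lborel)"
    by (intro nn_integral_multc[symmetric]) measurable
  also have "\<dots> \<le> (\<integral>\<^sup>+b\<in>{0<..}. ennreal (b powr (\<tau> - 1)) * enn_powr (distr_fun G b) (\<tau> / r) \<partial>lborel)"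
  proof (intro nn_integral_mono)
    fix b :: real
    show "ennreal (b powr (\<tau> - 1)) * indicator {0<..<a} b * enn_powr (distr_fun G a) (\<tau> / r)
      \<le> ennreal (b powr (\<tau> - 1)) * enn_powr (distr_fun G b) (\<tau> / r) * indicator {0<..} b"
      using r \<tau> distr_fun_antimono[OF assms(1), of b a]
      by (auto simp: indicator_def intro!: mult_left_mono enn_powr_mono)
  qed
  finally show ?thesis .
qed

text \<open>All three consequences come from the Chebyshev bound. For the last one, the set where
  \<open>G\<close> is infinite lies in every superlevel set, so positive measure would violate the
  bound at large levels.\<close>

lemma lorentz_norm_finite_imp:
  fixes G :: "'a::euclidean_space \<Rightarrow> ennreal"
  assumes [measurable]: "G \<in> borel_measurable borel" and r: "0 < r" and \<tau>: "0 < \<tau>"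
    and fin: "lorentz_norm r \<tau> G < \<infinity>"
  shows "(\<integral>\<^sup>+a\<in>{0<..}. ennreal (a powr (\<tau> - 1)) * enn_powr (distr_fun G a) (\<tau> / r) \<partial>lborel) < \<infinity>"
    and "0 < a \<Longrightarrow> distr_fun G a < \<infinity>"
    and "AE x in lborel. G x < \<infinity>"
proof -
  let ?L = "\<integral>\<^sup>+a\<in>{0<..}. ennreal (a powr (\<tau> - 1)) * enn_powr (distr_fun G a) (\<tau> / r) \<partial>lborel"
  have "ennreal r * ?L \<noteq> top"
    using fin unfolding lorentz_norm_distr_fun[OF assms(1-3)] by auto
  then show L: "?L < \<infinity>"
    using r by (auto simp: ennreal_mult_eq_top_iff ennreal_eq_0_iff less_top)
  have bd: "ennreal (a powr \<tau> / \<tau>) * enn_powr (distr_fun G a) (\<tau> / r) < top" if "0 < a" for a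
    using lorentz_norm_chebyshev[OF assms(1-3) that] L by (auto intro: le_less_trans)
  then show d: "distr_fun G a < \<infinity>" if "0 < a" for a
  proof -
    have "0 < a powr \<tau> / \<tau>" using that \<tau> by simp
    then show ?thesis
      using bd[OF that] enn_powr_eq_top_iff[of "distr_fun G a" "\<tau> / r"]
      by (auto simp: ennreal_mult_less_top ennreal_eq_0_iff simp del: enn_powr_eq_top_iff)
         (auto simp flip: less_top)
  qed
  define m where "m = emeasure lborel {x. G x = top}"
  have le: "m \<le> distr_fun G a" for a
    unfolding m_def distr_fun_def by (intro emeasure_mono) auto
  have "m = 0"
  proof (rule ccontr)
    assume m0: "m \<noteq> 0"
    obtain L where Lr: "?L = ennreal L" "0 \<le> L" using L by (cases ?L rule: ennreal_cases) auto
    obtain k where k: "m = ennreal k" "0 < k"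
      using d[of 1] le[of 1] m0 by (cases m rule: ennreal_cases) (auto simp: top_unique less_le)
    have "a powr \<tau> / \<tau> * k powr (\<tau> / r) \<le> L" if "0 < a" for a
    proof -
      have "ennreal (a powr \<tau> / \<tau> * k powr (\<tau> / r)) = ennreal (a powr \<tau> / \<tau>) * enn_powr m (\<tau> / r)"
        using k \<tau> by (simp add: enn_powr_ennreal flip: ennreal_mult)
      also have "\<dots> \<le> ennreal (a powr \<tau> / \<tau>) * enn_powr (distr_fun G a) (\<tau> / r)"
        using le r \<tau> by (intro mult_left_mono enn_powr_mono) auto
      also have "\<dots> \<le> ennreal L" using lorentz_norm_chebyshev[OF assms(1-3) that] Lr by simp
      finally show ?thesis using Lr by simp
    qed
    \<comment> \<open>At this level the left-hand side equals \<open>L + 1\<close>.\<close>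
    from this[of "((L + 1) * \<tau> / k powr (\<tau> / r)) powr (1 / \<tau>)"] show False
      using \<tau> k Lr by (simp add: powr_powr)
  qed
  then show "AE x in lborel. G x < \<infinity>"
    by (intro AE_I[where N="{x. G x = top}"]) (auto simp: m_def not_less top_unique)
qed

text \<open>Fubini on the graph of \<open>G\<close>: a point \<open>x\<close> lies on at most one
  finite level. Away from these exceptional levels, almost everywhere convergence of functions
  passes to the indicators of their superlevel sets.\<close>

lemma AE_distr_fun_level_null:
  fixes G :: "'a::euclidean_space \<Rightarrow> ennreal"
  assumes [measurable]: "G \<in> borel_measurable borel"
  shows "AE a in lborel. 0 < a \<longrightarrow> emeasure lborel {x. G x = ennreal a} = 0"
proof -
  let ?i = "\<lambda>a x. indicator {(a, x). 0 < a \<and> G x = ennreal a} (a, x) :: ennreal"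
  have "(\<integral>\<^sup>+a. (\<integral>\<^sup>+x. ?i a x \<partial>lborel) \<partial>lborel) = (\<integral>\<^sup>+x. (\<integral>\<^sup>+a. ?i a x \<partial>lborel) \<partial>lborel)"
    by (intro nn_integral_lborel_swap) measurable
  moreover have "(\<integral>\<^sup>+a. ?i a x \<partial>lborel) = 0" for x
  proof -
    have "(\<integral>\<^sup>+a. ?i a x \<partial>lborel) \<le> (\<integral>\<^sup>+a. indicator {enn2real (G x)} a \<partial>lborel)"
      by (intro nn_integral_mono) (auto simp: indicator_def)
    then show ?thesis by simp
  qed
  ultimately have "(\<integral>\<^sup>+a. (\<integral>\<^sup>+x. ?i a x \<partial>lborel) \<partial>lborel) = 0" by simp
  then have "AE a in lborel. (\<integral>\<^sup>+x. ?i a x \<partial>lborel) = 0"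
    by (subst (asm) nn_integral_0_iff_AE) auto
  then show ?thesis
  proof eventually_elim
    case (elim a)
    show ?case
    proof
      assume "0 < a"
      then have "(\<integral>\<^sup>+x. ?i a x \<partial>lborel) = (\<integral>\<^sup>+x. indicator {x. G x = ennreal a} x \<partial>lborel)"
        by (intro nn_integral_cong) (auto simp: indicator_def)
      then show "emeasure lborel {x. G x = ennreal a} = 0" using elim by simp
    qed
  qed
qed

text \<open>Dominated convergence is used twice: at a fixed level \<open>a\<close> for the
  indicators, where the superlevel set of \<open>H\<close> has finite measure, and then in
  \<open>a\<close>, where the integrand of \<open>H\<close> is the majorant. No subadditivity of the
  Lorentz functional enters.\<close>

lemma lorentz_norm_dominated_convergence:
  fixes G :: "'a::euclidean_space \<Rightarrow> ennreal" and Gk :: "nat \<Rightarrow> 'a \<Rightarrow> ennreal"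
  assumes G [measurable]: "G \<in> borel_measurable borel" and Gk [measurable]: "\<And>k. Gk k \<in> borel_measurable borel"
    and H [measurable]: "H \<in> borel_measurable borel" and r: "0 < r" and \<tau>: "0 < \<tau>"
    and lim: "AE x in lborel. (\<lambda>k. Gk k x) \<longlonglongrightarrow> G x"
    and le: "\<And>k. AE x in lborel. Gk k x \<le> H x" and fin: "lorentz_norm r \<tau> H < \<infinity>"
  shows "(\<lambda>k. lorentz_norm r \<tau> (Gk k)) \<longlonglongrightarrow> lorentz_norm r \<tau> G"
proof -
  have lim_d: "(\<lambda>k. distr_fun (Gk k) a) \<longlonglongrightarrow> distr_fun G a"
    if a: "0 < a" and null: "emeasure lborel {x. G x = ennreal a} = 0" for a
  proof -
    have d: "distr_fun F a = (\<integral>\<^sup>+x. indicator {x. ennreal a < F x} x \<partial>lborel)" if [measurable]: "F \<in> borel_measurable borel" for F :: "'a \<Rightarrow> ennreal"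
      by (simp add: distr_fun_def)
    have "AE x in lborel. G x \<noteq> ennreal a"
      using null by (intro AE_I[where N="{x. G x = ennreal a}"]) auto
    then have lim_i: "AE x in lborel. (\<lambda>k. indicator {x. ennreal a < Gk k x} x) \<longlonglongrightarrow> (indicator {x. ennreal a < G x} x :: ennreal)"
      using lim
    proof eventually_elim
      case (elim x)
      show ?case
      proof (cases "ennreal a < G x")
        case True
        then have "\<forall>\<^sub>F k in sequentially. ennreal a < Gk k x"
          using elim(2) by (simp add: order_tendsto_iff)
        then show ?thesis using True
          by (intro tendsto_eventually) (auto elim!: eventually_mono)
      next
        case False
        then have "G x < ennreal a" using elim(1) by auto
        then have "\<forall>\<^sub>F k in sequentially. Gk k x < ennreal a"
          using elim(2) by (simp add: order_tendsto_iff)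
        then show ?thesis using False
          by (intro tendsto_eventually) (auto elim!: eventually_mono simp: indicator_def)
      qed
    qed
    have le_i: "AE x in lborel. (indicator {x. ennreal a < Gk k x} x :: ennreal) \<le> indicator {x. ennreal a < H x} x" for k
      using le[of k] by eventually_elim (auto simp: indicator_def)
    have "(\<integral>\<^sup>+x. indicator {x. ennreal a < H x} x \<partial>lborel) < \<infinity>"
      using lorentz_norm_finite_imp(2)[OF H r \<tau> fin a] by (simp add: d)
    from nn_integral_dominated_convergence[OF _ _ _ le_i this lim_i]
    show ?thesis by (simp add: d)
  qed
  let ?f = "\<lambda>F a. ennreal (a powr (\<tau> - 1)) * enn_powr (distr_fun F a) (\<tau> / r) * indicator {0<..} a"
  have "(\<lambda>k. \<integral>\<^sup>+a. ?f (Gk k) a \<partial>lborel) \<longlonglongrightarrow> (\<integral>\<^sup>+a. ?f G a \<partial>lborel)"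
  proof (rule nn_integral_dominated_convergence[where w="?f H"])
    show "AE a in lborel. ?f (Gk k) a \<le> ?f H a" for k
    proof (intro AE_I2 mult_left_mono mult_right_mono enn_powr_mono)
      fix a
      show "distr_fun (Gk k) a \<le> distr_fun H a"
        unfolding distr_fun_def using le[of k] by (intro emeasure_mono_AE) auto
    qed (use r \<tau> in auto)
    show "(\<integral>\<^sup>+a. ?f H a \<partial>lborel) < \<infinity>"
      using lorentz_norm_finite_imp(1)[OF H r \<tau> fin] .
    show "AE a in lborel. (\<lambda>k. ?f (Gk k) a) \<longlonglongrightarrow> ?f G a"
      using AE_distr_fun_level_null[OF G]
    proof eventually_elim
      case (elim a)
      show ?case
      proof (cases "0 < a")
        case True
        then have "(\<lambda>k. enn_powr (distr_fun (Gk k) a) (\<tau> / r)) \<longlonglongrightarrow> enn_powr (distr_fun G a) (\<tau> / r)"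
          using elim lim_d r \<tau> by (intro tendsto_enn_powr) auto
        then show ?thesis using True by (auto intro!: ennreal_tendsto_cmult)
      qed simp
    qed
  qed measurable
  then show ?thesis
    unfolding lorentz_norm_distr_fun[OF G r \<tau>] lorentz_norm_distr_fun[OF Gk r \<tau>]
    using \<tau> by (intro tendsto_enn_powr ennreal_tendsto_cmult) auto
qed

section \<open>Hardy's inequality and the maximal operator in Lorentz spaces\<close>

lemma nn_integral_hardy:
  fixes \<phi> :: "real \<Rightarrow> ennreal"
  assumes P: "1 < P" and a: "a < P"
  shows "\<exists>C>0. \<forall>\<phi> :: real \<Rightarrow> ennreal. \<phi> \<in> borel_measurable borel \<longrightarrow>
    (\<integral>\<^sup>+t\<in>{0<..}. ennreal (t powr (a - 1 - P)) * enn_powr (\<integral>\<^sup>+u\<in>{0<..<t}. \<phi> u \<partial>lborel) P \<partial>lborel)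
    \<le> ennreal C * (\<integral>\<^sup>+u\<in>{0<..}. ennreal (u powr (a - 1)) * enn_powr (\<phi> u) P \<partial>lborel)"
proof -
  \<comment> \<open>Jensen's inequality is applied on the interval from 0 to \<open>t\<close> with
    weight \<open>u powr - b\<close>. Integrability at 0 needs \<open>b < 1\<close>, and convergence
    of the outer integral at infinity needs \<open>b\<close> above this quotient;
    \<open>a < P\<close> is exactly the room between the two. The exponent \<open>e\<close> is what
    remains of \<open>t\<close> after Jensen's inequality.\<close>
  have "(a - 1) / (P - 1) < 1" using P a by simp
  then obtain b where b: "(a - 1) / (P - 1) < b" "b < 1" using dense by blast
  define e where "e = a - 2 - b * (P - 1)"
  have e: "e < -1" using b(1) P by (simp add: e_def pos_divide_less_eq)
  define c' where "c' = 1 / (- (e + 1))"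
  have c': "0 < c'" using e by (simp add: c'_def)
  define C where "C = (1 / (1 - b)) powr (P - 1) * (c')"
  have C: "0 < C" using b c' by (simp add: C_def)
  {
    fix \<phi> :: "real \<Rightarrow> ennreal" assume [measurable]: "\<phi> \<in> borel_measurable borel"
    let ?w = "\<lambda>u. enn_powr (\<phi> u) P * ennreal (u powr (b * (P - 1)))"
    have "(\<integral>\<^sup>+t\<in>{0<..}. ennreal (t powr (a - 1 - P)) * enn_powr (\<integral>\<^sup>+u\<in>{0<..<t}. \<phi> u \<partial>lborel) P \<partial>lborel)
      \<le> (\<integral>\<^sup>+t. ennreal ((1 / (1 - b)) powr (P - 1)) * (\<integral>\<^sup>+u. ennreal (t powr e) * ?w u * indicator {(t, u). 0 < u \<and> u < t} (t, u) \<partial>lborel) \<partial>lborel)"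
    proof (intro nn_integral_mono)
      fix t :: real
      show "ennreal (t powr (a - 1 - P)) * enn_powr (\<integral>\<^sup>+u\<in>{0<..<t}. \<phi> u \<partial>lborel) P * indicator {0<..} t
        \<le> ennreal ((1 / (1 - b)) powr (P - 1)) * (\<integral>\<^sup>+u. ennreal (t powr e) * ?w u * indicator {(t, u). 0 < u \<and> u < t} (t, u) \<partial>lborel)"
      proof (cases "0 < t")
        case t: True
        let ?M = "restrict_space lborel {0<..<t}"
        let ?K = "t powr (1 - b) / (1 - b)"
        have "enn_powr (\<integral>\<^sup>+u. \<phi> u \<partial>?M) P \<le> ennreal (?K powr (P - 1)) * (\<integral>\<^sup>+u. enn_powr (\<phi> u) P * ennreal ((u powr - b) powr (1 - P)) \<partial>?M)"
        proof (rule nn_integral_weighted_jensen)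
          show "(\<integral>\<^sup>+u. ennreal (u powr - b) \<partial>?M) \<le> ennreal ?K"
            using nn_integral_powr_0[of "- b" t] b t by (simp add: nn_integral_restrict_space)
        qed (use P b t in \<open>auto simp: space_restrict_space intro!: measurable_restrict_space1\<close>)
        also have "(\<integral>\<^sup>+u. enn_powr (\<phi> u) P * ennreal ((u powr - b) powr (1 - P)) \<partial>?M) = (\<integral>\<^sup>+u\<in>{0<..<t}. ?w u \<partial>lborel)"
          by (simp add: nn_integral_restrict_space powr_powr algebra_simps)
        finally have "ennreal (t powr (a - 1 - P)) * enn_powr (\<integral>\<^sup>+u\<in>{0<..<t}. \<phi> u \<partial>lborel) P
            \<le> ennreal (t powr (a - 1 - P)) * (ennreal (?K powr (P - 1)) * (\<integral>\<^sup>+u\<in>{0<..<t}. ?w u \<partial>lborel))"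
          by (intro mult_left_mono) (auto simp: nn_integral_restrict_space)
        also have "\<dots> = ennreal (t powr (a - 1 - P) * ?K powr (P - 1)) * (\<integral>\<^sup>+u\<in>{0<..<t}. ?w u \<partial>lborel)"
          by (simp add: ennreal_mult mult.assoc)
        also have "t powr (a - 1 - P) * ?K powr (P - 1) = (1 / (1 - b)) powr (P - 1) * t powr e"
        proof -
          have "t powr (a - 1 - P) * ?K powr (P - 1) = (1 / (1 - b)) powr (P - 1) * (t powr (a - 1 - P) * t powr ((1 - b) * (P - 1)))"
            using t b by (simp add: powr_divide powr_powr)
          also have "t powr (a - 1 - P) * t powr ((1 - b) * (P - 1)) = t powr e"
            by (simp add: e_def algebra_simps flip: powr_add)
          finally show ?thesis .
        qed
        also have "ennreal ((1 / (1 - b)) powr (P - 1) * t powr e) * (\<integral>\<^sup>+u\<in>{0<..<t}. ?w u \<partial>lborel)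
            = ennreal ((1 / (1 - b)) powr (P - 1)) * (\<integral>\<^sup>+u. ennreal (t powr e) * ?w u * indicator {(t, u). 0 < u \<and> u < t} (t, u) \<partial>lborel)"
        proof -
          have "(\<integral>\<^sup>+u. ennreal (t powr e) * ?w u * indicator {(t, u). 0 < u \<and> u < t} (t, u) \<partial>lborel)
              = (\<integral>\<^sup>+u. ennreal (t powr e) * (?w u * indicator {0<..<t} u) \<partial>lborel)"
            by (intro nn_integral_cong) (auto simp: indicator_def)
          also have "\<dots> = ennreal (t powr e) * (\<integral>\<^sup>+u\<in>{0<..<t}. ?w u \<partial>lborel)"
            by (intro nn_integral_cmult) measurable
          finally show ?thesis by (simp add: ennreal_mult mult.assoc)
        qed
        finally show ?thesis using t by simp
      qed simp
    qed
    also have "\<dots> = ennreal ((1 / (1 - b)) powr (P - 1)) * (\<integral>\<^sup>+t. (\<integral>\<^sup>+u. ennreal (t powr e) * ?w u * indicator {(t, u). 0 < u \<and> u < t} (t, u) \<partial>lborel) \<partial>lborel)"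
      by (intro nn_integral_cmult) measurable
    also have "(\<integral>\<^sup>+t. (\<integral>\<^sup>+u. ennreal (t powr e) * ?w u * indicator {(t, u). 0 < u \<and> u < t} (t, u) \<partial>lborel) \<partial>lborel)
       = (\<integral>\<^sup>+u. (\<integral>\<^sup>+t. ennreal (t powr e) * ?w u * indicator {(t, u). 0 < u \<and> u < t} (t, u) \<partial>lborel) \<partial>lborel)"
      by (intro nn_integral_lborel_swap) measurable
    also have "\<dots> = (\<integral>\<^sup>+u. ennreal (c') * (ennreal (u powr (a - 1)) * enn_powr (\<phi> u) P * indicator {0<..} u) \<partial>lborel)"
    proof (intro nn_integral_cong)
      fix u :: real
      show "(\<integral>\<^sup>+t. ennreal (t powr e) * ?w u * indicator {(t, u). 0 < u \<and> u < t} (t, u) \<partial>lborel)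
         = ennreal (c') * (ennreal (u powr (a - 1)) * enn_powr (\<phi> u) P * indicator {0<..} u)"
      proof (cases "0 < u")
        case u: True
        have "(\<integral>\<^sup>+t. ennreal (t powr e) * ?w u * indicator {(t, u). 0 < u \<and> u < t} (t, u) \<partial>lborel)
            = (\<integral>\<^sup>+t. ennreal (t powr e) * indicator {u<..} t * ?w u \<partial>lborel)"
          using u by (intro nn_integral_cong) (auto simp: indicator_def)
        also have "\<dots> = (\<integral>\<^sup>+t\<in>{u<..}. ennreal (t powr e) \<partial>lborel) * ?w u"
          by (intro nn_integral_multc) measurable
        also have "\<dots> = ennreal (- (u powr (e + 1) / (e + 1))) * ?w u"
          using u e by (subst nn_integral_powr_top) auto
        also have "- (u powr (e + 1) / (e + 1)) = c' * u powr (e + 1)"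
          using e by (simp add: c'_def field_simps)
        also have "ennreal (c' * u powr (e + 1)) * ?w u
            = ennreal (c') * (ennreal (u powr (e + 1)) * ennreal (u powr (b * (P - 1))) * enn_powr (\<phi> u) P)"
          using c' by (simp add: ennreal_mult mult_ac)
        also have "ennreal (u powr (e + 1)) * ennreal (u powr (b * (P - 1))) = ennreal (u powr (a - 1))"
          by (simp add: e_def flip: ennreal_mult powr_add)
        finally show ?thesis using u by simp
      qed (simp add: indicator_def)
    qed
    also have "\<dots> = ennreal (c') * (\<integral>\<^sup>+u\<in>{0<..}. ennreal (u powr (a - 1)) * enn_powr (\<phi> u) P \<partial>lborel)"
      by (intro nn_integral_cmult) measurable
    finally have "(\<integral>\<^sup>+t\<in>{0<..}. ennreal (t powr (a - 1 - P)) * enn_powr (\<integral>\<^sup>+u\<in>{0<..<t}. \<phi> u \<partial>lborel) P \<partial>lborel)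
      \<le> ennreal C * (\<integral>\<^sup>+u\<in>{0<..}. ennreal (u powr (a - 1)) * enn_powr (\<phi> u) P \<partial>lborel)"
      using c' by (simp add: C_def ennreal_mult mult.assoc)
  }
  then show ?thesis using C by blast
qed


lemma maximal_add_const_le:
  fixes F :: "'a::euclidean_space \<Rightarrow> ennreal"
  assumes [measurable]: "F \<in> borel_measurable borel"
  shows "maximal (\<lambda>y. F y + ennreal c) x \<le> maximal F x + ennreal (vol TYPE('a)) * ennreal c"
  unfolding maximal_def
proof (rule SUP_least)
  fix \<rho> :: real assume "\<rho> \<in> {0<..}"
  then have \<rho>: "0 < \<rho>" by simp
  have "(\<integral>\<^sup>+y\<in>ball x \<rho>. (F y + ennreal c) \<partial>lborel) = (\<integral>\<^sup>+y\<in>ball x \<rho>. F y \<partial>lborel) + ennreal c * ennreal (vol TYPE('a) * \<rho> ^ DIM('a))"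
    using \<rho> by (simp add: distrib_right nn_integral_add nn_integral_cmult_indicator emeasure_lborel_ball)
  then have "ennreal (1 / \<rho> ^ DIM('a)) * (\<integral>\<^sup>+y\<in>ball x \<rho>. (F y + ennreal c) \<partial>lborel)
    = ennreal (1 / \<rho> ^ DIM('a)) * (\<integral>\<^sup>+y\<in>ball x \<rho>. F y \<partial>lborel) + ennreal c * (ennreal (1 / \<rho> ^ DIM('a)) * ennreal (vol TYPE('a) * \<rho> ^ DIM('a)))"
    by (simp add: distrib_left mult_ac)
  also have "ennreal (1 / \<rho> ^ DIM('a)) * ennreal (vol TYPE('a) * \<rho> ^ DIM('a)) = ennreal (vol TYPE('a))"
    using \<rho> vol_pos[where 'a='a, THEN less_imp_le] by (subst ennreal_mult[symmetric]) auto
  also have "ennreal (1 / \<rho> ^ DIM('a)) * (\<integral>\<^sup>+y\<in>ball x \<rho>. F y \<partial>lborel) + ennreal c * ennreal (vol TYPE('a))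
      \<le> (SUP r\<in>{0<..}. ennreal (1 / r ^ DIM('a)) * (\<integral>\<^sup>+y\<in>ball x r. F y \<partial>lborel)) + ennreal (vol TYPE('a)) * ennreal c"
    using \<rho> by (intro add_mono SUP_upper) (auto simp: mult.commute)
  finally show "ennreal (1 / \<rho> ^ DIM('a)) * (\<integral>\<^sup>+y\<in>ball x \<rho>. (F y + ennreal c) \<partial>lborel)
    \<le> (SUP r\<in>{0<..}. ennreal (1 / r ^ DIM('a)) * (\<integral>\<^sup>+y\<in>ball x r. F y \<partial>lborel)) + ennreal (vol TYPE('a)) * ennreal c" .
qed

lemma maximal_mono:
  fixes F G :: "'a::euclidean_space \<Rightarrow> ennreal"
  assumes "\<And>x. F x \<le> G x"
  shows "maximal F x \<le> maximal G x"
  unfolding maximal_def using assms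
  by (intro SUP_mono bexI) (auto intro!: mult_left_mono nn_integral_mono mult_right_mono)

text \<open>Comparison level by level: the part of the superlevel set of \<open>a\<close> inside
  that of \<open>b\<close> has measure at most the smaller of \<open>t\<close> and
  \<open>distr_fun G a\<close>, which is the length of the set of \<open>u\<close> below
  \<open>t\<close> with \<open>rearr G u\<close> above \<open>a\<close>. Layer cake on both sides
  does the rest.\<close>

lemma nn_integral_superlevel_le_rearr:
  fixes G :: "'a::euclidean_space \<Rightarrow> ennreal"
  assumes [measurable]: "G \<in> borel_measurable borel" and s: "0 < s" and t: "0 < t" and b: "0 \<le> b"
    and d: "distr_fun G b \<le> ennreal t"
  shows "(\<integral>\<^sup>+x\<in>{x. ennreal b < G x}. enn_powr (G x) s \<partial>lborel) \<le> (\<integral>\<^sup>+u\<in>{0<..<t}. enn_powr (rearr G u) s \<partial>lborel)"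
proof -
  have e_le: "emeasure lborel {x. ennreal a < G x \<and> ennreal b < G x} \<le> emeasure lborel {u. 0 < u \<and> u < t \<and> ennreal u < distr_fun G a}" for a
  proof -
    have 1: "emeasure lborel {x. ennreal a < G x \<and> ennreal b < G x} \<le> distr_fun G a"
      "emeasure lborel {x. ennreal a < G x \<and> ennreal b < G x} \<le> distr_fun G b"
      unfolding distr_fun_def by (intro emeasure_mono; auto)+
    show ?thesis
    proof (cases "ennreal t \<le> distr_fun G a")
      case True
      then have "{u. 0 < u \<and> u < t \<and> ennreal u < distr_fun G a} = {0<..<t}"
        using t by (auto intro: less_le_trans[OF ennreal_lessI])
      then show ?thesis using 1(2) d t by simp
    next
      case False
      then obtain c where c: "distr_fun G a = ennreal c" "0 \<le> c" by (metis ennreal_cases top_greatest)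
      then have "{u. 0 < u \<and> u < t \<and> ennreal u < distr_fun G a} = {0<..<c}"
        using False by (auto simp: ennreal_less_iff)
      then show ?thesis using 1(1) c by simp
    qed
  qed
  let ?w = "\<lambda>a. ennreal (s * a powr (s - 1)) * indicator {0<..} a"
  have "(\<integral>\<^sup>+x\<in>{x. ennreal b < G x}. enn_powr (G x) s \<partial>lborel)
    = (\<integral>\<^sup>+x. (\<integral>\<^sup>+a. ?w a * indicator {(a, x). ennreal a < G x \<and> ennreal b < G x} (a, x) \<partial>lborel) \<partial>lborel)"
  proof (intro nn_integral_cong)
    fix x :: 'a
    show "enn_powr (G x) s * indicator {x. ennreal b < G x} x
      = (\<integral>\<^sup>+a. ?w a * indicator {(a, x). ennreal a < G x \<and> ennreal b < G x} (a, x) \<partial>lborel)"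
      unfolding enn_powr_layer_cake[OF s]
      by (subst nn_integral_multc[symmetric]) (auto intro!: nn_integral_cong simp: indicator_def)
  qed
  also have "\<dots> = (\<integral>\<^sup>+a. (\<integral>\<^sup>+x. ?w a * indicator {(a, x). ennreal a < G x \<and> ennreal b < G x} (a, x) \<partial>lborel) \<partial>lborel)"
    by (intro nn_integral_lborel_swap) measurable
  also have "\<dots> \<le> (\<integral>\<^sup>+a. (\<integral>\<^sup>+u. ?w a * indicator {(a, u). 0 < u \<and> u < t \<and> ennreal u < distr_fun G a} (a, u) \<partial>lborel) \<partial>lborel)"
  proof (intro nn_integral_mono)
    fix a :: real
    have "(\<integral>\<^sup>+x. ?w a * indicator {(a, x). ennreal a < G x \<and> ennreal b < G x} (a, x) \<partial>lborel)
        = (\<integral>\<^sup>+x. ?w a * indicator {x. ennreal a < G x \<and> ennreal b < G x} x \<partial>lborel)"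
      by (intro nn_integral_cong) (auto simp: indicator_def)
    also have "\<dots> = ?w a * emeasure lborel {x. ennreal a < G x \<and> ennreal b < G x}"
      by (intro nn_integral_cmult_indicator) simp
    also have "\<dots> \<le> ?w a * emeasure lborel {u. 0 < u \<and> u < t \<and> ennreal u < distr_fun G a}"
      by (intro mult_left_mono e_le) simp
    also have "\<dots> = (\<integral>\<^sup>+u. ?w a * indicator {u. 0 < u \<and> u < t \<and> ennreal u < distr_fun G a} u \<partial>lborel)"
      by (intro nn_integral_cmult_indicator[symmetric]) simp
    also have "\<dots> = (\<integral>\<^sup>+u. ?w a * indicator {(a, u). 0 < u \<and> u < t \<and> ennreal u < distr_fun G a} (a, u) \<partial>lborel)"
      by (intro nn_integral_cong) (auto simp: indicator_def)
    finally show "(\<integral>\<^sup>+x. ?w a * indicator {(a, x). ennreal a < G x \<and> ennreal b < G x} (a, x) \<partial>lborel)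
      \<le> (\<integral>\<^sup>+u. ?w a * indicator {(a, u). 0 < u \<and> u < t \<and> ennreal u < distr_fun G a} (a, u) \<partial>lborel)" .
  qed
  also have "\<dots> = (\<integral>\<^sup>+u. (\<integral>\<^sup>+a. ?w a * indicator {(a, u). 0 < u \<and> u < t \<and> ennreal u < distr_fun G a} (a, u) \<partial>lborel) \<partial>lborel)"
    by (intro nn_integral_lborel_swap) measurable
  also have "\<dots> = (\<integral>\<^sup>+u\<in>{0<..<t}. enn_powr (rearr G u) s \<partial>lborel)"
  proof (intro nn_integral_cong)
    fix u :: real
    show "(\<integral>\<^sup>+a. ?w a * indicator {(a, u). 0 < u \<and> u < t \<and> ennreal u < distr_fun G a} (a, u) \<partial>lborel)
       = enn_powr (rearr G u) s * indicator {0<..<t} u"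
      unfolding enn_powr_layer_cake[OF s]
      by (subst nn_integral_multc[symmetric]) (auto intro!: nn_integral_cong simp: indicator_def less_rearr_iff)
  qed
  finally show ?thesis .
qed

text \<open>\<open>G\<close> is cut at the level \<open>b = rearr G t\<close>. The part above
  \<open>b\<close> is controlled by the weak-type bound, which yields the constant
  \<open>5 ^ DIM('a)\<close>. The part below contributes at most the volume times
  \<open>b powr s\<close> to the maximal function, and \<open>t * b powr s\<close> is at most the
  integral on the right because the rearrangement decreases; this is the summand 1.\<close>

lemma rearr_maximal_le:
  fixes G :: "'a::euclidean_space \<Rightarrow> ennreal"
  assumes [measurable]: "G \<in> borel_measurable borel" and s: "0 < s" and t: "0 < t"
  shows "enn_powr (rearr (\<lambda>x. enn_powr (maximal (\<lambda>y. enn_powr (G y) s) x) (1 / s)) t) s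
    \<le> ennreal ((5 ^ DIM('a) + 1) * vol TYPE('a) / t) * (\<integral>\<^sup>+u\<in>{0<..<t}. enn_powr (rearr G u) s \<partial>lborel)"
proof (cases "\<integral>\<^sup>+u\<in>{0<..<t}. enn_powr (rearr G u) s \<partial>lborel" rule: ennreal_cases)
  case top
  have "0 < (5 ^ DIM('a) + 1) * vol TYPE('a) / t" using t by (simp add: add_pos_pos)
  then show ?thesis using top by (simp add: ennreal_mult_top ennreal_eq_0_iff)
next
  case (real I)
  let ?V = "vol TYPE('a)" and ?n = "DIM('a)"
  have mono: "rearr G t \<le> rearr G u" if "u \<le> t" for u
  proof (rule ccontr)
    assume "\<not> rearr G t \<le> rearr G u"
    then have lt: "rearr G u < rearr G t" by simp
    then obtain a where a: "0 \<le> a" "rearr G u = ennreal a" by (metis ennreal_cases not_top_less)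
    then have "ennreal t < distr_fun G a" using lt less_rearr_iff[of G a t] by simp
    then have "ennreal u < distr_fun G a" using that by (meson ennreal_leI le_less_trans)
    then show False using a less_rearr_iff[of G a u] by simp
  qed
  have "ennreal t * enn_powr (rearr G t) s = (\<integral>\<^sup>+u\<in>{0<..<t}. enn_powr (rearr G t) s \<partial>lborel)"
    using t by (subst nn_integral_cmult_indicator) (auto simp: mult.commute)
  also have "\<dots> \<le> ennreal I"
    unfolding real(2)[symmetric] using s mono
    by (intro nn_integral_mono) (auto simp: indicator_def intro!: enn_powr_mono)
  finally have tb: "ennreal t * enn_powr (rearr G t) s \<le> ennreal I" .
  have "rearr G t \<noteq> top"
  proof
    assume "rearr G t = top"
    then show False using tb t by (simp add: ennreal_mult_top top_unique ennreal_eq_0_iff)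
  qed
  then obtain b where b: "rearr G t = ennreal b" "0 \<le> b" by (metis ennreal_cases)
  have tbI: "t * b powr s \<le> I" using tb b t real by (simp add: enn_powr_ennreal flip: ennreal_mult)
  have db: "distr_fun G b \<le> ennreal t"
    using less_rearr_iff[of G b t] b by (auto simp: not_less[symmetric])
  define F where "F x = enn_powr (G x) s * indicator {x. ennreal b < G x} x" for x
  have F [measurable]: "F \<in> borel_measurable borel" unfolding F_def by measurable
  have FI: "(\<integral>\<^sup>+x. F x \<partial>lborel) \<le> ennreal I"
    using nn_integral_superlevel_le_rearr[OF assms(1) s t b(2) db] real by (simp add: F_def)
  let ?X = "\<lambda>x. enn_powr (maximal (\<lambda>y. enn_powr (G y) s) x) (1 / s)"
  have max_le: "maximal (\<lambda>y. enn_powr (G y) s) x \<le> maximal F x + ennreal (?V * b powr s)" for x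
  proof -
    have "enn_powr (G y) s \<le> F y + ennreal (b powr s)" for y
    proof (cases "ennreal b < G y")
      case False
      then have "enn_powr (G y) s \<le> enn_powr (ennreal b) s" using s by (intro enn_powr_mono) auto
      then show ?thesis using b by (simp add: enn_powr_ennreal add_increasing)
    qed (simp add: F_def)
    then have "maximal (\<lambda>y. enn_powr (G y) s) x \<le> maximal (\<lambda>y. F y + ennreal (b powr s)) x"
      by (rule maximal_mono)
    also have "\<dots> \<le> maximal F x + ennreal ?V * ennreal (b powr s)"
      by (rule maximal_add_const_le[OF F])
    finally show ?thesis by (simp add: ennreal_mult)
  qed
  have "enn_powr (rearr ?X t) s \<le> ennreal ((5 ^ ?n + 1) * ?V / t * I) + ennreal e" if e: "0 < e" for e
  proof -
    \<comment> \<open>Chosen so that the weak-type bound at level \<open>a\<close> is at most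
      \<open>t\<close>. The summand \<open>e\<close> keeps \<open>a\<close> positive even if
      \<open>I = 0\<close>.\<close>
    define a where "a = 5 ^ ?n * ?V / t * I + e"
    have a: "0 < a" using e t real by (auto simp: a_def intro!: add_nonneg_pos)
    define c where "c = (a + ?V * b powr s) powr (1 / s)"
    have c: "0 \<le> c" "c powr s = a + ?V * b powr s"
      using a s by (auto simp: c_def powr_powr add_nonneg_nonneg)
    have "distr_fun ?X c \<le> emeasure lborel {x. ennreal a < maximal F x}"
      unfolding distr_fun_def
    proof (intro emeasure_mono subsetI)
      fix x assume "x \<in> {x. ennreal c < ?X x}"
      then have "enn_powr (ennreal c) s < maximal (\<lambda>y. enn_powr (G y) s) x"
        using s by (subst (asm) enn_powr_less_swap) auto
      then have "ennreal (a + ?V * b powr s) < maximal (\<lambda>y. enn_powr (G y) s) x"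
        using c by (simp add: enn_powr_ennreal)
      then have "ennreal a + ennreal (?V * b powr s) < maximal F x + ennreal (?V * b powr s)"
        using max_le[of x] a by (simp add: less_le_trans)
      then show "x \<in> {x. ennreal a < maximal F x}"
        by (metis add_right_mono leD leI mem_Collect_eq)
    qed measurable
    also have "\<dots> \<le> ennreal (5 ^ ?n * ?V / a) * (\<integral>\<^sup>+x. F x \<partial>lborel)"
      using a by (intro maximal_weak_type) auto
    also have "\<dots> \<le> ennreal (5 ^ ?n * ?V / a) * ennreal I"
      by (intro mult_left_mono FI) auto
    also have "\<dots> = ennreal (5 ^ ?n * ?V / a * I)"
      using a real by (simp flip: ennreal_mult)
    also have "\<dots> \<le> ennreal t"
    proof (intro ennreal_leI)
      have "5 ^ ?n * ?V * I = t * (5 ^ ?n * ?V / t * I)" using t by simp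
      also have "\<dots> \<le> t * a" using t e by (intro mult_left_mono) (auto simp: a_def)
      finally show "5 ^ ?n * ?V / a * I \<le> t" using a by (simp add: field_simps)
    qed
    finally have "\<not> ennreal c < rearr ?X t"
      using less_rearr_iff[of ?X c t] c by simp
    then have "enn_powr (rearr ?X t) s \<le> enn_powr (ennreal c) s"
      using s by (intro enn_powr_mono) auto
    also have "\<dots> = ennreal (a + ?V * b powr s)" using c by (simp add: enn_powr_ennreal)
    also have "\<dots> \<le> ennreal ((5 ^ ?n + 1) * ?V / t * I + e)"
    proof (intro ennreal_leI)
      have "?V * (b powr s) \<le> ?V * (I / t)"
        using tbI t by (intro mult_left_mono) (auto simp: field_simps)
      then show "a + ?V * b powr s \<le> (5 ^ ?n + 1) * ?V / t * I + e"
        by (simp add: a_def algebra_simps add_divide_distrib)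
    qed
    also have "\<dots> = ennreal ((5 ^ ?n + 1) * ?V / t * I) + ennreal e"
      using e t real by (intro ennreal_plus) auto
    finally show ?thesis .
  qed
  then have "enn_powr (rearr ?X t) s \<le> ennreal ((5 ^ ?n + 1) * ?V / t * I)"
    by (rule ennreal_le_epsilon)
  also have "\<dots> = ennreal ((5 ^ ?n + 1) * ?V / t) * ennreal I"
    using t real by (intro ennreal_mult) auto
  finally show ?thesis
    unfolding real(2) .
qed

text \<open>Here \<open>\<tau>\<close> may exceed \<open>r\<close>, so that \<open>lorentz_norm\<close> is only a quasi-norm; the bound
  comes from Hardy's inequality applied to the rearrangement.\<close>
lemma lorentz_norm_maximal_le:
  fixes s r \<tau> :: real
  assumes s: "1 \<le> s" "s < r" "s < \<tau>"
  shows "\<exists>C>0. \<forall>G :: 'a::euclidean_space \<Rightarrow> ennreal. G \<in> borel_measurable borel \<longrightarrow>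
    lorentz_norm r \<tau> (\<lambda>x. enn_powr (maximal (\<lambda>y. enn_powr (G y) s) x) (1 / s)) \<le> ennreal C * lorentz_norm r \<tau> G"
proof -
  define P where "P = \<tau> / s"
  define a where "a = \<tau> / r"
  \<comment> \<open>\<open>s < \<tau>\<close> gives \<open>1 < P\<close> and \<open>s < r\<close>
    gives \<open>a < P\<close>: the two hypotheses of Hardy's inequality.\<close>
  have P: "1 < P" and aP: "a < P" using s by (auto simp: P_def a_def intro!: divide_strict_left_mono)
  obtain C0 where C0: "0 < C0" "\<And>\<phi>. \<phi> \<in> borel_measurable borel \<Longrightarrow>
    (\<integral>\<^sup>+t\<in>{0<..}. ennreal (t powr (a - 1 - P)) * enn_powr (\<integral>\<^sup>+u\<in>{0<..<t}. \<phi> u \<partial>lborel) P \<partial>lborel)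
    \<le> ennreal C0 * (\<integral>\<^sup>+u\<in>{0<..}. ennreal (u powr (a - 1)) * enn_powr (\<phi> u) P \<partial>lborel)"
    using nn_integral_hardy[OF P aP] by blast
  define K where "K = (5 ^ DIM('a) + 1) * vol TYPE('a)"
  have K: "0 < K" by (simp add: K_def add_pos_pos)
  define C where "C = (K powr P * C0) powr (1 / \<tau>)"
  have "0 < C" using K C0 by (simp add: C_def)
  moreover {
    fix G :: "'a \<Rightarrow> ennreal" assume [measurable]: "G \<in> borel_measurable borel"
    let ?X = "\<lambda>x. enn_powr (maximal (\<lambda>y. enn_powr (G y) s) x) (1 / s)"
    let ?I = "\<lambda>t. \<integral>\<^sup>+u\<in>{0<..<t}. enn_powr (rearr G u) s \<partial>lborel"
    have I_meas [measurable]: "?I \<in> borel_measurable borel"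
    proof -
      have "(\<lambda>t. \<integral>\<^sup>+u. enn_powr (rearr G u) s * indicator {(t, u). 0 < u \<and> u < t} (t, u) \<partial>lborel) \<in> borel_measurable borel"
        by measurable
      then show ?thesis by (simp add: indicator_def)
    qed
    have "(\<integral>\<^sup>+t\<in>{0<..}. ennreal (t powr (a - 1)) * enn_powr (rearr ?X t) \<tau> \<partial>lborel)
      \<le> (\<integral>\<^sup>+t. ennreal (K powr P) * (ennreal (t powr (a - 1 - P)) * enn_powr (?I t) P * indicator {0<..} t) \<partial>lborel)"
    proof (intro nn_integral_mono)
      fix t :: real
      show "ennreal (t powr (a - 1)) * enn_powr (rearr ?X t) \<tau> * indicator {0<..} t
        \<le> ennreal (K powr P) * (ennreal (t powr (a - 1 - P)) * enn_powr (?I t) P * indicator {0<..} t)"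
      proof (cases "0 < t")
        case t: True
        have "enn_powr (rearr ?X t) \<tau> = enn_powr (enn_powr (rearr ?X t) s) P"
          using s by (simp add: enn_powr_enn_powr P_def)
        also have "\<dots> \<le> enn_powr (ennreal (K / t) * ?I t) P"
          using rearr_maximal_le[of G s t] s t P by (intro enn_powr_mono) (auto simp: K_def)
        also have "\<dots> = ennreal (K powr P * t powr (- P)) * enn_powr (?I t) P"
          using K t by (simp add: enn_powr_mult enn_powr_ennreal powr_divide powr_minus_divide)
        finally have "ennreal (t powr (a - 1)) * enn_powr (rearr ?X t) \<tau>
            \<le> ennreal (t powr (a - 1)) * (ennreal (K powr P * t powr (- P)) * enn_powr (?I t) P)"
          by (intro mult_left_mono) auto
        also have "\<dots> = ennreal (K powr P * (t powr (a - 1) * t powr (- P))) * enn_powr (?I t) P"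
          by (simp add: ennreal_mult mult_ac)
        also have "t powr (a - 1) * t powr (- P) = t powr (a - 1 - P)"
          by (simp flip: powr_add)
        finally show ?thesis using t by (simp add: ennreal_mult mult.assoc)
      qed simp
    qed
    also have "\<dots> = ennreal (K powr P) * (\<integral>\<^sup>+t\<in>{0<..}. ennreal (t powr (a - 1 - P)) * enn_powr (?I t) P \<partial>lborel)"
      by (intro nn_integral_cmult) measurable
    also have "\<dots> \<le> ennreal (K powr P) * (ennreal C0 * (\<integral>\<^sup>+u\<in>{0<..}. ennreal (u powr (a - 1)) * enn_powr (enn_powr (rearr G u) s) P \<partial>lborel))"
      by (intro mult_left_mono C0) measurable
    also have "\<dots> = ennreal (K powr P * C0) * (\<integral>\<^sup>+u\<in>{0<..}. ennreal (u powr (a - 1)) * enn_powr (rearr G u) \<tau> \<partial>lborel)"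
      using s C0(1) by (simp add: enn_powr_enn_powr P_def ennreal_mult mult.assoc)
    finally have "lorentz_norm r \<tau> ?X \<le> enn_powr (ennreal (K powr P * C0) * (\<integral>\<^sup>+u\<in>{0<..}. ennreal (u powr (a - 1)) * enn_powr (rearr G u) \<tau> \<partial>lborel)) (1 / \<tau>)"
      using s unfolding lorentz_norm_alt a_def by (intro enn_powr_mono) auto
    also have "\<dots> = ennreal C * lorentz_norm r \<tau> G"
      using C0(1) by (simp add: lorentz_norm_alt enn_powr_mult enn_powr_ennreal C_def a_def)
    finally have "lorentz_norm r \<tau> ?X \<le> ennreal C * lorentz_norm r \<tau> G" .
  }
  ultimately show ?thesis by blast
qed

section \<open>A mollifier\<close>

text \<open>Numerators of the derivatives of \<open>exp (- (1 / w))\<close> for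
  \<open>w = t * (1 - t)\<close>: the \<open>k\<close>-th derivative is \<open>bump_poly k\<close>
  times \<open>(1 / w) ^ (2 * k)\<close> times the exponential. In the recursion
  \<open>[:0, 1, -1:]\<close> is \<open>w\<close> and \<open>[:1, -2:]\<close> its
  derivative.\<close>

fun bump_poly :: "nat \<Rightarrow> real poly" where
  "bump_poly 0 = 1"
| "bump_poly (Suc k) = pderiv (bump_poly k) * [:0, 1, -1:] ^ 2
    + bump_poly k * [:1, -2:] * (1 - smult (2 * real k) [:0, 1, -1:])"

definition bump_deriv :: "nat \<Rightarrow> real \<Rightarrow> real" where
  "bump_deriv k t = (if 0 < t \<and> t < 1
     then poly (bump_poly k) t * (1 / (t * (1 - t))) ^ (2 * k) * exp (- (1 / (t * (1 - t)))) else 0)"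

text \<open>The exponential beats every power of \<open>1 / w\<close>. The quadratic vanishing at
  both endpoints makes the extension by zero differentiable there, with derivative zero.\<close>

lemma bump_deriv_bound: "\<exists>C. \<forall>t. \<bar>bump_deriv k t\<bar> \<le> C * (t ^ 2 * (1 - t) ^ 2)"
proof -
  have "compact (poly (bump_poly k) ` {0..1})"
    by (intro compact_continuous_image continuous_intros) auto
  then have "bounded (poly (bump_poly k) ` {0..1})" by (rule compact_imp_bounded)
  then obtain B where B: "\<And>t. t \<in> {0..1} \<Longrightarrow> \<bar>poly (bump_poly k) t\<bar> \<le> B"
    unfolding bounded_iff by force
  \<comment> \<open>Two powers more than are to be absorbed, so that the factor \<open>w ^ 2\<close>
    survives.\<close>
  define m where "m = 2 * k + 2"
  have B0: "0 \<le> B" using B[of 0] by simp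
  have "\<bar>bump_deriv k t\<bar> \<le> B * fact m * (t ^ 2 * (1 - t) ^ 2)" for t
  proof (cases "0 < t \<and> t < 1")
    case True
    define w where "w = t * (1 - t)"
    have w: "0 < w" using True by (simp add: w_def)
    have "(1 / w) ^ m / fact m \<le> exp (1 / w)"
      using exp_lower_Taylor_quadratic w
    proof -
      have "(\<lambda>n. (1 / w) ^ n /\<^sub>R fact n) sums exp (1 / w)"
        by (rule exp_converges)
      then have "(\<Sum>n\<in>{m}. (1 / w) ^ n /\<^sub>R fact n) \<le> exp (1 / w)"
        using w by (intro sum_le_suminf[THEN order_trans[OF _ eq_refl[OF sums_unique[symmetric]]]])
          (auto simp: sums_iff)
      then show ?thesis by (simp add: divide_inverse mult.commute)
    qed
    then have "(1 / w) ^ m \<le> exp (1 / w) * fact m"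
      by (subst (asm) pos_divide_le_eq) auto
    then have "(1 / w) ^ m / exp (1 / w) \<le> fact m"
      by (subst pos_divide_le_eq) (auto simp: mult.commute)
    then have "(1 / w) ^ m * exp (- (1 / w)) \<le> fact m"
      by (simp only: exp_minus divide_inverse)
    then have "w ^ 2 * ((1 / w) ^ m * exp (- (1 / w))) \<le> w ^ 2 * fact m"
      by (intro mult_left_mono) auto
    moreover have "w ^ 2 * ((1 / w) ^ m * exp (- (1 / w))) = (1 / w) ^ (2 * k) * exp (- (1 / w))"
      using w by (simp add: m_def power_add power_divide power2_eq_square)
    ultimately have E1: "(1 / w) ^ (2 * k) * exp (- (1 / w)) \<le> fact m * w ^ 2"
      by (simp add: mult.commute)
    have "\<bar>poly (bump_poly k) t\<bar> * ((1 / w) ^ (2 * k) * exp (- (1 / w))) \<le> B * (fact m * w ^ 2)"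
      by (rule mult_mono) (use E1 B[of t] True B0 w in auto)
    then show ?thesis
      using True w by (simp add: bump_deriv_def abs_mult w_def power_mult_distrib mult.assoc)
  next
    case False
    then have "bump_deriv k t = 0" by (auto simp: bump_deriv_def)
    then show ?thesis using B0 by simp
  qed
  then show ?thesis by blast
qed

lemma has_real_derivative_zero_quadratic:
  assumes "\<And>t. \<bar>f t\<bar> \<le> C * (t - a) ^ 2"
  shows "(f has_real_derivative 0) (at a)"
proof -
  have fa: "f a = 0" using assms[of a] by simp
  have "(\<lambda>t. f t / (t - a)) \<midarrow>a\<rightarrow> 0"
  proof (rule Lim_null_comparison)
    show "\<forall>\<^sub>F t in at a. norm (f t / (t - a)) \<le> C * \<bar>t - a\<bar>"
      unfolding eventually_at
    proof (intro exI[of _ 1] conjI ballI impI)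
      fix t assume "t \<noteq> a \<and> dist t a < 1"
      then have "0 < \<bar>t - a\<bar>" by simp
      moreover have "\<bar>f t\<bar> \<le> C * \<bar>t - a\<bar> * \<bar>t - a\<bar>"
        using assms[of t] by (simp add: power2_eq_square abs_mult_self_eq mult.assoc)
      ultimately show "norm (f t / (t - a)) \<le> C * \<bar>t - a\<bar>"
        by (simp add: abs_divide pos_divide_le_eq)
    qed simp
    have "(\<lambda>t. C * \<bar>t - a\<bar>) \<midarrow>a\<rightarrow> C * \<bar>a - a\<bar>" by (intro tendsto_intros)
    then show "(\<lambda>t. C * \<bar>t - a\<bar>) \<midarrow>a\<rightarrow> 0" by simp
  qed
  then show ?thesis
    using fa by (simp add: has_field_derivative_iff)
qed

lemma bump_deriv_has_derivative:
  "(bump_deriv k has_real_derivative bump_deriv (Suc k) t) (at t)"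
proof -
  consider "0 < t \<and> t < 1" | "t < 0 \<or> 1 < t" | "t = 0 \<or> t = 1" by linarith
  then show ?thesis
  proof cases
    case 1
    define w where "w = t * (1 - t)"
    have w: "0 < w" using 1 by (simp add: w_def)
    let ?f = "\<lambda>t. poly (bump_poly k) t * (1 / (t * (1 - t))) ^ (2 * k) * exp (- (1 / (t * (1 - t))))"
    have "(?f has_real_derivative bump_deriv (Suc k) t) (at t)"
    proof -
      define d where "d = - (1 - 2 * t) / w ^ 2"
      have dw: "((\<lambda>t. 1 / (t * (1 - t))) has_real_derivative d) (at t)"
        using 1 by (auto intro!: derivative_eq_intros simp: d_def w_def power2_eq_square)
      have "(?f has_real_derivative
          ((poly (pderiv (bump_poly k)) t * (1 / w) ^ (2 * k)
           + real (2 * k) * d * (1 / w) ^ (2 * k - 1) * poly (bump_poly k) t) * exp (- (1 / w))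
           - exp (- (1 / w)) * d * (poly (bump_poly k) t * (1 / w) ^ (2 * k)))) (at t)"
        by (rule DERIV_cong[OF DERIV_mult[OF DERIV_mult[OF poly_DERIV DERIV_power[OF dw]]
          DERIV_fun_exp[OF DERIV_minus[OF dw]]]])
          (simp add: w_def algebra_simps)
      moreover have "(poly (pderiv (bump_poly k)) t * (1 / w) ^ (2 * k)
           + real (2 * k) * d * (1 / w) ^ (2 * k - 1) * poly (bump_poly k) t) * exp (- (1 / w))
           - exp (- (1 / w)) * d * (poly (bump_poly k) t * (1 / w) ^ (2 * k))
          = bump_deriv (Suc k) t"
      proof -
        have e: "real (2 * k) * c * (1 / w) ^ (2 * k - 1) = real (2 * k) * c * (w * (1 / w) ^ (2 * k))" for c
          using w by (cases k) (auto simp: power_divide)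
        have p: "poly (bump_poly (Suc k)) t = poly (pderiv (bump_poly k)) t * w ^ 2
            + poly (bump_poly k) t * (1 - 2 * t) * (1 - 2 * real k * w)"
          by (simp add: w_def algebra_simps power2_eq_square)
        have w2: "(1 / w) ^ (2 * Suc k) = (1 / w) ^ (2 * k) / w ^ 2"
          by (simp add: power_divide power2_eq_square)
        have bd: "bump_deriv (Suc k) t = poly (bump_poly (Suc k)) t * ((1 / w) ^ (2 * k) / w ^ 2) * exp (- (1 / w))"
          using 1 unfolding w2[symmetric] by (simp add: bump_deriv_def w_def)
        have gen: "(P' * X + real (2 * k) * d * (w * X) * P) * E - E * d * (P * X)
            = (P' * w ^ 2 + P * (1 - 2 * t) * (1 - 2 * real k * w)) * (X / w ^ 2) * E" for P P' X E
          unfolding d_def using w by (simp add: field_simps power2_eq_square)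
        show ?thesis
          unfolding e bd p by (rule gen)
      qed
      ultimately show ?thesis by simp
    qed
    moreover have "\<forall>\<^sub>F s in nhds t. bump_deriv k s = ?f s"
    proof -
      have "\<forall>\<^sub>F s in nhds t. s \<in> {0<..<1}"
        using 1 by (intro eventually_nhds_in_open) auto
      then show ?thesis by eventually_elim (simp add: bump_deriv_def)
    qed
    ultimately show ?thesis by (subst DERIV_cong_ev[OF refl _ refl])
  next
    case 2
    have "\<forall>\<^sub>F s in nhds t. s \<in> - {0..1}"
      using 2 by (intro eventually_nhds_in_open) auto
    then have "\<forall>\<^sub>F s in nhds t. bump_deriv k s = 0"
      by eventually_elim (auto simp: bump_deriv_def)
    moreover have "bump_deriv (Suc k) t = 0" using 2 by (auto simp: bump_deriv_def)
    ultimately show ?thesis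
      by (subst DERIV_cong_ev[OF refl _ refl, of _ "\<lambda>_. 0"]) auto
  next
    \<comment> \<open>At an endpoint the two branches of the definition meet; only the quadratic
      bound is available, and it suffices.\<close>
    case 3
    obtain C where C: "\<And>t. \<bar>bump_deriv k t\<bar> \<le> C * (t ^ 2 * (1 - t) ^ 2)"
      using bump_deriv_bound by blast
    have C0: "0 \<le> C" using C[of "1/2"] abs_ge_zero[of "bump_deriv k (1/2)"]
      by (simp add: zero_le_mult_iff power2_eq_square split: if_splits)
    have le: "\<bar>bump_deriv k s\<bar> \<le> C * s ^ 2" "\<bar>bump_deriv k s\<bar> \<le> C * (s - 1) ^ 2" for s
    proof -
      have "\<bar>bump_deriv k s\<bar> \<le> C * s ^ 2 \<and> \<bar>bump_deriv k s\<bar> \<le> C * (s - 1) ^ 2"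
      proof (cases "0 < s \<and> s < 1")
        case True
        then have "s ^ 2 * (1 - s) ^ 2 \<le> s ^ 2 * 1" "s ^ 2 * (1 - s) ^ 2 \<le> 1 * (1 - s) ^ 2"
          by (intro mult_left_mono mult_right_mono; simp add: power_le_one)+
        then have "C * (s ^ 2 * (1 - s) ^ 2) \<le> C * s ^ 2" "C * (s ^ 2 * (1 - s) ^ 2) \<le> C * (1 - s) ^ 2"
          using C0 by (auto intro!: mult_left_mono)
        then show ?thesis using C[of s] by (simp add: power2_commute)
      next
        case False
        then have "bump_deriv k s = 0" by (auto simp: bump_deriv_def)
        then show ?thesis using C0 by simp
      qed
      then show "\<bar>bump_deriv k s\<bar> \<le> C * s ^ 2" "\<bar>bump_deriv k s\<bar> \<le> C * (s - 1) ^ 2" by auto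
    qed
    have "bump_deriv (Suc k) t = 0" using 3 by (auto simp: bump_deriv_def)
    moreover have "(bump_deriv k has_real_derivative 0) (at t)"
      using 3 le by (auto intro!: has_real_derivative_zero_quadratic[where C=C])
    ultimately show ?thesis by simp
  qed
qed

text \<open>For a product of one-variable functions a partial derivative raises the order in a
  single factor, so an iterated one depends only on how often each basis vector occurs in the list.
  \<open>D i k\<close> plays the role of the \<open>k\<close>-th derivative of factor
  \<open>i\<close>. This reduces \<open>smooth_fun\<close>, which speaks about all iterated
  derivatives, to dimension one.\<close>

lemma iter_pdiff_prod:
  fixes D :: "'a::euclidean_space \<Rightarrow> nat \<Rightarrow> real \<Rightarrow> real"
  assumes D: "\<And>i k t. (D i k has_real_derivative D i (Suc k) t) (at t)"
  shows "set vs \<subseteq> Basis \<Longrightarrow> iter_pdiff vs (\<lambda>x. \<Prod>i\<in>Basis. D i 0 (x \<bullet> i)) = (\<lambda>x. \<Prod>i\<in>Basis. D i (count_list vs i) (x \<bullet> i))"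
    and "((\<lambda>x. \<Prod>i\<in>Basis. D i (c i) (x \<bullet> i)) has_derivative
        (\<lambda>v. \<Sum>i\<in>Basis. (v \<bullet> i) * (D i (Suc (c i)) (z \<bullet> i) * (\<Prod>j\<in>Basis - {i}. D j (c j) (z \<bullet> j))))) (at z)"
proof -
  show der: "((\<lambda>x. \<Prod>i\<in>Basis. D i (c i) (x \<bullet> i)) has_derivative
        (\<lambda>v. \<Sum>i\<in>Basis. (v \<bullet> i) * (D i (Suc (c i)) (z \<bullet> i) * (\<Prod>j\<in>Basis - {i}. D j (c j) (z \<bullet> j))))) (at z)" for c z
  proof -
    have "((\<lambda>x. D i (c i) (x \<bullet> i)) has_derivative (\<lambda>v. D i (Suc (c i)) (z \<bullet> i) * (v \<bullet> i))) (at z)" for i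
      using D[of i "c i" "z \<bullet> i"] unfolding has_field_derivative_def
      by (rule has_derivative_compose[rotated]) (auto intro!: derivative_eq_intros)
    then have "((\<lambda>x. \<Prod>i\<in>Basis. D i (c i) (x \<bullet> i)) has_derivative (\<lambda>v. \<Sum>i\<in>Basis.
        D i (Suc (c i)) (z \<bullet> i) * (v \<bullet> i) * (\<Prod>j\<in>Basis - {i}. D j (c j) (z \<bullet> j)))) (at z)"
      by (intro has_derivative_prod)
    then show ?thesis by (simp add: mult_ac)
  qed
  show "set vs \<subseteq> Basis \<Longrightarrow> iter_pdiff vs (\<lambda>x. \<Prod>i\<in>Basis. D i 0 (x \<bullet> i)) = (\<lambda>x. \<Prod>i\<in>Basis. D i (count_list vs i) (x \<bullet> i))"
  proof (induction vs)
    case (Cons v vs)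
    then have v: "v \<in> Basis" and IH: "iter_pdiff vs (\<lambda>x. \<Prod>i\<in>Basis. D i 0 (x \<bullet> i)) = (\<lambda>x. \<Prod>i\<in>Basis. D i (count_list vs i) (x \<bullet> i))"
      by auto
    show ?case
    proof
      fix x :: 'a
      let ?t = "\<lambda>i. D i (Suc (count_list vs i)) (x \<bullet> i) * (\<Prod>j\<in>Basis - {i}. D j (count_list vs j) (x \<bullet> j))"
      have "iter_pdiff (v # vs) (\<lambda>x. \<Prod>i\<in>Basis. D i 0 (x \<bullet> i)) x = (\<Sum>i\<in>Basis. (v \<bullet> i) * ?t i)"
        by (simp only: iter_pdiff.simps IH pdiff_def frechet_derivative_at[OF der[where c="count_list vs"], symmetric])
      also have "\<dots> = (\<Sum>i\<in>Basis. if i = v then ?t v else 0)"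
        using v by (intro sum.cong) (auto simp: inner_Basis)
      also have "\<dots> = ?t v" using v by simp
      also have "\<dots> = (\<Prod>i\<in>Basis. D i (count_list (v # vs) i) (x \<bullet> i))"
        using v by (subst prod.remove[of Basis v]) (auto intro!: prod.cong split: if_splits)
      finally show "iter_pdiff (v # vs) (\<lambda>x. \<Prod>i\<in>Basis. D i 0 (x \<bullet> i)) x = (\<Prod>i\<in>Basis. D i (count_list (v # vs) i) (x \<bullet> i))" .
    qed
  qed simp
qed

text \<open>The product of one-dimensional bumps. Its support is the unit cube with a corner at the
  origin, and it is not normalised; positivity on the open cube serves to show later that its
  integral is not zero. Only first derivatives are made available, all others being hidden in the
  final clause.\<close>

lemma mollifier_exists:
  obtains \<Phi> :: "'a::euclidean_space \<Rightarrow> real" and D\<Phi> :: "'a \<Rightarrow> 'a \<Rightarrow> real"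
  where "continuous_on UNIV \<Phi>" "\<And>i. continuous_on UNIV (D\<Phi> i)" "\<And>z. 0 \<le> \<Phi> z"
    "\<And>z. z \<notin> cbox 0 One \<Longrightarrow> \<Phi> z = 0" "\<And>i z. i \<in> Basis \<Longrightarrow> z \<notin> cbox 0 One \<Longrightarrow> D\<Phi> i z = 0"
    "\<And>z. (\<Phi> has_derivative (\<lambda>v. \<Sum>i\<in>Basis. (v \<bullet> i) * D\<Phi> i z)) (at z)"
    "\<And>z. z \<in> box 0 One \<Longrightarrow> 0 < \<Phi> z"
    "\<And>x \<epsilon>. 0 < \<epsilon> \<Longrightarrow> test_function (\<lambda>y. \<Phi> ((1 / \<epsilon>) *\<^sub>R (y - x)))"
proof
  let ?\<Phi> = "\<lambda>z::'a. \<Prod>i\<in>Basis. bump_deriv 0 (z \<bullet> i)"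
  let ?D = "\<lambda>i (z::'a). bump_deriv 1 (z \<bullet> i) * (\<Prod>j\<in>Basis - {i}. bump_deriv 0 (z \<bullet> j))"
  have c: "continuous_on UNIV (bump_deriv k)" for k
    by (meson DERIV_continuous_on bump_deriv_has_derivative has_field_derivative_at_within)
  have c': "continuous_on UNIV (\<lambda>z::'a. bump_deriv k (z \<bullet> i))" for k i
    by (intro continuous_on_compose2[OF c] continuous_intros) auto
  show "continuous_on UNIV ?\<Phi>" "\<And>i. continuous_on UNIV (?D i)"
    by (intro continuous_on_prod continuous_on_mult c')+
  show "0 \<le> ?\<Phi> z" for z by (intro prod_nonneg) (simp add: bump_deriv_def)
  have out: "bump_deriv k t = 0" if "t \<notin> {0..1}" for k t using that by (auto simp: bump_deriv_def)
  have Phi0: "?\<Phi> z = 0" if "z \<notin> cbox 0 One" for z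
  proof -
    obtain i where "i \<in> Basis" "z \<bullet> i \<notin> {0..1}" using \<open>z \<notin> cbox 0 One\<close> by (auto simp: mem_box)
    then show ?thesis using out[of "z \<bullet> i" 0] by (intro prod_zero) auto
  qed
  then show "?\<Phi> z = 0" if "z \<notin> cbox 0 One" for z using that .
  show "?D i z = 0" if i: "i \<in> Basis" and "z \<notin> cbox 0 One" for i z
  proof -
    obtain j where j: "j \<in> Basis" "z \<bullet> j \<notin> {0..1}" using \<open>z \<notin> cbox 0 One\<close> by (auto simp: mem_box)
    then have "j = i \<or> (\<Prod>j\<in>Basis - {i}. bump_deriv 0 (z \<bullet> j)) = 0"
      using out[of "z \<bullet> j" 0] by (metis DiffI finite_Basis finite_Diff prod_zero singletonD)
    then show ?thesis using out[OF j(2)] by auto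
  qed
  show "(?\<Phi> has_derivative (\<lambda>v. \<Sum>i\<in>Basis. (v \<bullet> i) * ?D i z)) (at z)" for z
    using iter_pdiff_prod(2)[of "\<lambda>i. bump_deriv" "\<lambda>i. 0" z] bump_deriv_has_derivative by simp
  show "0 < ?\<Phi> z" if "z \<in> box 0 One" for z
    using that by (intro prod_pos) (auto simp: bump_deriv_def mem_box)
  show "test_function (\<lambda>y. ?\<Phi> ((1 / \<epsilon>) *\<^sub>R (y - x)))" if \<epsilon>: "0 < \<epsilon>" for x \<epsilon>
  proof -
    \<comment> \<open>The factor \<open>(1 / \<epsilon>) ^ k\<close> comes from the chain rule and
      makes \<open>D i\<close> a chain of derivatives in the sense of
      \<open>iter_pdiff_prod\<close>.\<close>
    define D where "D i k t = (1 / \<epsilon>) ^ k * bump_deriv k ((1 / \<epsilon>) * (t - x \<bullet> i))" for i :: 'a and k t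
    have D: "(D i k has_real_derivative D i (Suc k) t) (at t)" for i k t
      unfolding D_def using \<epsilon>
      by (auto intro!: derivative_eq_intros DERIV_chain2[OF bump_deriv_has_derivative])
    have eq: "(\<lambda>y. ?\<Phi> ((1 / \<epsilon>) *\<^sub>R (y - x))) = (\<lambda>y. \<Prod>i\<in>Basis. D i 0 (y \<bullet> i))"
      by (simp add: D_def inner_diff_left)
    have "smooth_fun (\<lambda>y. ?\<Phi> ((1 / \<epsilon>) *\<^sub>R (y - x)))"
      unfolding smooth_fun_def eq
      by (auto simp: iter_pdiff_prod(1)[where D=D, OF D] intro!: differentiableI iter_pdiff_prod(2)[where D=D, OF D])
    moreover have "compact (closure {y. ?\<Phi> ((1 / \<epsilon>) *\<^sub>R (y - x)) \<noteq> 0})"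
    proof -
      have "{y. ?\<Phi> ((1 / \<epsilon>) *\<^sub>R (y - x)) \<noteq> 0} \<subseteq> (\<lambda>z. x + \<epsilon> *\<^sub>R z) ` cbox 0 One"
      proof
        fix y assume "y \<in> {y. ?\<Phi> ((1 / \<epsilon>) *\<^sub>R (y - x)) \<noteq> 0}"
        then have "(1 / \<epsilon>) *\<^sub>R (y - x) \<in> cbox 0 One" using Phi0 by blast
        then show "y \<in> (\<lambda>z. x + \<epsilon> *\<^sub>R z) ` cbox 0 One"
          using \<epsilon> by (intro image_eqI[of _ _ "(1 / \<epsilon>) *\<^sub>R (y - x)"]) auto
      qed
      moreover have "bounded ((\<lambda>z. x + \<epsilon> *\<^sub>R z) ` cbox 0 One)"
        by (intro compact_imp_bounded compact_continuous_image continuous_intros compact_cbox)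
      ultimately show ?thesis
        using bounded_subset compact_closure by blast
    qed
    ultimately show ?thesis
      unfolding test_function_def by blast
  qed
qed

section \<open>Mollification of weakly differentiable functions\<close>

text \<open>It needs no integrability: a function that is not integrable has integral 0 by
  convention.\<close>

lemma ennreal_norm_integral_le:
  fixes f :: "'a \<Rightarrow> 'b::{banach, second_countable_topology}"
  shows "ennreal (norm (integral\<^sup>L M f)) \<le> (\<integral>\<^sup>+x. ennreal (norm (f x)) \<partial>M)"
  by (cases "integrable M f") (auto simp: integral_norm_bound_ennreal not_integrable_integral_eq)

lemma integrable_bounded_support_scaleR:
  fixes f :: "'a::euclidean_space \<Rightarrow> 'b::{banach, second_countable_topology}" and \<phi> :: "'a \<Rightarrow> real"
  assumes [measurable]: "f \<in> borel_measurable borel" "\<phi> \<in> borel_measurable borel"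
    and fin: "\<And>r. (\<integral>\<^sup>+x\<in>ball 0 r. ennreal (norm (f x)) \<partial>lborel) < \<infinity>"
    and B: "\<And>x. \<bar>\<phi> x\<bar> \<le> B" and S: "\<And>x. x \<notin> ball 0 r \<Longrightarrow> \<phi> x = 0"
  shows "integrable lborel (\<lambda>x. \<phi> x *\<^sub>R f x)"
proof (rule integrableI_bounded)
  have B0: "0 \<le> B" using B[of 0] by linarith
  have "(\<integral>\<^sup>+x. ennreal (norm (\<phi> x *\<^sub>R f x)) \<partial>lborel) \<le> (\<integral>\<^sup>+x. ennreal B * (ennreal (norm (f x)) * indicator (ball 0 r) x) \<partial>lborel)"
  proof (intro nn_integral_mono)
    fix x
    show "ennreal (norm (\<phi> x *\<^sub>R f x)) \<le> ennreal B * (ennreal (norm (f x)) * indicator (ball 0 r) x)"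
      using B[of x] S[of x] B0
      by (cases "x \<in> ball 0 r") (auto simp flip: ennreal_mult intro!: ennreal_leI mult_right_mono)
  qed
  also have "\<dots> = ennreal B * (\<integral>\<^sup>+x\<in>ball 0 r. ennreal (norm (f x)) \<partial>lborel)"
    by (intro nn_integral_cmult) measurable
  also have "\<dots> < \<infinity>" using fin[of r] by (simp add: ennreal_mult_less_top)
  finally show "(\<integral>\<^sup>+x. ennreal (norm (\<phi> x *\<^sub>R f x)) \<partial>lborel) < \<infinity>" .
qed measurable

lemma norm_le_DIM_of_unit_cbox:
  assumes "z \<in> cbox 0 (One::'a::euclidean_space)"
  shows "norm z \<le> real DIM('a)"
proof -
  have "norm z \<le> (\<Sum>i\<in>Basis. \<bar>z \<bullet> i\<bar>)" by (rule norm_le_l1)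
  also have "\<dots> \<le> (\<Sum>i\<in>(Basis::'a set). 1)"
    using assms by (intro sum_mono) (auto simp: mem_box)
  finally show ?thesis by simp
qed

lemma bounded_of_continuous_unit_cbox:
  fixes \<Phi> :: "'a::euclidean_space \<Rightarrow> real"
  assumes "continuous_on UNIV \<Phi>" "\<And>z. z \<notin> cbox 0 One \<Longrightarrow> \<Phi> z = 0"
  obtains B where "0 \<le> B" "\<And>z. \<bar>\<Phi> z\<bar> \<le> B"
proof -
  have "compact (\<Phi> ` cbox 0 One)"
    by (intro compact_continuous_image continuous_on_subset[OF assms(1)]) auto
  then have "bounded (\<Phi> ` cbox 0 One)" by (rule compact_imp_bounded)
  then obtain B where "\<forall>x\<in>\<Phi> ` cbox 0 One. norm x \<le> B" unfolding bounded_iff by blast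
  then have "\<bar>\<Phi> z\<bar> \<le> max 0 B" for z
    using assms(2)[of z] by (cases "z \<in> cbox 0 One") force+
  then show ?thesis using that[of "max 0 B"] by auto
qed

lemma integral_lborel_rescale:
  fixes F :: "'a::euclidean_space \<Rightarrow> real"
  assumes [measurable]: "F \<in> borel_measurable borel" and \<epsilon>: "0 < \<epsilon>"
  shows "(\<integral>y. F ((1 / \<epsilon>) *\<^sub>R (y - x)) \<partial>lborel) = \<epsilon> ^ DIM('a) * (\<integral>y. F y \<partial>lborel)"
proof -
  have "(\<integral>y. F ((1 / \<epsilon>) *\<^sub>R (y - x)) \<partial>lborel)
      = (\<integral>y. F ((1 / \<epsilon>) *\<^sub>R (y - x)) \<partial>density (distr lborel borel (\<lambda>z. x + \<epsilon> *\<^sub>R z)) (\<lambda>_. ennreal (\<bar>\<epsilon>\<bar> ^ DIM('a))))"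
    using lborel_affine[of \<epsilon> x] \<epsilon> by simp
  also have "\<dots> = \<epsilon> ^ DIM('a) * (\<integral>y. F y \<partial>lborel)"
    using \<epsilon> by (simp add: integral_density integral_distr)
  finally show ?thesis .
qed

text \<open>The increment of the kernel along the segment from \<open>x\<close> to
  \<open>x + h\<close> is the integral of its derivative; Fubini and the weak derivative then
  exchange \<open>f\<close> for \<open>g\<close>. Working with the kernel avoids any
  differentiability of the mollified function. \<open>J\<close> is unnormalised with total mass
  \<open>m\<close>, so subtracting \<open>m * (w \<bullet> h)\<close> replaces \<open>g\<close> by
  \<open>g - w\<close>; with \<open>w = g x\<close> this measures the distance to the linear
  approximation.\<close>

lemma mollified_increment:
  fixes f :: "'a::euclidean_space \<Rightarrow> real" and g :: "'a \<Rightarrow> 'a" and \<Phi> :: "'a \<Rightarrow> real" and D\<Phi> :: "'a \<Rightarrow> 'a \<Rightarrow> real"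
  assumes f [measurable]: "f \<in> borel_measurable borel" and g [measurable]: "g \<in> borel_measurable borel"
    and ff: "\<And>r. (\<integral>\<^sup>+x\<in>ball 0 r. ennreal (norm (f x)) \<partial>lborel) < \<infinity>"
    and fg: "\<And>r. (\<integral>\<^sup>+x\<in>ball 0 r. ennreal (norm (g x)) \<partial>lborel) < \<infinity>"
    and \<Phi>: "continuous_on UNIV \<Phi>" "\<And>i. continuous_on UNIV (D\<Phi> i)" "\<And>z. 0 \<le> \<Phi> z"
    "\<And>z. z \<notin> cbox 0 One \<Longrightarrow> \<Phi> z = 0" "\<And>i z. i \<in> Basis \<Longrightarrow> z \<notin> cbox 0 One \<Longrightarrow> D\<Phi> i z = 0"
    "\<And>z. (\<Phi> has_derivative (\<lambda>v. \<Sum>i\<in>Basis. (v \<bullet> i) * D\<Phi> i z)) (at z)"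
    and \<epsilon>: "0 < \<epsilon>"
    and weak: "\<And>x i. i \<in> Basis \<Longrightarrow> (\<integral>y. f y * D\<Phi> i ((1 / \<epsilon>) *\<^sub>R (y - x)) \<partial>lborel)
        = - \<epsilon> * (\<integral>y. (g y \<bullet> i) * \<Phi> ((1 / \<epsilon>) *\<^sub>R (y - x)) \<partial>lborel)"
  defines "J \<equiv> (\<lambda>x. \<integral>y. f y * \<Phi> ((1 / \<epsilon>) *\<^sub>R (y - x)) \<partial>lborel)"
    and "m \<equiv> \<epsilon> ^ DIM('a) * (\<integral>y. \<Phi> y \<partial>lborel)"
  shows "ennreal \<bar>J (x + h) - J x - m * (w \<bullet> h)\<bar>
    \<le> ennreal (norm h) * (\<integral>\<^sup>+t\<in>{0<..<1}. (\<integral>\<^sup>+y. ennreal (norm (g y - w) * \<Phi> ((1 / \<epsilon>) *\<^sub>R (y - (x + t *\<^sub>R h)))) \<partial>lborel) \<partial>lborel)"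
proof -
  let ?a = "\<lambda>t y. (1 / \<epsilon>) *\<^sub>R (y - (x + t *\<^sub>R h))"
  let ?S = "\<lambda>z. \<Sum>i\<in>Basis. (h \<bullet> i) * D\<Phi> i z"
  let ?I = "indicator {0..1} :: real \<Rightarrow> real"
  have [measurable]: "\<Phi> \<in> borel_measurable borel" "\<And>i. D\<Phi> i \<in> borel_measurable borel"
    using \<Phi>(1,2) by (auto intro: borel_measurable_continuous_onI)
  obtain B where B: "0 \<le> B" "\<And>z. \<bar>\<Phi> z\<bar> \<le> B"
    using bounded_of_continuous_unit_cbox[OF \<Phi>(1,4)] by blast
  have Sc: "continuous_on UNIV ?S" by (intro continuous_intros \<Phi>(2))
  have S0: "?S z = 0" if "z \<notin> cbox 0 One" for z
    using that \<Phi>(5) by (intro sum.neutral) auto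
  obtain BS where BS: "0 \<le> BS" "\<And>z. \<bar>?S z\<bar> \<le> BS"
    using bounded_of_continuous_unit_cbox[OF Sc S0] by blast
  \<comment> \<open>One ball that contains the supports of the kernels centred at all points of the
    segment.\<close>
  define r where "r = norm x + norm h + \<epsilon> * real DIM('a) + 1"
  have supp: "?a t y \<notin> cbox 0 One" if "t \<in> {0..1}" "y \<notin> ball 0 r" for t y
  proof
    assume "?a t y \<in> cbox 0 One"
    then have "norm (?a t y) \<le> real DIM('a)" by (rule norm_le_DIM_of_unit_cbox)
    then have "norm (y - (x + t *\<^sub>R h)) \<le> \<epsilon> * real DIM('a)"
      using \<epsilon> unfolding norm_scaleR by (simp add: pos_divide_le_eq mult.commute)
    moreover have "norm y \<le> norm (y - (x + t *\<^sub>R h)) + norm (x + t *\<^sub>R h)"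
      by (metis diff_add_cancel norm_triangle_ineq)
    moreover have "norm (x + t *\<^sub>R h) \<le> norm x + norm h"
      using that(1) by (intro norm_triangle_le add_mono) (auto simp: mult_left_le_one_le)
    ultimately show False using that(2) by (simp add: r_def)
  qed
  have fint: "integrable lborel (\<lambda>y. f y * \<Phi> (?a t y))" if "t \<in> {0..1}" for t
    using integrable_bounded_support_scaleR[OF f _ ff, of "\<lambda>y. \<Phi> (?a t y)" B r] B(2) \<Phi>(4) supp[OF that]
    by (simp add: mult.commute)
  have gint: "integrable lborel (\<lambda>y. (g y \<bullet> v) * \<Phi> (?a t y))" if "t \<in> {0..1}" for t v
  proof -
    have "integrable lborel (\<lambda>y. \<Phi> (?a t y) *\<^sub>R g y)"
      using integrable_bounded_support_scaleR[OF g _ fg, of "\<lambda>y. \<Phi> (?a t y)" B r] B(2) \<Phi>(4) supp[OF that] by simp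
    then have "integrable lborel (\<lambda>y. (\<Phi> (?a t y) *\<^sub>R g y) \<bullet> v)" by (intro integrable_inner_left)
    then show ?thesis by (simp add: mult.commute)
  qed
  have Pint: "integrable lborel (\<lambda>y. \<Phi> (?a t y))" if "t \<in> {0..1}" for t
    using integrable_bounded_support_scaleR[of "\<lambda>_. 1::real" "\<lambda>y. \<Phi> (?a t y)" B r] B(2) \<Phi>(4) supp[OF that]
      emeasure_lborel_ball_finite[of "0::'a"]
    by simp
  have fSint: "integrable lborel (\<lambda>y. f y * D\<Phi> i (?a t y))" if "t \<in> {0..1}" "i \<in> Basis" for t i
  proof -
    note ti = that
    obtain Bi where "\<And>z. \<bar>D\<Phi> i z\<bar> \<le> Bi"
      using bounded_of_continuous_unit_cbox[OF \<Phi>(2), of i] \<Phi>(5)[OF ti(2)] by blast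
    then show ?thesis
      using integrable_bounded_support_scaleR[OF f _ ff, of "\<lambda>y. D\<Phi> i (?a t y)" Bi r] \<Phi>(5)[OF ti(2)] supp[OF ti(1)]
      by (simp add: mult.commute)
  qed
  let ?H = "\<lambda>t y. ?I t * (f y * ?S (?a t y))"
  have Hint: "integrable (lborel \<Otimes>\<^sub>M lborel) (case_prod ?H)"
  proof (rule integrableI_bounded)
    have "(\<integral>\<^sup>+q. ennreal (norm (case_prod ?H q)) \<partial>(lborel \<Otimes>\<^sub>M lborel))
        = (\<integral>\<^sup>+t. \<integral>\<^sup>+y. ennreal (norm (?H t y)) \<partial>lborel \<partial>lborel)"
      by (subst lborel.nn_integral_fst[symmetric]) auto
    also have "\<dots> \<le> (\<integral>\<^sup>+t. indicator {0..1} t * (ennreal BS * (\<integral>\<^sup>+y\<in>ball 0 r. ennreal (norm (f y)) \<partial>lborel)) \<partial>(lborel::real measure))"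
    proof (intro nn_integral_mono)
      fix t :: real
      show "(\<integral>\<^sup>+y. ennreal (norm (?H t y)) \<partial>lborel) \<le> indicator {0..1} t * (ennreal BS * (\<integral>\<^sup>+y\<in>ball 0 r. ennreal (norm (f y)) \<partial>lborel))"
      proof (cases "t \<in> {0..1}")
        case True
        have "(\<integral>\<^sup>+y. ennreal (norm (?H t y)) \<partial>lborel) \<le> (\<integral>\<^sup>+y. ennreal BS * (ennreal (norm (f y)) * indicator (ball 0 r) y) \<partial>lborel)"
        proof (intro nn_integral_mono)
          fix y :: 'a
          show "ennreal (norm (?H t y)) \<le> ennreal BS * (ennreal (norm (f y)) * indicator (ball 0 r) y)"
          proof (cases "y \<in> ball 0 r")
            case True
            then show ?thesis using BS \<open>t \<in> {0..1}\<close>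
              by (auto simp: abs_mult mult.commute[of "\<bar>f y\<bar>"] simp flip: ennreal_mult intro!: ennreal_leI mult_right_mono)
          next
            case False
            then have "?S (?a t y) = 0" using S0 supp[OF \<open>t \<in> {0..1}\<close>] by blast
            then show ?thesis by simp
          qed
        qed
        also have "\<dots> = ennreal BS * (\<integral>\<^sup>+y\<in>ball 0 r. ennreal (norm (f y)) \<partial>lborel)"
          by (intro nn_integral_cmult) measurable
        finally show ?thesis using True by simp
      qed simp
    qed
    also have "\<dots> = ennreal BS * (\<integral>\<^sup>+y\<in>ball 0 r. ennreal (norm (f y)) \<partial>lborel)"
      by (simp add: nn_integral_multc)
    also have "\<dots> < \<infinity>" using ff[of r] by (simp add: ennreal_mult_less_top)
    finally show "(\<integral>\<^sup>+q. ennreal (norm (case_prod ?H q)) \<partial>(lborel \<Otimes>\<^sub>M lborel)) < \<infinity>" .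
  qed measurable
  \<comment> \<open>The inner derivative of the kernel argument along the segment is
    \<open>- (1 / \<epsilon>) *\<^sub>R h\<close>, which is the source of the factor
    \<open>- \<epsilon>\<close>.\<close>
  have FTC: "(\<integral>t. ?H t y \<partial>lborel) = - \<epsilon> * (f y * \<Phi> (?a 1 y) - f y * \<Phi> (?a 0 y))" for y
  proof -
    have der: "((\<lambda>t. - \<epsilon> * \<Phi> (?a t y)) has_real_derivative ?S (?a t y)) (at t)" for t
    proof -
      have a: "((\<lambda>t. ?a t y) has_derivative (\<lambda>s. s *\<^sub>R (- (1 / \<epsilon>) *\<^sub>R h))) (at t)"
        using \<epsilon> by (auto intro!: derivative_eq_intros simp: algebra_simps)
      have "((\<lambda>t. \<Phi> (?a t y)) has_derivative (\<lambda>s. \<Sum>i\<in>Basis. ((s *\<^sub>R (- (1 / \<epsilon>) *\<^sub>R h)) \<bullet> i) * D\<Phi> i (?a t y))) (at t)"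
        using has_derivative_compose[OF a \<Phi>(6)] by simp
      also have "(\<lambda>s. \<Sum>i\<in>Basis. ((s *\<^sub>R (- (1 / \<epsilon>) *\<^sub>R h)) \<bullet> i) * D\<Phi> i (?a t y)) = (*) (- (1 / \<epsilon>) * ?S (?a t y))"
        by (auto simp: sum_distrib_left sum_negf mult_ac fun_eq_iff intro!: sum.cong)
      finally have "((\<lambda>t. \<Phi> (?a t y)) has_real_derivative (- (1 / \<epsilon>) * ?S (?a t y))) (at t)"
        unfolding has_field_derivative_def .
      from DERIV_cmult[OF this, of "- \<epsilon>"] show ?thesis using \<epsilon> by simp
    qed
    have "(\<integral>t. ?S (?a t y) * ?I t \<partial>lborel) = - \<epsilon> * \<Phi> (?a 1 y) - (- \<epsilon> * \<Phi> (?a 0 y))"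
    proof (rule integral_FTC_Icc_real)
      have "continuous_on UNIV (\<lambda>t. ?S (?a t y))"
        by (rule continuous_on_compose2[OF Sc]) (auto intro!: continuous_intros)
      then show "isCont (\<lambda>t. ?S (?a t y)) t" for t
        by (simp add: continuous_on_eq_continuous_at)
    qed (use der in auto)
    then have "(\<integral>t. f y * (?S (?a t y) * ?I t) \<partial>lborel) = f y * (- \<epsilon> * \<Phi> (?a 1 y) - (- \<epsilon> * \<Phi> (?a 0 y)))"
      by simp
    then show ?thesis by (simp add: mult_ac right_diff_distrib)
  qed
  \<comment> \<open>The hypothesis \<open>weak\<close> is applied in each coordinate with the kernel
    centred at \<open>x + t *\<^sub>R h\<close>; its factor \<open>- \<epsilon>\<close> cancels the
    one in \<open>FTC\<close>.\<close>
  have slice: "(\<integral>y. ?H t y \<partial>lborel) = - \<epsilon> * (?I t * (\<integral>y. (g y \<bullet> h) * \<Phi> (?a t y) \<partial>lborel))" for t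
  proof (cases "t \<in> {0..1}")
    case True
    have "(\<integral>y. ?H t y \<partial>lborel) = (\<integral>y. (\<Sum>i\<in>Basis. (h \<bullet> i) * (f y * D\<Phi> i (?a t y))) \<partial>lborel)"
      using True by (simp add: sum_distrib_left mult_ac)
    also have "\<dots> = (\<Sum>i\<in>Basis. (h \<bullet> i) * (\<integral>y. f y * D\<Phi> i (?a t y) \<partial>lborel))"
      using fSint[OF True] by (subst Bochner_Integration.integral_sum) auto
    also have "\<dots> = (\<Sum>i\<in>Basis. (h \<bullet> i) * (- \<epsilon> * (\<integral>y. (g y \<bullet> i) * \<Phi> (?a t y) \<partial>lborel)))"
      using weak by (intro sum.cong) auto
    also have "\<dots> = - \<epsilon> * (\<Sum>i\<in>Basis. (h \<bullet> i) * (\<integral>y. (g y \<bullet> i) * \<Phi> (?a t y) \<partial>lborel))"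
      by (simp add: sum_distrib_left mult_ac sum_negf)
    also have "(\<Sum>i\<in>Basis. (h \<bullet> i) * (\<integral>y. (g y \<bullet> i) * \<Phi> (?a t y) \<partial>lborel))
        = (\<integral>y. (\<Sum>i\<in>Basis. (h \<bullet> i) * ((g y \<bullet> i) * \<Phi> (?a t y))) \<partial>lborel)"
      using gint[OF True] by (subst Bochner_Integration.integral_sum) auto
    also have "(\<lambda>y. \<Sum>i\<in>Basis. (h \<bullet> i) * ((g y \<bullet> i) * \<Phi> (?a t y))) = (\<lambda>y. (g y \<bullet> h) * \<Phi> (?a t y))"
      by (subst euclidean_inner[of "g _" h]) (simp add: sum_distrib_right mult_ac)
    finally show ?thesis using True by simp
  qed simp
  have "(\<integral>y. (\<integral>t. ?H t y \<partial>lborel) \<partial>lborel) = (\<integral>t. (\<integral>y. ?H t y \<partial>lborel) \<partial>lborel)"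
    by (rule lborel_pair.Fubini_integral[OF Hint])
  moreover have "(\<integral>y. (\<integral>t. ?H t y \<partial>lborel) \<partial>lborel) = - \<epsilon> * (J (x + h) - J x)"
    unfolding FTC J_def using fint[of 0] fint[of 1] by simp
  moreover have "(\<integral>t. (\<integral>y. ?H t y \<partial>lborel) \<partial>lborel) = - \<epsilon> * (\<integral>t. ?I t * (\<integral>y. (g y \<bullet> h) * \<Phi> (?a t y) \<partial>lborel) \<partial>lborel)"
    unfolding slice by simp
  ultimately have Jeq: "J (x + h) - J x = (\<integral>t. ?I t * (\<integral>y. (g y \<bullet> h) * \<Phi> (?a t y) \<partial>lborel) \<partial>lborel)"
    using \<epsilon> by simp
  have Gint: "integrable lborel (\<lambda>t. ?I t * (\<integral>y. (g y \<bullet> h) * \<Phi> (?a t y) \<partial>lborel))"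
  proof -
    have "integrable lborel (\<lambda>t. \<integral>y. ?H t y \<partial>lborel)"
      using lborel_pair.integrable_fst'[OF Hint] by simp
    then have "integrable lborel (\<lambda>t. (- (1 / \<epsilon>)) * (\<integral>y. ?H t y \<partial>lborel))"
      by (rule integrable_mult_right)
    then show ?thesis unfolding slice using \<epsilon> by simp
  qed
  have mP: "(\<integral>y. \<Phi> (?a t y) \<partial>lborel) = m" for t
    unfolding m_def by (intro integral_lborel_rescale \<epsilon>) measurable
  have "m * (w \<bullet> h) = (\<integral>t. (m * (w \<bullet> h)) * ?I t \<partial>lborel)"
    by simp
  then have "J (x + h) - J x - m * (w \<bullet> h)
      = (\<integral>t. ?I t * (\<integral>y. (g y \<bullet> h) * \<Phi> (?a t y) \<partial>lborel) \<partial>lborel) - (\<integral>t. (m * (w \<bullet> h)) * ?I t \<partial>lborel)"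
    using Jeq by simp
  also have "\<dots> = (\<integral>t. ?I t * (\<integral>y. (g y \<bullet> h) * \<Phi> (?a t y) \<partial>lborel) - (m * (w \<bullet> h)) * ?I t \<partial>lborel)"
    using Gint by (intro Bochner_Integration.integral_diff[symmetric]) auto
  also have "\<dots> = (\<integral>t. ?I t * (\<integral>y. ((g y - w) \<bullet> h) * \<Phi> (?a t y) \<partial>lborel) \<partial>lborel)"
  proof (intro Bochner_Integration.integral_cong refl)
    fix t :: real
    show "?I t * (\<integral>y. (g y \<bullet> h) * \<Phi> (?a t y) \<partial>lborel) - (m * (w \<bullet> h)) * ?I t
        = ?I t * (\<integral>y. ((g y - w) \<bullet> h) * \<Phi> (?a t y) \<partial>lborel)"
    proof (cases "t \<in> {0..1}")
      case True
      have "(\<integral>y. ((g y - w) \<bullet> h) * \<Phi> (?a t y) \<partial>lborel)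
          = (\<integral>y. (g y \<bullet> h) * \<Phi> (?a t y) - (w \<bullet> h) * \<Phi> (?a t y) \<partial>lborel)"
        by (simp add: inner_diff_left left_diff_distrib)
      also have "\<dots> = (\<integral>y. (g y \<bullet> h) * \<Phi> (?a t y) \<partial>lborel) - (w \<bullet> h) * m"
        using gint[OF True] Pint[OF True] mP[of t] by (subst Bochner_Integration.integral_diff) auto
      finally show ?thesis using True by (simp add: mult.commute)
    qed simp
  qed
  finally have eq: "J (x + h) - J x - m * (w \<bullet> h) = (\<integral>t. ?I t * (\<integral>y. ((g y - w) \<bullet> h) * \<Phi> (?a t y) \<partial>lborel) \<partial>lborel)" .
  have "ennreal \<bar>J (x + h) - J x - m * (w \<bullet> h)\<bar> \<le> (\<integral>\<^sup>+t. ennreal (norm (?I t * (\<integral>y. ((g y - w) \<bullet> h) * \<Phi> (?a t y) \<partial>lborel))) \<partial>lborel)"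
    unfolding eq using ennreal_norm_integral_le[of lborel "\<lambda>t. ?I t * (\<integral>y. ((g y - w) \<bullet> h) * \<Phi> (?a t y) \<partial>lborel)"] by simp
  also have "\<dots> \<le> (\<integral>\<^sup>+t. ennreal (norm h) * ((\<integral>\<^sup>+y. ennreal (norm (g y - w) * \<Phi> (?a t y)) \<partial>lborel) * indicator {0..1} t) \<partial>lborel)"
  proof (intro nn_integral_mono)
    fix t :: real
    show "ennreal (norm (?I t * (\<integral>y. ((g y - w) \<bullet> h) * \<Phi> (?a t y) \<partial>lborel)))
      \<le> ennreal (norm h) * ((\<integral>\<^sup>+y. ennreal (norm (g y - w) * \<Phi> (?a t y)) \<partial>lborel) * indicator {0..1} t)"
    proof (cases "t \<in> {0..1}")
      case True
      have "ennreal (norm (\<integral>y. ((g y - w) \<bullet> h) * \<Phi> (?a t y) \<partial>lborel)) \<le> (\<integral>\<^sup>+y. ennreal (norm (((g y - w) \<bullet> h) * \<Phi> (?a t y))) \<partial>lborel)"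
        by (rule ennreal_norm_integral_le)
      also have "\<dots> \<le> (\<integral>\<^sup>+y. ennreal (norm h) * ennreal (norm (g y - w) * \<Phi> (?a t y)) \<partial>lborel)"
      proof (intro nn_integral_mono)
        fix y :: 'a
        have "\<bar>(g y - w) \<bullet> h\<bar> * \<Phi> (?a t y) \<le> norm (g y - w) * norm h * \<Phi> (?a t y)"
          by (intro mult_right_mono Cauchy_Schwarz_ineq2 \<Phi>(3))
        then show "ennreal (norm (((g y - w) \<bullet> h) * \<Phi> (?a t y))) \<le> ennreal (norm h) * ennreal (norm (g y - w) * \<Phi> (?a t y))"
          using \<Phi>(3) by (auto simp: abs_mult mult_ac simp flip: ennreal_mult intro!: ennreal_leI)
      qed
      also have "\<dots> = ennreal (norm h) * (\<integral>\<^sup>+y. ennreal (norm (g y - w) * \<Phi> (?a t y)) \<partial>lborel)"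
        by (intro nn_integral_cmult) measurable
      finally show ?thesis using True by simp
    qed simp
  qed
  also have "\<dots> = (\<integral>\<^sup>+t. ennreal (norm h) * ((\<integral>\<^sup>+y. ennreal (norm (g y - w) * \<Phi> (?a t y)) \<partial>lborel) * indicator {0<..<1} t) \<partial>lborel)"
  proof (intro nn_integral_cong_AE)
    have "AE t in lborel. t \<noteq> (0::real)" "AE t in lborel. t \<noteq> (1::real)"
      by (rule AE_lborel_singleton)+
    then show "AE t in lborel. ennreal (norm h) * ((\<integral>\<^sup>+y. ennreal (norm (g y - w) * \<Phi> (?a t y)) \<partial>lborel) * indicator {0..1} t)
        = ennreal (norm h) * ((\<integral>\<^sup>+y. ennreal (norm (g y - w) * \<Phi> (?a t y)) \<partial>lborel) * indicator {0<..<1} t)"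
      by eventually_elim (auto simp: indicator_def)
  qed
  also have "\<dots> = ennreal (norm h) * (\<integral>\<^sup>+t\<in>{0<..<1}. (\<integral>\<^sup>+y. ennreal (norm (g y - w) * \<Phi> (?a t y)) \<partial>lborel) \<partial>lborel)"
    by (intro nn_integral_cmult) measurable
  finally show ?thesis .
qed

section \<open>Lebesgue points\<close>

lemma powr_norm_add_le:
  fixes a b :: "'b::real_normed_vector" and s :: real
  assumes "0 \<le> s"
  shows "norm (a + b) powr s \<le> 2 powr s * (norm a powr s + norm b powr s)"
proof -
  have "norm (a + b) \<le> 2 * max (norm a) (norm b)"
    using norm_triangle_ineq[of a b] by linarith
  then have "norm (a + b) powr s \<le> (2 * max (norm a) (norm b)) powr s"
    using assms by (intro powr_mono2) auto
  also have "\<dots> = 2 powr s * max (norm a) (norm b) powr s"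
    by (simp add: powr_mult)
  also have "\<dots> \<le> 2 powr s * (norm a powr s + norm b powr s)"
    by (intro mult_left_mono) (auto simp: max_def)
  finally show ?thesis .
qed

text \<open>Differentiation over cubes having \<open>x\<close> as a corner. Only the upper estimate
  is kept, in a form that can be summed when a ball is covered by several such cubes.\<close>

lemma lebesgue_point_corner:
  fixes F :: "'a::euclidean_space \<Rightarrow> real"
  assumes [measurable]: "F \<in> borel_measurable borel" and F0: "\<And>x. 0 \<le> F x"
    and fin: "\<And>r. (\<integral>\<^sup>+x\<in>ball 0 r. ennreal (F x) \<partial>lborel) < \<infinity>"
  shows "AE x in lborel. \<forall>e>0. \<exists>d>0. \<forall>h. 0 < h \<and> h < d \<longrightarrow>
    (\<integral>\<^sup>+y\<in>cbox x (x + h *\<^sub>R One). ennreal (F y) \<partial>lborel) \<le> ennreal ((F x + e) * h ^ DIM('a))"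
proof -
  have fin_box: "(\<integral>\<^sup>+x\<in>cbox a b. ennreal (F x) \<partial>lborel) < \<infinity>" for a b
  proof -
    obtain r where "cbox a b \<subseteq> ball 0 r"
      using bounded_subset_ballD[OF bounded_cbox] by blast
    then have "(\<integral>\<^sup>+x\<in>cbox a b. ennreal (F x) \<partial>lborel) \<le> (\<integral>\<^sup>+x\<in>ball 0 r. ennreal (F x) \<partial>lborel)"
      by (intro nn_integral_mono) (auto simp: indicator_def)
    then show ?thesis using fin[of r] by (simp add: le_less_trans)
  qed
  have int: "F integrable_on cbox a b" for a b
  proof -
    have "set_integrable lborel (cbox a b) F"
      unfolding set_integrable_def
    proof (rule integrableI_bounded)
      have "(\<integral>\<^sup>+x. ennreal (norm (indicat_real (cbox a b) x *\<^sub>R F x)) \<partial>lborel) = (\<integral>\<^sup>+x\<in>cbox a b. ennreal (F x) \<partial>lborel)"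
        using F0 by (intro nn_integral_cong) (auto simp: indicator_def)
      then show "(\<integral>\<^sup>+x. ennreal (norm (indicat_real (cbox a b) x *\<^sub>R F x)) \<partial>lborel) < \<infinity>"
        using fin_box by simp
    qed measurable
    then show ?thesis by (rule set_borel_integral_eq_integral(1))
  qed
  have eq: "(\<integral>\<^sup>+x\<in>cbox a b. ennreal (F x) \<partial>lborel) = ennreal (integral (cbox a b) F)" for a b
    using fin_box F0 by (intro set_nn_integral_lborel_eq_integral) (auto simp: set_borel_measurable_def)
  obtain N where N: "negligible N"
    "\<And>x e. x \<notin> N \<Longrightarrow> 0 < e \<Longrightarrow> \<exists>d>0. \<forall>h. 0 < h \<and> h < d \<longrightarrow>
      norm (integral (cbox x (x + h *\<^sub>R One)) F /\<^sub>R h ^ DIM('a) - F x) < e"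
    using integrable_ccontinuous_explicit[of F] int by blast
  have "AE x in lborel. x \<notin> N"
    using N(1) AE_not_in AE_completion_iff negligible_iff_null_sets by blast
  then show ?thesis
  proof eventually_elim
    case (elim x)
    show ?case
    proof (intro allI impI)
      fix e :: real assume "0 < e"
      then obtain d where d: "d > 0" "\<And>h. 0 < h \<Longrightarrow> h < d \<Longrightarrow>
          norm (integral (cbox x (x + h *\<^sub>R One)) F /\<^sub>R h ^ DIM('a) - F x) < e"
        using N(2)[OF elim] by blast
      have "(\<integral>\<^sup>+y\<in>cbox x (x + h *\<^sub>R One). ennreal (F y) \<partial>lborel) \<le> ennreal ((F x + e) * h ^ DIM('a))"
        if h: "0 < h" "h < d" for h
      proof -
        have "integral (cbox x (x + h *\<^sub>R One)) F / h ^ DIM('a) \<le> F x + e"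
          using d(2)[OF h] by (simp add: divide_inverse mult.commute abs_less_iff)
        then have "integral (cbox x (x + h *\<^sub>R One)) F \<le> (F x + e) * h ^ DIM('a)"
          using h by (simp add: pos_divide_le_eq)
        then show ?thesis unfolding eq by (rule ennreal_leI)
      qed
      then show "\<exists>d>0. \<forall>h. 0 < h \<and> h < d \<longrightarrow>
          (\<integral>\<^sup>+y\<in>cbox x (x + h *\<^sub>R One). ennreal (F y) \<partial>lborel) \<le> ennreal ((F x + e) * h ^ DIM('a))"
        using d(1) by blast
    qed
  qed
qed

definition reflect :: "'a::euclidean_space set \<Rightarrow> 'a \<Rightarrow> 'a"
  where "reflect S x = (\<Sum>j\<in>Basis. ((if j \<in> S then - 1 else 1) * (x \<bullet> j)) *\<^sub>R j)"

lemma reflect_inner: "j \<in> Basis \<Longrightarrow> reflect S x \<bullet> j = (if j \<in> S then - 1 else 1) * (x \<bullet> j)"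
  by (simp add: reflect_def)

lemma reflect_reflect [simp]: "reflect S (reflect S x) = x"
  by (rule euclidean_eqI) (auto simp: reflect_inner)

lemma norm_reflect [simp]: "norm (reflect S x) = norm x"
  by (subst (1 2) norm_eq_sqrt_inner, subst (1 2) euclidean_inner)
     (auto simp: reflect_inner intro!: sum.cong)

lemma reflect_measurable [measurable]: "reflect S \<in> borel \<rightarrow>\<^sub>M borel"
  unfolding reflect_def[abs_def] by measurable

lemma lborel_reflect: "distr lborel borel (reflect S) = (lborel :: 'a::euclidean_space measure)"
proof -
  have "(lborel :: 'a measure) = density (distr lborel borel (reflect S)) (\<lambda>_. (\<Prod>j\<in>(Basis::'a set). ennreal \<bar>if j \<in> S then - 1 else 1\<bar>))"
    using lborel_affine_euclidean[of "\<lambda>j. if j \<in> S then - 1 else (1::real)" "0::'a"]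
    by (simp add: reflect_def[abs_def] prod_ennreal)
  also have "(\<Prod>j\<in>(Basis::'a set). ennreal \<bar>if j \<in> S then - 1 else 1\<bar>) = 1"
    by (intro prod.neutral) auto
  finally show ?thesis by (simp add: density_1)
qed

lemma nn_integral_reflect:
  fixes F :: "'a::euclidean_space \<Rightarrow> ennreal"
  assumes [measurable]: "F \<in> borel_measurable borel"
  shows "(\<integral>\<^sup>+x. F (reflect S x) \<partial>lborel) = (\<integral>\<^sup>+x. F x \<partial>lborel)"
  by (subst (2) lborel_reflect[symmetric, of S]) (simp add: nn_integral_distr)

text \<open>Reflecting the coordinates turns the differentiation theorem over one-sided cubes into one
  over balls, up to the factor \<open>2 ^ DIM('a)\<close>.\<close>
lemma lebesgue_point_ball:
  fixes F :: "'a::euclidean_space \<Rightarrow> real"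
  assumes [measurable]: "F \<in> borel_measurable borel" and F0: "\<And>x. 0 \<le> F x"
    and fin: "\<And>r. (\<integral>\<^sup>+x\<in>ball 0 r. ennreal (F x) \<partial>lborel) < \<infinity>"
  shows "AE x in lborel. \<forall>e>0. \<exists>d>0. \<forall>h. 0 < h \<and> h < d \<longrightarrow>
    (\<integral>\<^sup>+y\<in>ball x h. ennreal (F y) \<partial>lborel) \<le> ennreal (2 ^ DIM('a) * (F x + e) * h ^ DIM('a))"
proof -
  let ?P = "\<lambda>S x. \<forall>e>0. \<exists>d>0. \<forall>h. 0 < h \<and> h < d \<longrightarrow>
    (\<integral>\<^sup>+y\<in>cbox x (x + h *\<^sub>R One). ennreal (F (reflect S y)) \<partial>lborel) \<le> ennreal ((F (reflect S x) + e) * h ^ DIM('a))"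
  have P1: "AE x in lborel. ?P S x" for S
  proof (rule lebesgue_point_corner)
    fix r
    have "(\<integral>\<^sup>+x\<in>ball 0 r. ennreal (F (reflect S x)) \<partial>lborel) = (\<integral>\<^sup>+x. ennreal (F (reflect S x)) * indicator (ball 0 r) (reflect S x) \<partial>lborel)"
      by (intro nn_integral_cong) (auto simp: indicator_def)
    also have "\<dots> = (\<integral>\<^sup>+x\<in>ball 0 r. ennreal (F x) \<partial>lborel)"
      by (rule nn_integral_reflect) measurable
    finally show "(\<integral>\<^sup>+x\<in>ball 0 r. ennreal (F (reflect S x)) \<partial>lborel) < \<infinity>" using fin by simp
  qed (use F0 in auto)
  \<comment> \<open>Since reflections preserve the measure, the property of the reflected function
    holds at the reflected point for almost every \<open>x\<close>.\<close>
  have "AE x in distr lborel borel (reflect S). ?P S x" for S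
    using P1[of S] unfolding lborel_reflect .
  then have "AE x in lborel. ?P S (reflect S x)" for S
    by (rule AE_distrD[rotated]) measurable
  then have "AE x in lborel. \<forall>S\<in>Pow Basis. ?P S (reflect S x)"
    by (intro AE_finite_allI) auto
  then show ?thesis
  proof eventually_elim
    case (elim x)
    show ?case
    proof (intro allI impI)
      fix e :: real assume e: "0 < e"
      let ?Q = "\<lambda>h S. cbox (reflect S x) (reflect S x + h *\<^sub>R One)"
      have "\<forall>S\<in>Pow Basis. \<exists>d>0. \<forall>h. 0 < h \<and> h < d \<longrightarrow>
        (\<integral>\<^sup>+y\<in>?Q h S. ennreal (F (reflect S y)) \<partial>lborel) \<le> ennreal ((F x + e) * h ^ DIM('a))"
      proof
        fix S :: "'a set" assume "S \<in> Pow Basis"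
        then have "?P S (reflect S x)" using elim by blast
        then show "\<exists>d>0. \<forall>h. 0 < h \<and> h < d \<longrightarrow>
          (\<integral>\<^sup>+y\<in>?Q h S. ennreal (F (reflect S y)) \<partial>lborel) \<le> ennreal ((F x + e) * h ^ DIM('a))"
          using e by simp
      qed
      then obtain d where d: "\<And>S. S \<in> Pow Basis \<Longrightarrow> 0 < d S"
        "\<And>S h. S \<in> Pow Basis \<Longrightarrow> 0 < h \<Longrightarrow> h < d S \<Longrightarrow>
          (\<integral>\<^sup>+y\<in>?Q h S. ennreal (F (reflect S y)) \<partial>lborel) \<le> ennreal ((F x + e) * h ^ DIM('a))"
        unfolding bchoice_iff by blast
      define d0 where "d0 = Min (d ` Pow Basis)"
      have fin: "finite (d ` Pow Basis)" "d ` Pow Basis \<noteq> {}" by auto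
      have d0: "0 < d0" "\<And>S. S \<in> Pow Basis \<Longrightarrow> d0 \<le> d S"
        using d(1) Min_gr_iff[OF fin, of 0] Min_le[OF fin(1)] by (auto simp: d0_def)
      have "(\<integral>\<^sup>+y\<in>ball x h. ennreal (F y) \<partial>lborel) \<le> ennreal (2 ^ DIM('a) * (F x + e) * h ^ DIM('a))"
        if h: "0 < h" "h < d0" for h
      proof -
        have "(\<integral>\<^sup>+y\<in>ball x h. ennreal (F y) \<partial>lborel)
            \<le> (\<integral>\<^sup>+y. (\<Sum>S\<in>Pow Basis. ennreal (F (reflect S (reflect S y))) * indicator (?Q h S) (reflect S y)) \<partial>lborel)"
        proof (intro nn_integral_mono)
          fix y :: 'a
          show "ennreal (F y) * indicator (ball x h) y
            \<le> (\<Sum>S\<in>Pow Basis. ennreal (F (reflect S (reflect S y))) * indicator (?Q h S) (reflect S y))"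
          proof (cases "y \<in> ball x h")
            case True
            \<comment> \<open>The coordinates in which \<open>y\<close> lies below \<open>x\<close>.
              Reflecting exactly these moves \<open>y\<close> into the one-sided cube at the
              reflected point.\<close>
            define S where "S = {j\<in>Basis. y \<bullet> j < x \<bullet> j}"
            have "reflect S y \<in> ?Q h S"
              unfolding mem_box
            proof (intro ballI)
              fix j :: 'a assume j: "j \<in> Basis"
              have "\<bar>(x - y) \<bullet> j\<bar> \<le> h"
                using Basis_le_norm[OF j, of "x - y"] True by (simp add: dist_norm)
              then show "reflect S x \<bullet> j \<le> reflect S y \<bullet> j \<and> reflect S y \<bullet> j \<le> (reflect S x + h *\<^sub>R One) \<bullet> j"
                using j by (auto simp: reflect_inner inner_simps S_def)
            qed
            then have "ennreal (F y) * indicator (ball x h) y = ennreal (F (reflect S (reflect S y))) * indicator (?Q h S) (reflect S y)"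
              using True by simp
            also have "\<dots> \<le> (\<Sum>S\<in>Pow Basis. ennreal (F (reflect S (reflect S y))) * indicator (?Q h S) (reflect S y))"
              by (intro member_le_sum) (auto simp: S_def)
            finally show ?thesis .
          qed simp
        qed
        also have "\<dots> = (\<Sum>S\<in>Pow Basis. (\<integral>\<^sup>+y. ennreal (F (reflect S (reflect S y))) * indicator (?Q h S) (reflect S y) \<partial>lborel))"
          by (intro nn_integral_sum) measurable
        also have "\<dots> = (\<Sum>S\<in>Pow Basis. (\<integral>\<^sup>+y\<in>?Q h S. ennreal (F (reflect S y)) \<partial>lborel))"
          using nn_integral_reflect[of "\<lambda>y. ennreal (F (reflect S y)) * indicator (?Q h S) y" S for S]
          by (intro sum.cong refl) simp
        also have "\<dots> \<le> (\<Sum>S\<in>Pow (Basis::'a set). ennreal ((F x + e) * h ^ DIM('a)))"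
          using d(2) d0(2) h by (intro sum_mono) (meson less_le_trans)
        also have "\<dots> = ennreal (2 ^ DIM('a) * ((F x + e) * h ^ DIM('a)))"
          using F0[of x] e h by (simp add: card_Pow ennreal_of_nat_eq_real_of_nat flip: ennreal_mult)
        finally show ?thesis by (simp add: mult.assoc)
      qed
      then show "\<exists>d>0. \<forall>h. 0 < h \<and> h < d \<longrightarrow>
          (\<integral>\<^sup>+y\<in>ball x h. ennreal (F y) \<partial>lborel) \<le> ennreal (2 ^ DIM('a) * (F x + e) * h ^ DIM('a))"
        using d0(1) by blast
    qed
  qed
qed

text \<open>The differentiation theorem is applied to \<open>norm (g y - c) powr s\<close> for all
  \<open>c\<close> in a countable dense set, which costs one null set only; at a good point some
  \<open>c\<close> is close to \<open>g x\<close>. The factor \<open>2 ^ DIM('a)\<close> is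
  harmless, as the limit is zero.\<close>

lemma lebesgue_point_Ls:
  fixes g :: "'a::euclidean_space \<Rightarrow> 'b::euclidean_space"
  assumes g [measurable]: "g \<in> borel_measurable borel" and s: "0 < s"
    and fin: "\<And>r. (\<integral>\<^sup>+x\<in>ball 0 r. ennreal (norm (g x) powr s) \<partial>lborel) < \<infinity>"
  shows "AE x in lborel. \<forall>e>0. \<exists>d>0. \<forall>h. 0 < h \<and> h < d \<longrightarrow>
    (\<integral>\<^sup>+y\<in>ball x h. ennreal (norm (g y - g x) powr s) \<partial>lborel) \<le> ennreal (e * h ^ DIM('a))"
proof -
  obtain D :: "'b set" where D: "countable D" "\<And>X. open X \<Longrightarrow> X \<noteq> {} \<Longrightarrow> \<exists>d\<in>D. d \<in> X"
    using countable_dense_setE by metis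
  have "AE x in lborel. \<forall>e>0. \<exists>d>0. \<forall>h. 0 < h \<and> h < d \<longrightarrow>
    (\<integral>\<^sup>+y\<in>ball x h. ennreal (norm (g y - c) powr s) \<partial>lborel) \<le> ennreal (2 ^ DIM('a) * (norm (g x - c) powr s + e) * h ^ DIM('a))" for c
  proof (rule lebesgue_point_ball)
    fix r
    have "(\<integral>\<^sup>+x\<in>ball 0 r. ennreal (norm (g x - c) powr s) \<partial>lborel)
      \<le> (\<integral>\<^sup>+x. ennreal (2 powr s) * (ennreal (norm (g x) powr s) * indicator (ball 0 r) x + ennreal (norm c powr s) * indicator (ball 0 r) x) \<partial>lborel)"
    proof (intro nn_integral_mono)
      fix x
      show "ennreal (norm (g x - c) powr s) * indicator (ball 0 r) x
        \<le> ennreal (2 powr s) * (ennreal (norm (g x) powr s) * indicator (ball 0 r) x + ennreal (norm c powr s) * indicator (ball 0 r) x)"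
        using powr_norm_add_le[of s "g x" "- c"] s
        by (cases "x \<in> ball 0 r") (auto simp flip: ennreal_plus ennreal_mult intro!: ennreal_leI)
    qed
    also have "\<dots> = ennreal (2 powr s) * ((\<integral>\<^sup>+x\<in>ball 0 r. ennreal (norm (g x) powr s) \<partial>lborel) + ennreal (norm c powr s) * emeasure lborel (ball (0::'a) r))"
      by (simp add: nn_integral_cmult nn_integral_add)
    also have "\<dots> < \<infinity>"
      using fin[of r] emeasure_lborel_ball_finite[of "0::'a" r] by (simp add: ennreal_mult_less_top)
    finally show "(\<integral>\<^sup>+x\<in>ball 0 r. ennreal (norm (g x - c) powr s) \<partial>lborel) < \<infinity>" .
  qed auto
  then have "AE x in lborel. \<forall>c\<in>D. \<forall>e>0. \<exists>d>0. \<forall>h. 0 < h \<and> h < d \<longrightarrow>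
    (\<integral>\<^sup>+y\<in>ball x h. ennreal (norm (g y - c) powr s) \<partial>lborel) \<le> ennreal (2 ^ DIM('a) * (norm (g x - c) powr s + e) * h ^ DIM('a))"
    using D(1) by (subst AE_ball_countable) auto
  then show ?thesis
  proof eventually_elim
    case (elim x)
    show ?case
    proof (intro allI impI)
      fix e :: real assume e: "0 < e"
      let ?n = "DIM('a)" and ?V = "vol TYPE('a)"
      \<comment> \<open>Solves
        \<open>2 powr s * (2 ^ n * (\<eta> + \<eta>) + V * \<eta>) = e\<close>, where
        \<open>V\<close> is the volume of the unit ball; one \<open>\<eta>\<close> bounds the
        distance to \<open>c\<close>, the other is the error of the differentiation theorem.\<close>
      define \<eta> where "\<eta> = e / (2 powr s * (2 ^ ?n * 2 + ?V))"
      have \<eta>: "0 < \<eta>" using e by (simp add: \<eta>_def add_pos_pos)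
      obtain c where c: "c \<in> D" "dist (g x) c < \<eta> powr (1 / s)"
        using D(2)[of "ball (g x) (\<eta> powr (1 / s))"] \<eta> by auto
      have "norm (g x - c) powr s \<le> (\<eta> powr (1 / s)) powr s"
        using c s by (intro powr_mono2) (auto simp: dist_norm)
      then have le: "norm (g x - c) powr s \<le> \<eta>" using s \<eta> by (simp add: powr_powr)
      obtain d where d: "0 < d" "\<And>h. 0 < h \<Longrightarrow> h < d \<Longrightarrow> (\<integral>\<^sup>+y\<in>ball x h. ennreal (norm (g y - c) powr s) \<partial>lborel)
          \<le> ennreal (2 ^ ?n * (norm (g x - c) powr s + \<eta>) * h ^ ?n)"
        using bspec[OF elim c(1), THEN spec, THEN mp, OF \<eta>] by blast
      have "(\<integral>\<^sup>+y\<in>ball x h. ennreal (norm (g y - g x) powr s) \<partial>lborel) \<le> ennreal (e * h ^ ?n)"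
        if h: "0 < h" "h < d" for h
      proof -
        have "(\<integral>\<^sup>+y\<in>ball x h. ennreal (norm (g y - g x) powr s) \<partial>lborel)
          \<le> (\<integral>\<^sup>+y. ennreal (2 powr s) * (ennreal (norm (g y - c) powr s) * indicator (ball x h) y + ennreal \<eta> * indicator (ball x h) y) \<partial>lborel)"
        proof (intro nn_integral_mono)
          fix y
          have "norm (g y - g x) powr s \<le> 2 powr s * (norm (g y - c) powr s + norm (g x - c) powr s)"
            using powr_norm_add_le[of s "g y - c" "c - g x"] s by (simp add: norm_minus_commute)
          also have "\<dots> \<le> 2 powr s * (norm (g y - c) powr s + \<eta>)"
            using le by (intro mult_left_mono) auto
          finally show "ennreal (norm (g y - g x) powr s) * indicator (ball x h) y
            \<le> ennreal (2 powr s) * (ennreal (norm (g y - c) powr s) * indicator (ball x h) y + ennreal \<eta> * indicator (ball x h) y)"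
            using \<eta> by (cases "y \<in> ball x h") (auto simp flip: ennreal_plus ennreal_mult intro!: ennreal_leI)
        qed
        also have "\<dots> = ennreal (2 powr s) * ((\<integral>\<^sup>+y\<in>ball x h. ennreal (norm (g y - c) powr s) \<partial>lborel) + ennreal \<eta> * ennreal (?V * h ^ ?n))"
          using h by (simp add: nn_integral_cmult nn_integral_add emeasure_lborel_ball)
        also have "\<dots> \<le> ennreal (2 powr s) * (ennreal (2 ^ ?n * (\<eta> + \<eta>) * h ^ ?n) + ennreal \<eta> * ennreal (?V * h ^ ?n))"
          using h le by (intro mult_left_mono add_right_mono order_trans[OF d(2)[OF h]] ennreal_leI mult_right_mono) auto
        also have "\<dots> = ennreal (2 powr s * (2 ^ ?n * (\<eta> + \<eta>) * h ^ ?n + \<eta> * (?V * h ^ ?n)))"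
          using h \<eta> by (simp flip: ennreal_plus ennreal_mult)
        also have "2 powr s * (2 ^ ?n * (\<eta> + \<eta>) * h ^ ?n + \<eta> * (?V * h ^ ?n)) = (\<eta> * (2 powr s * (2 ^ ?n * 2 + ?V))) * h ^ ?n"
          by (simp add: algebra_simps)
        also have "\<eta> * (2 powr s * (2 ^ ?n * 2 + ?V)) = e"
        proof -
          have "0 < 2 ^ ?n * 2 + ?V" by (intro add_pos_pos) auto
          then show ?thesis by (simp add: \<eta>_def)
        qed
        finally show ?thesis .
      qed
      then show "\<exists>d>0. \<forall>h. 0 < h \<and> h < d \<longrightarrow>
        (\<integral>\<^sup>+y\<in>ball x h. ennreal (norm (g y - g x) powr s) \<partial>lborel) \<le> ennreal (e * h ^ ?n)"
        using d(1) by blast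
    qed
  qed
qed

section \<open>Growth of local averages\<close>

text \<open>Fubini: for given \<open>y\<close> the admissible \<open>z\<close> lie in
  \<open>ball x t\<close> and in \<open>ball y d\<close>, hence in the smaller of the two, and there
  are none unless \<open>y\<close> is within \<open>t + d\<close> of \<open>x\<close>.\<close>

lemma nn_integral_ball_ball_le:
  fixes F :: "'a::euclidean_space \<Rightarrow> ennreal"
  assumes [measurable]: "F \<in> borel_measurable borel" and t: "0 < t" and d: "0 < d"
  shows "(\<integral>\<^sup>+z\<in>ball x t. (\<integral>\<^sup>+y\<in>ball z d. F y \<partial>lborel) \<partial>lborel)
    \<le> ennreal (vol TYPE('a) * (min t d) ^ DIM('a)) * (\<integral>\<^sup>+y\<in>ball x (t + d). F y \<partial>lborel)"
proof -
  have "(\<integral>\<^sup>+z\<in>ball x t. (\<integral>\<^sup>+y\<in>ball z d. F y \<partial>lborel) \<partial>lborel)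
      = (\<integral>\<^sup>+z. (\<integral>\<^sup>+y. F y * indicator {(z, y). dist x z < t \<and> dist z y < d} (z, y) \<partial>lborel) \<partial>lborel)"
    by (subst nn_integral_multc[symmetric], measurable) (auto intro!: nn_integral_cong simp: indicator_def)
  also have "\<dots> = (\<integral>\<^sup>+y. (\<integral>\<^sup>+z. F y * indicator {(z, y). dist x z < t \<and> dist z y < d} (z, y) \<partial>lborel) \<partial>lborel)"
    by (intro nn_integral_lborel_swap) measurable
  also have "\<dots> \<le> (\<integral>\<^sup>+y. ennreal (vol TYPE('a) * (min t d) ^ DIM('a)) * (F y * indicator (ball x (t + d)) y) \<partial>lborel)"
  proof (intro nn_integral_mono)
    fix y :: 'a
    show "(\<integral>\<^sup>+z. F y * indicator {(z, y). dist x z < t \<and> dist z y < d} (z, y) \<partial>lborel)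
      \<le> ennreal (vol TYPE('a) * (min t d) ^ DIM('a)) * (F y * indicator (ball x (t + d)) y)"
    proof (cases "y \<in> ball x (t + d)")
      case True
      define c where "c = (if t \<le> d then x else y)"
      have "(\<integral>\<^sup>+z. F y * indicator {(z, y). dist x z < t \<and> dist z y < d} (z, y) \<partial>lborel)
          \<le> (\<integral>\<^sup>+z. F y * indicator (ball c (min t d)) z \<partial>lborel)"
        by (intro nn_integral_mono) (auto simp: indicator_def c_def dist_commute)
      also have "\<dots> = F y * ennreal (vol TYPE('a) * (min t d) ^ DIM('a))"
        using t d by (subst nn_integral_cmult_indicator) (auto simp: emeasure_lborel_ball)
      finally show ?thesis using True by (simp add: mult.commute)
    next
      case False
      have "\<not> (dist x z < t \<and> dist z y < d)" for z
        using False dist_triangle[of x y z] by auto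
      then have "(indicator {(z, y). dist x z < t \<and> dist z y < d} (z, y) :: ennreal) = 0" for z
        by simp
      then show ?thesis by (simp only: mult_zero_right nn_integral_const) simp
    qed
  qed
  also have "\<dots> = ennreal (vol TYPE('a) * (min t d) ^ DIM('a)) * (\<integral>\<^sup>+y\<in>ball x (t + d). F y \<partial>lborel)"
    by (intro nn_integral_cmult) measurable
  finally show ?thesis .
qed

text \<open>Local averages at scale \<open>d\<close> do not increase the growth bound \<open>N powr s * t ^ n\<close>
  by more than a constant, since \<open>min t d * (t + d) \<le> 2 * t * d\<close>.\<close>
lemma ball_average_growth:
  fixes \<Gamma> :: "'a::euclidean_space \<Rightarrow> ennreal"
  assumes [measurable]: "\<Gamma> \<in> borel_measurable borel" and s: "1 \<le> s"
    and R: "0 < R" and d: "0 < d" "d < R" and t: "0 < t" "t \<le> 1" and N: "0 \<le> N"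
    and bd: "\<And>t. 0 < t \<Longrightarrow> t < 2 * R \<Longrightarrow> (\<integral>\<^sup>+y\<in>ball x t. enn_powr (\<Gamma> y) s \<partial>lborel) \<le> ennreal (N powr s * t ^ DIM('a))"
  shows "(\<integral>\<^sup>+z\<in>ball 0 t. enn_powr (ennreal (1 / d ^ DIM('a)) * (\<integral>\<^sup>+y\<in>ball (x + R *\<^sub>R z) d. \<Gamma> y \<partial>lborel)) s \<partial>lborel)
    \<le> ennreal (vol TYPE('a) powr s * 2 ^ DIM('a) * N powr s * t ^ DIM('a))"
proof -
  let ?n = "DIM('a)" and ?V = "vol TYPE('a)"
  let ?A = "\<lambda>z. \<integral>\<^sup>+y\<in>ball z d. enn_powr (\<Gamma> y) s \<partial>lborel"
  have A_meas [measurable]: "?A \<in> borel_measurable borel"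
  proof -
    have "(\<lambda>z. \<integral>\<^sup>+y. enn_powr (\<Gamma> y) s * indicator {(z, y). dist z y < d} (z, y) \<partial>lborel) \<in> borel_measurable borel"
      by measurable
    then show ?thesis by (simp add: indicator_def)
  qed
  have "enn_powr (ennreal (1 / d ^ ?n) * (\<integral>\<^sup>+y\<in>ball z d. \<Gamma> y \<partial>lborel)) s \<le> ennreal (?V powr (s - 1) / d ^ ?n) * ?A z" for z
  proof -
    have "enn_powr (ennreal (1 / d ^ ?n) * (\<integral>\<^sup>+y\<in>ball z d. \<Gamma> y \<partial>lborel)) s
        = ennreal ((1 / d ^ ?n) powr s) * enn_powr (\<integral>\<^sup>+y\<in>ball z d. \<Gamma> y \<partial>lborel) s"
      using d by (simp add: enn_powr_mult enn_powr_ennreal)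
    also have "\<dots> \<le> ennreal ((1 / d ^ ?n) powr s) * (ennreal ((?V * d ^ ?n) powr (s - 1)) * ?A z)"
      using d s by (intro mult_left_mono nn_integral_power_le) (auto simp: emeasure_lborel_ball)
    also have "\<dots> = ennreal ((1 / d ^ ?n) powr s * (?V * d ^ ?n) powr (s - 1)) * ?A z"
      by (simp add: ennreal_mult mult.assoc)
    also have "(1 / d ^ ?n) powr s * (?V * d ^ ?n) powr (s - 1) = ?V powr (s - 1) / d ^ ?n"
      using d by (simp add: powr_mult powr_divide powr_diff)
    finally show ?thesis .
  qed
  then have "(\<integral>\<^sup>+z\<in>ball 0 t. enn_powr (ennreal (1 / d ^ ?n) * (\<integral>\<^sup>+y\<in>ball (x + R *\<^sub>R z) d. \<Gamma> y \<partial>lborel)) s \<partial>lborel)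
      \<le> (\<integral>\<^sup>+z\<in>ball 0 t. (ennreal (?V powr (s - 1) / d ^ ?n) * ?A (x + R *\<^sub>R z)) \<partial>lborel)"
    by (intro nn_integral_mono mult_right_mono) auto
  also have "\<dots> = ennreal (?V powr (s - 1) / d ^ ?n) * (\<integral>\<^sup>+z\<in>ball 0 t. ?A (x + R *\<^sub>R z) \<partial>lborel)"
    by (subst nn_integral_cmult[symmetric]) (auto simp: mult.assoc)
  also have "\<dots> \<le> ennreal (?V powr (s - 1) / d ^ ?n) * ennreal (?V * (2 ^ ?n * d ^ ?n * N powr s * t ^ ?n))"
  proof (intro mult_left_mono)
    have "ennreal (R ^ ?n) * (\<integral>\<^sup>+z\<in>ball 0 t. ?A (x + R *\<^sub>R z) \<partial>lborel) = (\<integral>\<^sup>+z\<in>ball x (R * t). ?A z \<partial>lborel)"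
      using R by (intro nn_integral_ball_scale) auto
    also have "\<dots> \<le> ennreal (?V * (min (R * t) d) ^ ?n) * (\<integral>\<^sup>+y\<in>ball x (R * t + d). enn_powr (\<Gamma> y) s \<partial>lborel)"
      using R t d by (intro nn_integral_ball_ball_le) auto
    also have "\<dots> \<le> ennreal (?V * (min (R * t) d) ^ ?n) * ennreal (N powr s * (R * t + d) ^ ?n)"
    proof (intro mult_left_mono bd)
      \<comment> \<open>The enlarged radius \<open>R * t + d\<close> may exceed \<open>R\<close>;
        this is why the growth bound is assumed up to \<open>2 * R\<close>.\<close>
      have "R * t \<le> R" using R t by (simp add: mult_left_le)
      then show "R * t + d < 2 * R" using d by linarith
    qed (use R t d in \<open>auto intro: add_pos_pos\<close>)
    also have "\<dots> = ennreal (?V * N powr s * (min (R * t) d * (R * t + d)) ^ ?n)"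
      using R t d by (simp add: power_mult_distrib mult_ac flip: ennreal_mult)
    also have "\<dots> \<le> ennreal (?V * N powr s * (2 * (R * t) * d) ^ ?n)"
    proof (intro ennreal_leI mult_left_mono power_mono)
      show "min (R * t) d * (R * t + d) \<le> 2 * (R * t) * d"
      proof (cases "R * t \<le> d")
        case True
        then have "R * t * (R * t + d) \<le> R * t * (d + d)" using R t by (intro mult_left_mono) auto
        then show ?thesis using True by (simp add: algebra_simps)
      next
        case False
        then have "d * (R * t + d) \<le> d * (R * t + R * t)" using d by (intro mult_left_mono) auto
        then show ?thesis using False by (simp add: algebra_simps)
      qed
    qed (use R t d in auto)
    also have "?V * N powr s * (2 * (R * t) * d) ^ ?n = R ^ ?n * (?V * (2 ^ ?n * d ^ ?n * N powr s * t ^ ?n))"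
      by (simp add: power_mult_distrib mult_ac)
    finally have scaled: "ennreal (R ^ ?n) * (\<integral>\<^sup>+z\<in>ball 0 t. ?A (x + R *\<^sub>R z) \<partial>lborel)
        \<le> ennreal (R ^ ?n * (?V * (2 ^ ?n * d ^ ?n * N powr s * t ^ ?n)))" .
    show "(\<integral>\<^sup>+z\<in>ball 0 t. ?A (x + R *\<^sub>R z) \<partial>lborel) \<le> ennreal (?V * (2 ^ ?n * d ^ ?n * N powr s * t ^ ?n))"
      by (rule ennreal_scaled_le_cancel[OF scaled]) (use R d t in auto)
  qed simp
  also have "\<dots> = ennreal (?V powr (s - 1) / d ^ ?n * (?V * (2 ^ ?n * d ^ ?n * N powr s * t ^ ?n)))"
    using d t by (intro ennreal_mult[symmetric]) auto
  also have "?V powr (s - 1) / d ^ ?n * (?V * (2 ^ ?n * d ^ ?n * N powr s * t ^ ?n)) = ?V powr s * 2 ^ ?n * N powr s * t ^ ?n"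
    using d by (simp add: powr_diff)
  finally show ?thesis .
qed


section \<open>The Sobolev estimate at almost every point\<close>

lemma AE_lborel_affine:
  fixes x :: "'a::euclidean_space"
  assumes "AE y in lborel. P y" "0 < c"
  shows "AE k in lborel. P (x + c *\<^sub>R k)"
proof -
  obtain N where N: "N \<in> null_sets lborel" "\<And>y. y \<notin> N \<Longrightarrow> P y"
    by (rule AE_E3[OF assms(1)]) simp
  then have [measurable]: "N \<in> sets borel" by auto
  have "0 = (\<integral>\<^sup>+y. indicator N y \<partial>lborel)" using N(1) by (simp add: null_setsD1)
  also have "\<dots> = ennreal (c ^ DIM('a)) * (\<integral>\<^sup>+k. indicator N (x + c *\<^sub>R k) \<partial>lborel)"
    using assms(2) by (intro nn_integral_lborel_affine) auto
  finally have eq: "0 = ennreal (c ^ DIM('a)) * (\<integral>\<^sup>+k. indicator N (x + c *\<^sub>R k) \<partial>lborel)" .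
  have "ennreal (c ^ DIM('a)) \<noteq> 0"
    using zero_less_power[OF assms(2), of "DIM('a)"] by (simp only: ennreal_eq_0_iff not_le)
  then have "(\<integral>\<^sup>+k. indicator N (x + c *\<^sub>R k) \<partial>lborel) = 0"
    using eq by (metis mult_eq_0_iff)
  then have "AE k in lborel. indicator N (x + c *\<^sub>R k) = (0::ennreal)"
    by (subst (asm) nn_integral_0_iff_AE) auto
  then show ?thesis
  proof eventually_elim
    case (elim k)
    then have "x + c *\<^sub>R k \<notin> N" by (simp add: indicator_def split: if_splits)
    then show ?case using N(2) by blast
  qed
qed

lemma locally_integrable_nn_integral_finite:
  fixes f :: "'a::euclidean_space \<Rightarrow> 'b::{banach, second_countable_topology}"
  assumes "locally_integrable f"
  shows "(\<integral>\<^sup>+x\<in>ball 0 r. ennreal (norm (f x)) \<partial>lborel) < \<infinity>"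
proof -
  have "set_integrable lebesgue (cball 0 r) f"
    using assms by (auto simp: locally_integrable_def)
  then have "(\<integral>\<^sup>+x. ennreal (norm (indicat_real (cball 0 r) x *\<^sub>R f x)) \<partial>lebesgue) < \<infinity>"
    unfolding set_integrable_def integrable_iff_bounded by simp
  then have "(\<integral>\<^sup>+x. ennreal (norm (indicat_real (cball 0 r) x *\<^sub>R f x)) \<partial>lborel) < \<infinity>"
    by (simp add: nn_integral_completion)
  moreover have "(\<integral>\<^sup>+x\<in>ball 0 r. ennreal (norm (f x)) \<partial>lborel)
      \<le> (\<integral>\<^sup>+x. ennreal (norm (indicat_real (cball 0 r) x *\<^sub>R f x)) \<partial>lborel)"
    by (intro nn_integral_mono) (auto simp: indicator_def)
  ultimately show ?thesis by (rule le_less_trans[rotated])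
qed

text \<open>The definition of the weak gradient tested with the dilated and translated bump; the
  chain-rule factor \<open>1 / \<epsilon>\<close> is moved to the other side.\<close>

lemma weak_gradient_mollifier:
  fixes f :: "'a::euclidean_space \<Rightarrow> real" and \<Phi> :: "'a \<Rightarrow> real"
  assumes wg: "weak_gradient f g" and [measurable]: "f \<in> borel_measurable borel" "g \<in> borel_measurable borel"
    and c: "continuous_on UNIV \<Phi>" "\<And>i. continuous_on UNIV (D\<Phi> i)"
    and der: "\<And>z. (\<Phi> has_derivative (\<lambda>v. \<Sum>i\<in>Basis. (v \<bullet> i) * D\<Phi> i z)) (at z)"
    and test: "test_function (\<lambda>y. \<Phi> ((1 / \<epsilon>) *\<^sub>R (y - x)))" and \<epsilon>: "0 < \<epsilon>" and i: "i \<in> Basis"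
  shows "(\<integral>y. f y * D\<Phi> i ((1 / \<epsilon>) *\<^sub>R (y - x)) \<partial>lborel)
        = - \<epsilon> * (\<integral>y. (g y \<bullet> i) * \<Phi> ((1 / \<epsilon>) *\<^sub>R (y - x)) \<partial>lborel)"
proof -
  have [measurable]: "\<Phi> \<in> borel_measurable borel" "\<And>i. D\<Phi> i \<in> borel_measurable borel"
    using c by (auto intro: borel_measurable_continuous_onI)
  have pd: "pdiff i (\<lambda>y. \<Phi> ((1 / \<epsilon>) *\<^sub>R (y - x))) y = (1 / \<epsilon>) * D\<Phi> i ((1 / \<epsilon>) *\<^sub>R (y - x))" for y
  proof -
    have a: "((\<lambda>y. (1 / \<epsilon>) *\<^sub>R (y - x)) has_derivative (\<lambda>v. (1 / \<epsilon>) *\<^sub>R v)) (at y)"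
      by (auto intro!: derivative_eq_intros)
    have "((\<lambda>y. \<Phi> ((1 / \<epsilon>) *\<^sub>R (y - x))) has_derivative
        (\<lambda>v. \<Sum>j\<in>Basis. (((1 / \<epsilon>) *\<^sub>R v) \<bullet> j) * D\<Phi> j ((1 / \<epsilon>) *\<^sub>R (y - x)))) (at y)"
      using has_derivative_compose[OF a der] by simp
    then have "pdiff i (\<lambda>y. \<Phi> ((1 / \<epsilon>) *\<^sub>R (y - x))) y
        = (\<Sum>j\<in>Basis. (((1 / \<epsilon>) *\<^sub>R i) \<bullet> j) * D\<Phi> j ((1 / \<epsilon>) *\<^sub>R (y - x)))"
      unfolding pdiff_def by (simp add: frechet_derivative_at[symmetric])
    also have "\<dots> = (\<Sum>j\<in>Basis. if j = i then (1 / \<epsilon>) * D\<Phi> i ((1 / \<epsilon>) *\<^sub>R (y - x)) else 0)"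
      using i by (intro sum.cong) (auto simp: inner_Basis)
    finally show ?thesis using i by simp
  qed
  have "(\<integral>y. f y * pdiff i (\<lambda>y. \<Phi> ((1 / \<epsilon>) *\<^sub>R (y - x))) y \<partial>lebesgue)
      = - (\<integral>y. (g y \<bullet> i) * \<Phi> ((1 / \<epsilon>) *\<^sub>R (y - x)) \<partial>lebesgue)"
    using wg test i unfolding weak_gradient_def by blast
  then have "(\<integral>y. (1 / \<epsilon>) * (f y * D\<Phi> i ((1 / \<epsilon>) *\<^sub>R (y - x))) \<partial>lborel)
      = - (\<integral>y. (g y \<bullet> i) * \<Phi> ((1 / \<epsilon>) *\<^sub>R (y - x)) \<partial>lborel)"
    unfolding pd by (subst (asm) (1 2) integral_completion) (auto simp: mult_ac)
  then have "\<epsilon> * ((1 / \<epsilon>) * (\<integral>y. f y * D\<Phi> i ((1 / \<epsilon>) *\<^sub>R (y - x)) \<partial>lborel))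
      = \<epsilon> * - (\<integral>y. (g y \<bullet> i) * \<Phi> ((1 / \<epsilon>) *\<^sub>R (y - x)) \<partial>lborel)"
    by (simp only: integral_mult_right_zero)
  then show ?thesis using \<epsilon> by simp
qed

text \<open>The unit-ball inequality is applied to the mollified function, rescaled to radius
  \<open>R\<close> and with the linear part \<open>w\<close> removed; \<open>A\<close> is then an
  average of \<open>norm (g y - w)\<close> at a scale proportional to \<open>\<epsilon>\<close>. As
  local averages keep the growth bound, the constant does not depend on \<open>\<epsilon>\<close>,
  and Fatou's lemma removes the mollification. The exceptional points are those where the
  mollifications fail to converge, hence the quantifiers over \<open>w\<close>, \<open>R\<close> and
  \<open>N\<close> may stand inside the almost-everywhere statement.\<close>

lemma sobolev_pointwise:
  assumes s: "1 \<le> s" and sp: "s \<le> p" and snp: "real DIM('a::euclidean_space) * (1 / s - 1 / p) < 1"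
  shows "\<exists>C\<ge>0. \<forall>(f :: 'a \<Rightarrow> real) g. f \<in> borel_measurable borel \<longrightarrow> g \<in> borel_measurable borel \<longrightarrow> weak_gradient f g \<longrightarrow>
    (AE x in lborel. \<forall>w R N. 0 < R \<longrightarrow> 0 \<le> N \<longrightarrow>
      (\<forall>t. 0 < t \<and> t < 2 * R \<longrightarrow> (\<integral>\<^sup>+y\<in>ball x t. ennreal (norm (g y - w) powr s) \<partial>lborel) \<le> ennreal (N powr s * t ^ DIM('a))) \<longrightarrow>
      (\<integral>\<^sup>+k\<in>ball 0 1. ennreal (\<bar>f (x + R *\<^sub>R k) - f x - R * (w \<bullet> k)\<bar> powr p) \<partial>lborel) \<le> ennreal (C * R powr p * N powr p))"
proof -
  let ?n = "DIM('a)" and ?V = "vol TYPE('a)"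
  obtain C0 where C0: "C0 \<ge> 0" "\<And>(u :: 'a \<Rightarrow> real) A N. u \<in> borel_measurable borel \<Longrightarrow> A \<in> borel_measurable borel \<Longrightarrow> 0 \<le> N \<Longrightarrow>
     (\<And>z h. ennreal \<bar>u (z + h) - u z\<bar> \<le> ennreal (norm h) * (\<integral>\<^sup>+t\<in>{0<..<1}. A (z + t *\<^sub>R h) \<partial>lborel)) \<Longrightarrow>
     (\<And>t. 0 < t \<Longrightarrow> t \<le> 1 \<Longrightarrow> (\<integral>\<^sup>+x\<in>ball 0 t. enn_powr (A x) s \<partial>lborel) \<le> ennreal (N powr s * t ^ ?n)) \<Longrightarrow>
     (\<integral>\<^sup>+h\<in>ball 0 1. ennreal (\<bar>u h - u 0\<bar> powr p) \<partial>lborel) \<le> ennreal (C0 * N powr p)"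
    using unit_ball_sobolev_poincare[OF s sp snp] by blast
  obtain \<Phi> :: "'a \<Rightarrow> real" and D\<Phi> where \<Phi>:
    "continuous_on UNIV \<Phi>" "\<And>i. continuous_on UNIV (D\<Phi> i)" "\<And>z. 0 \<le> \<Phi> z"
    "\<And>z. z \<notin> cbox 0 One \<Longrightarrow> \<Phi> z = 0" "\<And>i z. i \<in> Basis \<Longrightarrow> z \<notin> cbox 0 One \<Longrightarrow> D\<Phi> i z = 0"
    "\<And>z. (\<Phi> has_derivative (\<lambda>v. \<Sum>i\<in>Basis. (v \<bullet> i) * D\<Phi> i z)) (at z)"
    "\<And>z. z \<in> box 0 One \<Longrightarrow> 0 < \<Phi> z"
    "\<And>x \<epsilon>. 0 < \<epsilon> \<Longrightarrow> test_function (\<lambda>y. \<Phi> ((1 / \<epsilon>) *\<^sub>R (y - x)))"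
    using mollifier_exists by blast
  have [measurable]: "\<Phi> \<in> borel_measurable borel"
    using \<Phi>(1) by (rule borel_measurable_continuous_onI)
  obtain B where B: "0 \<le> B" "\<And>z. \<bar>\<Phi> z\<bar> \<le> B"
    using bounded_of_continuous_unit_cbox[OF \<Phi>(1,4)] by blast
  \<comment> \<open>Points of the unit cube have norm at most the dimension; the factor 2 places the
    support of the scaled kernel inside an open ball.\<close>
  define n2 where "n2 = 2 * real ?n"
  have n2: "0 < n2" by (simp add: n2_def)
  have supp: "\<Phi> ((1 / \<epsilon>) *\<^sub>R (y - x)) \<le> B * indicator (ball x (n2 * \<epsilon>)) y" if "0 < \<epsilon>" for \<epsilon> x y
  proof (cases "(1 / \<epsilon>) *\<^sub>R (y - x) \<in> cbox 0 One")
    case True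
    then have "norm ((1 / \<epsilon>) *\<^sub>R (y - x)) \<le> real ?n" by (rule norm_le_DIM_of_unit_cbox)
    then have "norm (y - x) \<le> real ?n * \<epsilon>"
      using \<open>0 < \<epsilon>\<close> unfolding norm_scaleR by (simp add: pos_divide_le_eq)
    also have "\<dots> < n2 * \<epsilon>" using \<open>0 < \<epsilon>\<close> by (simp add: n2_def)
    finally show ?thesis using B(2)[of "(1 / \<epsilon>) *\<^sub>R (y - x)"] by (simp add: dist_norm norm_minus_commute)
  next
    case False
    then show ?thesis using \<Phi>(4) B(1) by (simp add: indicator_def)
  qed
  have supp0: "\<Phi> ((1 / \<epsilon>) *\<^sub>R (y - x)) = 0" if "0 < \<epsilon>" "y \<notin> ball x (n2 * \<epsilon>)" for \<epsilon> x y
    using supp[OF that(1), of y x] that(2) \<Phi>(3)[of "(1 / \<epsilon>) *\<^sub>R (y - x)"] by simp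
  define m1 where "m1 = (\<integral>y. \<Phi> y \<partial>lborel)"
  have \<Phi>int: "integrable lborel \<Phi>"
  proof -
    have "integrable lborel (\<lambda>x. \<Phi> x *\<^sub>R (1::real))"
    proof (rule integrable_bounded_support_scaleR[where B=B and r="real ?n + 1"])
      show "(\<integral>\<^sup>+x\<in>ball 0 r. ennreal (norm (1::real)) \<partial>(lborel :: 'a measure)) < \<infinity>" for r
        using emeasure_lborel_ball_finite[of "0::'a" r] by simp
      show "\<Phi> z = 0" if "z \<notin> ball 0 (real ?n + 1)" for z
        using that \<Phi>(4)[of z] norm_le_DIM_of_unit_cbox[of z] by fastforce
    qed (use B in auto)
    then show ?thesis by simp
  qed
  have m1: "0 < m1"
  proof -
    have "0 \<le> m1" unfolding m1_def by (intro Bochner_Integration.integral_nonneg \<Phi>(3))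
    moreover have "m1 \<noteq> 0"
    proof
      assume "m1 = 0"
      then have "AE z in lborel. \<Phi> z = 0"
        using \<Phi>(3) \<Phi>int unfolding m1_def by (subst (asm) integral_nonneg_eq_0_iff_AE) auto
      then have "AE z in lborel. z \<notin> box 0 (One::'a)"
        by eventually_elim (use \<Phi>(7) in fastforce)
      then have "emeasure lborel (box 0 (One::'a)) = 0"
        by (subst (asm) AE_iff_measurable[OF _ refl]) auto
      then show False by (simp add: emeasure_lborel_box)
    qed
    ultimately show ?thesis by simp
  qed
  \<comment> \<open>Collects the losses on the way to the growth bound
    \<open>(R * N * c0) powr s\<close> for \<open>A\<close>: height and mass of the kernel, the
    volume of its supporting ball, and the two constants of \<open>ball_average_growth\<close> after
    an \<open>s\<close>-th root.\<close>
  define c0 where "c0 = B * n2 ^ ?n / m1 * ?V * 2 powr (real ?n / s)"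
  have c0: "0 \<le> c0" using B m1 n2 by (simp add: c0_def)
  define C where "C = C0 * c0 powr p"
  have "0 \<le> C" using C0(1) by (simp add: C_def)
  moreover {
    fix f :: "'a \<Rightarrow> real" and g :: "'a \<Rightarrow> 'a"
    assume f [measurable]: "f \<in> borel_measurable borel" and g [measurable]: "g \<in> borel_measurable borel"
      and wg: "weak_gradient f g"
    have ff: "(\<integral>\<^sup>+x\<in>ball 0 r. ennreal (norm (f x)) \<partial>lborel) < \<infinity>"
      and fg: "(\<integral>\<^sup>+x\<in>ball 0 r. ennreal (norm (g x)) \<partial>lborel) < \<infinity>" for r
      using locally_integrable_nn_integral_finite[of f r] locally_integrable_nn_integral_finite[of g r] wg
      unfolding weak_gradient_def by blast+
    define J where "J \<epsilon> x = (\<integral>y. f y * \<Phi> ((1 / \<epsilon>) *\<^sub>R (y - x)) \<partial>lborel)" for \<epsilon> x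
    define fm where "fm \<epsilon> x = J \<epsilon> x / (\<epsilon> ^ ?n * m1)" for \<epsilon> x
    have J_meas [measurable]: "J \<epsilon> \<in> borel_measurable borel" for \<epsilon>
      unfolding J_def by measurable
    have fm_meas [measurable]: "fm \<epsilon> \<in> borel_measurable borel" for \<epsilon>
      unfolding fm_def by measurable
    have incr: "ennreal \<bar>J \<epsilon> (X + h) - J \<epsilon> X - \<epsilon> ^ ?n * m1 * (w \<bullet> h)\<bar>
        \<le> ennreal (norm h) * (\<integral>\<^sup>+t\<in>{0<..<1}. (\<integral>\<^sup>+y. ennreal (norm (g y - w) * \<Phi> ((1 / \<epsilon>) *\<^sub>R (y - (X + t *\<^sub>R h)))) \<partial>lborel) \<partial>lborel)"
      if "0 < \<epsilon>" for \<epsilon> X h w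
      unfolding J_def m1_def
    proof (rule mollified_increment[where D\<Phi>=D\<Phi>, OF f g ff fg \<Phi>(1-6) that])
      show "(\<integral>y. f y * D\<Phi> i ((1 / \<epsilon>) *\<^sub>R (y - x)) \<partial>lborel)
        = - \<epsilon> * (\<integral>y. (g y \<bullet> i) * \<Phi> ((1 / \<epsilon>) *\<^sub>R (y - x)) \<partial>lborel)" if "i \<in> Basis" for x i
        using \<Phi>(8) \<open>0 < \<epsilon>\<close> that
        by (intro weak_gradient_mollifier[where D\<Phi>=D\<Phi>, OF wg f g \<Phi>(1,2,6)]) auto
    qed
    have lp: "AE x in lborel. \<forall>e>0. \<exists>d>0. \<forall>h. 0 < h \<and> h < d \<longrightarrow>
        (\<integral>\<^sup>+y\<in>ball x h. ennreal (norm (f y - f x) powr 1) \<partial>lborel) \<le> ennreal (e * h ^ ?n)"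
      using ff by (intro lebesgue_point_Ls) auto
    \<comment> \<open>Convergence at the Lebesgue points of \<open>f\<close>, with exponent 1. Only
      the sequence \<open>1 / real (Suc j)\<close> of scales is needed.\<close>
    have conv: "AE x in lborel. (\<lambda>j. fm (1 / real (Suc j)) x) \<longlonglongrightarrow> f x"
      using lp
    proof eventually_elim
      case (elim x)
      have *: "\<bar>fm \<epsilon> x - f x\<bar> \<le> B * n2 ^ ?n / m1 * e"
        if \<epsilon>: "0 < \<epsilon>" and e: "0 < e" and bd: "(\<integral>\<^sup>+y\<in>ball x (n2 * \<epsilon>). ennreal (norm (f y - f x) powr 1) \<partial>lborel) \<le> ennreal (e * (n2 * \<epsilon>) ^ ?n)" for \<epsilon> e
      proof -
        have "integrable lborel (\<lambda>y. \<Phi> ((1 / \<epsilon>) *\<^sub>R (y - x)) *\<^sub>R f y)"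
        proof (rule integrable_bounded_support_scaleR[OF f _ ff, where B=B and r="norm x + n2 * \<epsilon>"])
          show "\<Phi> ((1 / \<epsilon>) *\<^sub>R (y - x)) = 0" if "y \<notin> ball 0 (norm x + n2 * \<epsilon>)" for y
          proof -
            have "y \<notin> ball x (n2 * \<epsilon>)"
              using that norm_triangle_ineq[of x "y - x"] by (auto simp: dist_norm norm_minus_commute)
            then show ?thesis by (rule supp0[OF \<epsilon>])
          qed
        qed (use B in auto)
        moreover have "integrable lborel (\<lambda>y. \<Phi> ((1 / \<epsilon>) *\<^sub>R (y - x)))"
        proof -
          have "integrable lborel (\<lambda>y. \<Phi> ((1 / \<epsilon>) *\<^sub>R (y - x)) *\<^sub>R (1::real))"
          proof (rule integrable_bounded_support_scaleR[where B=B and r="norm x + n2 * \<epsilon>"])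
            show "(\<integral>\<^sup>+x\<in>ball 0 r. ennreal (norm (1::real)) \<partial>(lborel :: 'a measure)) < \<infinity>" for r
              using emeasure_lborel_ball_finite[of "0::'a" r] by simp
            show "\<Phi> ((1 / \<epsilon>) *\<^sub>R (y - x)) = 0" if "y \<notin> ball 0 (norm x + n2 * \<epsilon>)" for y
            proof -
              have "y \<notin> ball x (n2 * \<epsilon>)"
                using that norm_triangle_ineq[of x "y - x"] by (auto simp: dist_norm norm_minus_commute)
              then show ?thesis using supp[OF \<epsilon>, of y x] \<Phi>(3)[of "(1 / \<epsilon>) *\<^sub>R (y - x)"] by simp
            qed
          qed (use B in auto)
          then show ?thesis by simp
        qed
        ultimately have "(\<integral>y. (f y - f x) * \<Phi> ((1 / \<epsilon>) *\<^sub>R (y - x)) \<partial>lborel)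
            = J \<epsilon> x - f x * (\<epsilon> ^ ?n * m1)"
          unfolding J_def m1_def using integral_lborel_rescale[of \<Phi> \<epsilon> x] \<epsilon>
          by (simp add: left_diff_distrib Bochner_Integration.integral_diff mult.commute)
        then have "ennreal \<bar>J \<epsilon> x - f x * (\<epsilon> ^ ?n * m1)\<bar> \<le> (\<integral>\<^sup>+y. ennreal (norm ((f y - f x) * \<Phi> ((1 / \<epsilon>) *\<^sub>R (y - x)))) \<partial>lborel)"
          using ennreal_norm_integral_le[of lborel "\<lambda>y. (f y - f x) * \<Phi> ((1 / \<epsilon>) *\<^sub>R (y - x))"] by simp
        also have "\<dots> \<le> (\<integral>\<^sup>+y. ennreal B * (ennreal (norm (f y - f x) powr 1) * indicator (ball x (n2 * \<epsilon>)) y) \<partial>lborel)"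
        proof (intro nn_integral_mono)
          fix y
          have "\<bar>f y - f x\<bar> * \<Phi> ((1 / \<epsilon>) *\<^sub>R (y - x)) \<le> \<bar>f y - f x\<bar> * (B * indicator (ball x (n2 * \<epsilon>)) y)"
            by (intro mult_left_mono supp \<epsilon>) auto
          then show "ennreal (norm ((f y - f x) * \<Phi> ((1 / \<epsilon>) *\<^sub>R (y - x))))
              \<le> ennreal B * (ennreal (norm (f y - f x) powr 1) * indicator (ball x (n2 * \<epsilon>)) y)"
            using \<Phi>(3) B(1) supp0[OF \<epsilon>, of y x] by (cases "y \<in> ball x (n2 * \<epsilon>)")
              (auto simp: abs_mult mult_ac simp flip: ennreal_mult intro!: ennreal_leI)
        qed
        also have "\<dots> = ennreal B * (\<integral>\<^sup>+y\<in>ball x (n2 * \<epsilon>). ennreal (norm (f y - f x) powr 1) \<partial>lborel)"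
          by (intro nn_integral_cmult) measurable
        also have "\<dots> \<le> ennreal B * ennreal (e * (n2 * \<epsilon>) ^ ?n)"
          by (intro mult_left_mono bd) auto
        also have "\<dots> = ennreal (B * (e * (n2 * \<epsilon>) ^ ?n))"
          using B e n2 \<epsilon> by (simp flip: ennreal_mult)
        finally have "\<bar>J \<epsilon> x - f x * (\<epsilon> ^ ?n * m1)\<bar> \<le> B * (e * (n2 * \<epsilon>) ^ ?n)"
          using B e n2 \<epsilon> by (subst (asm) ennreal_le_iff) auto
        then have "\<bar>J \<epsilon> x - f x * (\<epsilon> ^ ?n * m1)\<bar> / (\<epsilon> ^ ?n * m1) \<le> B * (e * (n2 * \<epsilon>) ^ ?n) / (\<epsilon> ^ ?n * m1)"
          using \<epsilon> m1 by (intro divide_right_mono) auto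
        moreover have "\<bar>J \<epsilon> x - f x * (\<epsilon> ^ ?n * m1)\<bar> / (\<epsilon> ^ ?n * m1) = \<bar>fm \<epsilon> x - f x\<bar>"
          using \<epsilon> m1 by (simp add: fm_def divide_simps flip: abs_divide)
            (simp add: abs_mult abs_divide)
        moreover have "B * (e * (n2 * \<epsilon>) ^ ?n) / (\<epsilon> ^ ?n * m1) = B * n2 ^ ?n / m1 * e"
          using \<epsilon> by (simp add: power_mult_distrib)
        ultimately show ?thesis by simp
      qed
      show ?case
      proof (rule LIMSEQ_I)
        fix e :: real assume e: "0 < e"
        define q where "q = B * n2 ^ ?n / m1"
        \<comment> \<open>The summand 1 covers \<open>q = 0\<close>, and the factor 2 makes the
          final inequality strict.\<close>
        define e' where "e' = e / (2 * (q + 1))"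
        have q: "0 \<le> q" using B n2 m1 by (simp add: q_def)
        have e': "0 < e'" "B * n2 ^ ?n / m1 * e' < e"
        proof -
          show "0 < e'" using q e by (simp add: e'_def)
          have "q * e' \<le> (q + 1) * e'"
            using \<open>0 < e'\<close> by (intro mult_right_mono) auto
          also have "\<dots> = e / 2" using q by (simp add: e'_def field_simps)
          finally show "B * n2 ^ ?n / m1 * e' < e" using e unfolding q_def by linarith
        qed
        obtain d where d: "d > 0" "\<And>h. 0 < h \<Longrightarrow> h < d \<Longrightarrow>
            (\<integral>\<^sup>+y\<in>ball x h. ennreal (norm (f y - f x) powr 1) \<partial>lborel) \<le> ennreal (e' * h ^ ?n)"
          using elim[THEN spec, THEN mp, OF e'(1)] by blast
        obtain j0 where j0: "1 / real (Suc j0) < d / n2"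
          using nat_approx_posE[of "d / n2"] d(1) n2 by (auto simp: inverse_eq_divide)
        have "norm (fm (1 / real (Suc j)) x - f x) < e" if "j0 \<le> j" for j
        proof -
          have "1 / real (Suc j) \<le> 1 / real (Suc j0)" using that by (simp add: field_simps)
          then have "1 / real (Suc j) < d / n2" using j0 by linarith
          then have "n2 * (1 / real (Suc j)) < d"
            using n2 by (simp add: pos_less_divide_eq mult.commute)
          then show ?thesis
            using *[of "1 / real (Suc j)" e'] d(2)[of "n2 * (1 / real (Suc j))"] e' n2 by auto
        qed
        then show "\<exists>no. \<forall>n\<ge>no. norm (fm (1 / real (Suc n)) x - f x) < e" by blast
      qed
    qed
    have "AE x in lborel. \<forall>w R N. 0 < R \<longrightarrow> 0 \<le> N \<longrightarrow>
      (\<forall>t. 0 < t \<and> t < 2 * R \<longrightarrow> (\<integral>\<^sup>+y\<in>ball x t. ennreal (norm (g y - w) powr s) \<partial>lborel) \<le> ennreal (N powr s * t ^ ?n)) \<longrightarrow>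
      (\<integral>\<^sup>+k\<in>ball 0 1. ennreal (\<bar>f (x + R *\<^sub>R k) - f x - R * (w \<bullet> k)\<bar> powr p) \<partial>lborel) \<le> ennreal (C * R powr p * N powr p)"
      using conv
    proof eventually_elim
      case (elim x)
      show ?case
      proof (intro allI impI)
        fix w R N
        assume R: "0 < (R::real)" and N: "0 \<le> (N::real)"
          and bd: "\<forall>t. 0 < t \<and> t < 2 * R \<longrightarrow> (\<integral>\<^sup>+y\<in>ball x t. ennreal (norm (g y - w) powr s) \<partial>lborel) \<le> ennreal (N powr s * t ^ ?n)"
        define \<Gamma> where "\<Gamma> y = ennreal (norm (g y - w))" for y
        have \<Gamma> [measurable]: "\<Gamma> \<in> borel_measurable borel" unfolding \<Gamma>_def by measurable
        have bd': "(\<integral>\<^sup>+y\<in>ball x t. enn_powr (\<Gamma> y) s \<partial>lborel) \<le> ennreal (N powr s * t ^ ?n)" if "0 < t" "t < 2 * R" for t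
          using bd that by (simp add: \<Gamma>_def enn_powr_ennreal)
        define u where "u \<epsilon> k = fm \<epsilon> (x + R *\<^sub>R k) - R * (w \<bullet> k)" for \<epsilon> k
        have u_meas [measurable]: "u \<epsilon> \<in> borel_measurable borel" for \<epsilon> unfolding u_def by measurable
        have main: "(\<integral>\<^sup>+k\<in>ball 0 1. ennreal (\<bar>u \<epsilon> k - u \<epsilon> 0\<bar> powr p) \<partial>lborel) \<le> ennreal (C * R powr p * N powr p)"
          if \<epsilon>: "0 < \<epsilon>" "n2 * \<epsilon> < R" for \<epsilon>
        proof -
          define \<delta> where "\<delta> = n2 * \<epsilon>"
          have \<delta>: "0 < \<delta>" "\<delta> < R" using \<epsilon> n2 by (auto simp: \<delta>_def)
          define c where "c = R * (B * n2 ^ ?n / m1)"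
          have c: "0 \<le> c" using R B n2 m1 by (simp add: c_def)
          \<comment> \<open>An average of \<open>norm (g y - w)\<close> over radius
            \<open>\<delta>\<close>, in the rescaled variable. \<open>c\<close> turns the kernel
            bound \<open>B\<close>, its mass and the stretching by \<open>R\<close> into one
            factor.\<close>
          define A where "A z = ennreal c * (ennreal (1 / \<delta> ^ ?n) * (\<integral>\<^sup>+y\<in>ball (x + R *\<^sub>R z) \<delta>. \<Gamma> y \<partial>lborel))" for z
          have A_meas [measurable]: "A \<in> borel_measurable borel"
          proof -
            have "(\<lambda>z. \<integral>\<^sup>+y. \<Gamma> y * indicator {(z, y). dist (x + R *\<^sub>R z) y < \<delta>} (z, y) \<partial>lborel) \<in> borel_measurable borel"
              by measurable
            then have "(\<lambda>z. \<integral>\<^sup>+y\<in>ball (x + R *\<^sub>R z) \<delta>. \<Gamma> y \<partial>lborel) \<in> borel_measurable borel"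
              by (simp add: indicator_def)
            then show ?thesis unfolding A_def by measurable
          qed
          have "(\<integral>\<^sup>+k\<in>ball 0 1. ennreal (\<bar>u \<epsilon> k - u \<epsilon> 0\<bar> powr p) \<partial>lborel) \<le> ennreal (C0 * (R * N * c0) powr p)"
          proof (rule C0(2))
            fix z h :: 'a
            let ?X = "x + R *\<^sub>R z"
            have "u \<epsilon> (z + h) - u \<epsilon> z = (1 / (\<epsilon> ^ ?n * m1)) * (J \<epsilon> (?X + R *\<^sub>R h) - J \<epsilon> ?X - \<epsilon> ^ ?n * m1 * (w \<bullet> (R *\<^sub>R h)))"
              using \<epsilon> m1 by (simp add: u_def fm_def field_simps inner_simps scaleR_right_distrib add.assoc)
            then have "ennreal \<bar>u \<epsilon> (z + h) - u \<epsilon> z\<bar> = ennreal (1 / (\<epsilon> ^ ?n * m1)) * ennreal \<bar>J \<epsilon> (?X + R *\<^sub>R h) - J \<epsilon> ?X - \<epsilon> ^ ?n * m1 * (w \<bullet> (R *\<^sub>R h))\<bar>"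
              using \<epsilon> m1 by (simp add: abs_mult flip: ennreal_mult)
            also have "\<dots> \<le> ennreal (1 / (\<epsilon> ^ ?n * m1)) * (ennreal (norm (R *\<^sub>R h)) *
                (\<integral>\<^sup>+t\<in>{0<..<1}. (\<integral>\<^sup>+y. ennreal (norm (g y - w) * \<Phi> ((1 / \<epsilon>) *\<^sub>R (y - (?X + t *\<^sub>R (R *\<^sub>R h))))) \<partial>lborel) \<partial>lborel))"
              by (intro mult_left_mono incr \<epsilon>) auto
            also have "\<dots> \<le> ennreal (1 / (\<epsilon> ^ ?n * m1)) * (ennreal (norm (R *\<^sub>R h)) *
                (\<integral>\<^sup>+t. ennreal B * ((\<integral>\<^sup>+y\<in>ball (x + R *\<^sub>R (z + t *\<^sub>R h)) \<delta>. \<Gamma> y \<partial>lborel) * indicator {0<..<1} t) \<partial>lborel))"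
            proof (intro mult_left_mono nn_integral_mono)
              fix t :: real
              let ?Y = "?X + t *\<^sub>R (R *\<^sub>R h)"
              have Y: "?Y = x + R *\<^sub>R (z + t *\<^sub>R h)" by (simp add: algebra_simps)
              have "(\<integral>\<^sup>+y. ennreal (norm (g y - w) * \<Phi> ((1 / \<epsilon>) *\<^sub>R (y - ?Y))) \<partial>lborel)
                  \<le> (\<integral>\<^sup>+y. ennreal B * (\<Gamma> y * indicator (ball ?Y \<delta>) y) \<partial>lborel)"
              proof (intro nn_integral_mono)
                fix y
                have "norm (g y - w) * \<Phi> ((1 / \<epsilon>) *\<^sub>R (y - ?Y)) \<le> norm (g y - w) * (B * indicator (ball ?Y \<delta>) y)"
                  unfolding \<delta>_def by (intro mult_left_mono supp \<epsilon>) auto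
                then show "ennreal (norm (g y - w) * \<Phi> ((1 / \<epsilon>) *\<^sub>R (y - ?Y))) \<le> ennreal B * (\<Gamma> y * indicator (ball ?Y \<delta>) y)"
                  using B(1) supp0[OF \<epsilon>(1), of y ?Y] unfolding \<Gamma>_def \<delta>_def[symmetric] by (cases "y \<in> ball ?Y \<delta>")
                    (auto simp: mult_ac simp flip: ennreal_mult intro!: ennreal_leI simp del: mem_ball)
              qed
              also have "\<dots> = ennreal B * (\<integral>\<^sup>+y\<in>ball ?Y \<delta>. \<Gamma> y \<partial>lborel)"
                by (intro nn_integral_cmult) measurable
              finally show "(\<integral>\<^sup>+y. ennreal (norm (g y - w) * \<Phi> ((1 / \<epsilon>) *\<^sub>R (y - ?Y))) \<partial>lborel) * indicator {0<..<1} t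
                  \<le> ennreal B * ((\<integral>\<^sup>+y\<in>ball (x + R *\<^sub>R (z + t *\<^sub>R h)) \<delta>. \<Gamma> y \<partial>lborel) * indicator {0<..<1} t)"
                unfolding Y by (cases "t \<in> {0<..<1}") auto
            qed auto
            also have "\<dots> = ennreal (1 / (\<epsilon> ^ ?n * m1)) * (ennreal (norm (R *\<^sub>R h)) * (ennreal B *
                (\<integral>\<^sup>+t. ((\<integral>\<^sup>+y\<in>ball (x + R *\<^sub>R (z + t *\<^sub>R h)) \<delta>. \<Gamma> y \<partial>lborel) * indicator {0<..<1} t) \<partial>lborel)))"
            proof -
              have "(\<lambda>t. \<integral>\<^sup>+y. \<Gamma> y * indicator {(t, y). dist (x + R *\<^sub>R (z + t *\<^sub>R h)) y < \<delta>} (t, y) \<partial>lborel) \<in> borel_measurable borel"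
                by measurable
              then have "(\<lambda>t. (\<integral>\<^sup>+y\<in>ball (x + R *\<^sub>R (z + t *\<^sub>R h)) \<delta>. \<Gamma> y \<partial>lborel) * indicator {0<..<1} t) \<in> borel_measurable borel"
                by (intro borel_measurable_times_ennreal) (simp_all add: indicator_def)
              then show ?thesis by (subst nn_integral_cmult) auto
            qed
            also have "\<dots> = ennreal (norm h) * (ennreal (c * (1 / \<delta> ^ ?n)) *
                (\<integral>\<^sup>+t. ((\<integral>\<^sup>+y\<in>ball (x + R *\<^sub>R (z + t *\<^sub>R h)) \<delta>. \<Gamma> y \<partial>lborel) * indicator {0<..<1} t) \<partial>lborel))"
            proof -
              have "1 / (\<epsilon> ^ ?n * m1) * (norm (R *\<^sub>R h) * B) = norm h * (c * (1 / \<delta> ^ ?n))"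
                using n2 R by (simp add: c_def \<delta>_def power_mult_distrib mult_ac)
              then have "ennreal (1 / (\<epsilon> ^ ?n * m1)) * (ennreal (norm (R *\<^sub>R h)) * ennreal B) = ennreal (norm h) * ennreal (c * (1 / \<delta> ^ ?n))"
                using \<epsilon> m1 B c \<delta> by (simp flip: ennreal_mult)
              from arg_cong[OF this, of "\<lambda>q. q * (\<integral>\<^sup>+t. ((\<integral>\<^sup>+y\<in>ball (x + R *\<^sub>R (z + t *\<^sub>R h)) \<delta>. \<Gamma> y \<partial>lborel) * indicator {0<..<1} t) \<partial>lborel)"]
              show ?thesis by (simp only: mult.assoc)
            qed
            also have "\<dots> = ennreal (norm h) * (\<integral>\<^sup>+t\<in>{0<..<1}. A (z + t *\<^sub>R h) \<partial>lborel)"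
            proof -
              have "(\<lambda>t. \<integral>\<^sup>+y. \<Gamma> y * indicator {(t, y). dist (x + R *\<^sub>R (z + t *\<^sub>R h)) y < \<delta>} (t, y) \<partial>lborel) \<in> borel_measurable borel"
                by measurable
              then have "(\<lambda>t. (\<integral>\<^sup>+y\<in>ball (x + R *\<^sub>R (z + t *\<^sub>R h)) \<delta>. \<Gamma> y \<partial>lborel) * indicator {0<..<1} t) \<in> borel_measurable borel"
                by (intro borel_measurable_times_ennreal) (simp_all add: indicator_def)
              then have "ennreal (c * (1 / \<delta> ^ ?n)) * (\<integral>\<^sup>+t. ((\<integral>\<^sup>+y\<in>ball (x + R *\<^sub>R (z + t *\<^sub>R h)) \<delta>. \<Gamma> y \<partial>lborel) * indicator {0<..<1} t) \<partial>lborel)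
                  = (\<integral>\<^sup>+t. ennreal (c * (1 / \<delta> ^ ?n)) * ((\<integral>\<^sup>+y\<in>ball (x + R *\<^sub>R (z + t *\<^sub>R h)) \<delta>. \<Gamma> y \<partial>lborel) * indicator {0<..<1} t) \<partial>lborel)"
                by (intro nn_integral_cmult[symmetric]) auto
              also have "\<dots> = (\<integral>\<^sup>+t\<in>{0<..<1}. A (z + t *\<^sub>R h) \<partial>lborel)"
                using c \<delta> ennreal_mult[of c "1 / \<delta> ^ ?n"] by (intro nn_integral_cong) (simp add: A_def mult.assoc)
              finally show ?thesis by simp
            qed
            finally show "ennreal \<bar>u \<epsilon> (z + h) - u \<epsilon> z\<bar> \<le> ennreal (norm h) * (\<integral>\<^sup>+t\<in>{0<..<1}. A (z + t *\<^sub>R h) \<partial>lborel)" .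
          next
            fix t :: real assume t: "0 < t" "t \<le> 1"
            have "(\<integral>\<^sup>+z\<in>ball 0 t. enn_powr (A z) s \<partial>lborel) = (\<integral>\<^sup>+z. ennreal (c powr s) *
                (enn_powr (ennreal (1 / \<delta> ^ ?n) * (\<integral>\<^sup>+y\<in>ball (x + R *\<^sub>R z) \<delta>. \<Gamma> y \<partial>lborel)) s * indicator (ball 0 t) z) \<partial>lborel)"
              using c by (intro nn_integral_cong) (simp add: A_def enn_powr_mult enn_powr_ennreal mult.assoc)
            also have "\<dots> = ennreal (c powr s) * (\<integral>\<^sup>+z\<in>ball 0 t.
                enn_powr (ennreal (1 / \<delta> ^ ?n) * (\<integral>\<^sup>+y\<in>ball (x + R *\<^sub>R z) \<delta>. \<Gamma> y \<partial>lborel)) s \<partial>lborel)"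
            proof -
              have "(\<lambda>z. \<integral>\<^sup>+y. \<Gamma> y * indicator {(z, y). dist (x + R *\<^sub>R z) y < \<delta>} (z, y) \<partial>lborel) \<in> borel_measurable borel"
                by measurable
              then have [measurable]: "(\<lambda>z. \<integral>\<^sup>+y\<in>ball (x + R *\<^sub>R z) \<delta>. \<Gamma> y \<partial>lborel) \<in> borel_measurable borel"
                by (simp add: indicator_def)
              show ?thesis by (intro nn_integral_cmult) measurable
            qed
            also have "\<dots> \<le> ennreal (c powr s) * ennreal (?V powr s * 2 ^ ?n * N powr s * t ^ ?n)"
              using s R \<delta> t N bd' by (intro mult_left_mono ball_average_growth) auto
            also have "\<dots> = ennreal (c powr s * (?V powr s * 2 ^ ?n * N powr s * t ^ ?n))"
              using t by (simp flip: ennreal_mult)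
            also have "c powr s * (?V powr s * 2 ^ ?n * N powr s * t ^ ?n) = (R * N * c0) powr s * t ^ ?n"
            proof -
              have "2 ^ ?n = (2 powr (real ?n / s)) powr s"
                using s by (simp add: powr_powr flip: powr_realpow)
              then show ?thesis
                using R B n2 m1 N by (simp add: c_def c0_def powr_mult powr_divide mult_ac)
            qed
            finally show "(\<integral>\<^sup>+z\<in>ball 0 t. enn_powr (A z) s \<partial>lborel) \<le> ennreal ((R * N * c0) powr s * t ^ ?n)" .
          qed (use R N c0 in auto)
          also have "C0 * (R * N * c0) powr p = C * R powr p * N powr p"
            using R N c0 by (simp add: C_def powr_mult mult_ac)
          finally show ?thesis .
        qed
        \<comment> \<open>Almost every \<open>k\<close> leads to a good point, since affine maps
          preserve null sets; \<open>x\<close> itself is good by assumption, so the value at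
          \<open>k = 0\<close> converges as well.\<close>
        have conv': "AE k in lborel. (\<lambda>j. fm (1 / real (Suc j)) (x + R *\<^sub>R k)) \<longlonglongrightarrow> f (x + R *\<^sub>R k)"
          using AE_lborel_affine[OF conv R] by simp
        have "(\<integral>\<^sup>+k\<in>ball 0 1. ennreal (\<bar>f (x + R *\<^sub>R k) - f x - R * (w \<bullet> k)\<bar> powr p) \<partial>lborel)
          \<le> (\<integral>\<^sup>+k. liminf (\<lambda>j. ennreal (\<bar>u (1 / real (Suc j)) k - u (1 / real (Suc j)) 0\<bar> powr p) * indicator (ball 0 1) k) \<partial>lborel)"
        proof (rule nn_integral_mono_AE)
          show "AE k in lborel. ennreal (\<bar>f (x + R *\<^sub>R k) - f x - R * (w \<bullet> k)\<bar> powr p) * indicator (ball 0 1) k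
            \<le> liminf (\<lambda>j. ennreal (\<bar>u (1 / real (Suc j)) k - u (1 / real (Suc j)) 0\<bar> powr p) * indicator (ball 0 1) k)"
            using conv'
          proof eventually_elim
            fix k :: 'a
            assume k: "(\<lambda>j. fm (1 / real (Suc j)) (x + R *\<^sub>R k)) \<longlonglongrightarrow> f (x + R *\<^sub>R k)"
            have "(\<lambda>j. u (1 / real (Suc j)) k - u (1 / real (Suc j)) 0) \<longlonglongrightarrow> (f (x + R *\<^sub>R k) - R * (w \<bullet> k)) - f x"
              unfolding u_def using k elim by (auto intro!: tendsto_diff)
            then have "(\<lambda>j. \<bar>u (1 / real (Suc j)) k - u (1 / real (Suc j)) 0\<bar> powr p) \<longlonglongrightarrow> \<bar>(f (x + R *\<^sub>R k) - R * (w \<bullet> k)) - f x\<bar> powr p"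
              using s sp by (intro tendsto_powr' tendsto_rabs tendsto_const) auto
            then have "(\<lambda>j. ennreal (\<bar>u (1 / real (Suc j)) k - u (1 / real (Suc j)) 0\<bar> powr p) * indicator (ball 0 1) k)
                \<longlonglongrightarrow> ennreal (\<bar>(f (x + R *\<^sub>R k) - R * (w \<bullet> k)) - f x\<bar> powr p) * indicator (ball 0 1) k"
              by (cases "k \<in> ball 0 1") (auto intro!: tendsto_ennrealI)
            from lim_imp_Liminf[OF sequentially_bot this]
            show "ennreal (\<bar>f (x + R *\<^sub>R k) - f x - R * (w \<bullet> k)\<bar> powr p) * indicator (ball 0 1) k
              \<le> liminf (\<lambda>j. ennreal (\<bar>u (1 / real (Suc j)) k - u (1 / real (Suc j)) 0\<bar> powr p) * indicator (ball 0 1) k)"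
              by (simp add: algebra_simps)
          qed
        qed
        \<comment> \<open>Fatou's lemma; the bound \<open>main\<close> is available once
          \<open>n2 * \<epsilon>\<close> has dropped below \<open>R\<close>.\<close>
        also have "\<dots> \<le> liminf (\<lambda>j. \<integral>\<^sup>+k\<in>ball 0 1. ennreal (\<bar>u (1 / real (Suc j)) k - u (1 / real (Suc j)) 0\<bar> powr p) \<partial>lborel)"
          by (intro nn_integral_liminf) measurable
        also have "\<dots> \<le> liminf (\<lambda>j. ennreal (C * R powr p * N powr p))"
        proof (rule Liminf_mono)
          obtain j0 where j0: "1 / real (Suc j0) < R / n2"
            using nat_approx_posE[of "R / n2"] R n2 by (auto simp: inverse_eq_divide)
          show "\<forall>\<^sub>F j in sequentially. (\<integral>\<^sup>+k\<in>ball 0 1. ennreal (\<bar>u (1 / real (Suc j)) k - u (1 / real (Suc j)) 0\<bar> powr p) \<partial>lborel)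
              \<le> ennreal (C * R powr p * N powr p)"
            using eventually_ge_at_top[of j0]
          proof eventually_elim
            case (elim j)
            then have "1 / real (Suc j) \<le> 1 / real (Suc j0)" by (simp add: field_simps)
            then have "1 / real (Suc j) < R / n2" using j0 by linarith
            then have "n2 * (1 / real (Suc j)) < R"
              using n2 by (simp add: pos_less_divide_eq mult.commute)
            then show ?case by (intro main) auto
          qed
        qed
        also have "\<dots> = ennreal (C * R powr p * N powr p)"
          by (simp add: Liminf_const)
        finally show "(\<integral>\<^sup>+k\<in>ball 0 1. ennreal (\<bar>f (x + R *\<^sub>R k) - f x - R * (w \<bullet> k)\<bar> powr p) \<partial>lborel) \<le> ennreal (C * R powr p * N powr p)" .
      qed
    qed
  }
  ultimately show ?thesis by blast
qed

section \<open>Polar coordinates and rotations\<close>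

text \<open>Polar coordinates with respect to the cone measure: insert
  \<open>1 = (\<integral>\<rho>. n |k|^n \<rho>^(-n-1))\<close> over \<open>\<rho> > |k|\<close> and substitute \<open>k = \<rho> x\<close>.\<close>
lemma nn_integral_polar:
  fixes \<Psi> :: "'a::euclidean_space \<Rightarrow> ennreal"
  assumes [measurable]: "\<Psi> \<in> borel_measurable borel"
  shows "(\<integral>\<^sup>+k. \<Psi> k \<partial>lborel) = (\<integral>\<^sup>+x\<in>ball 0 1 - {0}.
    (ennreal (real DIM('a)) * (\<integral>\<^sup>+\<rho>\<in>{0<..}. \<Psi> (\<rho> *\<^sub>R (x /\<^sub>R norm x)) * ennreal (\<rho> ^ (DIM('a) - 1)) \<partial>lborel)) \<partial>lborel)"
proof -
  let ?n = "DIM('a)"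
  let ?K = "\<lambda>k \<rho>. \<Psi> k * ennreal (real ?n * norm k ^ ?n * \<rho> powr (- real ?n - 1)) * indicator {(k, \<rho>). k \<noteq> 0 \<and> norm k < \<rho>} (k, \<rho>)"
  have n: "0 < ?n" by simp
  have K_meas: "(\<lambda>(k, \<rho>). ?K k \<rho>) \<in> borel_measurable (borel \<Otimes>\<^sub>M borel)" by measurable
  have "(\<integral>\<^sup>+k. \<Psi> k \<partial>lborel) = (\<integral>\<^sup>+k. (\<integral>\<^sup>+\<rho>. ?K k \<rho> \<partial>lborel) \<partial>lborel)"
  proof (rule nn_integral_cong_AE)
    have "AE k in lborel. k \<noteq> (0::'a)" by (rule AE_lborel_singleton)
    then show "AE k in lborel. \<Psi> k = (\<integral>\<^sup>+\<rho>. ?K k \<rho> \<partial>lborel)"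
    proof eventually_elim
      case (elim k)
      have "(\<integral>\<^sup>+\<rho>. ?K k \<rho> \<partial>lborel) = (\<integral>\<^sup>+\<rho>. (\<Psi> k * ennreal (real ?n * norm k ^ ?n)) * (ennreal (\<rho> powr (- real ?n - 1)) * indicator {norm k<..} \<rho>) \<partial>lborel)"
        using elim by (intro nn_integral_cong) (auto simp: indicator_def mult.assoc simp flip: ennreal_mult)
      also have "\<dots> = (\<Psi> k * ennreal (real ?n * norm k ^ ?n)) * (\<integral>\<^sup>+\<rho>\<in>{norm k<..}. ennreal (\<rho> powr (- real ?n - 1)) \<partial>lborel)"
        by (intro nn_integral_cmult) measurable
      also have "(\<integral>\<^sup>+\<rho>\<in>{norm k<..}. ennreal (\<rho> powr (- real ?n - 1)) \<partial>lborel) = ennreal (norm k powr (- real ?n) / real ?n)"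
        using elim n by (subst nn_integral_powr_top) auto
      also have "(\<Psi> k * ennreal (real ?n * norm k ^ ?n)) * ennreal (norm k powr (- real ?n) / real ?n)
          = \<Psi> k * ennreal ((real ?n * norm k ^ ?n) * (norm k powr (- real ?n) / real ?n))"
        by (simp add: mult.assoc flip: ennreal_mult)
      also have "(real ?n * norm k ^ ?n) * (norm k powr (- real ?n) / real ?n) = 1"
        using elim n by (simp add: powr_minus powr_realpow)
      finally show ?case by simp
    qed
  qed
  also have "\<dots> = (\<integral>\<^sup>+\<rho>. (\<integral>\<^sup>+k. ?K k \<rho> \<partial>lborel) \<partial>lborel)"
    by (rule nn_integral_lborel_swap[OF K_meas])
  also have "\<dots> = (\<integral>\<^sup>+\<rho>. (\<integral>\<^sup>+x. (\<Psi> (\<rho> *\<^sub>R x) * ennreal (real ?n * norm x ^ ?n) * ennreal (\<rho> ^ (?n - 1))) * indicator {0<..} \<rho> * indicator (ball 0 1 - {0}) x \<partial>lborel) \<partial>lborel)"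
  proof (rule nn_integral_cong)
    fix \<rho> :: real
    show "(\<integral>\<^sup>+k. ?K k \<rho> \<partial>lborel) = (\<integral>\<^sup>+x. (\<Psi> (\<rho> *\<^sub>R x) * ennreal (real ?n * norm x ^ ?n) * ennreal (\<rho> ^ (?n - 1))) * indicator {0<..} \<rho> * indicator (ball 0 1 - {0}) x \<partial>lborel)"
    proof (cases "0 < \<rho>")
      case True
      have Km: "(\<lambda>k. ?K k \<rho>) \<in> borel_measurable borel"
        by (rule measurable_compose[OF measurable_Pair2'[of \<rho> borel borel] K_meas, unfolded split_conv]) simp
      have Km': "(\<lambda>x. ?K (0 + \<rho> *\<^sub>R x) \<rho>) \<in> borel_measurable lborel"
        by (rule measurable_compose[of "\<lambda>x. 0 + \<rho> *\<^sub>R x", OF _ Km]) simp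
      have "(\<integral>\<^sup>+k. ?K k \<rho> \<partial>lborel) = ennreal (\<rho> ^ ?n) * (\<integral>\<^sup>+x. ?K (0 + \<rho> *\<^sub>R x) \<rho> \<partial>lborel)"
        by (rule nn_integral_lborel_affine[OF Km True, of 0])
      also have "\<dots> = (\<integral>\<^sup>+x. ennreal (\<rho> ^ ?n) * ?K (0 + \<rho> *\<^sub>R x) \<rho> \<partial>lborel)"
        by (rule nn_integral_cmult[OF Km', symmetric])
      also have "\<dots> = (\<integral>\<^sup>+x. (\<Psi> (\<rho> *\<^sub>R x) * ennreal (real ?n * norm x ^ ?n) * ennreal (\<rho> ^ (?n - 1))) * indicator {0<..} \<rho> * indicator (ball 0 1 - {0}) x \<partial>lborel)"
      proof (intro nn_integral_cong)
        fix x :: 'a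
        have "\<rho> ^ ?n * (real ?n * norm (\<rho> *\<^sub>R x) ^ ?n * \<rho> powr (- real ?n - 1)) = (real ?n * norm x ^ ?n) * (\<rho> ^ ?n * \<rho> ^ ?n * \<rho> powr (- real ?n - 1))"
          using True by (simp add: power_mult_distrib mult_ac)
        also have "\<rho> ^ ?n * \<rho> ^ ?n * \<rho> powr (- real ?n - 1) = \<rho> powr (real ?n + real ?n + (- real ?n - 1))"
          using True by (simp add: powr_realpow[symmetric] powr_add[symmetric])
        also have "\<dots> = \<rho> powr real (?n - 1)"
          using n by (simp add: of_nat_diff)
        also have "\<dots> = \<rho> ^ (?n - 1)" using True by (rule powr_realpow)
        finally have eq: "\<rho> ^ ?n * (real ?n * norm (\<rho> *\<^sub>R x) ^ ?n * \<rho> powr (- real ?n - 1)) = (real ?n * norm x ^ ?n) * \<rho> ^ (?n - 1)" .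
        then have "ennreal (\<rho> ^ ?n) * ennreal (real ?n * norm (\<rho> *\<^sub>R x) ^ ?n * \<rho> powr (- real ?n - 1)) = ennreal (real ?n * norm x ^ ?n) * ennreal (\<rho> ^ (?n - 1))"
          using True by (simp flip: ennreal_mult)
        moreover have "indicator {(k, \<rho>). k \<noteq> 0 \<and> norm k < \<rho>} (0 + \<rho> *\<^sub>R x, \<rho>) = (indicator {0<..} \<rho> * indicator (ball 0 1 - {0}) x :: ennreal)"
          using True by (auto simp: indicator_def)
        ultimately show "ennreal (\<rho> ^ ?n) * ?K (0 + \<rho> *\<^sub>R x) \<rho> = (\<Psi> (\<rho> *\<^sub>R x) * ennreal (real ?n * norm x ^ ?n) * ennreal (\<rho> ^ (?n - 1))) * indicator {0<..} \<rho> * indicator (ball 0 1 - {0}) x"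
        proof -
          assume A: "ennreal (\<rho> ^ ?n) * ennreal (real ?n * norm (\<rho> *\<^sub>R x) ^ ?n * \<rho> powr (- real ?n - 1)) = ennreal (real ?n * norm x ^ ?n) * ennreal (\<rho> ^ (?n - 1))"
            and I: "indicator {(k, \<rho>). k \<noteq> 0 \<and> norm k < \<rho>} (0 + \<rho> *\<^sub>R x, \<rho>) = (indicator {0<..} \<rho> * indicator (ball 0 1 - {0}) x :: ennreal)"
          have G: "a * (P * b * i) = P * (a * b) * i" for P a b i :: ennreal by (simp only: mult_ac)
          show ?thesis unfolding I unfolding add_0 G A by (simp only: mult_ac)
        qed
      qed
      finally show ?thesis .
    next
      case False
      then have "indicator {(k::'a, \<rho>). k \<noteq> 0 \<and> norm k < \<rho>} (k, \<rho>) = (0::ennreal)" for k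
        using norm_ge_zero[of k] by (auto simp: indicator_def simp del: norm_ge_zero)
      then show ?thesis using False by (simp only: mult_zero_right) simp
    qed
  qed
  also have "\<dots> = (\<integral>\<^sup>+x. (\<integral>\<^sup>+\<rho>. (\<Psi> (\<rho> *\<^sub>R x) * ennreal (real ?n * norm x ^ ?n) * ennreal (\<rho> ^ (?n - 1))) * indicator {0<..} \<rho> * indicator (ball 0 1 - {0}) x \<partial>lborel) \<partial>lborel)"
    by (intro nn_integral_lborel_swap) measurable
  also have "\<dots> = (\<integral>\<^sup>+x\<in>ball 0 1 - {0}. (ennreal (real ?n) * (\<integral>\<^sup>+\<rho>\<in>{0<..}. \<Psi> (\<rho> *\<^sub>R (x /\<^sub>R norm x)) * ennreal (\<rho> ^ (?n - 1)) \<partial>lborel)) \<partial>lborel)"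
  proof (intro nn_integral_cong)
    fix x :: 'a
    show "(\<integral>\<^sup>+\<rho>. (\<Psi> (\<rho> *\<^sub>R x) * ennreal (real ?n * norm x ^ ?n) * ennreal (\<rho> ^ (?n - 1))) * indicator {0<..} \<rho> * indicator (ball 0 1 - {0}) x \<partial>lborel)
      = (ennreal (real ?n) * (\<integral>\<^sup>+\<rho>\<in>{0<..}. \<Psi> (\<rho> *\<^sub>R (x /\<^sub>R norm x)) * ennreal (\<rho> ^ (?n - 1)) \<partial>lborel)) * indicator (ball 0 1 - {0}) x"
    proof (cases "x \<in> ball 0 1 - {0}")
      case True
      then have x: "0 < norm x" by simp
      \<comment> \<open>A second substitution, now in the radius: it replaces \<open>x\<close> by
        its direction and cancels \<open>norm x ^ n\<close> against the Jacobian and the power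
        \<open>n - 1\<close> of the radius.\<close>
      let ?c = "1 / norm x"
      have Hm: "(\<lambda>\<rho>. (\<Psi> (\<rho> *\<^sub>R x) * ennreal (real ?n * norm x ^ ?n) * ennreal (\<rho> ^ (?n - 1))) * indicator {0<..} \<rho>) \<in> borel_measurable borel" by measurable
      have c: "0 < ?c" using x by simp
      have "(\<integral>\<^sup>+\<rho>. (\<Psi> (\<rho> *\<^sub>R x) * ennreal (real ?n * norm x ^ ?n) * ennreal (\<rho> ^ (?n - 1))) * indicator {0<..} \<rho> \<partial>lborel)
        = ennreal (?c ^ DIM(real)) * (\<integral>\<^sup>+\<sigma>. (\<Psi> ((0 + ?c *\<^sub>R \<sigma>) *\<^sub>R x) * ennreal (real ?n * norm x ^ ?n) * ennreal ((0 + ?c *\<^sub>R \<sigma>) ^ (?n - 1))) * indicator {0<..} (0 + ?c *\<^sub>R \<sigma>) \<partial>lborel)"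
        by (rule nn_integral_lborel_affine[OF Hm c, of 0])
      also have "\<dots> = (\<integral>\<^sup>+\<sigma>. ennreal (?c ^ DIM(real)) * ((\<Psi> ((0 + ?c *\<^sub>R \<sigma>) *\<^sub>R x) * ennreal (real ?n * norm x ^ ?n) * ennreal ((0 + ?c *\<^sub>R \<sigma>) ^ (?n - 1))) * indicator {0<..} (0 + ?c *\<^sub>R \<sigma>)) \<partial>lborel)"
        by (intro nn_integral_cmult[symmetric]) measurable
      also have "\<dots> = (\<integral>\<^sup>+\<sigma>. ennreal (real ?n) * (\<Psi> (\<sigma> *\<^sub>R (x /\<^sub>R norm x)) * ennreal (\<sigma> ^ (?n - 1)) * indicator {0<..} \<sigma>) \<partial>lborel)"
      proof (intro nn_integral_cong)
        fix \<sigma> :: real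
        show "ennreal (?c ^ DIM(real)) * ((\<Psi> ((0 + ?c *\<^sub>R \<sigma>) *\<^sub>R x) * ennreal (real ?n * norm x ^ ?n) * ennreal ((0 + ?c *\<^sub>R \<sigma>) ^ (?n - 1))) * indicator {0<..} (0 + ?c *\<^sub>R \<sigma>))
          = ennreal (real ?n) * (\<Psi> (\<sigma> *\<^sub>R (x /\<^sub>R norm x)) * ennreal (\<sigma> ^ (?n - 1)) * indicator {0<..} \<sigma>)"
        proof (cases "0 < \<sigma>")
          case True
          obtain m where m: "?n = Suc m" using n by (cases ?n) auto
          have "?c * ((real ?n * norm x ^ ?n) * (?c * \<sigma>) ^ (?n - 1)) = real ?n * \<sigma> ^ (?n - 1)"
            using x unfolding m by (simp add: power_mult_distrib power_divide)
          then have "ennreal ?c * (ennreal (real ?n * norm x ^ ?n) * ennreal ((?c * \<sigma>) ^ (?n - 1))) = ennreal (real ?n) * ennreal (\<sigma> ^ (?n - 1))"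
            using x True by (simp flip: ennreal_mult)
          moreover have "(0 + ?c *\<^sub>R \<sigma>) *\<^sub>R x = \<sigma> *\<^sub>R (x /\<^sub>R norm x)"
            by (simp add: divide_inverse mult.commute)
          moreover have "indicator {0<..} (0 + ?c *\<^sub>R \<sigma>) = (1::ennreal)" "indicator {0<..} \<sigma> = (1::ennreal)"
            using x True by auto
          ultimately show ?thesis
          proof -
            assume A: "ennreal ?c * (ennreal (real ?n * norm x ^ ?n) * ennreal ((?c * \<sigma>) ^ (?n - 1))) = ennreal (real ?n) * ennreal (\<sigma> ^ (?n - 1))"
              and B: "(0 + ?c *\<^sub>R \<sigma>) *\<^sub>R x = \<sigma> *\<^sub>R (x /\<^sub>R norm x)"
              and I: "indicator {0<..} (0 + ?c *\<^sub>R \<sigma>) = (1::ennreal)" "indicator {0<..} \<sigma> = (1::ennreal)"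
            have G: "a * ((P * b * d) * i) = P * (a * (b * d)) * i" for P a b d i :: ennreal by (simp only: mult_ac)
            show ?thesis
              unfolding B I G unfolding add_0 real_scaleR_def DIM_real power_one_right A by (simp only: mult_ac)
          qed
        next
          case False
          then have "?c * \<sigma> \<le> 0" using x by (intro mult_nonneg_nonpos) auto
          then have "\<not> 0 < ?c * \<sigma>" by (simp only: not_less)
          then show ?thesis using False by simp
        qed
      qed
      also have "\<dots> = ennreal (real ?n) * (\<integral>\<^sup>+\<rho>\<in>{0<..}. \<Psi> (\<rho> *\<^sub>R (x /\<^sub>R norm x)) * ennreal (\<rho> ^ (?n - 1)) \<partial>lborel)"
        by (intro nn_integral_cmult) measurable
      finally show ?thesis using True by simp
    qed simp
  qed
  finally show ?thesis .
qed

section \<open>Measure-preserving reflections between unit vectors\<close>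

definition householder :: "'a::euclidean_space \<Rightarrow> 'a \<Rightarrow> 'a"
  where "householder u x = x - (2 * (x \<bullet> u)) *\<^sub>R u"

lemma householder_involution: "norm u = 1 \<Longrightarrow> householder u (householder u x) = x"
  by (simp add: householder_def inner_diff_left norm_eq_1 algebra_simps)

lemma householder_dist: "norm u = 1 \<Longrightarrow> dist (householder u x) (householder u y) = dist x y"
  unfolding dist_norm norm_eq_sqrt_inner householder_def
  by (simp add: inner_diff_left inner_diff_right norm_eq_1 inner_commute algebra_simps)

lemma continuous_on_householder: "continuous_on S (householder u)"
  unfolding householder_def[abs_def] by (intro continuous_intros)

lemma householder_measurable [measurable]: "householder u \<in> borel \<rightarrow>\<^sub>M borel"
  by (intro borel_measurable_continuous_onI continuous_on_householder)

text \<open>Vitali: up to a null set, \<open>U\<close> is a disjoint union of closed balls, and an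
  isometric involution takes these to disjoint balls of the same radii inside the preimage. The
  argument uses distances only and involves no determinant.\<close>

lemma emeasure_householder_ge:
  fixes u :: "'a::euclidean_space"
  assumes u: "norm u = 1" and U: "open U"
  shows "emeasure lborel U \<le> emeasure lborel (householder u -` U)"
proof -
  let ?K = "{(a, r). 0 < r \<and> cball a r \<subseteq> U}"
  have "\<exists>i. i \<in> ?K \<and> x \<in> cball (fst i) (snd i) \<and> snd i < d" if x: "x \<in> U" and d: "0 < d" for x d
  proof -
    obtain e where "0 < e" "cball x e \<subseteq> U" using open_contains_cball x U by blast
    then have "(x, min e (d / 2)) \<in> ?K" using d by (auto simp: subset_iff)
    then show ?thesis using d \<open>0 < e\<close> by (intro exI[of _ "(x, min e (d / 2))"]) auto
  qed
  note cov = this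
  obtain C where C: "countable C" "C \<subseteq> ?K"
    "pairwise (\<lambda>i j. disjnt (cball (fst i) (snd i)) (cball (fst j) (snd j))) C"
    "negligible (U - (\<Union>i\<in>C. cball (fst i) (snd i)))"
  proof (rule Vitali_covering_theorem_cballs[of ?K snd U fst])
    show "0 < snd i" if "i \<in> ?K" for i using that by auto
  qed (use cov in blast)+
  let ?B = "\<lambda>i. cball (fst i) (snd i) :: 'a set"
  have pre: "householder u -` cball a r = cball (householder u a) r" for a r
    using householder_dist[OF u] householder_involution[OF u] by (auto simp: mem_cball) metis+
  have eq: "emeasure lborel (householder u -` ?B i) = emeasure lborel (?B i)" if "i \<in> C" for i
    using that C(2) by (auto simp: pre emeasure_cball)
  have [measurable]: "(\<Union>i\<in>C. ?B i) \<in> sets borel"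
    using C(1) by (intro sets.countable_UN') auto
  have U_sets [measurable]: "U \<in> sets borel" using U by simp
  have "emeasure lborel U \<le> emeasure lborel (\<Union>i\<in>C. ?B i) + emeasure lborel (U - (\<Union>i\<in>C. ?B i))"
    by (rule order_trans[OF emeasure_mono emeasure_subadditive]) auto
  also have "emeasure lborel (U - (\<Union>i\<in>C. ?B i)) = 0"
  proof -
    have "emeasure lebesgue (U - (\<Union>i\<in>C. ?B i)) = 0"
      using C(4) negligible_iff_null_sets null_setsD1 by blast
    then show ?thesis by simp
  qed
  also have "emeasure lborel (\<Union>i\<in>C. ?B i) + 0 = (\<integral>\<^sup>+i. emeasure lborel (?B i) \<partial>count_space C)"
    using C(1,3) by (simp, intro emeasure_UN_countable) (auto simp: disjoint_family_on_def pairwise_def disjnt_def)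
  also have "\<dots> = (\<integral>\<^sup>+i. emeasure lborel (householder u -` ?B i) \<partial>count_space C)"
    using eq by (intro nn_integral_cong) auto
  also have "\<dots> = emeasure lborel (\<Union>i\<in>C. householder u -` ?B i)"
  proof (rule emeasure_UN_countable[symmetric])
    show "disjoint_family_on (\<lambda>i. householder u -` ?B i) C"
      unfolding disjoint_family_on_def
    proof (intro ballI impI)
      fix i j assume "i \<in> C" "j \<in> C" "i \<noteq> j"
      then have "?B i \<inter> ?B j = {}" using C(3) unfolding pairwise_def disjnt_def by blast
      then show "(householder u -` ?B i) \<inter> (householder u -` ?B j) = {}"
        by (simp flip: vimage_Int)
    qed
  qed (use C(1) in \<open>auto simp: pre\<close>)
  also have "\<dots> \<le> emeasure lborel (householder u -` U)"
  proof (rule emeasure_mono)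
    show "householder u -` U \<in> sets lborel"
      using measurable_sets_borel[OF householder_measurable U_sets, of u] by simp
    have "?B i \<subseteq> U" if "i \<in> C" for i using C(2) that by (cases i) auto
    then show "(\<Union>i\<in>C. householder u -` ?B i) \<subseteq> householder u -` U" by blast
  qed
  finally show ?thesis .
qed

text \<open>The preceding inequality for a box and for its preimage; the involution turns the two
  into an equality.\<close>

lemma lborel_householder:
  fixes u :: "'a::euclidean_space"
  assumes u: "norm u = 1"
  shows "distr lborel borel (householder u) = lborel"
proof (rule lborel_eqI[symmetric])
  fix l v :: 'a assume le: "\<And>b. b \<in> Basis \<Longrightarrow> l \<bullet> b \<le> v \<bullet> b"
  have op: "open (householder u -` box l v)"
    by (intro open_vimage open_box continuous_on_householder)
  have "householder u -` (householder u -` box l v) = box l v"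
    using householder_involution[OF u] by auto
  then have "emeasure lborel (householder u -` box l v) = emeasure lborel (box l v)"
    using emeasure_householder_ge[OF u op] emeasure_householder_ge[OF u open_box, of l v] by simp
  then show "emeasure (distr lborel borel (householder u)) (box l v) = (\<Prod>b\<in>Basis. (v - l) \<bullet> b)"
    using le by (simp add: emeasure_distr emeasure_lborel_box_eq inner_diff_left)
qed simp

text \<open>The reflection in the hyperplane orthogonal to \<open>a - b\<close> exchanges
  \<open>a\<close> and \<open>b\<close>. It allows an arbitrary direction to be replaced by the
  particular basis vector chosen in \<open>kappa\<close>.\<close>

lemma isometry_exists:
  fixes a b :: "'a::euclidean_space"
  assumes ab: "norm a = 1" "norm b = 1"
  obtains T :: "'a \<Rightarrow> 'a" where "\<And>x. norm (T x) = norm x" "\<And>x. b \<bullet> T x = a \<bullet> x"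
    "\<And>F :: 'a \<Rightarrow> ennreal. F \<in> borel_measurable borel \<Longrightarrow> (\<integral>\<^sup>+x. F (T x) \<partial>lborel) = (\<integral>\<^sup>+x. F x \<partial>lborel)"
proof (cases "a = b")
  case True
  then show ?thesis using that[of "\<lambda>x. x"] by simp
next
  case False
  define u where "u = (1 / norm (a - b)) *\<^sub>R (a - b)"
  have u: "norm u = 1" using False by (simp add: u_def)
  have hb: "householder u b = a"
  proof -
    have "(norm (a - b))\<^sup>2 = 2 - 2 * (a \<bullet> b)"
      using ab by (simp add: power2_norm_eq_inner inner_diff_left inner_diff_right norm_eq_1 inner_commute)
    moreover have "b \<bullet> (a - b) = a \<bullet> b - 1"
      using ab by (simp add: inner_diff_right norm_eq_1 inner_commute)
    ultimately have "2 * (b \<bullet> (a - b)) = - (norm (a - b))\<^sup>2" by simp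
    then have "(2 * (b \<bullet> u)) *\<^sub>R u = - (a - b)"
      using False by (simp add: u_def power2_eq_square)
    then show ?thesis by (simp add: householder_def)
  qed
  have h0: "householder u 0 = 0" by (simp add: householder_def)
  show ?thesis
  proof (rule that[of "householder u"])
    show "norm (householder u x) = norm x" for x
      using householder_dist[OF u, of x 0] by (simp add: h0)
    show "b \<bullet> householder u x = a \<bullet> x" for x
      using hb by (simp add: householder_def inner_diff_right inner_diff_left inner_commute mult.commute flip: hb)
    show "(\<integral>\<^sup>+x. F (householder u x) \<partial>lborel) = (\<integral>\<^sup>+x. F x \<partial>lborel)" if [measurable]: "F \<in> borel_measurable borel" for F :: "'a \<Rightarrow> ennreal"
      by (subst (2) lborel_householder[OF u, symmetric]) (simp add: nn_integral_distr)
  qed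
qed


section \<open>The constant kappa and the linear model\<close>

text \<open>Unfolding the cone measure turns \<open>kappa\<close> into an integral over the
  punctured ball. It is at most the dimension times the volume, so \<open>enn2real\<close> loses no
  information; it is positive because the hyperplane orthogonal to \<open>e\<close> is null, and
  this positivity is what makes the lower estimate of the theorem meaningful.\<close>

lemma kappa_ball_integral:
  defines "e \<equiv> (SOME e::'a::euclidean_space. e \<in> Basis)"
  assumes q: "0 < q"
  shows "(\<integral>\<^sup>+x\<in>ball 0 1 - {0}. (ennreal (real DIM('a)) * ennreal (\<bar>e \<bullet> (x /\<^sub>R norm x)\<bar> powr q)) \<partial>lborel) = ennreal (kappa q TYPE('a))"
    and "0 < kappa q TYPE('a)"
proof -
  let ?F = "\<lambda>x. ennreal (real DIM('a)) * ennreal (\<bar>e \<bullet> (x /\<^sub>R norm x)\<bar> powr q)"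
  let ?I = "\<integral>\<^sup>+x\<in>ball 0 1 - {0}. ?F x \<partial>lborel"
  have e: "e \<in> Basis" unfolding e_def using nonempty_Basis by (metis some_in_eq)
  have [measurable]: "(\<lambda>x::'a. x /\<^sub>R norm x) \<in> borel_measurable (restrict_space lborel (ball 0 1 - {0}))"
    by (intro measurable_restrict_space1) measurable
  have "(\<integral>\<^sup>+\<omega>. ennreal (\<bar>e \<bullet> \<omega>\<bar> powr q) \<partial>sphere_measure) = ?I"
    by (simp add: sphere_measure_def nn_integral_scale_measure nn_integral_distr nn_integral_restrict_space
        ennreal_of_nat_eq_real_of_nat nn_integral_cmult[symmetric] mult.assoc del: inner_scaleR_right)
  then have k: "kappa q TYPE('a) = enn2real ?I" unfolding kappa_def e_def by simp
  have le: "\<bar>e \<bullet> (x /\<^sub>R norm x)\<bar> powr q \<le> 1" for x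
  proof -
    have "\<bar>e \<bullet> (x /\<^sub>R norm x)\<bar> \<le> norm e * norm (x /\<^sub>R norm x)" by (rule Cauchy_Schwarz_ineq2)
    also have "\<dots> \<le> 1" using e by (cases "x = 0") auto
    finally show ?thesis using q by (intro powr_le1) auto
  qed
  have "?I \<le> (\<integral>\<^sup>+x. ennreal (real DIM('a)) * indicator (ball 0 1) x \<partial>(lborel :: 'a measure))"
  proof (intro nn_integral_mono)
    fix x :: 'a
    have "?F x \<le> ennreal (real DIM('a)) * 1"
      using le[of x] by (intro mult_left_mono) (auto simp: ennreal_le_1)
    then show "?F x * indicator (ball 0 1 - {0}) x \<le> ennreal (real DIM('a)) * indicator (ball 0 1) x"
      by (auto simp: indicator_def)
  qed
  also have "\<dots> = ennreal (real DIM('a)) * emeasure lborel (ball (0::'a) 1)"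
    by (intro nn_integral_cmult_indicator) auto
  also have "\<dots> < top" using emeasure_lborel_ball_finite[of "0::'a" 1] by (simp add: ennreal_mult_less_top)
  finally have fin: "?I < top" .
  then show "?I = ennreal (kappa q TYPE('a))" unfolding k by simp
  have "?I \<noteq> 0"
  proof
    assume "?I = 0"
    then have "AE x in lborel. ?F x * indicator (ball 0 1 - {0}) x = 0"
      by (subst (asm) nn_integral_0_iff_AE) auto
    then have "AE x in lborel. x \<notin> ball (0::'a) 1 \<inter> {x. e \<bullet> x \<noteq> 0}"
    proof eventually_elim
      case (elim x)
      show ?case
      proof
        assume x: "x \<in> ball 0 1 \<inter> {x. e \<bullet> x \<noteq> 0}"
        then have "x \<noteq> 0" by auto
        then have "0 < \<bar>e \<bullet> (x /\<^sub>R norm x)\<bar> powr q" using x by simp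
        then have "?F x \<noteq> 0" by (simp add: ennreal_eq_0_iff)
        then show False using elim x \<open>x \<noteq> 0\<close> by auto
      qed
    qed
    then have "AE x in lborel. x \<notin> ball (0::'a) 1"
    proof -
      assume 1: "AE x in lborel. x \<notin> ball (0::'a) 1 \<inter> {x. e \<bullet> x \<noteq> 0}"
      have "negligible {x. e \<bullet> x = 0}"
        using e by (intro negligible_hyperplane) auto
      then have "AE x in lborel. x \<notin> {x. e \<bullet> x = 0}"
        using AE_not_in AE_completion_iff negligible_iff_null_sets by blast
      with 1 show ?thesis by eventually_elim auto
    qed
    then have "emeasure lborel (ball (0::'a) 1) = 0"
      by (subst (asm) AE_iff_measurable[where N="ball 0 1"]) auto
    moreover have "vol TYPE('a) \<noteq> 0" using vol_pos[where 'a='a] by linarith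
    ultimately show False by (simp add: emeasure_lborel_ball)
  qed
  then show "0 < kappa q TYPE('a)"
    using fin unfolding k by (simp add: enn2real_positive_iff zero_less_iff_neq_zero)
qed

text \<open>The threshold radius is \<open>b = a powr (q / \<gamma>)\<close>. The condition selects
  the radii below \<open>b\<close> for positive \<open>\<gamma>\<close> and those above
  \<open>b\<close> for negative \<open>\<gamma>\<close>, in each case the side on which
  \<open>\<rho> powr (\<gamma> - 1)\<close> is integrable, and
  \<open>b powr \<gamma> = a powr q\<close>.\<close>

lemma nn_integral_radial_threshold:
  fixes a :: real
  assumes \<gamma>: "\<gamma> \<noteq> 0" and q: "0 < q" and a: "0 \<le> a"
  shows "(\<integral>\<^sup>+\<rho>\<in>{0<..}. (ennreal (\<rho> powr (\<gamma> - 1)) * indicator {\<rho>. \<rho> powr (\<gamma> / q) < a} \<rho>) \<partial>lborel) = ennreal (a powr q / \<bar>\<gamma>\<bar>)"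
proof (cases "a = 0")
  case True
  then show ?thesis by (simp add: not_less)
next
  case False
  with a have a0: "0 < a" by simp
  define b where "b = a powr (q / \<gamma>)"
  have b: "0 < b" "b powr (\<gamma> / q) = a" "b powr \<gamma> = a powr q"
    using a0 \<gamma> q by (auto simp: b_def powr_powr)
  show ?thesis
  proof (cases "0 < \<gamma>")
    case True
    have "\<rho> powr (\<gamma> / q) < a \<longleftrightarrow> \<rho> < b" if "0 < \<rho>" for \<rho>
    proof -
      have "0 < \<gamma> / q" using True q by simp
      then show ?thesis
        using that b powr_less_mono2[of "\<gamma> / q" \<rho> b] powr_mono2[of "\<gamma> / q" b \<rho>] by (auto simp: not_less[symmetric])
    qed
    then have "(\<integral>\<^sup>+\<rho>\<in>{0<..}. (ennreal (\<rho> powr (\<gamma> - 1)) * indicator {\<rho>. \<rho> powr (\<gamma> / q) < a} \<rho>) \<partial>lborel)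
      = (\<integral>\<^sup>+\<rho>\<in>{0<..<b}. ennreal (\<rho> powr (\<gamma> - 1)) \<partial>lborel)"
      by (intro nn_integral_cong) (auto simp: indicator_def)
    then show ?thesis using True b by (subst (asm) nn_integral_powr_0) auto
  next
    case False
    then have g: "\<gamma> < 0" using \<gamma> by simp
    have "\<rho> powr (\<gamma> / q) < a \<longleftrightarrow> b < \<rho>" if "0 < \<rho>" for \<rho>
    proof -
      have "\<gamma> / q < 0" using g q by (simp add: divide_neg_pos)
      then show ?thesis
        using that b powr_less_mono2_neg[of "\<gamma> / q" b \<rho>] powr_mono2'[of "\<gamma> / q" \<rho> b] by (auto simp: not_less[symmetric])
    qed
    then have "(\<integral>\<^sup>+\<rho>\<in>{0<..}. (ennreal (\<rho> powr (\<gamma> - 1)) * indicator {\<rho>. \<rho> powr (\<gamma> / q) < a} \<rho>) \<partial>lborel)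
      = (\<integral>\<^sup>+\<rho>\<in>{b<..}. ennreal (\<rho> powr (\<gamma> - 1)) \<partial>lborel)"
      using b(1) by (intro nn_integral_cong) (auto simp: indicator_def)
    then show ?thesis using g b by (subst (asm) nn_integral_powr_top) auto
  qed
qed


text \<open>The blown-up quantity for an affine function with gradient \<open>v\<close>, hence the
  value of the pointwise limit. Polar coordinates reduce it to the radial threshold with
  \<open>a = \<bar>v \<bullet> w\<bar>\<close>, and an isometry carries the direction of
  \<open>v\<close> to the basis vector in \<open>kappa\<close>.\<close>

lemma nn_integral_linear_threshold:
  fixes v :: "'a::euclidean_space"
  assumes \<gamma>: "\<gamma> \<noteq> 0" and q: "0 < q"
  shows "(\<integral>\<^sup>+k. indicator {k. k \<noteq> 0 \<and> norm k powr (1 + \<gamma> / q) < \<bar>v \<bullet> k\<bar>} k * ennreal (norm k powr (\<gamma> - real DIM('a))) \<partial>lborel)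
    = ennreal (kappa q TYPE('a) / \<bar>\<gamma>\<bar> * norm v powr q)"
proof -
  let ?n = "DIM('a)"
  let ?S = "{k. k \<noteq> 0 \<and> norm k powr (1 + \<gamma> / q) < \<bar>v \<bullet> k\<bar>}"
  define e where "e = (SOME e::'a. e \<in> Basis)"
  have e: "e \<in> Basis" unfolding e_def using nonempty_Basis by (metis some_in_eq)
  have S [measurable]: "?S \<in> sets borel" by measurable
  have "(\<integral>\<^sup>+k. indicator ?S k * ennreal (norm k powr (\<gamma> - real ?n)) \<partial>lborel)
    = (\<integral>\<^sup>+x\<in>ball 0 1 - {0}. (ennreal (real ?n) * (\<integral>\<^sup>+\<rho>\<in>{0<..}. (indicator ?S (\<rho> *\<^sub>R (x /\<^sub>R norm x)) *
        ennreal (norm (\<rho> *\<^sub>R (x /\<^sub>R norm x)) powr (\<gamma> - real ?n))) * ennreal (\<rho> ^ (?n - 1)) \<partial>lborel)) \<partial>lborel)"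
    by (rule nn_integral_polar) measurable
  also have "\<dots> = (\<integral>\<^sup>+x\<in>ball 0 1 - {0}. (ennreal (real ?n) * ennreal (\<bar>v \<bullet> (x /\<^sub>R norm x)\<bar> powr q / \<bar>\<gamma>\<bar>)) \<partial>lborel)"
  proof (rule nn_integral_cong)
    fix x :: 'a
    show "(ennreal (real ?n) * (\<integral>\<^sup>+\<rho>\<in>{0<..}. (indicator ?S (\<rho> *\<^sub>R (x /\<^sub>R norm x)) *
        ennreal (norm (\<rho> *\<^sub>R (x /\<^sub>R norm x)) powr (\<gamma> - real ?n))) * ennreal (\<rho> ^ (?n - 1)) \<partial>lborel)) * indicator (ball 0 1 - {0}) x
      = (ennreal (real ?n) * ennreal (\<bar>v \<bullet> (x /\<^sub>R norm x)\<bar> powr q / \<bar>\<gamma>\<bar>)) * indicator (ball 0 1 - {0}) x"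
    proof (cases "x \<in> ball 0 1 - {0}")
      case True
      define w where "w = x /\<^sub>R norm x"
      have w: "norm w = 1" using True by (simp add: w_def)
      have "(\<integral>\<^sup>+\<rho>\<in>{0<..}. (indicator ?S (\<rho> *\<^sub>R w) * ennreal (norm (\<rho> *\<^sub>R w) powr (\<gamma> - real ?n))) * ennreal (\<rho> ^ (?n - 1)) \<partial>lborel)
        = (\<integral>\<^sup>+\<rho>\<in>{0<..}. (ennreal (\<rho> powr (\<gamma> - 1)) * indicator {\<rho>. \<rho> powr (\<gamma> / q) < \<bar>v \<bullet> w\<bar>} \<rho>) \<partial>lborel)"
      proof (rule nn_integral_cong)
        fix \<rho> :: real
        show "(indicator ?S (\<rho> *\<^sub>R w) * ennreal (norm (\<rho> *\<^sub>R w) powr (\<gamma> - real ?n))) * ennreal (\<rho> ^ (?n - 1)) * indicator {0<..} \<rho>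
          = (ennreal (\<rho> powr (\<gamma> - 1)) * indicator {\<rho>. \<rho> powr (\<gamma> / q) < \<bar>v \<bullet> w\<bar>} \<rho>) * indicator {0<..} \<rho>"
        proof (cases "0 < \<rho>")
          case True
          \<comment> \<open>On a ray one power of \<open>\<rho>\<close> cancels between
            \<open>norm k powr (1 + \<gamma> / q)\<close> and
            \<open>\<bar>v \<bullet> k\<bar>\<close>.\<close>
          have "\<rho> *\<^sub>R w \<in> ?S \<longleftrightarrow> \<rho> powr (\<gamma> / q) < \<bar>v \<bullet> w\<bar>"
            using True w by (auto simp: powr_add abs_mult)
          moreover have "\<rho> powr (\<gamma> - real ?n) * \<rho> ^ (?n - 1) = \<rho> powr (\<gamma> - 1)"
          proof -
            have "\<rho> ^ (?n - 1) = \<rho> powr (real ?n - 1)"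
              using True by (simp add: powr_realpow[symmetric] of_nat_diff)
            then show ?thesis by (simp flip: powr_add)
          qed
          then have "ennreal (norm (\<rho> *\<^sub>R w) powr (\<gamma> - real ?n)) * ennreal (\<rho> ^ (?n - 1)) = ennreal (\<rho> powr (\<gamma> - 1))"
            using True w by (simp flip: ennreal_mult)
          ultimately show ?thesis using True by (simp add: indicator_def mult.assoc)
        qed simp
      qed
      also have "\<dots> = ennreal (\<bar>v \<bullet> w\<bar> powr q / \<bar>\<gamma>\<bar>)"
        by (intro nn_integral_radial_threshold \<gamma> q) simp
      finally show ?thesis unfolding w_def by simp
    qed simp
  qed
  also have "\<dots> = ennreal (kappa q TYPE('a) / \<bar>\<gamma>\<bar> * norm v powr q)"
  proof (cases "v = 0")
    case False
    have "norm (v /\<^sub>R norm v) = 1" "norm e = 1" using False e by auto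
    then obtain T where T: "\<And>x. norm (T x) = norm x" "\<And>x. e \<bullet> T x = (v /\<^sub>R norm v) \<bullet> x"
      and Tint: "\<And>F :: 'a \<Rightarrow> ennreal. F \<in> borel_measurable borel \<Longrightarrow> (\<integral>\<^sup>+x. F (T x) \<partial>lborel) = (\<integral>\<^sup>+x. F x \<partial>lborel)"
      using isometry_exists by blast
    have T0: "T x = 0 \<longleftrightarrow> x = 0" for x using T(1)[of x] by (metis norm_eq_zero)
    have "(\<integral>\<^sup>+x\<in>ball 0 1 - {0}. (ennreal (real ?n) * ennreal (\<bar>v \<bullet> (x /\<^sub>R norm x)\<bar> powr q / \<bar>\<gamma>\<bar>)) \<partial>lborel)
      = (\<integral>\<^sup>+x. ennreal (norm v powr q / \<bar>\<gamma>\<bar>) * (ennreal (real ?n) * ennreal (\<bar>e \<bullet> (T x /\<^sub>R norm (T x))\<bar> powr q) * indicator (ball 0 1 - {0}) (T x)) \<partial>lborel)"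
    proof (rule nn_integral_cong)
      fix x :: 'a
      have "v \<bullet> (x /\<^sub>R norm x) = norm v * (e \<bullet> (T x /\<^sub>R norm (T x)))"
        using False by (simp add: T)
      then have "\<bar>v \<bullet> (x /\<^sub>R norm x)\<bar> powr q / \<bar>\<gamma>\<bar> = norm v powr q / \<bar>\<gamma>\<bar> * \<bar>e \<bullet> (T x /\<^sub>R norm (T x))\<bar> powr q"
        by (simp add: abs_mult powr_mult)
      then have "ennreal (\<bar>v \<bullet> (x /\<^sub>R norm x)\<bar> powr q / \<bar>\<gamma>\<bar>) = ennreal (norm v powr q / \<bar>\<gamma>\<bar>) * ennreal (\<bar>e \<bullet> (T x /\<^sub>R norm (T x))\<bar> powr q)"
        by (simp only: ennreal_mult[symmetric] powr_ge_zero divide_nonneg_nonneg abs_ge_zero)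
      moreover have "indicator (ball 0 1 - {0}) (T x) = (indicator (ball 0 1 - {0}) x :: ennreal)"
        by (simp add: indicator_def T0 T(1))
      ultimately show "(ennreal (real ?n) * ennreal (\<bar>v \<bullet> (x /\<^sub>R norm x)\<bar> powr q / \<bar>\<gamma>\<bar>)) * indicator (ball 0 1 - {0}) x
        = ennreal (norm v powr q / \<bar>\<gamma>\<bar>) * (ennreal (real ?n) * ennreal (\<bar>e \<bullet> (T x /\<^sub>R norm (T x))\<bar> powr q) * indicator (ball 0 1 - {0}) (T x))"
        by (simp only: mult_ac)
    qed
    also have "\<dots> = (\<integral>\<^sup>+x. ennreal (norm v powr q / \<bar>\<gamma>\<bar>) * (ennreal (real ?n) * ennreal (\<bar>e \<bullet> (x /\<^sub>R norm x)\<bar> powr q) * indicator (ball 0 1 - {0}) x) \<partial>lborel)"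
      by (rule Tint) measurable
    also have "\<dots> = ennreal (norm v powr q / \<bar>\<gamma>\<bar>) * (\<integral>\<^sup>+x\<in>ball 0 1 - {0}. (ennreal (real ?n) * ennreal (\<bar>e \<bullet> (x /\<^sub>R norm x)\<bar> powr q)) \<partial>lborel)"
      by (intro nn_integral_cmult) measurable
    also have "\<dots> = ennreal (norm v powr q / \<bar>\<gamma>\<bar>) * ennreal (kappa q TYPE('a))"
      using kappa_ball_integral(1)[where 'a='a, OF q] unfolding e_def by simp
    also have "\<dots> = ennreal (kappa q TYPE('a) / \<bar>\<gamma>\<bar> * norm v powr q)"
      using kappa_ball_integral(2)[where 'a='a, OF q] by (simp add: mult.commute flip: ennreal_mult)
    finally show ?thesis .
  qed simp
  finally show ?thesis .
qed

text \<open>Every ray meets this boundary at most once, at radius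
  \<open>\<bar>v \<bullet> w\<bar> powr (q / \<gamma>)\<close>. Without a null boundary the measures
  of the blown-up sets need not converge.\<close>

lemma negligible_linear_threshold:
  fixes v :: "'a::euclidean_space"
  assumes \<gamma>: "\<gamma> \<noteq> 0" and q: "0 < q"
  shows "emeasure lborel {k. k \<noteq> 0 \<and> \<bar>v \<bullet> k\<bar> = norm k powr (1 + \<gamma> / q)} = 0"
proof -
  let ?S = "{k. k \<noteq> 0 \<and> \<bar>v \<bullet> k\<bar> = norm k powr (1 + \<gamma> / q)}"
  have S [measurable]: "?S \<in> sets borel" by measurable
  have "emeasure lborel ?S = (\<integral>\<^sup>+k. indicator ?S k \<partial>lborel)" by simp
  also have "\<dots> = (\<integral>\<^sup>+x\<in>ball 0 1 - {0}. (ennreal (real DIM('a)) * (\<integral>\<^sup>+\<rho>\<in>{0<..}. indicator ?S (\<rho> *\<^sub>R (x /\<^sub>R norm x)) * ennreal (\<rho> ^ (DIM('a) - 1)) \<partial>lborel)) \<partial>lborel)"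
    by (rule nn_integral_polar) measurable
  also have "\<dots> = (\<integral>\<^sup>+x. 0 \<partial>(lborel :: 'a measure))"
  proof (rule nn_integral_cong)
    fix x :: 'a
    show "(ennreal (real DIM('a)) * (\<integral>\<^sup>+\<rho>\<in>{0<..}. indicator ?S (\<rho> *\<^sub>R (x /\<^sub>R norm x)) * ennreal (\<rho> ^ (DIM('a) - 1)) \<partial>lborel)) * indicator (ball 0 1 - {0}) x = 0"
    proof (cases "x \<in> ball 0 1 - {0}")
      case True
      define w where "w = x /\<^sub>R norm x"
      have w: "norm w = 1" using True by (simp add: w_def)
      have "(\<integral>\<^sup>+\<rho>\<in>{0<..}. indicator ?S (\<rho> *\<^sub>R w) * ennreal (\<rho> ^ (DIM('a) - 1)) \<partial>lborel) = (\<integral>\<^sup>+\<rho>. 0 \<partial>(lborel :: real measure))"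
      proof (rule nn_integral_cong_AE)
        have "AE \<rho> in lborel. \<rho> \<noteq> \<bar>v \<bullet> w\<bar> powr (q / \<gamma>)" by (rule AE_lborel_singleton)
        then show "AE \<rho> in lborel. indicator ?S (\<rho> *\<^sub>R w) * ennreal (\<rho> ^ (DIM('a) - 1)) * indicator {0<..} \<rho> = 0"
        proof eventually_elim
          case (elim \<rho>)
          have "\<rho> *\<^sub>R w \<notin> ?S" if "0 < \<rho>"
          proof
            assume "\<rho> *\<^sub>R w \<in> ?S"
            then have "\<bar>v \<bullet> w\<bar> = \<rho> powr (\<gamma> / q)"
              using that w by (auto simp: powr_add abs_mult)
            then have "\<bar>v \<bullet> w\<bar> powr (q / \<gamma>) = \<rho>"
              using that \<gamma> q by (simp add: powr_powr)
            then show False using elim by simp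
          qed
          then show ?case by (auto simp: indicator_def)
        qed
      qed
      then show ?thesis unfolding w_def by simp
    qed simp
  qed
  finally show ?thesis by simp
qed

section \<open>Blow-up at a point\<close>

text \<open>A family with a continuous parameter: for fixed \<open>k\<close> the admissible
  \<open>\<rho>\<close> fill the interval from \<open>norm k\<close> to \<open>2 * norm k\<close>,
  which has fixed measure for \<open>d\<rho> / \<rho>\<close>. The rings overlap, and integration
  over \<open>\<rho>\<close> takes the place of a dyadic sum.\<close>

definition dyadic_ring :: "real \<Rightarrow> 'a::euclidean_space set"
  where "dyadic_ring \<rho> = {k. norm k < \<rho> \<and> \<rho> \<le> 2 * norm k}"

lemma dyadic_ring_sets [measurable]: "dyadic_ring \<rho> \<in> sets borel"
  unfolding dyadic_ring_def by measurable

lemma dyadic_ring_subset_ball: "dyadic_ring \<rho> \<subseteq> ball 0 \<rho>"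
  by (auto simp: dyadic_ring_def)

text \<open>Weight with which the family of rings counts each point. It is left as an integral so
  that \<open>a = 0\<close>, where a logarithm appears, is no special case; here \<open>a\<close>
  will be \<open>\<gamma>\<close> minus the dimension.\<close>

definition layer_const :: "real \<Rightarrow> real"
  where "layer_const a = enn2real (\<integral>\<^sup>+\<rho>\<in>{1<..2}. ennreal (\<rho> powr (a - 1)) \<partial>lborel)"

lemma layer_const:
  "(\<integral>\<^sup>+\<rho>\<in>{1<..2}. ennreal (\<rho> powr (a - 1)) \<partial>lborel) = ennreal (layer_const a)" "0 < layer_const a"
proof -
  let ?I = "\<integral>\<^sup>+\<rho>\<in>{1<..2}. ennreal (\<rho> powr (a - 1)) \<partial>lborel"
  have bounds: "2 powr (- \<bar>a - 1\<bar>) \<le> \<rho> powr (a - 1)" "\<rho> powr (a - 1) \<le> 2 powr \<bar>a - 1\<bar>" if "1 < \<rho>" "\<rho> \<le> 2" for \<rho> :: real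
  proof -
    have "\<rho> powr (a - 1) \<le> \<rho> powr \<bar>a - 1\<bar>" using that by (intro powr_mono) auto
    also have "\<dots> \<le> 2 powr \<bar>a - 1\<bar>" using that by (intro powr_mono2) auto
    finally show "\<rho> powr (a - 1) \<le> 2 powr \<bar>a - 1\<bar>" .
    have "2 powr (- \<bar>a - 1\<bar>) \<le> \<rho> powr (- \<bar>a - 1\<bar>)" using that by (intro powr_mono2') auto
    also have "\<dots> \<le> \<rho> powr (a - 1)" using that by (intro powr_mono) auto
    finally show "2 powr (- \<bar>a - 1\<bar>) \<le> \<rho> powr (a - 1)" .
  qed
  have "?I \<le> (\<integral>\<^sup>+\<rho>\<in>{1<..2}. ennreal (2 powr \<bar>a - 1\<bar>) \<partial>(lborel :: real measure))"
    using bounds by (intro nn_integral_mono) (auto simp: indicator_def intro!: ennreal_leI)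
  also have "\<dots> = ennreal (2 powr \<bar>a - 1\<bar>)"
    by (subst nn_integral_cmult_indicator) auto
  finally have fin: "?I < top" by (auto intro: le_less_trans)
  then show eq: "?I = ennreal (layer_const a)" by (simp add: layer_const_def)
  have "ennreal (2 powr (- \<bar>a - 1\<bar>)) = (\<integral>\<^sup>+\<rho>\<in>{1<..2}. ennreal (2 powr (- \<bar>a - 1\<bar>)) \<partial>(lborel :: real measure))"
    by (subst nn_integral_cmult_indicator) auto
  also have "\<dots> \<le> ?I"
    using bounds by (intro nn_integral_mono) (auto simp: indicator_def intro!: ennreal_leI)
  finally have "ennreal (2 powr (- \<bar>a - 1\<bar>)) \<le> ennreal (layer_const a)"
    unfolding eq .
  moreover have "0 < ennreal (2 powr (- \<bar>a - 1\<bar>))" by simp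
  ultimately have "0 < ennreal (layer_const a)" by (rule less_le_trans[rotated])
  then show "0 < layer_const a" by simp
qed

lemma nn_integral_ring:
  fixes k :: "'a::euclidean_space"
  shows "(\<integral>\<^sup>+\<rho>\<in>{0<..}. (ennreal (\<rho> powr (a - 1)) * indicator (dyadic_ring \<rho>) k) \<partial>lborel) = ennreal (layer_const a) * ennreal (norm k powr a)"
proof (cases "k = 0")
  case True
  then have "(\<integral>\<^sup>+\<rho>\<in>{0<..}. (ennreal (\<rho> powr (a - 1)) * indicator (dyadic_ring \<rho>) k) \<partial>lborel) = (\<integral>\<^sup>+\<rho>. 0 \<partial>(lborel :: real measure))"
    by (intro nn_integral_cong) (auto simp: indicator_def dyadic_ring_def)
  then show ?thesis using True by simp
next
  case False
  then have k: "0 < norm k" by simp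
  have "(\<integral>\<^sup>+\<rho>\<in>{0<..}. (ennreal (\<rho> powr (a - 1)) * indicator (dyadic_ring \<rho>) k) \<partial>lborel)
      = (\<integral>\<^sup>+\<rho>\<in>{norm k<..2 * norm k}. ennreal (\<rho> powr (a - 1)) \<partial>lborel)"
    using k by (intro nn_integral_cong) (auto simp: indicator_def dyadic_ring_def)
  also have "\<dots> = ennreal (norm k ^ DIM(real)) * (\<integral>\<^sup>+\<sigma>. ennreal ((0 + norm k *\<^sub>R \<sigma>) powr (a - 1)) * indicator {norm k<..2 * norm k} (0 + norm k *\<^sub>R \<sigma>) \<partial>lborel)"
    using k by (intro nn_integral_lborel_affine) auto
  also have "(\<integral>\<^sup>+\<sigma>. ennreal ((0 + norm k *\<^sub>R \<sigma>) powr (a - 1)) * indicator {norm k<..2 * norm k} (0 + norm k *\<^sub>R \<sigma>) \<partial>lborel)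
      = (\<integral>\<^sup>+\<sigma>. ennreal (norm k powr (a - 1)) * (ennreal (\<sigma> powr (a - 1)) * indicator {1<..2} \<sigma>) \<partial>lborel)"
    using k by (intro nn_integral_cong) (auto simp: indicator_def powr_mult simp flip: ennreal_mult)
  also have "\<dots> = ennreal (norm k powr (a - 1)) * ennreal (layer_const a)"
    by (subst nn_integral_cmult) (auto simp: layer_const)
  also have "ennreal (norm k ^ DIM(real)) * (ennreal (norm k powr (a - 1)) * ennreal (layer_const a)) = ennreal (layer_const a) * ennreal (norm k powr a)"
    using k layer_const(2)[of a] by (simp add: powr_diff mult.commute flip: ennreal_mult)
  finally show ?thesis .
qed

text \<open>Fubini over the ring radius. On a single ring \<open>norm k\<close> is comparable to
  \<open>\<rho>\<close>, so measures of sets there can be bounded by Chebyshev's inequality with a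
  constant threshold.\<close>

lemma nn_integral_norm_powr_layers:
  fixes S :: "'a::euclidean_space set"
  assumes [measurable]: "S \<in> sets borel"
  shows "ennreal (layer_const a) * (\<integral>\<^sup>+k. indicator S k * ennreal (norm k powr a) \<partial>lborel)
    = (\<integral>\<^sup>+\<rho>\<in>{0<..}. (ennreal (\<rho> powr (a - 1)) * emeasure lborel (S \<inter> dyadic_ring \<rho>)) \<partial>lborel)"
proof -
  let ?F = "\<lambda>k \<rho>. indicator S k * (ennreal (\<rho> powr (a - 1)) * indicator {(k::'a, \<rho>). norm k < \<rho> \<and> \<rho> \<le> 2 * norm k} (k, \<rho>) * indicator {0<..} \<rho>)"
  have dyadic_ring: "indicator {(k::'a, \<rho>). norm k < \<rho> \<and> \<rho> \<le> 2 * norm k} (k, \<rho>) = (indicator (dyadic_ring \<rho>) k :: ennreal)" for k \<rho>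
    by (auto simp: indicator_def dyadic_ring_def)
  have "ennreal (layer_const a) * (\<integral>\<^sup>+k. indicator S k * ennreal (norm k powr a) \<partial>lborel)
      = (\<integral>\<^sup>+k. ennreal (layer_const a) * (indicator S k * ennreal (norm k powr a)) \<partial>lborel)"
    by (intro nn_integral_cmult[symmetric]) measurable
  also have "\<dots> = (\<integral>\<^sup>+k. (\<integral>\<^sup>+\<rho>. ?F k \<rho> \<partial>lborel) \<partial>lborel)"
  proof (intro nn_integral_cong)
    fix k :: 'a
    have "(\<integral>\<^sup>+\<rho>. ?F k \<rho> \<partial>lborel) = indicator S k * (\<integral>\<^sup>+\<rho>. (ennreal (\<rho> powr (a - 1)) * indicator {(k::'a, \<rho>). norm k < \<rho> \<and> \<rho> \<le> 2 * norm k} (k, \<rho>) * indicator {0<..} \<rho>) \<partial>lborel)"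
      by (intro nn_integral_cmult) measurable
    then show "ennreal (layer_const a) * (indicator S k * ennreal (norm k powr a)) = (\<integral>\<^sup>+\<rho>. ?F k \<rho> \<partial>lborel)"
      unfolding dyadic_ring nn_integral_ring by (simp add: mult_ac)
  qed
  also have "\<dots> = (\<integral>\<^sup>+\<rho>. (\<integral>\<^sup>+k. ?F k \<rho> \<partial>lborel) \<partial>lborel)"
    by (intro nn_integral_lborel_swap) measurable
  also have "\<dots> = (\<integral>\<^sup>+\<rho>\<in>{0<..}. (ennreal (\<rho> powr (a - 1)) * emeasure lborel (S \<inter> dyadic_ring \<rho>)) \<partial>lborel)"
  proof (intro nn_integral_cong)
    fix \<rho> :: real
    have "(\<integral>\<^sup>+k. ?F k \<rho> \<partial>lborel) = (\<integral>\<^sup>+k. (ennreal (\<rho> powr (a - 1)) * indicator {0<..} \<rho>) * indicator (S \<inter> dyadic_ring \<rho>) k \<partial>lborel)"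
      unfolding dyadic_ring by (intro nn_integral_cong) (auto simp: indicator_def)
    also have "\<dots> = (ennreal (\<rho> powr (a - 1)) * indicator {0<..} \<rho>) * emeasure lborel (S \<inter> dyadic_ring \<rho>)"
      by (intro nn_integral_cmult_indicator) simp
    finally show "(\<integral>\<^sup>+k. ?F k \<rho> \<partial>lborel) = ennreal (\<rho> powr (a - 1)) * emeasure lborel (S \<inter> dyadic_ring \<rho>) * indicator {0<..} \<rho>"
      by (simp add: mult_ac)
  qed
  finally show ?thesis .
qed

definition blowup_set :: "real \<Rightarrow> ('a::euclidean_space \<Rightarrow> real) \<Rightarrow> 'a set"
  where "blowup_set \<beta> U = {k. k \<noteq> 0 \<and> norm k powr \<beta> < \<bar>U k\<bar>}"

lemma blowup_set_sets [measurable]: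
  assumes [measurable]: "U \<in> borel_measurable borel"
  shows "blowup_set \<beta> U \<in> sets borel"
  unfolding blowup_set_def by measurable

text \<open>Blowing up at \<open>x\<close> with radius \<open>R = lam powr (- q / \<gamma>)\<close> absorbs \<open>lam\<close> completely;
  \<open>R\<close> tends to \<open>0\<close> both for \<open>lam \<rightarrow> \<infinity>\<close>, \<open>\<gamma> > 0\<close> and for \<open>lam \<rightarrow> 0\<close>, \<open>\<gamma> < 0\<close>.\<close>
lemma G_fun_rescaled:
  fixes f :: "'a::euclidean_space \<Rightarrow> real"
  assumes [measurable]: "f \<in> borel_measurable borel" and \<gamma>: "\<gamma> \<noteq> 0" and q: "0 < q" and lam: "0 < lam"
  defines "R \<equiv> lam powr (- q / \<gamma>)"
  shows "enn_powr (ennreal lam * G_fun \<gamma> q lam f x) q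
    = (\<integral>\<^sup>+k. indicator (blowup_set (1 + \<gamma> / q) (\<lambda>k. (f (x + R *\<^sub>R k) - f x) / R)) k * ennreal (norm k powr (\<gamma> - real DIM('a))) \<partial>lborel)"
proof -
  let ?n = "DIM('a)"
  let ?B = "blowup_set (1 + \<gamma> / q) (\<lambda>k. (f (x + R *\<^sub>R k) - f x) / R)"
  have R: "0 < R" using lam by (simp add: R_def)
  \<comment> \<open>The second identity removes \<open>lam\<close> from the defining inequality of
    the set, the first removes it from the measure.\<close>
  have Rg: "R powr \<gamma> = lam powr (- q)" "lam * R powr (\<gamma> / q) = 1"
  proof -
    show "R powr \<gamma> = lam powr (- q)"
      unfolding R_def powr_powr using \<gamma> by simp
    have "- q / \<gamma> * (\<gamma> / q) = - 1" using \<gamma> q by simp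
    then show "lam * R powr (\<gamma> / q) = 1"
      unfolding R_def powr_powr using lam by (simp add: powr_minus)
  qed
  have "{y. (x, y) \<in> E_set lam (\<gamma> / q) f} \<in> sets borel"
    unfolding E_set_def by measurable
  then have [measurable]: "(\<lambda>y. indicator (E_set lam (\<gamma> / q) f) (x, y) :: ennreal) \<in> borel_measurable borel"
    by (subst indicator_vimage[of "\<lambda>y. (x, y)", symmetric]) (auto simp: vimage_def)
  have E: "(x, x + R *\<^sub>R k) \<in> E_set lam (\<gamma> / q) f \<longleftrightarrow> k \<in> ?B" for k
  proof (cases "k = 0")
    case False
    then have k: "0 < norm k" by simp
    have "(x, x + R *\<^sub>R k) \<in> E_set lam (\<gamma> / q) f \<longleftrightarrow> lam < \<bar>f x - f (x + R *\<^sub>R k)\<bar> / (R * norm k) powr (1 + \<gamma> / q)"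
      using R False by (simp add: E_set_def)
    also have "\<dots> \<longleftrightarrow> lam * (R * norm k) powr (1 + \<gamma> / q) < \<bar>f (x + R *\<^sub>R k) - f x\<bar>"
      using R k by (simp add: pos_less_divide_eq abs_minus_commute)
    also have "lam * (R * norm k) powr (1 + \<gamma> / q) = (lam * R powr (\<gamma> / q)) * (R * norm k powr (1 + \<gamma> / q))"
      using R k by (simp add: powr_mult powr_add)
    also have "\<dots> = R * norm k powr (1 + \<gamma> / q)" using Rg by simp
    also have "R * norm k powr (1 + \<gamma> / q) < \<bar>f (x + R *\<^sub>R k) - f x\<bar> \<longleftrightarrow> k \<in> ?B"
      using R False by (simp add: blowup_set_def abs_divide pos_less_divide_eq mult.commute)
    finally show ?thesis .
  qed (auto simp: E_set_def blowup_set_def)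
  have "(\<integral>\<^sup>+y. indicator (E_set lam (\<gamma> / q) f) (x, y) * ennreal (norm (x - y) powr (\<gamma> - real ?n)) \<partial>lborel)
    = ennreal (R ^ ?n) * (\<integral>\<^sup>+k. indicator (E_set lam (\<gamma> / q) f) (x, x + R *\<^sub>R k) * ennreal (norm (x - (x + R *\<^sub>R k)) powr (\<gamma> - real ?n)) \<partial>lborel)"
    using R by (intro nn_integral_lborel_affine) auto
  also have "(\<integral>\<^sup>+k. indicator (E_set lam (\<gamma> / q) f) (x, x + R *\<^sub>R k) * ennreal (norm (x - (x + R *\<^sub>R k)) powr (\<gamma> - real ?n)) \<partial>lborel)
    = (\<integral>\<^sup>+k. ennreal (R powr (\<gamma> - real ?n)) * (indicator ?B k * ennreal (norm k powr (\<gamma> - real ?n))) \<partial>lborel)"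
  proof (intro nn_integral_cong)
    fix k
    have "indicator (E_set lam (\<gamma> / q) f) (x, x + R *\<^sub>R k) = (indicator ?B k :: ennreal)"
      using E[of k] by (simp add: indicator_def)
    moreover have "ennreal (norm (x - (x + R *\<^sub>R k)) powr (\<gamma> - real ?n)) = ennreal (R powr (\<gamma> - real ?n)) * ennreal (norm k powr (\<gamma> - real ?n))"
      using R by (simp add: powr_mult flip: ennreal_mult)
    ultimately show "indicator (E_set lam (\<gamma> / q) f) (x, x + R *\<^sub>R k) * ennreal (norm (x - (x + R *\<^sub>R k)) powr (\<gamma> - real ?n))
      = ennreal (R powr (\<gamma> - real ?n)) * (indicator ?B k * ennreal (norm k powr (\<gamma> - real ?n)))"
      by (simp only: mult_ac)
  qed
  also have "\<dots> = ennreal (R powr (\<gamma> - real ?n)) * (\<integral>\<^sup>+k. indicator ?B k * ennreal (norm k powr (\<gamma> - real ?n)) \<partial>lborel)"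
    by (intro nn_integral_cmult) measurable
  also have "ennreal (R ^ ?n) * (ennreal (R powr (\<gamma> - real ?n)) * (\<integral>\<^sup>+k. indicator ?B k * ennreal (norm k powr (\<gamma> - real ?n)) \<partial>lborel))
      = ennreal (lam powr (- q)) * (\<integral>\<^sup>+k. indicator ?B k * ennreal (norm k powr (\<gamma> - real ?n)) \<partial>lborel)"
    using R by (simp add: mult.assoc[symmetric] powr_diff powr_realpow Rg flip: ennreal_mult)
  finally have I: "(\<integral>\<^sup>+y. indicator (E_set lam (\<gamma> / q) f) (x, y) * ennreal (norm (x - y) powr (\<gamma> - real ?n)) \<partial>lborel)
      = ennreal (lam powr (- q)) * (\<integral>\<^sup>+k. indicator ?B k * ennreal (norm k powr (\<gamma> - real ?n)) \<partial>lborel)" .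
  have "enn_powr (ennreal lam * G_fun \<gamma> q lam f x) q = ennreal (lam powr q) * (ennreal (lam powr (- q)) * (\<integral>\<^sup>+k. indicator ?B k * ennreal (norm k powr (\<gamma> - real ?n)) \<partial>lborel))"
    unfolding G_fun_def nn_integral_completion I enn_powr_mult[of "ennreal lam"] enn_powr_inverse(2)[OF q]
    using lam by (simp add: enn_powr_ennreal)
  also have "\<dots> = (\<integral>\<^sup>+k. indicator ?B k * ennreal (norm k powr (\<gamma> - real ?n)) \<partial>lborel)"
    using lam by (simp add: mult.assoc[symmetric] powr_minus flip: ennreal_mult)
  finally show ?thesis .
qed

text \<open>The minimum of two bounds: the volume of the ball containing the ring, and Chebyshev's
  inequality for the increments, with \<open>bd\<close> taken at radius \<open>R * \<rho>\<close>.
  The dependence on \<open>R\<close> cancels, which is what makes the final estimate uniform in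
  \<open>lam\<close>.\<close>

lemma blowup_ring_bound:
  fixes f :: "'a::euclidean_space \<Rightarrow> real"
  assumes [measurable]: "f \<in> borel_measurable borel" and p: "0 < p" and C: "0 \<le> C" and N: "0 \<le> N"
    and R: "0 < R" and \<rho>: "0 < \<rho>"
    and bd: "\<And>R. 0 < R \<Longrightarrow> (\<integral>\<^sup>+k\<in>ball 0 1. ennreal (\<bar>f (x + R *\<^sub>R k) - f x\<bar> powr p) \<partial>lborel) \<le> ennreal (C * R powr p * N powr p)"
  shows "emeasure lborel (blowup_set \<beta> (\<lambda>k. (f (x + R *\<^sub>R k) - f x) / R) \<inter> dyadic_ring \<rho>)
    \<le> ennreal (\<rho> ^ DIM('a) * min (vol TYPE('a)) (2 powr (\<bar>\<beta>\<bar> * p) * C * \<rho> powr ((1 - \<beta>) * p) * N powr p))"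
proof -
  let ?n = "DIM('a)" and ?D = "\<lambda>k. \<bar>f (x + R *\<^sub>R k) - f x\<bar>"
  let ?S = "blowup_set \<beta> (\<lambda>k. (f (x + R *\<^sub>R k) - f x) / R) \<inter> dyadic_ring \<rho>"
  have S [measurable]: "?S \<in> sets borel" by measurable
  have "emeasure lborel ?S \<le> emeasure lborel (ball (0::'a) \<rho>)"
    using dyadic_ring_subset_ball by (intro emeasure_mono) auto
  also have "\<dots> = ennreal (\<rho> ^ ?n * vol TYPE('a))"
    using \<rho> by (simp add: emeasure_lborel_ball mult.commute)
  finally have le1: "emeasure lborel ?S \<le> ennreal (\<rho> ^ ?n * vol TYPE('a))" .
  \<comment> \<open>A lower bound for the increment on the set: on the ring
    \<open>norm k powr \<beta>\<close> is at least
    \<open>2 powr (- \<bar>\<beta>\<bar>) * \<rho> powr \<beta>\<close>, whichever sign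
    \<open>\<beta>\<close> has.\<close>
  define m where "m = R * (2 powr (- \<bar>\<beta>\<bar>) * \<rho> powr \<beta>)"
  have m: "0 < m" using R \<rho> by (simp add: m_def)
  have "m \<le> ?D k" if "k \<in> ?S" for k
  proof -
    have k: "norm k < \<rho>" "\<rho> \<le> 2 * norm k" "norm k powr \<beta> < ?D k / R"
      using that R by (auto simp: dyadic_ring_def blowup_set_def abs_divide)
    have "2 powr (- \<bar>\<beta>\<bar>) \<le> (norm k / \<rho>) powr \<beta>"
    proof (cases "0 \<le> \<beta>")
      case True
      have "(1 / 2) powr \<beta> \<le> (norm k / \<rho>) powr \<beta>"
        using k \<rho> True by (intro powr_mono2) (auto simp: field_simps)
      then show ?thesis using True by (simp add: powr_minus powr_divide inverse_eq_divide)
    next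
      case False
      have "0 < norm k" using k \<rho> by linarith
      then have "1 powr \<beta> \<le> (norm k / \<rho>) powr \<beta>"
        using k \<rho> False by (intro powr_mono2') (auto simp: field_simps)
      moreover have "2 powr (- \<bar>\<beta>\<bar>) \<le> (1::real)"
        using powr_mono[of "- \<bar>\<beta>\<bar>" 0 "2::real"] by simp
      ultimately show ?thesis by simp
    qed
    then have "2 powr (- \<bar>\<beta>\<bar>) * \<rho> powr \<beta> \<le> (norm k / \<rho>) powr \<beta> * \<rho> powr \<beta>"
      by (intro mult_right_mono) auto
    also have "\<dots> = norm k powr \<beta>" using \<rho> by (simp add: powr_divide)
    finally have "2 powr (- \<bar>\<beta>\<bar>) * \<rho> powr \<beta> < ?D k / R" using k(3) by simp
    then show ?thesis using R by (simp add: m_def pos_less_divide_eq mult.commute less_imp_le)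
  qed
  then have "ennreal (m powr p) * emeasure lborel ?S \<le> (\<integral>\<^sup>+k\<in>ball 0 \<rho>. ennreal (?D k powr p) \<partial>lborel)"
  proof -
    assume le: "\<And>k. k \<in> ?S \<Longrightarrow> m \<le> ?D k"
    have "ennreal (m powr p) * emeasure lborel ?S = (\<integral>\<^sup>+k. ennreal (m powr p) * indicator ?S k \<partial>lborel)"
      by (intro nn_integral_cmult_indicator[symmetric]) simp
    also have "\<dots> \<le> (\<integral>\<^sup>+k\<in>ball 0 \<rho>. ennreal (?D k powr p) \<partial>lborel)"
    proof (intro nn_integral_mono)
      fix k :: 'a
      show "ennreal (m powr p) * indicator ?S k \<le> ennreal (?D k powr p) * indicator (ball 0 \<rho>) k"
      proof (cases "k \<in> ?S")
        case True
        then have "k \<in> ball 0 \<rho>" using dyadic_ring_subset_ball[of \<rho>] by blast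
        moreover have "m powr p \<le> ?D k powr p" using le[OF True] m p by (intro powr_mono2) auto
        ultimately show ?thesis using True by (simp add: ennreal_leI)
      qed simp
    qed
    finally show ?thesis .
  qed
  also have "(\<integral>\<^sup>+k\<in>ball 0 \<rho>. ennreal (?D k powr p) \<partial>lborel)
      = ennreal (\<rho> ^ ?n) * (\<integral>\<^sup>+k\<in>ball 0 1. ennreal (\<bar>f (x + (R * \<rho>) *\<^sub>R k) - f x\<bar> powr p) \<partial>lborel)"
    using nn_integral_ball_scale[of "\<lambda>k. ennreal (?D k powr p)" \<rho> 0 1] \<rho> by simp
  also have "\<dots> \<le> ennreal (\<rho> ^ ?n) * ennreal (C * (R * \<rho>) powr p * N powr p)"
    using R \<rho> by (intro mult_left_mono bd) auto
  also have "\<dots> = ennreal (m powr p * (\<rho> ^ ?n * (2 powr (\<bar>\<beta>\<bar> * p) * C * \<rho> powr ((1 - \<beta>) * p) * N powr p)))"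
  proof -
    have "(R * \<rho>) powr p = m powr p * (2 powr (\<bar>\<beta>\<bar> * p) * \<rho> powr ((1 - \<beta>) * p))"
    proof -
      have "(2 powr (- \<bar>\<beta>\<bar>)) powr p * 2 powr (\<bar>\<beta>\<bar> * p) = (1::real)"
        by (simp add: powr_powr flip: powr_add)
      moreover have "\<rho> powr (\<beta> * p) * \<rho> powr ((1 - \<beta>) * p) = \<rho> powr p"
        by (simp add: algebra_simps flip: powr_add)
      moreover have "m powr p * (2 powr (\<bar>\<beta>\<bar> * p) * \<rho> powr ((1 - \<beta>) * p))
        = R powr p * (((2 powr (- \<bar>\<beta>\<bar>)) powr p * 2 powr (\<bar>\<beta>\<bar> * p)) * (\<rho> powr (\<beta> * p) * \<rho> powr ((1 - \<beta>) * p)))"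
        unfolding m_def powr_mult powr_powr[of \<rho>] by (simp only: mult_ac)
      ultimately show ?thesis by (simp add: powr_mult)
    qed
    then show ?thesis using R \<rho> C by (simp add: mult_ac flip: ennreal_mult)
  qed
  finally have "emeasure lborel ?S \<le> ennreal (\<rho> ^ ?n * (2 powr (\<bar>\<beta>\<bar> * p) * C * \<rho> powr ((1 - \<beta>) * p) * N powr p))"
    by (rule ennreal_scaled_le_cancel) (use m \<rho> C in auto)
  with le1 show ?thesis by (simp add: min_def)
qed


text \<open>The crossover radius of the two bounds is \<open>N powr (q / \<gamma>)\<close>; the condition \<open>q < p\<close>
  makes both halves converge, whatever the sign of \<open>\<gamma>\<close>.\<close>
lemma nn_integral_min_powr_le:
  assumes \<gamma>: "\<gamma> \<noteq> 0" and q: "0 < q" "q < p" and A: "0 < A" and B: "0 \<le> B" and N: "0 \<le> N"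
  shows "(\<integral>\<^sup>+\<rho>\<in>{0<..}. ennreal (\<rho> powr (\<gamma> - 1) * min A (B * \<rho> powr (- \<gamma> / q * p) * N powr p)) \<partial>lborel)
    \<le> ennreal ((A / \<bar>\<gamma>\<bar> + B / (\<bar>\<gamma>\<bar> * (p / q - 1))) * N powr q)"
proof (cases "N = 0")
  case True
  then show ?thesis using A by simp
next
  case False
  then have N0: "0 < N" using N by simp
  define b where "b = N powr (q / \<gamma>)"
  \<comment> \<open>Total exponent of \<open>\<rho>\<close> under the Chebyshev bound;
    \<open>e + 1\<close> has the sign opposite to that of \<open>\<gamma>\<close> precisely because
    \<open>p > q\<close>.\<close>
  define e where "e = \<gamma> - 1 + (- \<gamma> / q * p)"
  have b: "0 < b" "b powr \<gamma> = N powr q" using N0 \<gamma> by (auto simp: b_def powr_powr)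
  have pq: "0 < p / q - 1" using q by simp
  have e1: "e + 1 = - (\<gamma> * (p / q - 1))" by (simp add: e_def algebra_simps)
  have be: "b powr (e + 1) * N powr p = N powr q"
  proof -
    have "q / \<gamma> * (e + 1) = q - p" unfolding e1 using \<gamma> q by (simp add: field_simps)
    then have "b powr (e + 1) = N powr (q - p)" by (simp add: b_def powr_powr)
    then show ?thesis by (simp flip: powr_add)
  qed
  \<comment> \<open>The side of the crossover \<open>b\<close> on which \<open>A\<close> bounds the
    minimum: near 0 for positive \<open>\<gamma>\<close>, near infinity for negative
    \<open>\<gamma>\<close>. \<open>I2\<close> is the other side.\<close>
  define I1 where "I1 = (if 0 < \<gamma> then {0<..<b} else {b<..})"
  define I2 where "I2 = (if 0 < \<gamma> then {b<..} else {0<..<b})"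
  have [measurable]: "I1 \<in> sets borel" "I2 \<in> sets borel" by (auto simp: I1_def I2_def)
  have int1: "(\<integral>\<^sup>+\<rho>\<in>I1. ennreal (\<rho> powr (\<gamma> - 1)) \<partial>lborel) = ennreal (N powr q / \<bar>\<gamma>\<bar>)"
  proof (cases "0 < \<gamma>")
    case True
    then show ?thesis using b nn_integral_powr_0[of "\<gamma> - 1" b] by (simp add: I1_def)
  next
    case False
    then show ?thesis using b \<gamma> nn_integral_powr_top[of "\<gamma> - 1" b] by (simp add: I1_def)
  qed
  have int2: "(\<integral>\<^sup>+\<rho>\<in>I2. ennreal (\<rho> powr e) \<partial>lborel) = ennreal (b powr (e + 1) / (\<bar>\<gamma>\<bar> * (p / q - 1)))"
  proof (cases "0 < \<gamma>")
    case True
    then have "0 < \<gamma> * (p / q - 1)" using pq by simp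
    then have "e < -1" using e1 by linarith
    then have "(\<integral>\<^sup>+\<rho>\<in>I2. ennreal (\<rho> powr e) \<partial>lborel) = ennreal (- (b powr (e + 1) / (e + 1)))"
      using b True by (simp add: I2_def nn_integral_powr_top)
    also have "- (b powr (e + 1) / (e + 1)) = b powr (e + 1) / (\<bar>\<gamma>\<bar> * (p / q - 1))"
      unfolding e1 using True by simp
    finally show ?thesis .
  next
    case False
    then have "\<gamma> * (p / q - 1) < 0" using pq \<gamma> by (simp add: mult_neg_pos)
    then have "-1 < e" using e1 by linarith
    then have "(\<integral>\<^sup>+\<rho>\<in>I2. ennreal (\<rho> powr e) \<partial>lborel) = ennreal (b powr (e + 1) / (e + 1))"
      using b False by (simp add: I2_def nn_integral_powr_0)
    also have "b powr (e + 1) / (e + 1) = b powr (e + 1) / (\<bar>\<gamma>\<bar> * (p / q - 1))"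
      unfolding e1 using False by simp
    finally show ?thesis .
  qed
  have "(\<integral>\<^sup>+\<rho>\<in>{0<..}. ennreal (\<rho> powr (\<gamma> - 1) * min A (B * \<rho> powr (- \<gamma> / q * p) * N powr p)) \<partial>lborel)
    \<le> (\<integral>\<^sup>+\<rho>. ennreal A * (ennreal (\<rho> powr (\<gamma> - 1)) * indicator I1 \<rho>) + ennreal (B * N powr p) * (ennreal (\<rho> powr e) * indicator I2 \<rho>) \<partial>lborel)"
  proof (rule nn_integral_mono_AE)
    have "AE \<rho> in lborel. \<rho> \<noteq> b" by (rule AE_lborel_singleton)
    then show "AE \<rho> in lborel. ennreal (\<rho> powr (\<gamma> - 1) * min A (B * \<rho> powr (- \<gamma> / q * p) * N powr p)) * indicator {0<..} \<rho>
      \<le> ennreal A * (ennreal (\<rho> powr (\<gamma> - 1)) * indicator I1 \<rho>) + ennreal (B * N powr p) * (ennreal (\<rho> powr e) * indicator I2 \<rho>)"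
    proof eventually_elim
      case (elim \<rho>)
      let ?m = "min A (B * \<rho> powr (- \<gamma> / q * p) * N powr p)"
      show ?case
      proof (cases "0 < \<rho>")
        case True
        have "\<rho> \<in> I1 \<or> \<rho> \<in> I2" using True elim by (auto simp: I1_def I2_def)
        then show ?thesis
        proof
          assume i: "\<rho> \<in> I1"
          have "ennreal (\<rho> powr (\<gamma> - 1) * ?m) \<le> ennreal (\<rho> powr (\<gamma> - 1) * A)"
            by (intro ennreal_leI mult_left_mono) auto
          then show ?thesis using i True A by (simp add: ennreal_mult mult.commute add_increasing2)
        next
          assume i: "\<rho> \<in> I2"
          have "ennreal (\<rho> powr (\<gamma> - 1) * ?m) \<le> ennreal (\<rho> powr (\<gamma> - 1) * (B * \<rho> powr (- \<gamma> / q * p) * N powr p))"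
            by (intro ennreal_leI mult_left_mono) auto
          also have "\<rho> powr (\<gamma> - 1) * (B * \<rho> powr (- \<gamma> / q * p) * N powr p) = (B * N powr p) * \<rho> powr e"
            unfolding e_def powr_add by simp
          also have "ennreal ((B * N powr p) * \<rho> powr e) = ennreal (B * N powr p) * ennreal (\<rho> powr e)"
            using B by (intro ennreal_mult) auto
          finally show ?thesis using i True by (simp add: add_increasing)
        qed
      qed simp
    qed
  qed
  also have "\<dots> = ennreal A * ennreal (N powr q / \<bar>\<gamma>\<bar>) + ennreal (B * N powr p) * ennreal (b powr (e + 1) / (\<bar>\<gamma>\<bar> * (p / q - 1)))"
    by (simp add: nn_integral_add nn_integral_cmult int1 int2)
  also have "\<dots> = ennreal (A * (N powr q / \<bar>\<gamma>\<bar>) + B * N powr p * (b powr (e + 1) / (\<bar>\<gamma>\<bar> * (p / q - 1))))"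
    using A B pq by (simp flip: ennreal_mult ennreal_plus)
  also have "A * (N powr q / \<bar>\<gamma>\<bar>) + B * N powr p * (b powr (e + 1) / (\<bar>\<gamma>\<bar> * (p / q - 1)))
      = (A / \<bar>\<gamma>\<bar> + B / (\<bar>\<gamma>\<bar> * (p / q - 1))) * N powr q"
  proof -
    have "B * N powr p * (X / D) = B / D * (X * N powr p)" for X D by simp
    then show ?thesis unfolding be by (simp only: be) (simp add: distrib_right)
  qed
  finally show ?thesis .
qed

text \<open>The ring bounds, integrated over \<open>\<rho>\<close>. The estimate for a single ring
  is kept as a second conclusion because it provides the majorant, independent of \<open>R\<close>,
  for the passage to the limit.\<close>

lemma blowup_integral_bound:
  fixes f :: "'a::euclidean_space \<Rightarrow> real"
  assumes f [measurable]: "f \<in> borel_measurable borel" and \<gamma>: "\<gamma> \<noteq> 0" and q: "0 < q" "q < p" and C: "0 \<le> C" and N: "0 \<le> N"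
    and R: "0 < R"
    and bd: "\<And>R. 0 < R \<Longrightarrow> (\<integral>\<^sup>+k\<in>ball 0 1. ennreal (\<bar>f (x + R *\<^sub>R k) - f x\<bar> powr p) \<partial>lborel) \<le> ennreal (C * R powr p * N powr p)"
  defines "\<beta> \<equiv> 1 + \<gamma> / q" and "n \<equiv> real DIM('a)"
  shows "(\<integral>\<^sup>+k. indicator (blowup_set \<beta> (\<lambda>k. (f (x + R *\<^sub>R k) - f x) / R)) k * ennreal (norm k powr (\<gamma> - n)) \<partial>lborel)
    \<le> ennreal (1 / layer_const (\<gamma> - n) * (vol TYPE('a) / \<bar>\<gamma>\<bar> + 2 powr (\<bar>\<beta>\<bar> * p) * C / (\<bar>\<gamma>\<bar> * (p / q - 1))) * N powr q)"
    and "0 < \<rho> \<Longrightarrow> ennreal (\<rho> powr (\<gamma> - n - 1)) * emeasure lborel (blowup_set \<beta> (\<lambda>k. (f (x + R *\<^sub>R k) - f x) / R) \<inter> dyadic_ring \<rho>)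
      \<le> ennreal (\<rho> powr (\<gamma> - 1) * min (vol TYPE('a)) (2 powr (\<bar>\<beta>\<bar> * p) * C * \<rho> powr (- \<gamma> / q * p) * N powr p))"
proof -
  let ?S = "blowup_set \<beta> (\<lambda>k. (f (x + R *\<^sub>R k) - f x) / R)"
  let ?m = "\<lambda>\<rho>. min (vol TYPE('a)) (2 powr (\<bar>\<beta>\<bar> * p) * C * \<rho> powr (- \<gamma> / q * p) * N powr p)"
  let ?l = "layer_const (\<gamma> - n)"
  have S [measurable]: "?S \<in> sets borel" by measurable
  show dyadic_ring: "ennreal (\<rho> powr (\<gamma> - n - 1)) * emeasure lborel (?S \<inter> dyadic_ring \<rho>) \<le> ennreal (\<rho> powr (\<gamma> - 1) * ?m \<rho>)" if \<rho>: "0 < \<rho>" for \<rho>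
  proof -
    have m0: "0 \<le> ?m \<rho>" using C by simp
    have "emeasure lborel (?S \<inter> dyadic_ring \<rho>) \<le> ennreal (\<rho> ^ DIM('a) * min (vol TYPE('a)) (2 powr (\<bar>\<beta>\<bar> * p) * C * \<rho> powr ((1 - \<beta>) * p) * N powr p))"
      using q by (intro blowup_ring_bound[OF f _ C N R \<rho> bd]) auto
    also have "(1 - \<beta>) * p = - \<gamma> / q * p" by (simp add: \<beta>_def)
    finally have "ennreal (\<rho> powr (\<gamma> - n - 1)) * emeasure lborel (?S \<inter> dyadic_ring \<rho>) \<le> ennreal (\<rho> powr (\<gamma> - n - 1)) * ennreal (\<rho> ^ DIM('a) * ?m \<rho>)"
      by (rule mult_left_mono) simp
    also have "\<dots> = ennreal (\<rho> powr (\<gamma> - n - 1) * (\<rho> ^ DIM('a) * ?m \<rho>))"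
      using \<rho> m0 by (intro ennreal_mult[symmetric]) auto
    also have "\<rho> powr (\<gamma> - n - 1) * (\<rho> ^ DIM('a) * ?m \<rho>) = \<rho> powr (\<gamma> - 1) * ?m \<rho>"
    proof -
      have "\<rho> powr (\<gamma> - n - 1) * \<rho> ^ DIM('a) = \<rho> powr (\<gamma> - 1)"
        using \<rho> by (simp add: n_def powr_realpow[symmetric] flip: powr_add)
      then show ?thesis by (simp only: mult.assoc[symmetric])
    qed
    finally show ?thesis .
  qed
  have "ennreal ?l * (\<integral>\<^sup>+k. indicator ?S k * ennreal (norm k powr (\<gamma> - n)) \<partial>lborel)
      = (\<integral>\<^sup>+\<rho>\<in>{0<..}. (ennreal (\<rho> powr (\<gamma> - n - 1)) * emeasure lborel (?S \<inter> dyadic_ring \<rho>)) \<partial>lborel)"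
    by (rule nn_integral_norm_powr_layers[OF S])
  also have "\<dots> \<le> (\<integral>\<^sup>+\<rho>\<in>{0<..}. ennreal (\<rho> powr (\<gamma> - 1) * ?m \<rho>) \<partial>lborel)"
    using dyadic_ring by (intro nn_integral_mono) (auto simp: indicator_def)
  also have "\<dots> \<le> ennreal ((vol TYPE('a) / \<bar>\<gamma>\<bar> + 2 powr (\<bar>\<beta>\<bar> * p) * C / (\<bar>\<gamma>\<bar> * (p / q - 1))) * N powr q)"
    using C by (intro nn_integral_min_powr_le \<gamma> q N) auto
  also have "(vol TYPE('a) / \<bar>\<gamma>\<bar> + 2 powr (\<bar>\<beta>\<bar> * p) * C / (\<bar>\<gamma>\<bar> * (p / q - 1))) * N powr q
      = ?l * (1 / ?l * (vol TYPE('a) / \<bar>\<gamma>\<bar> + 2 powr (\<bar>\<beta>\<bar> * p) * C / (\<bar>\<gamma>\<bar> * (p / q - 1))) * N powr q)"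
    using layer_const(2)[of "\<gamma> - n"] by simp
  finally have scaled: "ennreal ?l * (\<integral>\<^sup>+k. indicator ?S k * ennreal (norm k powr (\<gamma> - n)) \<partial>lborel)
    \<le> ennreal (?l * (1 / ?l * (vol TYPE('a) / \<bar>\<gamma>\<bar> + 2 powr (\<bar>\<beta>\<bar> * p) * C / (\<bar>\<gamma>\<bar> * (p / q - 1))) * N powr q))" .
  have "0 \<le> vol TYPE('a) / \<bar>\<gamma>\<bar> + 2 powr (\<bar>\<beta>\<bar> * p) * C / (\<bar>\<gamma>\<bar> * (p / q - 1))"
    using C q by (intro add_nonneg_nonneg divide_nonneg_nonneg mult_nonneg_nonneg) auto
  then show "(\<integral>\<^sup>+k. indicator ?S k * ennreal (norm k powr (\<gamma> - n)) \<partial>lborel)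
    \<le> ennreal (1 / ?l * (vol TYPE('a) / \<bar>\<gamma>\<bar> + 2 powr (\<bar>\<beta>\<bar> * p) * C / (\<bar>\<gamma>\<bar> * (p / q - 1))) * N powr q)"
    using layer_const(2)[of "\<gamma> - n"] by (intro ennreal_scaled_le_cancel[OF scaled]) auto
qed

section \<open>Convergence of the blown-up sets\<close>

text \<open>The sets where \<open>h\<close> and \<open>hj j\<close> are positive can differ only
  where \<open>\<bar>h x\<bar> \<le> \<eta>\<close> or
  \<open>\<eta> \<le> \<bar>hj j x - h x\<bar>\<close>. The former has small measure for small
  \<open>\<eta>\<close>, as \<open>S\<close> has finite measure and the zero set is null; the latter
  by Chebyshev's inequality for large \<open>j\<close>.\<close>

lemma emeasure_superlevel_tendsto:
  fixes h :: "'a::euclidean_space \<Rightarrow> real" and hj :: "nat \<Rightarrow> 'a \<Rightarrow> real"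
  assumes [measurable]: "h \<in> borel_measurable borel" "\<And>j. hj j \<in> borel_measurable borel" "S \<in> sets borel"
    and S: "emeasure lborel S < \<infinity>" and p: "0 < p"
    and lim: "(\<lambda>j. \<integral>\<^sup>+x\<in>S. ennreal (\<bar>hj j x - h x\<bar> powr p) \<partial>lborel) \<longlonglongrightarrow> 0"
    and null: "emeasure lborel {x \<in> S. h x = 0} = 0"
  shows "(\<lambda>j. emeasure lborel {x \<in> S. 0 < hj j x}) \<longlonglongrightarrow> emeasure lborel {x \<in> S. 0 < h x}"
proof -
  have fin: "emeasure lborel {x \<in> S. P x} < \<infinity>" for P
  proof -
    have "emeasure lborel {x \<in> S. P x} \<le> emeasure lborel S" by (intro emeasure_mono) auto
    then show ?thesis using S by (rule le_less_trans)
  qed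
  define a where "a = measure lborel {x \<in> S. 0 < h x}"
  define b where "b j = measure lborel {x \<in> S. 0 < hj j x}" for j
  have a: "emeasure lborel {x \<in> S. 0 < h x} = ennreal a" and b: "emeasure lborel {x \<in> S. 0 < hj j x} = ennreal (b j)" for j
    unfolding a_def b_def using fin[of "\<lambda>x. 0 < h x"] fin[of "\<lambda>x. 0 < hj j x"]
    by (auto intro!: emeasure_eq_ennreal_measure simp: less_top)
  have a0: "0 \<le> a" "0 \<le> b j" for j by (auto simp: a_def b_def)
  have "(\<lambda>k. emeasure lborel {x \<in> S. \<bar>h x\<bar> \<le> 1 / real (Suc k)}) \<longlonglongrightarrow> emeasure lborel (\<Inter>k. {x \<in> S. \<bar>h x\<bar> \<le> 1 / real (Suc k)})"
  proof (rule Lim_emeasure_decseq)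
    show "decseq (\<lambda>k. {x \<in> S. \<bar>h x\<bar> \<le> 1 / real (Suc k)})"
    proof (rule decseq_SucI, safe)
      fix k x assume "\<bar>h x\<bar> \<le> 1 / real (Suc (Suc k))"
      also have "\<dots> \<le> 1 / real (Suc k)" by (simp add: field_simps)
      finally show "\<bar>h x\<bar> \<le> 1 / real (Suc k)" .
    qed
  qed (use fin in \<open>auto simp: less_top\<close>)
  also have "(\<Inter>k. {x \<in> S. \<bar>h x\<bar> \<le> 1 / real (Suc k)}) = {x \<in> S. h x = 0}"
  proof (intro equalityI subsetI)
    fix x assume x: "x \<in> (\<Inter>k. {x \<in> S. \<bar>h x\<bar> \<le> 1 / real (Suc k)})"
    have "\<not> 0 < \<bar>h x\<bar>"
    proof
      assume "0 < \<bar>h x\<bar>"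
      then obtain k where "1 / real (Suc k) < \<bar>h x\<bar>" using nat_approx_posE[of "\<bar>h x\<bar>"] by (auto simp: inverse_eq_divide)
      moreover have "\<bar>h x\<bar> \<le> 1 / real (Suc k)" using x by blast
      ultimately show False by linarith
    qed
    then show "x \<in> {x \<in> S. h x = 0}" using x by auto
  qed auto
  finally have D: "(\<lambda>k. emeasure lborel {x \<in> S. \<bar>h x\<bar> \<le> 1 / real (Suc k)}) \<longlonglongrightarrow> 0"
    unfolding null .
  have "b \<longlonglongrightarrow> a"
  proof (rule LIMSEQ_I)
    fix e :: real assume e: "0 < e"
    have "\<forall>\<^sub>F k in sequentially. emeasure lborel {x \<in> S. \<bar>h x\<bar> \<le> 1 / real (Suc k)} < ennreal (e / 3)"
      using D e by (intro order_tendstoD) auto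
    then obtain k where k: "emeasure lborel {x \<in> S. \<bar>h x\<bar> \<le> 1 / real (Suc k)} < ennreal (e / 3)"
      unfolding eventually_sequentially by blast
    \<comment> \<open>\<open>\<eta>\<close> depends on \<open>e\<close> and \<open>h\<close> only
      and is fixed before \<open>j\<close>; both sets are then below \<open>e / 3\<close>.\<close>
    define \<eta> where "\<eta> = 1 / real (Suc k)"
    have \<eta>: "0 < \<eta>" by (simp add: \<eta>_def)
    have "\<forall>\<^sub>F j in sequentially. (\<integral>\<^sup>+x\<in>S. ennreal (\<bar>hj j x - h x\<bar> powr p) \<partial>lborel) < ennreal (\<eta> powr p * (e / 3))"
      using lim e \<eta> by (intro order_tendstoD) auto
    then obtain j0 where j0: "\<And>j. j0 \<le> j \<Longrightarrow> (\<integral>\<^sup>+x\<in>S. ennreal (\<bar>hj j x - h x\<bar> powr p) \<partial>lborel) < ennreal (\<eta> powr p * (e / 3))"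
      unfolding eventually_sequentially by blast
    have "norm (b j - a) < e" if j: "j0 \<le> j" for j
    proof -
      let ?D = "{x \<in> S. \<bar>h x\<bar> \<le> \<eta>}" and ?E = "{x \<in> S. \<eta> \<le> \<bar>hj j x - h x\<bar>}"
      have "ennreal (\<eta> powr p) * emeasure lborel ?E = (\<integral>\<^sup>+x. ennreal (\<eta> powr p) * indicator ?E x \<partial>lborel)"
        by (intro nn_integral_cmult_indicator[symmetric]) simp
      also have "\<dots> \<le> (\<integral>\<^sup>+x\<in>S. ennreal (\<bar>hj j x - h x\<bar> powr p) \<partial>lborel)"
        using p \<eta> by (intro nn_integral_mono) (auto simp: indicator_def intro!: ennreal_leI powr_mono2)
      also have "\<dots> \<le> ennreal (\<eta> powr p * (e / 3))" using j0[OF j] by simp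
      finally have E: "emeasure lborel ?E \<le> ennreal (e / 3)"
        by (rule ennreal_scaled_le_cancel) (use \<eta> e in auto)
      have D': "emeasure lborel ?D \<le> ennreal (e / 3)" using k by (simp add: \<eta>_def)
      have DE: "emeasure lborel (?D \<union> ?E) \<le> ennreal (2 * e / 3)"
      proof -
        have "emeasure lborel (?D \<union> ?E) \<le> emeasure lborel ?D + emeasure lborel ?E"
          by (intro emeasure_subadditive) auto
        also have "\<dots> \<le> ennreal (e / 3) + ennreal (e / 3)" by (intro add_mono D' E)
        also have "\<dots> = ennreal (2 * e / 3)" using e by (simp flip: ennreal_plus)
        finally show ?thesis .
      qed
      have "ennreal (b j) \<le> ennreal (a + 2 * e / 3)"
      proof -
        have "ennreal (b j) \<le> emeasure lborel ({x \<in> S. 0 < h x} \<union> (?D \<union> ?E))"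
          unfolding b[symmetric] by (intro emeasure_mono) auto
        also have "\<dots> \<le> emeasure lborel {x \<in> S. 0 < h x} + emeasure lborel (?D \<union> ?E)"
          by (intro emeasure_subadditive) auto
        also have "\<dots> \<le> ennreal a + ennreal (2 * e / 3)"
          unfolding a by (intro add_left_mono DE)
        also have "\<dots> = ennreal (a + 2 * e / 3)" using e a0 by (simp flip: ennreal_plus)
        finally show ?thesis .
      qed
      then have 1: "b j \<le> a + 2 * e / 3" using a0 e by (subst (asm) ennreal_le_iff) auto
      have "ennreal a \<le> ennreal (b j + 2 * e / 3)"
      proof -
        have "ennreal a \<le> emeasure lborel ({x \<in> S. 0 < hj j x} \<union> (?D \<union> ?E))"
          unfolding a[symmetric] by (intro emeasure_mono) auto
        also have "\<dots> \<le> emeasure lborel {x \<in> S. 0 < hj j x} + emeasure lborel (?D \<union> ?E)"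
          by (intro emeasure_subadditive) auto
        also have "\<dots> \<le> ennreal (b j) + ennreal (2 * e / 3)"
          unfolding b by (intro add_left_mono DE)
        also have "\<dots> = ennreal (b j + 2 * e / 3)" using e a0 by (simp flip: ennreal_plus)
        finally show ?thesis .
      qed
      then have 2: "a \<le> b j + 2 * e / 3" using a0 e by (subst (asm) ennreal_le_iff) auto
      show ?thesis using 1 2 e by (simp add: abs_less_iff)
    qed
    then show "\<exists>no. \<forall>n\<ge>no. norm (b n - a) < e" by blast
  qed
  then show ?thesis unfolding a b by (rule tendsto_ennrealI)
qed

text \<open>Each ring has finite measure, so convergence of the quotients in the \<open>p\<close>-th
  mean on balls gives convergence of the measures ring by ring. Dominated convergence in
  \<open>\<rho>\<close> then reaches the whole space, where the weight may be singular at 0 or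
  slowly decaying at infinity.\<close>

lemma blowup_integral_tendsto:
  fixes f :: "'a::euclidean_space \<Rightarrow> real" and R :: "nat \<Rightarrow> real"
  assumes f [measurable]: "f \<in> borel_measurable borel" and \<gamma>: "\<gamma> \<noteq> 0" and q: "0 < q" "q < p" and C: "0 \<le> C" and N: "0 \<le> N"
    and R: "\<And>j. 0 < R j"
    and bd: "\<And>R. 0 < R \<Longrightarrow> (\<integral>\<^sup>+k\<in>ball 0 1. ennreal (\<bar>f (x + R *\<^sub>R k) - f x\<bar> powr p) \<partial>lborel) \<le> ennreal (C * R powr p * N powr p)"
    and diff: "\<And>\<rho>. 0 < \<rho> \<Longrightarrow> (\<lambda>j. \<integral>\<^sup>+k\<in>ball 0 \<rho>. ennreal (\<bar>(f (x + R j *\<^sub>R k) - f x) / R j - v \<bullet> k\<bar> powr p) \<partial>lborel) \<longlonglongrightarrow> 0"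
  defines "\<beta> \<equiv> 1 + \<gamma> / q" and "n \<equiv> real DIM('a)"
  shows "(\<lambda>j. \<integral>\<^sup>+k. indicator (blowup_set \<beta> (\<lambda>k. (f (x + R j *\<^sub>R k) - f x) / R j)) k * ennreal (norm k powr (\<gamma> - n)) \<partial>lborel)
    \<longlonglongrightarrow> ennreal (kappa q TYPE('a) / \<bar>\<gamma>\<bar> * norm v powr q)"
proof -
  let ?U = "\<lambda>j k. (f (x + R j *\<^sub>R k) - f x) / R j"
  let ?S = "\<lambda>j. blowup_set \<beta> (?U j)" and ?T = "blowup_set \<beta> (\<lambda>k. v \<bullet> k)"
  let ?l = "layer_const (\<gamma> - n)"
  let ?w = "\<lambda>\<rho>. ennreal (\<rho> powr (\<gamma> - 1) * min (vol TYPE('a)) (2 powr (\<bar>\<beta>\<bar> * p) * C * \<rho> powr (- \<gamma> / q * p) * N powr p)) * indicator {0<..} \<rho>"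
  have [measurable]: "?S j \<in> sets borel" "?T \<in> sets borel" for j by measurable
  have ring_meas [measurable]: "(\<lambda>\<rho>. emeasure lborel (X \<inter> dyadic_ring \<rho>)) \<in> borel_measurable borel" if [measurable]: "X \<in> sets borel" for X :: "'a set"
  proof -
    have "(\<lambda>\<rho>. \<integral>\<^sup>+k. indicator X k * indicator {(k::'a, \<rho>). norm k < \<rho> \<and> \<rho> \<le> 2 * norm k} (k, \<rho>) \<partial>lborel) \<in> borel_measurable borel"
      by measurable
    also have "(\<lambda>\<rho>. \<integral>\<^sup>+k. indicator X k * indicator {(k::'a, \<rho>). norm k < \<rho> \<and> \<rho> \<le> 2 * norm k} (k, \<rho>) \<partial>lborel) = (\<lambda>\<rho>. emeasure lborel (X \<inter> dyadic_ring \<rho>))"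
    proof
      fix \<rho> :: real
      have "(\<integral>\<^sup>+k. indicator X k * indicator {(k::'a, \<rho>). norm k < \<rho> \<and> \<rho> \<le> 2 * norm k} (k, \<rho>) \<partial>lborel) = (\<integral>\<^sup>+k. indicator (X \<inter> dyadic_ring \<rho>) k \<partial>lborel)"
        by (intro nn_integral_cong) (auto simp: indicator_def dyadic_ring_def)
      then show "(\<integral>\<^sup>+k. indicator X k * indicator {(k::'a, \<rho>). norm k < \<rho> \<and> \<rho> \<le> 2 * norm k} (k, \<rho>) \<partial>lborel) = emeasure lborel (X \<inter> dyadic_ring \<rho>)"
        by simp
    qed
    finally show ?thesis .
  qed
  \<comment> \<open>Applied to \<open>\<bar>U k\<bar> - norm k powr \<beta>\<close> for the quotient
    \<open>U\<close> and for its linear limit; the powers cancel in the difference of the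
    two.\<close>
  have slice: "(\<lambda>j. emeasure lborel (?S j \<inter> dyadic_ring \<rho>)) \<longlonglongrightarrow> emeasure lborel (?T \<inter> dyadic_ring \<rho>)" if \<rho>: "0 < \<rho>" for \<rho>
  proof -
    have k0: "k \<noteq> 0" if "k \<in> dyadic_ring \<rho>" for k :: 'a using that \<rho> by (auto simp: dyadic_ring_def)
    have "(\<lambda>j. emeasure lborel {k \<in> dyadic_ring \<rho>. 0 < \<bar>?U j k\<bar> - norm k powr \<beta>}) \<longlonglongrightarrow> emeasure lborel {k \<in> dyadic_ring \<rho>. 0 < \<bar>v \<bullet> k\<bar> - norm k powr \<beta>}"
    proof (rule emeasure_superlevel_tendsto[where p=p])
      have "emeasure lborel (dyadic_ring \<rho> :: 'a set) \<le> emeasure lborel (ball (0::'a) \<rho>)"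
        using dyadic_ring_subset_ball by (intro emeasure_mono) auto
      then show "emeasure lborel (dyadic_ring \<rho> :: 'a set) < \<infinity>"
        using emeasure_lborel_ball_finite[of "0::'a" \<rho>] by (rule le_less_trans)
      show "(\<lambda>j. \<integral>\<^sup>+k\<in>dyadic_ring \<rho>. ennreal (\<bar>(\<bar>?U j k\<bar> - norm k powr \<beta>) - (\<bar>v \<bullet> k\<bar> - norm k powr \<beta>)\<bar> powr p) \<partial>lborel) \<longlonglongrightarrow> 0"
      proof (rule tendsto_sandwich[OF _ _ tendsto_const diff[OF \<rho>]])
        show "\<forall>\<^sub>F j in sequentially. (\<integral>\<^sup>+k\<in>dyadic_ring \<rho>. ennreal (\<bar>(\<bar>?U j k\<bar> - norm k powr \<beta>) - (\<bar>v \<bullet> k\<bar> - norm k powr \<beta>)\<bar> powr p) \<partial>lborel)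
          \<le> (\<integral>\<^sup>+k\<in>ball 0 \<rho>. ennreal (\<bar>?U j k - v \<bullet> k\<bar> powr p) \<partial>lborel)"
        proof (rule always_eventually, rule allI, rule nn_integral_mono)
          fix j and k :: 'a
          have "\<bar>(\<bar>?U j k\<bar> - norm k powr \<beta>) - (\<bar>v \<bullet> k\<bar> - norm k powr \<beta>)\<bar> \<le> \<bar>?U j k - v \<bullet> k\<bar>" by linarith
          then have "\<bar>(\<bar>?U j k\<bar> - norm k powr \<beta>) - (\<bar>v \<bullet> k\<bar> - norm k powr \<beta>)\<bar> powr p \<le> \<bar>?U j k - v \<bullet> k\<bar> powr p"
            using q by (intro powr_mono2) auto
          then show "ennreal (\<bar>(\<bar>?U j k\<bar> - norm k powr \<beta>) - (\<bar>v \<bullet> k\<bar> - norm k powr \<beta>)\<bar> powr p) * indicator (dyadic_ring \<rho>) k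
            \<le> ennreal (\<bar>?U j k - v \<bullet> k\<bar> powr p) * indicator (ball 0 \<rho>) k"
            using dyadic_ring_subset_ball[of \<rho>] by (cases "k \<in> dyadic_ring \<rho>") (auto intro!: ennreal_leI)
        qed
      qed auto
      have "emeasure lborel {k \<in> dyadic_ring \<rho>. \<bar>v \<bullet> k\<bar> - norm k powr \<beta> = 0} \<le> emeasure lborel {k. k \<noteq> 0 \<and> \<bar>v \<bullet> k\<bar> = norm k powr (1 + \<gamma> / q)}"
        using k0 by (intro emeasure_mono) (auto simp: \<beta>_def)
      then show "emeasure lborel {k \<in> dyadic_ring \<rho>. \<bar>v \<bullet> k\<bar> - norm k powr \<beta> = 0} = 0"
        unfolding negligible_linear_threshold[OF \<gamma> q(1)] by simp
    qed (use q in auto)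
    moreover have "{k \<in> dyadic_ring \<rho>. 0 < \<bar>?U j k\<bar> - norm k powr \<beta>} = ?S j \<inter> dyadic_ring \<rho>" for j
      using k0 by (auto simp: blowup_set_def)
    moreover have "{k \<in> dyadic_ring \<rho>. 0 < \<bar>v \<bullet> k\<bar> - norm k powr \<beta>} = ?T \<inter> dyadic_ring \<rho>"
      using k0 by (auto simp: blowup_set_def)
    ultimately show ?thesis by simp
  qed
  have "(\<lambda>j. \<integral>\<^sup>+\<rho>\<in>{0<..}. (ennreal (\<rho> powr (\<gamma> - n - 1)) * emeasure lborel (?S j \<inter> dyadic_ring \<rho>)) \<partial>lborel)
    \<longlonglongrightarrow> (\<integral>\<^sup>+\<rho>\<in>{0<..}. (ennreal (\<rho> powr (\<gamma> - n - 1)) * emeasure lborel (?T \<inter> dyadic_ring \<rho>)) \<partial>lborel)"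
  proof (rule nn_integral_dominated_convergence[where w="?w"])
    show "AE \<rho> in lborel. ennreal (\<rho> powr (\<gamma> - n - 1)) * emeasure lborel (?S j \<inter> dyadic_ring \<rho>) * indicator {0<..} \<rho> \<le> ?w \<rho>" for j
      using blowup_integral_bound(2)[OF f \<gamma> q C N R bd, of _ j] unfolding \<beta>_def n_def
      by (intro AE_I2) (auto simp: indicator_def)
    have "(\<integral>\<^sup>+\<rho>. ?w \<rho> \<partial>lborel) \<le> ennreal ((vol TYPE('a) / \<bar>\<gamma>\<bar> + 2 powr (\<bar>\<beta>\<bar> * p) * C / (\<bar>\<gamma>\<bar> * (p / q - 1))) * N powr q)"
      using C by (intro nn_integral_min_powr_le \<gamma> q N) auto
    then show "(\<integral>\<^sup>+\<rho>. ?w \<rho> \<partial>lborel) < \<infinity>" by (auto intro: le_less_trans)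
    show "AE \<rho> in lborel. (\<lambda>j. ennreal (\<rho> powr (\<gamma> - n - 1)) * emeasure lborel (?S j \<inter> dyadic_ring \<rho>) * indicator {0<..} \<rho>)
        \<longlonglongrightarrow> ennreal (\<rho> powr (\<gamma> - n - 1)) * emeasure lborel (?T \<inter> dyadic_ring \<rho>) * indicator {0<..} \<rho>"
    proof (rule AE_I2)
      fix \<rho> :: real
      show "(\<lambda>j. ennreal (\<rho> powr (\<gamma> - n - 1)) * emeasure lborel (?S j \<inter> dyadic_ring \<rho>) * indicator {0<..} \<rho>)
        \<longlonglongrightarrow> ennreal (\<rho> powr (\<gamma> - n - 1)) * emeasure lborel (?T \<inter> dyadic_ring \<rho>) * indicator {0<..} \<rho>"
        using slice[of \<rho>] by (cases "0 < \<rho>") (auto intro!: ennreal_tendsto_cmult)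
    qed
  qed measurable
  then have "(\<lambda>j. ennreal ?l * (\<integral>\<^sup>+k. indicator (?S j) k * ennreal (norm k powr (\<gamma> - n)) \<partial>lborel))
      \<longlonglongrightarrow> ennreal ?l * (\<integral>\<^sup>+k. indicator ?T k * ennreal (norm k powr (\<gamma> - n)) \<partial>lborel)"
    by (simp add: nn_integral_norm_powr_layers)
  note A = this
  have "(\<lambda>j. ennreal (1 / ?l) * (ennreal ?l * (\<integral>\<^sup>+k. indicator (?S j) k * ennreal (norm k powr (\<gamma> - n)) \<partial>lborel)))
      \<longlonglongrightarrow> ennreal (1 / ?l) * (ennreal ?l * (\<integral>\<^sup>+k. indicator ?T k * ennreal (norm k powr (\<gamma> - n)) \<partial>lborel))"
    by (rule ennreal_tendsto_cmult[OF _ A]) simp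
  moreover have "ennreal (1 / ?l) * (ennreal ?l * X) = X" for X
    using layer_const(2)[of "\<gamma> - n"] by (simp add: mult.assoc[symmetric] flip: ennreal_mult)
  moreover have "(\<integral>\<^sup>+k. indicator ?T k * ennreal (norm k powr (\<gamma> - n)) \<partial>lborel) = ennreal (kappa q TYPE('a) / \<bar>\<gamma>\<bar> * norm v powr q)"
    unfolding blowup_set_def \<beta>_def n_def by (rule nn_integral_linear_threshold[OF \<gamma> q(1)])
  ultimately show ?thesis by simp
qed

text \<open>The good points do not depend on \<open>lam\<close>, so one null set serves the bound
  for every \<open>lam\<close> and the limit along every admissible sequence. Sequences are the form
  required by dominated convergence.\<close>

lemma blowup_pointwise:
  assumes s: "1 \<le> s" and sp: "s \<le> p" and snp: "real DIM('a::euclidean_space) * (1 / s - 1 / p) < 1"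
    and \<gamma>: "\<gamma> \<noteq> 0" and q: "0 < q" "q < p"
  shows "\<exists>C>0. \<forall>(f :: 'a \<Rightarrow> real) g. f \<in> borel_measurable borel \<longrightarrow> g \<in> borel_measurable borel \<longrightarrow> weak_gradient f g \<longrightarrow>
    (\<forall>r. (\<integral>\<^sup>+y\<in>ball 0 r. ennreal (norm (g y) powr s) \<partial>lborel) < \<infinity>) \<longrightarrow>
    (AE x in lborel. maximal (\<lambda>y. ennreal (norm (g y) powr s)) x < \<infinity>) \<longrightarrow>
    (AE x in lborel.
      (\<forall>lam>0. ennreal lam * G_fun \<gamma> q lam f x \<le> ennreal C * enn_powr (maximal (\<lambda>y. ennreal (norm (g y) powr s)) x) (1 / s)) \<and>
      (\<forall>lam. (\<forall>j. 0 < lam j) \<longrightarrow> (\<lambda>j. lam j powr (- q / \<gamma>)) \<longlonglongrightarrow> 0 \<longrightarrow>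
        (\<lambda>j. ennreal (lam j) * G_fun \<gamma> q (lam j) f x) \<longlonglongrightarrow> ennreal ((kappa q TYPE('a) / \<bar>\<gamma>\<bar>) powr (1 / q)) * ennreal (norm (g x))))"
proof -
  let ?n = "DIM('a)"
  obtain C0 where C0: "0 \<le> C0" and SP: "\<And>(f :: 'a \<Rightarrow> real) g. f \<in> borel_measurable borel \<Longrightarrow> g \<in> borel_measurable borel \<Longrightarrow> weak_gradient f g \<Longrightarrow>
    (AE x in lborel. \<forall>w R N. 0 < R \<longrightarrow> 0 \<le> N \<longrightarrow>
      (\<forall>t. 0 < t \<and> t < 2 * R \<longrightarrow> (\<integral>\<^sup>+y\<in>ball x t. ennreal (norm (g y - w) powr s) \<partial>lborel) \<le> ennreal (N powr s * t ^ ?n)) \<longrightarrow>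
      (\<integral>\<^sup>+k\<in>ball 0 1. ennreal (\<bar>f (x + R *\<^sub>R k) - f x - R * (w \<bullet> k)\<bar> powr p) \<partial>lborel) \<le> ennreal (C0 * R powr p * N powr p))"
    using sobolev_pointwise[OF s sp snp] by blast
  define \<beta> where "\<beta> = 1 + \<gamma> / q"
  define C1 where "C1 = 1 / layer_const (\<gamma> - real ?n) * (vol TYPE('a) / \<bar>\<gamma>\<bar> + 2 powr (\<bar>\<beta>\<bar> * p) * C0 / (\<bar>\<gamma>\<bar> * (p / q - 1)))"
  have C1: "0 < C1"
    unfolding C1_def using layer_const(2)[of "\<gamma> - real ?n"] C0 \<gamma> q
    by (intro mult_pos_pos add_pos_nonneg divide_nonneg_nonneg mult_nonneg_nonneg) auto
  define C where "C = C1 powr (1 / q)"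
  have C: "0 < C" using C1 by (simp add: C_def)
  {
    fix f :: "'a \<Rightarrow> real" and g :: "'a \<Rightarrow> 'a"
    assume f [measurable]: "f \<in> borel_measurable borel" and g [measurable]: "g \<in> borel_measurable borel" and wg: "weak_gradient f g"
      and fin: "\<And>r. (\<integral>\<^sup>+y\<in>ball 0 r. ennreal (norm (g y) powr s) \<partial>lborel) < \<infinity>"
      and Mfin: "AE x in lborel. maximal (\<lambda>y. ennreal (norm (g y) powr s)) x < \<infinity>"
    let ?M = "maximal (\<lambda>y. ennreal (norm (g y) powr s))"
    have leb: "AE x in lborel. \<forall>e>0. \<exists>d>0. \<forall>h. 0 < h \<and> h < d \<longrightarrow>
        (\<integral>\<^sup>+y\<in>ball x h. ennreal (norm (g y - g x) powr s) \<partial>lborel) \<le> ennreal (e * h ^ ?n)"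
      using s fin by (intro lebesgue_point_Ls) auto
    have "AE x in lborel.
      (\<forall>lam>0. ennreal lam * G_fun \<gamma> q lam f x \<le> ennreal C * enn_powr (?M x) (1 / s)) \<and>
      (\<forall>lam. (\<forall>j. 0 < lam j) \<longrightarrow> (\<lambda>j. lam j powr (- q / \<gamma>)) \<longlonglongrightarrow> 0 \<longrightarrow>
        (\<lambda>j. ennreal (lam j) * G_fun \<gamma> q (lam j) f x) \<longlonglongrightarrow> ennreal ((kappa q TYPE('a) / \<bar>\<gamma>\<bar>) powr (1 / q)) * ennreal (norm (g x)))"
      using SP[OF f g wg] leb Mfin
    proof eventually_elim
      case (elim x)
      note sp_x = elim(1)[rule_format] and leb_x = elim(2)
      obtain M where M: "0 \<le> M" "?M x = ennreal M"
        using elim(3) by (cases "?M x" rule: ennreal_cases) auto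
      define N where "N = M powr (1 / s)"
      have N: "0 \<le> N" "N powr s = M" using M s by (auto simp: N_def powr_powr)
      \<comment> \<open>With \<open>w = 0\<close> the maximal function controls the growth at all
        radii, so the estimate holds for every \<open>R\<close>, not merely for small ones.\<close>
      have bd: "(\<integral>\<^sup>+k\<in>ball 0 1. ennreal (\<bar>f (x + R *\<^sub>R k) - f x\<bar> powr p) \<partial>lborel) \<le> ennreal (C0 * R powr p * N powr p)" if R: "0 < R" for R
      proof -
        have "(\<integral>\<^sup>+y\<in>ball x t. ennreal (norm (g y - 0) powr s) \<partial>lborel) \<le> ennreal (N powr s * t ^ ?n)" if "0 < t" for t
          using maximal_ge[OF that, of "\<lambda>y. ennreal (norm (g y) powr s)" x] M N that
          by (simp add: mult.commute flip: ennreal_mult)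
        then show ?thesis using sp_x[OF R N(1), of 0] by simp
      qed
      have upper: "ennreal lam * G_fun \<gamma> q lam f x \<le> ennreal C * enn_powr (?M x) (1 / s)" if lam: "0 < lam" for lam
      proof -
        have "enn_powr (ennreal lam * G_fun \<gamma> q lam f x) q \<le> ennreal (C1 * N powr q)"
          unfolding G_fun_rescaled[OF f \<gamma> q(1) lam] C1_def \<beta>_def
          using lam by (intro blowup_integral_bound(1)[OF f \<gamma> q C0 N(1) _ bd]) auto
        then have "ennreal lam * G_fun \<gamma> q lam f x \<le> enn_powr (ennreal (C1 * N powr q)) (1 / q)"
          using q by (subst (asm) enn_powr_le_swap) auto
        also have "\<dots> = ennreal (C * N)"
          using C1 N q by (simp add: enn_powr_ennreal powr_mult powr_powr C_def)
        also have "\<dots> = ennreal C * enn_powr (?M x) (1 / s)"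
          using M C by (simp add: enn_powr_ennreal N_def ennreal_mult)
        finally show ?thesis .
      qed
      have lim: "(\<lambda>j. ennreal (lam j) * G_fun \<gamma> q (lam j) f x) \<longlonglongrightarrow> ennreal ((kappa q TYPE('a) / \<bar>\<gamma>\<bar>) powr (1 / q)) * ennreal (norm (g x))"
        if lam: "\<forall>j. 0 < lam j" and R0: "(\<lambda>j. lam j powr (- q / \<gamma>)) \<longlonglongrightarrow> 0" for lam :: "nat \<Rightarrow> real"
      proof -
        define R where "R j = lam j powr (- q / \<gamma>)" for j
        have R: "0 < R j" for j using lam by (simp add: R_def less_imp_neq[symmetric])
        have diff: "(\<lambda>j. \<integral>\<^sup>+k\<in>ball 0 \<rho>. ennreal (\<bar>(f (x + R j *\<^sub>R k) - f x) / R j - g x \<bullet> k\<bar> powr p) \<partial>lborel) \<longlonglongrightarrow> 0" if \<rho>: "0 < \<rho>" for \<rho>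
        proof (rule order_tendstoI)
          fix a :: ennreal assume "0 < a"
          then obtain b where b: "0 < b" "b < a" using dense by blast
          then obtain c where c: "b = ennreal c" "0 < c" by (cases b rule: ennreal_cases) auto
          \<comment> \<open>Chosen such that the Sobolev estimate with growth constant
            \<open>e\<close> stays below \<open>c\<close>; the summand 1 avoids division by zero
            when \<open>C0 = 0\<close>.\<close>
          define e where "e = (c / (C0 * \<rho> ^ ?n * \<rho> powr p + 1)) powr (1 / p)"
          have K: "0 < C0 * \<rho> ^ ?n * \<rho> powr p + 1" using C0 \<rho> by (intro add_nonneg_pos) auto
          have e: "0 < e" "e powr p = c / (C0 * \<rho> ^ ?n * \<rho> powr p + 1)"
            using c K s sp by (auto simp: e_def powr_powr)
          have "0 < e powr s" using e by simp
          then obtain d where d: "0 < d" "\<And>h. 0 < h \<Longrightarrow> h < d \<Longrightarrow>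
              (\<integral>\<^sup>+y\<in>ball x h. ennreal (norm (g y - g x) powr s) \<partial>lborel) \<le> ennreal (e powr s * h ^ ?n)"
            using leb_x[THEN spec, THEN mp] by blast
          have "\<forall>\<^sub>F j in sequentially. R j < d / (2 * \<rho>)"
            using R0 d \<rho> unfolding R_def by (intro order_tendstoD) auto
          then show "\<forall>\<^sub>F j in sequentially. (\<integral>\<^sup>+k\<in>ball 0 \<rho>. ennreal (\<bar>(f (x + R j *\<^sub>R k) - f x) / R j - g x \<bullet> k\<bar> powr p) \<partial>lborel) < a"
          proof eventually_elim
            case (elim j)
            \<comment> \<open>Now \<open>w = g x\<close>: growth with constant \<open>e\<close>
              holds at radii below \<open>d\<close> only, and the Sobolev estimate at radius
              \<open>R j * \<rho>\<close> asks for all radii below twice that.\<close>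
            have Rr: "0 < R j * \<rho>" "2 * (R j * \<rho>) < d" using elim R[of j] \<rho> by (auto simp: field_simps)
            have "(\<integral>\<^sup>+k\<in>ball 0 \<rho>. ennreal (\<bar>(f (x + R j *\<^sub>R k) - f x) / R j - g x \<bullet> k\<bar> powr p) \<partial>lborel)
              = ennreal (\<rho> ^ ?n) * (\<integral>\<^sup>+k\<in>ball 0 1. ennreal (\<bar>(f (x + R j *\<^sub>R (\<rho> *\<^sub>R k)) - f x) / R j - g x \<bullet> (\<rho> *\<^sub>R k)\<bar> powr p) \<partial>lborel)"
              using nn_integral_ball_scale[of "\<lambda>k. ennreal (\<bar>(f (x + R j *\<^sub>R k) - f x) / R j - g x \<bullet> k\<bar> powr p)" \<rho> 0 1] \<rho> by simp
            also have "(\<integral>\<^sup>+k\<in>ball 0 1. ennreal (\<bar>(f (x + R j *\<^sub>R (\<rho> *\<^sub>R k)) - f x) / R j - g x \<bullet> (\<rho> *\<^sub>R k)\<bar> powr p) \<partial>lborel)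
              = (\<integral>\<^sup>+k. ennreal (R j powr (- p)) * (ennreal (\<bar>f (x + (R j * \<rho>) *\<^sub>R k) - f x - (R j * \<rho>) * (g x \<bullet> k)\<bar> powr p) * indicator (ball 0 1) k) \<partial>lborel)"
            proof (rule nn_integral_cong)
              fix k :: 'a
              have "(f (x + R j *\<^sub>R (\<rho> *\<^sub>R k)) - f x) / R j - g x \<bullet> (\<rho> *\<^sub>R k) = (f (x + (R j * \<rho>) *\<^sub>R k) - f x - (R j * \<rho>) * (g x \<bullet> k)) / R j"
                using R[of j] by (simp add: diff_divide_distrib)
              then have "\<bar>(f (x + R j *\<^sub>R (\<rho> *\<^sub>R k)) - f x) / R j - g x \<bullet> (\<rho> *\<^sub>R k)\<bar> powr p = R j powr (- p) * \<bar>f (x + (R j * \<rho>) *\<^sub>R k) - f x - (R j * \<rho>) * (g x \<bullet> k)\<bar> powr p"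
                using R[of j] by (simp add: abs_divide powr_divide powr_minus_divide)
              then show "ennreal (\<bar>(f (x + R j *\<^sub>R (\<rho> *\<^sub>R k)) - f x) / R j - g x \<bullet> (\<rho> *\<^sub>R k)\<bar> powr p) * indicator (ball 0 1) k
                = ennreal (R j powr (- p)) * (ennreal (\<bar>f (x + (R j * \<rho>) *\<^sub>R k) - f x - (R j * \<rho>) * (g x \<bullet> k)\<bar> powr p) * indicator (ball 0 1) k)"
                by (simp only: ennreal_mult[OF powr_ge_zero powr_ge_zero] mult.assoc)
            qed
            also have "\<dots> = ennreal (R j powr (- p)) * (\<integral>\<^sup>+k\<in>ball 0 1. ennreal (\<bar>f (x + (R j * \<rho>) *\<^sub>R k) - f x - (R j * \<rho>) * (g x \<bullet> k)\<bar> powr p) \<partial>lborel)"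
              by (intro nn_integral_cmult) measurable
            also have "ennreal (\<rho> ^ ?n) * (ennreal (R j powr (- p)) * (\<integral>\<^sup>+k\<in>ball 0 1. ennreal (\<bar>f (x + (R j * \<rho>) *\<^sub>R k) - f x - (R j * \<rho>) * (g x \<bullet> k)\<bar> powr p) \<partial>lborel))
              \<le> ennreal (\<rho> ^ ?n) * (ennreal (R j powr (- p)) * ennreal (C0 * (R j * \<rho>) powr p * e powr p))"
              using Rr e d by (intro mult_left_mono sp_x) auto
            also have "\<dots> = ennreal (\<rho> ^ ?n * (R j powr (- p) * (C0 * (R j * \<rho>) powr p * e powr p)))"
              using C0 \<rho> by (simp flip: ennreal_mult)
            also have "\<rho> ^ ?n * (R j powr (- p) * (C0 * (R j * \<rho>) powr p * e powr p)) = (C0 * \<rho> ^ ?n * \<rho> powr p) * e powr p"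
              using R[of j] \<rho> by (simp add: powr_mult powr_minus)
            also have "ennreal ((C0 * \<rho> ^ ?n * \<rho> powr p) * e powr p) \<le> ennreal c"
            proof (rule ennreal_leI)
              have "(C0 * \<rho> ^ ?n * \<rho> powr p) * e powr p \<le> (C0 * \<rho> ^ ?n * \<rho> powr p + 1) * e powr p"
                by (intro mult_right_mono) auto
              also have "\<dots> = c" unfolding e(2) using K by (metis less_irrefl nonzero_mult_div_cancel_left times_divide_eq_right)
              finally show "(C0 * \<rho> ^ ?n * \<rho> powr p) * e powr p \<le> c" .
            qed
            also have "\<dots> < a" using b c by simp
            finally show ?case .
          qed
        qed simp
        have "(\<lambda>j. enn_powr (ennreal (lam j) * G_fun \<gamma> q (lam j) f x) q) \<longlonglongrightarrow> ennreal (kappa q TYPE('a) / \<bar>\<gamma>\<bar> * norm (g x) powr q)"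
          unfolding G_fun_rescaled[OF f \<gamma> q(1) lam[rule_format]] R_def[symmetric]
          by (rule blowup_integral_tendsto[OF f \<gamma> q C0 N(1) R bd diff])
        then have "(\<lambda>j. enn_powr (enn_powr (ennreal (lam j) * G_fun \<gamma> q (lam j) f x) q) (1 / q)) \<longlonglongrightarrow> enn_powr (ennreal (kappa q TYPE('a) / \<bar>\<gamma>\<bar> * norm (g x) powr q)) (1 / q)"
          using q by (intro tendsto_enn_powr) auto
        moreover have "enn_powr (ennreal (kappa q TYPE('a) / \<bar>\<gamma>\<bar> * norm (g x) powr q)) (1 / q) = ennreal ((kappa q TYPE('a) / \<bar>\<gamma>\<bar>) powr (1 / q)) * ennreal (norm (g x))"
        proof -
          define c where "c = kappa q TYPE('a) / \<bar>\<gamma>\<bar>"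
          have "0 \<le> c" using kappa_ball_integral(2)[where 'a='a, OF q(1)] by (simp add: c_def)
          then show ?thesis
            unfolding c_def[symmetric] using q by (simp add: enn_powr_ennreal powr_mult powr_powr flip: ennreal_mult)
        qed
        ultimately show ?thesis
          using q by (simp add: enn_powr_inverse)
      qed
      show ?case using upper lim by blast
    qed
  }
  then show ?thesis using C by blast
qed

section \<open>The main theorem\<close>

text \<open>Measurability of \<open>G\<close> comes from completeness of the Lebesgue measure.\<close>
lemma lorentz_norm_cong_AE:
  fixes G G' :: "'a::euclidean_space \<Rightarrow> ennreal"
  assumes [measurable]: "G' \<in> borel_measurable borel" and ae: "AE x in lborel. G x = G' x"
  shows "lorentz_norm r \<tau> G = lorentz_norm r \<tau> G'"
proof -
  have "emeasure lebesgue {x. ennreal s < G x} = emeasure lebesgue {x. ennreal s < G' x}" for s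
  proof (rule emeasure_eq_AE)
    \<comment> \<open>\<open>G\<close> need not be Borel: its superlevel sets differ from Borel ones
      by null sets, which suffices for the completed measure in \<open>rearr\<close>.\<close>
    have ae': "AE x in lebesgue. (x \<in> {x. ennreal s < G' x}) = (x \<in> {x. ennreal s < G x})"
      unfolding AE_completion_iff using ae by eventually_elim auto
    have "{x. ennreal s < G' x} \<in> sets borel" by measurable
    then show S: "{x. ennreal s < G' x} \<in> sets lebesgue" by simp
    show "{x. ennreal s < G x} \<in> sets lebesgue"
      by (rule completion.in_sets_AE[OF ae' S]) simp
    show "AE x in lebesgue. (x \<in> {x. ennreal s < G x}) = (x \<in> {x. ennreal s < G' x})"
      using ae' by eventually_elim auto
  qed
  then have "rearr G = rearr G'" by (simp add: rearr_def fun_eq_iff)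
  then show ?thesis by (simp add: lorentz_norm_def)
qed

lemma G_fun_measurable:
  fixes f :: "'a::euclidean_space \<Rightarrow> real"
  assumes [measurable]: "f \<in> borel_measurable borel"
  shows "G_fun \<gamma> q lam f \<in> borel_measurable borel"
proof -
  have "(\<lambda>x. enn_powr (\<integral>\<^sup>+y. indicator {(x, y). x \<noteq> y \<and> \<bar>f x - f y\<bar> / norm (x - y) powr (1 + \<gamma> / q) > lam} (x, y)
      * ennreal (norm (x - y) powr (\<gamma> - real DIM('a))) \<partial>lborel) (1 / q)) \<in> borel_measurable borel"
    by measurable
  then show ?thesis
    unfolding G_fun_def[abs_def] E_set_def nn_integral_completion .
qed

section \<open>Passage to Borel representatives\<close>

text \<open>For \<open>x\<close> outside the exceptional set the slices of the two sets
  \<open>E_set\<close> at \<open>x\<close> differ by a null set of \<open>y\<close>, so the inner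
  integrals agree.\<close>

lemma G_fun_cong_AE:
  assumes ae: "AE x in lborel. f x = f' x"
  shows "AE x in lborel. G_fun \<gamma> q lam f x = G_fun \<gamma> q lam f' x"
  using ae
proof eventually_elim
  case (elim x)
  have "(\<integral>\<^sup>+y. indicator (E_set lam (\<gamma> / q) f) (x, y) * ennreal (norm (x - y) powr (\<gamma> - real DIM('a))) \<partial>lborel)
      = (\<integral>\<^sup>+y. indicator (E_set lam (\<gamma> / q) f') (x, y) * ennreal (norm (x - y) powr (\<gamma> - real DIM('a))) \<partial>lborel)"
    using ae by (intro nn_integral_cong_AE, eventually_elim) (simp add: E_set_def elim indicator_def)
  then show ?case by (simp add: G_fun_def nn_integral_completion)
qed

lemma locally_integrable_measurable:
  fixes f :: "'a::euclidean_space \<Rightarrow> 'b::{banach, second_countable_topology}"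
  assumes "locally_integrable f"
  shows "f \<in> borel_measurable lebesgue"
proof (rule borel_measurable_LIMSEQ_metric)
  show "(\<lambda>x. indicat_real (cball 0 (real k)) x *\<^sub>R f x) \<in> borel_measurable lebesgue" for k
    using assms unfolding locally_integrable_def set_integrable_def by (metis borel_measurable_integrable compact_cball)
  fix x :: 'a
  obtain k0 where k0: "norm x \<le> real k0" using real_arch_simple by blast
  have "\<forall>\<^sub>F k in sequentially. indicat_real (cball 0 (real k)) x *\<^sub>R f x = f x"
    using eventually_ge_at_top[of k0] by eventually_elim (use k0 in \<open>simp add: indicator_def\<close>)
  then show "(\<lambda>k. indicat_real (cball 0 (real k)) x *\<^sub>R f x) \<longlonglongrightarrow> f x"
    by (rule tendsto_eventually)
qed

lemma locally_integrable_borel_representative: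
  fixes f :: "'a::euclidean_space \<Rightarrow> 'b::euclidean_space"
  assumes "locally_integrable f"
  obtains f' where "f' \<in> borel_measurable borel" "AE x in lborel. f x = f' x"
proof -
  have f: "f \<in> borel_measurable lebesgue" by (rule locally_integrable_measurable[OF assms])
  have "\<exists>h. h \<in> borel_measurable lborel \<and> (AE x in lborel. f x \<bullet> i = h x)" for i
    using completion_ex_borel_measurable_real[of "\<lambda>x. f x \<bullet> i" lborel] f by auto
  then obtain h where h: "\<And>i. h i \<in> borel_measurable lborel" "\<And>i. AE x in lborel. f x \<bullet> i = h i x"
    by metis
  have [measurable]: "h i \<in> borel_measurable borel" for i using h(1) by simp
  have "AE x in lborel. \<forall>i\<in>Basis. f x \<bullet> i = h i x"
    using h(2) by (intro AE_finite_allI) auto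
  then have "AE x in lborel. f x = (\<Sum>i\<in>Basis. h i x *\<^sub>R i)"
    by eventually_elim (rule euclidean_eqI, simp)
  then show ?thesis
    by (rule that[rotated]) measurable
qed

text \<open>The integrals against test functions see only the class of \<open>f\<close> and
  \<open>g\<close>. This allows the analysis above, carried out for Borel functions, to serve
  general locally integrable ones.\<close>

lemma weak_gradient_cong_AE:
  fixes f f' :: "'a::euclidean_space \<Rightarrow> real"
  assumes wg: "weak_gradient f g" and f': "f' \<in> borel_measurable borel" and g': "g' \<in> borel_measurable borel"
    and ae: "AE x in lborel. f x = f' x" "AE x in lborel. g x = g' x"
  shows "weak_gradient f' g'"
proof -
  have ae_l: "AE x in lebesgue. f' x = f x" "AE x in lebesgue. g' x = g x"
    unfolding AE_completion_iff using ae by (auto elim: AE_mp)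
  have li: "locally_integrable h'" if "locally_integrable h" "h' \<in> borel_measurable borel" "AE x in lebesgue. h' x = h x"
    for h h' :: "'a \<Rightarrow> 'b::{banach, second_countable_topology}"
    unfolding locally_integrable_def
  proof (intro allI impI)
    fix K :: "'a set" assume K: "compact K"
    then have i: "integrable lebesgue (\<lambda>x. indicat_real K x *\<^sub>R h x)"
      using that(1) by (simp add: locally_integrable_def set_integrable_def)
    have K' [measurable]: "K \<in> sets borel" using K by (simp add: borel_compact)
    have "(\<lambda>x. indicat_real K x *\<^sub>R h' x) \<in> borel_measurable borel" using that(2) by measurable
    then have m: "(\<lambda>x. indicat_real K x *\<^sub>R h' x) \<in> borel_measurable lebesgue"
      by (intro measurable_completion) simp
    have "AE x in lebesgue. indicat_real K x *\<^sub>R h x = indicat_real K x *\<^sub>R h' x"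
      using that(3) by eventually_elim simp
    then show "set_integrable lebesgue K h'"
      unfolding set_integrable_def using i m by (rule integrable_cong_AE_imp[rotated 2])
  qed
  have f_l: "f \<in> borel_measurable lebesgue" "g \<in> borel_measurable lebesgue"
    using wg by (auto simp: weak_gradient_def intro: locally_integrable_measurable)
  have f'_l: "f' \<in> borel_measurable lebesgue" "g' \<in> borel_measurable lebesgue"
    using f' g' by (auto intro!: measurable_completion)
  show ?thesis
    unfolding weak_gradient_def
  proof (intro conjI allI impI ballI)
    show "locally_integrable f'" "locally_integrable g'"
      using wg li[OF _ f' ae_l(1)] li[OF _ g' ae_l(2)] by (auto simp: weak_gradient_def)
    fix \<phi> :: "'a \<Rightarrow> real" and i :: 'a assume \<phi>: "test_function \<phi>" and i: "i \<in> Basis"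
    have diff: "iter_pdiff vs \<phi> differentiable (at x)" if "set vs \<subseteq> Basis" for vs x
      using \<phi> that unfolding test_function_def smooth_fun_def by blast
    \<comment> \<open>The lists \<open>[]\<close> and \<open>[i]\<close> in the definition of
      \<open>smooth_fun\<close> yield differentiability, hence continuity, of \<open>\<phi>\<close>
      and of its partial derivative; measurability of the products follows.\<close>
    have "continuous_on UNIV \<phi>" "continuous_on UNIV (pdiff i \<phi>)"
      using diff[of "[]"] diff[of "[i]"] i by (auto intro!: continuous_at_imp_continuous_on differentiable_imp_continuous_within)
    then have [measurable]: "\<phi> \<in> borel_measurable lebesgue" "pdiff i \<phi> \<in> borel_measurable lebesgue"
      by (auto intro!: measurable_completion borel_measurable_continuous_onI)
    note [measurable] = f_l f'_l
    have "(\<integral>x. f' x * pdiff i \<phi> x \<partial>lebesgue) = (\<integral>x. f x * pdiff i \<phi> x \<partial>lebesgue)"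
      by (intro integral_cong_AE) (measurable, use ae_l(1) in \<open>auto elim: AE_mp\<close>)
    also have "\<dots> = - (\<integral>x. (g x \<bullet> i) * \<phi> x \<partial>lebesgue)"
      using wg \<phi> i by (simp add: weak_gradient_def)
    also have "(\<integral>x. (g x \<bullet> i) * \<phi> x \<partial>lebesgue) = (\<integral>x. (g' x \<bullet> i) * \<phi> x \<partial>lebesgue)"
      by (intro integral_cong_AE) (measurable, use ae_l(2) in \<open>auto elim: AE_mp\<close>)
    finally show "(\<integral>x. f' x * pdiff i \<phi> x \<partial>lebesgue) = - (\<integral>x. (g' x \<bullet> i) * \<phi> x \<partial>lebesgue)" .
  qed
qed

text \<open>With these exponents the maximal function is bounded and the subcritical
  Sobolev--Poincare inequality holds with \<open>p > q\<close>.\<close>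
lemma exponents_exist:
  fixes \<gamma> m n q :: real
  assumes m: "1 < m" and n: "1 \<le> n" and q: "0 < q"
    and cond: "m > n \<or> (m \<le> n \<and> \<gamma> > 0 \<and> n * (1 / m - 1 / q) < 1) \<or> (m \<le> n \<and> \<gamma> < 0 \<and> q < m)"
  obtains s p where "1 \<le> s" "s < m" "s \<le> p" "q < p" "n * (1 / s - 1 / p) < 1"
proof (cases "q < m")
  case True
  \<comment> \<open>If \<open>q < m\<close>, then \<open>p = s\<close> will do and the subcritical
    condition reads \<open>0 < 1\<close>.\<close>
  then have "max q 1 < m" using m by simp
  then obtain s where "max q 1 < s" "s < m" using dense by blast
  then show ?thesis by (intro that[of s s]) auto
next
  case qm: False
  show ?thesis
  proof (cases "n < m")
    case True
    then obtain s where s: "n < s" "s < m" using dense by blast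
    \<comment> \<open>Above the dimension \<open>n / s < 1\<close>, so any exponent \<open>p\<close>
      that is large enough is admissible.\<close>
    have "n * (1 / s - 1 / (q + 1)) \<le> n * (1 / s)"
      using n q by (intro mult_left_mono) auto
    also have "\<dots> < 1" using s n by simp
    finally show ?thesis using s n qm by (intro that[of s "q + 1"]) auto
  next
    case False
    with cond qm have c: "n * (1 / m - 1 / q) < 1" by auto
    \<comment> \<open>The strict inequality holds at the endpoint \<open>s = m\<close>,
      \<open>p = q\<close> and persists under the small perturbation \<open>s = m - d\<close>,
      \<open>p = q + d\<close>.\<close>
    have "((\<lambda>d. n * (1 / (m - d) - 1 / (q + d))) \<longlongrightarrow> n * (1 / (m - 0) - 1 / (q + 0))) (at_right 0)"
      using m q by (intro tendsto_intros) auto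
    then have "\<forall>\<^sub>F d in at_right 0. n * (1 / (m - d) - 1 / (q + d)) < 1"
      using c by (intro order_tendstoD) auto
    moreover have "\<forall>\<^sub>F d in at_right 0. d < m - 1"
      using m by (intro eventually_at_right_less order_tendstoD(2)[OF tendsto_ident_at]) auto
    moreover have "\<forall>\<^sub>F d in at_right (0::real). 0 < d"
      by (simp add: eventually_at_filter)
    ultimately have "\<forall>\<^sub>F d in at_right 0. n * (1 / (m - d) - 1 / (q + d)) < 1 \<and> d < m - 1 \<and> 0 < d"
      by eventually_elim auto
    then obtain d where "n * (1 / (m - d) - 1 / (q + d)) < 1" "d < m - 1" "0 < d"
      using eventually_happens[of _ "at_right (0::real)"] by auto
    then show ?thesis using qm by (intro that[of "m - d" "q + d"]) auto
  qed
qed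

section \<open>Bounds and limits for the Lorentz norms\<close>

text \<open>The function \<open>X\<close>, the \<open>s\<close>-th root of the maximal function, has
  three roles: its Lorentz norm gives the upper bound, it dominates all \<open>lam * G_fun\<close>
  at once, and its finiteness almost everywhere provides the hypotheses of
  \<open>blowup_pointwise\<close>.\<close>

lemma Phi_borel:
  fixes \<gamma> r \<tau> q s p :: real
  assumes \<gamma>: "\<gamma> \<noteq> 0" and r: "1 < r" and \<tau>: "1 < \<tau>" and q: "0 < q" "q < p"
    and s: "1 \<le> s" "s < r" "s < \<tau>" "s \<le> p" and snp: "real DIM('a::euclidean_space) * (1 / s - 1 / p) < 1"
  shows "\<exists>C>0. \<forall>(f :: 'a \<Rightarrow> real) g. f \<in> borel_measurable borel \<longrightarrow> g \<in> borel_measurable borel \<longrightarrow> in_WL r \<tau> f g \<longrightarrow>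
    (\<forall>lam>0. Phi r \<tau> \<gamma> q lam f \<le> ennreal C * lorentz_norm r \<tau> (\<lambda>x. ennreal (norm (g x)))) \<and>
    (\<forall>lam. (\<forall>j. 0 < lam j) \<longrightarrow> (\<lambda>j. lam j powr (- q / \<gamma>)) \<longlonglongrightarrow> 0 \<longrightarrow>
      (\<lambda>j. Phi r \<tau> \<gamma> q (lam j) f) \<longlonglongrightarrow> ennreal ((kappa q TYPE('a) / \<bar>\<gamma>\<bar>) powr (1 / q)) * lorentz_norm r \<tau> (\<lambda>x. ennreal (norm (g x))))"
proof -
  obtain C1 where C1: "0 < C1" and pw: "\<And>(f :: 'a \<Rightarrow> real) g. f \<in> borel_measurable borel \<Longrightarrow> g \<in> borel_measurable borel \<Longrightarrow> weak_gradient f g \<Longrightarrow>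
    (\<And>r. (\<integral>\<^sup>+y\<in>ball 0 r. ennreal (norm (g y) powr s) \<partial>lborel) < \<infinity>) \<Longrightarrow>
    (AE x in lborel. maximal (\<lambda>y. ennreal (norm (g y) powr s)) x < \<infinity>) \<Longrightarrow>
    (AE x in lborel.
      (\<forall>lam>0. ennreal lam * G_fun \<gamma> q lam f x \<le> ennreal C1 * enn_powr (maximal (\<lambda>y. ennreal (norm (g y) powr s)) x) (1 / s)) \<and>
      (\<forall>lam. (\<forall>j. 0 < lam j) \<longrightarrow> (\<lambda>j. lam j powr (- q / \<gamma>)) \<longlonglongrightarrow> 0 \<longrightarrow>
        (\<lambda>j. ennreal (lam j) * G_fun \<gamma> q (lam j) f x) \<longlonglongrightarrow> ennreal ((kappa q TYPE('a) / \<bar>\<gamma>\<bar>) powr (1 / q)) * ennreal (norm (g x))))"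
    using blowup_pointwise[OF s(1) s(4) snp \<gamma> q] by blast
  obtain C2 where C2: "0 < C2" and max: "\<And>G :: 'a \<Rightarrow> ennreal. G \<in> borel_measurable borel \<Longrightarrow>
    lorentz_norm r \<tau> (\<lambda>x. enn_powr (maximal (\<lambda>y. enn_powr (G y) s) x) (1 / s)) \<le> ennreal C2 * lorentz_norm r \<tau> G"
    using lorentz_norm_maximal_le[OF s(1-3)] by blast
  define c where "c = (kappa q TYPE('a) / \<bar>\<gamma>\<bar>) powr (1 / q)"
  have c: "0 < c" using kappa_ball_integral(2)[where 'a='a, OF q(1)] \<gamma> by (simp add: c_def)
  {
    fix f :: "'a \<Rightarrow> real" and g :: "'a \<Rightarrow> 'a"
    assume f [measurable]: "f \<in> borel_measurable borel" and g [measurable]: "g \<in> borel_measurable borel" and wl: "in_WL r \<tau> f g"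
    let ?L = "lorentz_norm r \<tau> (\<lambda>x. ennreal (norm (g x)))"
    have wg: "weak_gradient f g" and Lfin: "?L < \<infinity>" using wl by (auto simp: in_WL_def)
    define M where "M = maximal (\<lambda>y. ennreal (norm (g y) powr s))"
    have M [measurable]: "M \<in> borel_measurable borel" unfolding M_def by (rule maximal_measurable) measurable
    define X where "X x = enn_powr (M x) (1 / s)" for x
    have X [measurable]: "X \<in> borel_measurable borel" unfolding X_def by measurable
    have XL: "lorentz_norm r \<tau> X \<le> ennreal C2 * ?L"
      using max[of "\<lambda>x. ennreal (norm (g x))"] by (simp add: X_def[abs_def] M_def enn_powr_ennreal)
    have XC: "lorentz_norm r \<tau> (\<lambda>x. ennreal C1 * X x) = ennreal C1 * lorentz_norm r \<tau> X"
      using C1 \<tau> by (intro lorentz_norm_cmult) auto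
    have Xfin: "lorentz_norm r \<tau> X < \<infinity>"
      using XL Lfin by (auto intro: le_less_trans simp: ennreal_mult_less_top)
    have Mfin: "AE x in lborel. M x < \<infinity>"
      using lorentz_norm_finite_imp(3)[OF X _ _ Xfin] r \<tau>
      by (auto simp: X_def less_top[symmetric] elim!: AE_mp)
    have locfin: "(\<integral>\<^sup>+y\<in>ball (0::'a) \<rho>. ennreal (norm (g y) powr s) \<partial>lborel) < \<infinity>" for \<rho>
    proof -
      \<comment> \<open>The maximal function is finite somewhere, because the whole space is not
        null. At such a point it bounds the integral over every ball, and a large one contains
        \<open>ball 0 \<rho>\<close>.\<close>
      obtain x where x: "M x < \<infinity>"
      proof (rule ccontr)
        assume "\<not> thesis"
        then have "\<not> M x < \<infinity>" for x using that by blast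
        then have "AE x in lborel. x \<notin> (UNIV :: 'a set)" using Mfin by simp
        then show False by (subst (asm) AE_iff_measurable[where N=UNIV]) auto
      qed
      have r': "0 < \<bar>\<rho>\<bar> + norm x + 1" by (simp add: add_nonneg_pos)
      have sub: "ball (0::'a) \<rho> \<subseteq> ball x (\<bar>\<rho>\<bar> + norm x + 1)"
      proof
        fix y :: 'a assume "y \<in> ball 0 \<rho>"
        then show "y \<in> ball x (\<bar>\<rho>\<bar> + norm x + 1)"
          using norm_triangle_ineq4[of x y] by (simp add: dist_norm)
      qed
      have "(\<integral>\<^sup>+y\<in>ball 0 \<rho>. ennreal (norm (g y) powr s) \<partial>lborel)
          \<le> (\<integral>\<^sup>+y\<in>ball x (\<bar>\<rho>\<bar> + norm x + 1). ennreal (norm (g y) powr s) \<partial>lborel)"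
        using sub by (intro nn_integral_mono) (auto simp: indicator_def)
      also have "\<dots> \<le> ennreal ((\<bar>\<rho>\<bar> + norm x + 1) ^ DIM('a)) * M x"
        unfolding M_def by (rule maximal_ge[OF r'])
      also have "\<dots> < \<infinity>" using x by (simp add: ennreal_mult_less_top)
      finally show ?thesis .
    qed
    note P = pw[OF f g wg locfin Mfin[unfolded M_def], folded M_def c_def, folded X_def]
    have G [measurable]: "G_fun \<gamma> q lam f \<in> borel_measurable borel" for lam
      by (rule G_fun_measurable) simp
    have Phi: "Phi r \<tau> \<gamma> q lam f = lorentz_norm r \<tau> (\<lambda>x. ennreal lam * G_fun \<gamma> q lam f x)" if "0 < lam" for lam
      using that \<tau> by (simp add: Phi_def lorentz_norm_cmult)
    have dom: "AE x in lborel. ennreal lam * G_fun \<gamma> q lam f x \<le> ennreal C1 * X x" if "0 < lam" for lam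
      using P by eventually_elim (use that in blast)
    have upper: "Phi r \<tau> \<gamma> q lam f \<le> ennreal (C1 * C2) * ?L" if "0 < lam" for lam
    proof -
      have "Phi r \<tau> \<gamma> q lam f \<le> lorentz_norm r \<tau> (\<lambda>x. ennreal C1 * X x)"
        unfolding Phi[OF that] using \<tau> dom[OF that] by (intro lorentz_norm_mono_AE) auto
      also have "\<dots> \<le> ennreal C1 * (ennreal C2 * ?L)"
        unfolding XC by (intro mult_left_mono XL) auto
      finally show ?thesis using C1 C2 by (simp add: ennreal_mult mult.assoc)
    qed
    have lim: "(\<lambda>j. Phi r \<tau> \<gamma> q (lam j) f) \<longlonglongrightarrow> ennreal c * ?L"
      if lam: "\<forall>j. 0 < lam j" "(\<lambda>j. lam j powr (- q / \<gamma>)) \<longlonglongrightarrow> 0" for lam :: "nat \<Rightarrow> real"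
    proof -
      have "(\<lambda>j. lorentz_norm r \<tau> (\<lambda>x. ennreal (lam j) * G_fun \<gamma> q (lam j) f x)) \<longlonglongrightarrow> lorentz_norm r \<tau> (\<lambda>x. ennreal c * ennreal (norm (g x)))"
      proof (rule lorentz_norm_dominated_convergence[where H="\<lambda>x. ennreal C1 * X x"])
        show "AE x in lborel. (\<lambda>j. ennreal (lam j) * G_fun \<gamma> q (lam j) f x) \<longlonglongrightarrow> ennreal c * ennreal (norm (g x))"
          using P by eventually_elim (use lam in blast)
        show "AE x in lborel. ennreal (lam j) * G_fun \<gamma> q (lam j) f x \<le> ennreal C1 * X x" for j
          using dom lam(1) by blast
        show "lorentz_norm r \<tau> (\<lambda>x. ennreal C1 * X x) < \<infinity>"
          unfolding XC using Xfin by (simp add: ennreal_mult_less_top)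
      qed (use r \<tau> in auto)
      also have "lorentz_norm r \<tau> (\<lambda>x. ennreal c * ennreal (norm (g x))) = ennreal c * ?L"
        using c \<tau> by (intro lorentz_norm_cmult) auto
      finally show ?thesis using Phi lam(1) by simp
    qed
    have "(\<forall>lam>0. Phi r \<tau> \<gamma> q lam f \<le> ennreal (C1 * C2) * ?L) \<and>
      (\<forall>lam. (\<forall>j. 0 < lam j) \<longrightarrow> (\<lambda>j. lam j powr (- q / \<gamma>)) \<longlonglongrightarrow> 0 \<longrightarrow>
      (\<lambda>j. Phi r \<tau> \<gamma> q (lam j) f) \<longlonglongrightarrow> ennreal ((kappa q TYPE('a) / \<bar>\<gamma>\<bar>) powr (1 / q)) * ?L)"
      using upper lim unfolding c_def by blast
  }
  then show ?thesis using C1 C2 by (intro exI[of _ "C1 * C2"]) auto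
qed

text \<open>Two reductions: from general \<open>f\<close> and \<open>g\<close> to Borel
  representatives, and from filter limits to sequences. The filter is the one along which
  \<open>lam powr (- q / \<gamma>)\<close> tends to 0.\<close>

lemma Phi_bound_and_limit:
  fixes \<gamma> r \<tau> q s p :: real
  assumes \<gamma>: "\<gamma> \<noteq> 0" and r: "1 < r" and \<tau>: "1 < \<tau>" and q: "0 < q" "q < p"
    and s: "1 \<le> s" "s < r" "s < \<tau>" "s \<le> p" and snp: "real DIM('a::euclidean_space) * (1 / s - 1 / p) < 1"
  shows "\<exists>C>0. \<forall>(f :: 'a \<Rightarrow> real) g. in_WL r \<tau> f g \<longrightarrow>
    (\<forall>lam>0. Phi r \<tau> \<gamma> q lam f \<le> ennreal C * lorentz_norm r \<tau> (\<lambda>x. ennreal (norm (g x)))) \<and>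
    ((\<lambda>lam. Phi r \<tau> \<gamma> q lam f) \<longlongrightarrow> ennreal ((kappa q TYPE('a) / \<bar>\<gamma>\<bar>) powr (1 / q)) * lorentz_norm r \<tau> (\<lambda>x. ennreal (norm (g x))))
      (if 0 < \<gamma> then at_top else at_right 0)"
proof -
  obtain C where C: "0 < C" and bd: "\<And>(f :: 'a \<Rightarrow> real) g lam. f \<in> borel_measurable borel \<Longrightarrow> g \<in> borel_measurable borel \<Longrightarrow> in_WL r \<tau> f g \<Longrightarrow>
    0 < lam \<Longrightarrow> Phi r \<tau> \<gamma> q lam f \<le> ennreal C * lorentz_norm r \<tau> (\<lambda>x. ennreal (norm (g x)))"
    and lim: "\<And>(f :: 'a \<Rightarrow> real) g lam. f \<in> borel_measurable borel \<Longrightarrow> g \<in> borel_measurable borel \<Longrightarrow> in_WL r \<tau> f g \<Longrightarrow>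
    (\<And>j. 0 < lam j) \<Longrightarrow> (\<lambda>j. lam j powr (- q / \<gamma>)) \<longlonglongrightarrow> 0 \<Longrightarrow>
      (\<lambda>j. Phi r \<tau> \<gamma> q (lam j) f) \<longlonglongrightarrow> ennreal ((kappa q TYPE('a) / \<bar>\<gamma>\<bar>) powr (1 / q)) * lorentz_norm r \<tau> (\<lambda>x. ennreal (norm (g x)))"
    using Phi_borel[OF \<gamma> r \<tau> q s snp] by blast
  {
    fix f :: "'a \<Rightarrow> real" and g :: "'a \<Rightarrow> 'a" assume wl: "in_WL r \<tau> f g"
    let ?L = "lorentz_norm r \<tau> (\<lambda>x. ennreal (norm (g x)))"
    let ?c = "(kappa q TYPE('a) / \<bar>\<gamma>\<bar>) powr (1 / q)"
    have wg: "weak_gradient f g" using wl by (simp add: in_WL_def)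
    then have li: "locally_integrable f" "locally_integrable g" by (auto simp: weak_gradient_def)
    obtain f' where f': "f' \<in> borel_measurable borel" "AE x in lborel. f x = f' x"
      by (rule locally_integrable_borel_representative[OF li(1)])
    obtain g' where g': "g' \<in> borel_measurable borel" "AE x in lborel. g x = g' x"
      by (rule locally_integrable_borel_representative[OF li(2)])
    have "AE x in lborel. ennreal (norm (g x)) = ennreal (norm (g' x))"
      using g'(2) by eventually_elim simp
    then have Lg: "?L = lorentz_norm r \<tau> (\<lambda>x. ennreal (norm (g' x)))"
      using g'(1) by (intro lorentz_norm_cong_AE) auto
    have wl': "in_WL r \<tau> f' g'"
      using weak_gradient_cong_AE[OF wg f'(1) g'(1) f'(2) g'(2)] wl Lg by (simp add: in_WL_def)
    have Phi: "Phi r \<tau> \<gamma> q lam f = Phi r \<tau> \<gamma> q lam f'" for lam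
      unfolding Phi_def using lorentz_norm_cong_AE[OF G_fun_measurable[OF f'(1)] G_fun_cong_AE[OF f'(2)]] by simp
    have upper: "Phi r \<tau> \<gamma> q lam f \<le> ennreal C * ?L" if "0 < lam" for lam
      unfolding Phi Lg by (rule bd[OF f'(1) g'(1) wl' that])
    have lims: "(\<lambda>j. Phi r \<tau> \<gamma> q (lam j) f) \<longlonglongrightarrow> ennreal ?c * ?L"
      if "\<And>j. 0 < lam j" "(\<lambda>j. lam j powr (- q / \<gamma>)) \<longlonglongrightarrow> 0" for lam
      unfolding Phi Lg by (rule lim[OF f'(1) g'(1) wl' that])
    have "((\<lambda>lam. Phi r \<tau> \<gamma> q lam f) \<longlongrightarrow> ennreal ?c * ?L) (if 0 < \<gamma> then at_top else at_right 0)"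
    proof (cases "0 < \<gamma>")
      case True
      have "((\<lambda>lam. Phi r \<tau> \<gamma> q lam f) \<longlongrightarrow> ennreal ?c * ?L) at_top"
      proof (rule tendsto_at_topI_sequentially)
        fix Y :: "nat \<Rightarrow> real" assume Y: "filterlim Y at_top sequentially"
        \<comment> \<open>The sequential limit requires every term to be positive; the maximum with
          1 secures this and leaves the tail unchanged.\<close>
        then have ev: "\<forall>\<^sub>F j in sequentially. max 1 (Y j) = Y j"
          unfolding filterlim_at_top by (auto elim!: eventually_mono simp: max_def dest!: spec[of _ 1])
        have "filterlim (\<lambda>j. max 1 (Y j)) at_top sequentially"
          using Y by (rule filterlim_at_top_mono) (simp add: always_eventually)
        then have "(\<lambda>j. max 1 (Y j) powr (- q / \<gamma>)) \<longlonglongrightarrow> 0"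
          using True q by (intro tendsto_neg_powr) auto
        then have "(\<lambda>j. Phi r \<tau> \<gamma> q (max 1 (Y j)) f) \<longlonglongrightarrow> ennreal ?c * ?L"
          by (intro lims) auto
        then show "(\<lambda>j. Phi r \<tau> \<gamma> q (Y j) f) \<longlonglongrightarrow> ennreal ?c * ?L"
          by (rule Lim_transform_eventually) (use ev in \<open>eventually_elim, simp\<close>)
      qed
      then show ?thesis using True by simp
    next
      case False
      then have g: "\<gamma> < 0" using \<gamma> by simp
      have "((\<lambda>lam. Phi r \<tau> \<gamma> q lam f) \<longlongrightarrow> ennreal ?c * ?L) (at_right 0)"
      proof (rule tendsto_at_right_sequentially[of 0 1])
        fix Y :: "nat \<Rightarrow> real" assume Y: "\<And>n. 0 < Y n" "Y \<longlonglongrightarrow> 0"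
        have "0 < - q / \<gamma>" using g q by (simp add: divide_pos_neg)
        then have "(\<lambda>j. Y j powr (- q / \<gamma>)) \<longlonglongrightarrow> 0 powr (- q / \<gamma>)"
          using Y by (intro tendsto_powr' tendsto_const) (auto simp: less_imp_le)
        then show "(\<lambda>j. Phi r \<tau> \<gamma> q (Y j) f) \<longlonglongrightarrow> ennreal ?c * ?L"
          by (intro lims Y) simp
      qed simp
      then show ?thesis using False by simp
    qed
    with upper have "(\<forall>lam>0. Phi r \<tau> \<gamma> q lam f \<le> ennreal C * ?L) \<and>
      ((\<lambda>lam. Phi r \<tau> \<gamma> q lam f) \<longlongrightarrow> ennreal ?c * ?L) (if 0 < \<gamma> then at_top else at_right 0)"
      by blast
  }
  then show ?thesis using C by blast
qed

theorem theorem5p18: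
  fixes \<gamma> r \<tau> q :: real
  defines "m \<equiv> min r \<tau>"
  defines "n \<equiv> real DIM('a::euclidean_space)"
  assumes "\<gamma> \<noteq> 0" and "r > 1" and "\<tau> > 1" and "q > 0"
  assumes "m > n
         \<or> (m \<le> n \<and> \<gamma> > 0 \<and> n * (1 / m - 1 / q) < 1)
         \<or> (m \<le> n \<and> \<gamma> < 0 \<and> q < m)"
  shows "(\<exists>C1>0. \<exists>C2>0. \<forall>(f :: 'a \<Rightarrow> real) g. in_WL r \<tau> f g \<longrightarrow>
            ennreal C1 * lorentz_norm r \<tau> (\<lambda>x. ennreal (norm (g x)))
              \<le> (SUP lam\<in>{0<..}. Phi r \<tau> \<gamma> q lam f)
          \<and> (SUP lam\<in>{0<..}. Phi r \<tau> \<gamma> q lam f)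
              \<le> ennreal C2 * lorentz_norm r \<tau> (\<lambda>x. ennreal (norm (g x))))
       \<and> (\<forall>(f :: 'a \<Rightarrow> real) g. in_WL r \<tau> f g \<longrightarrow> \<gamma> > 0 \<longrightarrow>
            ((\<lambda>lam. Phi r \<tau> \<gamma> q lam f) \<longlongrightarrow>
               ennreal ((kappa q TYPE('a) / \<gamma>) powr (1 / q)) * lorentz_norm r \<tau> (\<lambda>x. ennreal (norm (g x))))
              at_top)
       \<and> (\<forall>(f :: 'a \<Rightarrow> real) g. in_WL r \<tau> f g \<longrightarrow> \<gamma> < 0 \<longrightarrow>
            ((n \<ge> 2 \<and> q < (n - \<gamma>) / n * m) \<or> (n = 1 \<and> \<gamma> < -1 \<and> q < - \<gamma> * m)) \<longrightarrow>
            ((\<lambda>lam. Phi r \<tau> \<gamma> q lam f) \<longlongrightarrow>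
               ennreal ((- kappa q TYPE('a) / \<gamma>) powr (1 / q)) * lorentz_norm r \<tau> (\<lambda>x. ennreal (norm (g x))))
              (at_right 0))"
proof -
  let ?c = "(kappa q TYPE('a) / \<bar>\<gamma>\<bar>) powr (1 / q)"
  let ?F = "if 0 < \<gamma> then at_top else at_right (0::real)"
  let ?L = "\<lambda>g :: 'a \<Rightarrow> 'a. lorentz_norm r \<tau> (\<lambda>x. ennreal (norm (g x)))"
  have m: "1 < m" using assms(4,5) by (simp add: m_def)
  have n: "1 \<le> n" using DIM_positive[where 'a='a] by (simp add: n_def)
  \<comment> \<open>A single pair of exponents serves the upper bound and both limits.\<close>
  obtain s p where sp: "1 \<le> s" "s < m" "s \<le> p" "q < p" "n * (1 / s - 1 / p) < 1"
    by (rule exponents_exist[OF m n assms(6,7)])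
  have "s < r" "s < \<tau>" using sp(2) by (auto simp: m_def)
  then obtain C where C: "0 < C"
    and upper: "\<And>(f :: 'a \<Rightarrow> real) g lam. in_WL r \<tau> f g \<Longrightarrow> 0 < lam \<Longrightarrow> Phi r \<tau> \<gamma> q lam f \<le> ennreal C * ?L g"
    and lim: "\<And>(f :: 'a \<Rightarrow> real) g. in_WL r \<tau> f g \<Longrightarrow> ((\<lambda>lam. Phi r \<tau> \<gamma> q lam f) \<longlongrightarrow> ennreal ?c * ?L g) ?F"
    using Phi_bound_and_limit[where 'a='a, OF assms(3-6) sp(4) sp(1) _ _ sp(3) sp(5)[unfolded n_def]] by blast
  have c: "0 < ?c"
    using kappa_ball_integral(2)[where 'a='a, OF assms(6)] assms(3) by simp
  \<comment> \<open>\<open>lam\<close> is eventually positive along either filter, so the limit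
    cannot exceed the supremum. The lower constant is thus the limit constant \<open>?c\<close>, for
    both signs of \<open>\<gamma>\<close>.\<close>
  have lower: "ennreal ?c * ?L g \<le> (SUP lam\<in>{0<..}. Phi r \<tau> \<gamma> q lam f)" if "in_WL r \<tau> f g" for f :: "'a \<Rightarrow> real" and g
  proof (rule tendsto_upperbound[OF lim[OF that]])
    have "\<forall>\<^sub>F lam in ?F. 0 < lam"
      by (auto simp: eventually_gt_at_top eventually_at_filter)
    then show "\<forall>\<^sub>F lam in ?F. Phi r \<tau> \<gamma> q lam f \<le> (SUP lam\<in>{0<..}. Phi r \<tau> \<gamma> q lam f)"
      by eventually_elim (auto intro: SUP_upper)
    show "?F \<noteq> bot" by simp
  qed
  have "\<exists>C1>0. \<exists>C2>0. \<forall>(f :: 'a \<Rightarrow> real) g. in_WL r \<tau> f g \<longrightarrow>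
            ennreal C1 * ?L g \<le> (SUP lam\<in>{0<..}. Phi r \<tau> \<gamma> q lam f)
          \<and> (SUP lam\<in>{0<..}. Phi r \<tau> \<gamma> q lam f) \<le> ennreal C2 * ?L g"
    using c C lower upper by (intro exI[of _ ?c] exI[of _ C] conjI allI impI) (auto intro!: SUP_least)
  moreover have "((\<lambda>lam. Phi r \<tau> \<gamma> q lam f) \<longlongrightarrow> ennreal ((kappa q TYPE('a) / \<gamma>) powr (1 / q)) * ?L g) at_top"
    if "in_WL r \<tau> f g" "\<gamma> > 0" for f :: "'a \<Rightarrow> real" and g
    using lim[OF that(1)] that(2) by simp
  moreover have "((\<lambda>lam. Phi r \<tau> \<gamma> q lam f) \<longlongrightarrow> ennreal ((- kappa q TYPE('a) / \<gamma>) powr (1 / q)) * ?L g) (at_right 0)"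
    if "in_WL r \<tau> f g" "\<gamma> < 0" for f :: "'a \<Rightarrow> real" and g
    using lim[OF that(1)] that(2) by simp
  ultimately show ?thesis by blast
qed

end
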